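(* Let $\alpha,\beta,\gamma>0$ and let $U$ be the interior of a smooth simple closed curve contained inside the (normalized) $\alpha,\beta,\gamma$ hexagon. Let $a,b,c\to\infty$ through positive integers with $a:b:c\to\alpha:\beta:\gamma$ in $\mathbb{P}^2(\mathbb{R})$. For a uniformly random lozenge tiling of the $a,b,c$ hexagon, the expected number of vertical lozenges whose normalized coordinates lie in $U$ equals $$(ab+bc+ac)\left(\frac{1}{A}\iint_U P_{\alpha,\beta,\gamma}(x,y)\,dx\,dy+o(1)\right),$$ where $A=(\alpha\beta+\beta\gamma+\alpha\gamma)\sqrt3/2$ is the area of the $\alpha,\beta,\gamma$ hexagon and $$P_{\alpha,\beta,\gamma}(x,y)=\begin{cases}\frac1\pi\cot^{-1}\!\left(\frac{Q_{\alpha,\beta,\gamma}(x,y)}{\sqrt{E_{\alpha,\beta,\gamma}(x,y)}}\right) & \text{if } E_{\alpha,\beta,\gamma}(x,y)>0,\\ 0 & \text{if } (x,y)\in R_0,\\ 1 & \text{if } (x,y)\in R_1.\end{cases}$$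
   Context: A lozenge is a rhombus with unit sides and angles $\pi/3$ and $2\pi/3$; a vertical lozenge is one whose long diagonal is vertical. The $a,b,c$ hexagon is the equiangular hexagon with side lengths $a,b,c,a,b,c$ in clockwise order (starting from the upper-left side), with the two horizontal sides of length $b$; its lozenge tilings use lozenges with vertices on the triangular lattice, and every tiling consists of $ab+bc+ac$ lozenges. Normalized coordinates: write $a+b+c=\sigma(\alpha+\beta+\gamma)$, put the origin at the center of the hexagon and divide all coordinates by $\sigma$; so with $a'=a/\sigma$, $b'=b/\sigma$, $c'=c/\sigma$ the normalized hexagon has sides on the lines $y=\frac{\sqrt3}{2}(2x+b'+c')$, $y=\frac{\sqrt3}{4}(a'+c')$, $y=\frac{\sqrt3}{2}(-2x+a'+b')$, $y=\frac{\sqrt3}{2}(2x-b'-c')$, $y=-\frac{\sqrt3}{4}(a'+c')$, $y=\frac{\sqrt3}{2}(-2x-a'-b')$. The $\alpha,\beta,\gamma$ hexagon is the same with $a',b',c'$ replaced by $\alpha,\beta,\gamma$. The normalized coordinates of a lozenge are those of its center. Define $E_{\alpha,\beta,\gamma}(x,y)=3\alpha\beta\gamma(\alpha+\beta+\gamma)-\big(3(\alpha+\gamma)^2x^2-2\sqrt3(\alpha+2\beta+\gamma)(\alpha-\gamma)xy+((\alpha+2\beta+\gamma)^2-4\alpha\gamma)y^2\big)$, whose zero set is the ellipse inscribed in the $\alpha,\beta,\gamma$ hexagon, and $Q_{\alpha,\beta,\gamma}(x,y)=\frac{\sqrt3}{2}\left(\frac43y^2-4x^2+\beta^2+\alpha\beta+\beta\gamma-\alpha\gamma\right)$.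 The inscribed ellipse touches the hexagon at six points; the four lying on sides of length $\alpha$ or $\gamma$ are the singular points. The points of the hexagon outside the ellipse form six connected components; $R_1$ is the closure of the union of the two components containing the leftmost and rightmost points of the hexagon, minus the four singular points, and $R_0$ is the closure of the union of the other four components, minus the four singular points. $\cot^{-1}$ takes values in $(0,\pi)$. *)

theory Defs
  imports "HOL-Probability.Probability"
begin

type_synonym point = "real \<times> real"

section \<open>Hexagons, lozenges and tilings\<close>

text \<open>
  The closed \<open>a, b, c\<close> hexagon centred at the origin: side lengths \<open>a, b, c, a, b, c\<close>
  clockwise from the upper-left side.  It is used both with integral side lengths (the region
  that is tiled) and with the limiting side lengths \<open>\<alpha>, \<beta>, \<gamma>\<close>.
\<close>

definition hexagon :: "real \<Rightarrow> real \<Rightarrow> real \<Rightarrow> point set" where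
  "hexagon a b c = {(x, y).
     y \<le> sqrt 3 / 2 * (2 * x + b + c) \<and>
     y \<le> sqrt 3 / 4 * (a + c) \<and>
     y \<le> sqrt 3 / 2 * (- 2 * x + a + b) \<and>
     y \<ge> sqrt 3 / 2 * (2 * x - b - c) \<and>
     y \<ge> - sqrt 3 / 4 * (a + c) \<and>
     y \<ge> sqrt 3 / 2 * (- 2 * x - a - b)}"

text \<open>
  The unit triangular lattice, translated so that the vertices of the (integral) hexagon are
  lattice points.  The base point is the leftmost vertex of the hexagon.
\<close>

definition tri_lattice :: "nat \<Rightarrow> nat \<Rightarrow> nat \<Rightarrow> point set" where
  "tri_lattice a b c =
     {(- (real a + 2 * real b + real c) / 4, sqrt 3 / 4 * (real c - real a))
        + of_int i *\<^sub>R (1, 0) + of_int j *\<^sub>R (1 / 2, sqrt 3 / 2) | i j. True}"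

definition parallelogram :: "point \<Rightarrow> point \<Rightarrow> point \<Rightarrow> point set" where
  "parallelogram p u v = {p + s *\<^sub>R u + t *\<^sub>R v | s t. s \<in> {0..1} \<and> t \<in> {0..1}}"

text \<open>
  Unit vectors at angle \<open>\<pi>/3\<close>.  Every lozenge is spanned by such a pair from one of its acute
  corners, and its long diagonal is then \<open>u + v\<close>.
\<close>

definition lozenge_frame :: "point \<Rightarrow> point \<Rightarrow> bool" where
  "lozenge_frame u v \<longleftrightarrow> norm u = 1 \<and> norm v = 1 \<and> inner u v = cos (pi / 3)"

definition lozenges :: "point set \<Rightarrow> point set set" where
  "lozenges \<Lambda> = {parallelogram p u v | p u v.
     lozenge_frame u v \<and> {p, p + u, p + v, p + u + v} \<subseteq> \<Lambda>}"

definition vertical :: "point set \<Rightarrow> bool" where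
  "vertical L \<longleftrightarrow>
     (\<exists>p u v. L = parallelogram p u v \<and> lozenge_frame u v \<and> fst (u + v) = 0)"

text \<open>The centre of symmetry; it is computed for lozenges in \<open>center_parallelogram\<close> below.\<close>

definition center :: "point set \<Rightarrow> point" where
  "center L = (THE m. \<forall>q. q \<in> L \<longleftrightarrow> 2 *\<^sub>R m - q \<in> L)"

definition tilings :: "nat \<Rightarrow> nat \<Rightarrow> nat \<Rightarrow> point set set set" where
  "tilings a b c = {T. T \<subseteq> lozenges (tri_lattice a b c)
     \<and> \<Union>T = hexagon (real a) (real b) (real c)
     \<and> pairwise (\<lambda>L M. interior L \<inter> interior M = {}) T}"

text \<open>
  The expected number, for a uniformly random tiling, of vertical lozenges whose centre lies in
  \<open>U\<close> after division of all coordinates by \<open>\<sigma>\<close>.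
\<close>

definition expected_vertical :: "nat \<Rightarrow> nat \<Rightarrow> nat \<Rightarrow> real \<Rightarrow> point set \<Rightarrow> real" where
  "expected_vertical a b c \<sigma> U =
     measure_pmf.expectation (pmf_of_set (tilings a b c))
       (\<lambda>T. real (card {L \<in> T. vertical L \<and> (1 / \<sigma>) *\<^sub>R center L \<in> U}))"


section \<open>The limiting density\<close>

definition E_form :: "real \<Rightarrow> real \<Rightarrow> real \<Rightarrow> point \<Rightarrow> real" where
  "E_form \<alpha> \<beta> \<gamma> = (\<lambda>(x, y).
     3 * \<alpha> * \<beta> * \<gamma> * (\<alpha> + \<beta> + \<gamma>)
     - (3 * (\<alpha> + \<gamma>)\<^sup>2 * x\<^sup>2
        - 2 * sqrt 3 * (\<alpha> + 2 * \<beta> + \<gamma>) * (\<alpha> - \<gamma>) * x * y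
        + ((\<alpha> + 2 * \<beta> + \<gamma>)\<^sup>2 - 4 * \<alpha> * \<gamma>) * y\<^sup>2))"

definition Q_form :: "real \<Rightarrow> real \<Rightarrow> real \<Rightarrow> point \<Rightarrow> real" where
  "Q_form \<alpha> \<beta> \<gamma> = (\<lambda>(x, y).
     sqrt 3 / 2 * (4 / 3 * y\<^sup>2 - 4 * x\<^sup>2 + \<beta>\<^sup>2 + \<alpha> * \<beta> + \<beta> * \<gamma> - \<alpha> * \<gamma>))"

text \<open>The points where the inscribed ellipse touches the four non-horizontal sides.\<close>

definition singular_points :: "real \<Rightarrow> real \<Rightarrow> real \<Rightarrow> point set" where
  "singular_points \<alpha> \<beta> \<gamma> = {p \<in> hexagon \<alpha> \<beta> \<gamma>. E_form \<alpha> \<beta> \<gamma> p = 0 \<and>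
     (snd p = sqrt 3 / 2 * (2 * fst p + \<beta> + \<gamma>) \<or>
      snd p = sqrt 3 / 2 * (- 2 * fst p + \<alpha> + \<beta>) \<or>
      snd p = sqrt 3 / 2 * (2 * fst p - \<beta> - \<gamma>) \<or>
      snd p = sqrt 3 / 2 * (- 2 * fst p - \<alpha> - \<beta>))}"

text \<open>The form \<open>E_form\<close> is positive inside the ellipse and negative outside.\<close>

definition outer_components :: "real \<Rightarrow> real \<Rightarrow> real \<Rightarrow> point set set" where
  "outer_components \<alpha> \<beta> \<gamma> = components {p \<in> hexagon \<alpha> \<beta> \<gamma>. E_form \<alpha> \<beta> \<gamma> p < 0}"

definition leftmost_or_rightmost :: "point set \<Rightarrow> point \<Rightarrow> bool" where
  "leftmost_or_rightmost H p \<longleftrightarrow>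
     p \<in> H \<and> ((\<forall>q\<in>H. fst p \<le> fst q) \<or> (\<forall>q\<in>H. fst q \<le> fst p))"

definition R0 :: "real \<Rightarrow> real \<Rightarrow> real \<Rightarrow> point set" where
  "R0 \<alpha> \<beta> \<gamma> =
     closure (\<Union>{C \<in> outer_components \<alpha> \<beta> \<gamma>.
       \<not> (\<exists>p\<in>C. leftmost_or_rightmost (hexagon \<alpha> \<beta> \<gamma>) p)})
     - singular_points \<alpha> \<beta> \<gamma>"

definition R1 :: "real \<Rightarrow> real \<Rightarrow> real \<Rightarrow> point set" where
  "R1 \<alpha> \<beta> \<gamma> =
     closure (\<Union>{C \<in> outer_components \<alpha> \<beta> \<gamma>.
       \<exists>p\<in>C. leftmost_or_rightmost (hexagon \<alpha> \<beta> \<gamma>) p})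
     - singular_points \<alpha> \<beta> \<gamma>"

definition arccot :: "real \<Rightarrow> real" where
  "arccot t = (THE \<theta>. 0 < \<theta> \<and> \<theta> < pi \<and> cot \<theta> = t)"

text \<open>
  The density is left unspecified at the four singular points and outside the hexagon; the
  three cases are mutually exclusive.
\<close>

definition P_density :: "real \<Rightarrow> real \<Rightarrow> real \<Rightarrow> point \<Rightarrow> real" where
  "P_density \<alpha> \<beta> \<gamma> p =
     (if E_form \<alpha> \<beta> \<gamma> p > 0
      then 1 / pi * arccot (Q_form \<alpha> \<beta> \<gamma> p / sqrt (E_form \<alpha> \<beta> \<gamma> p))
      else if p \<in> R0 \<alpha> \<beta> \<gamma> then 0
      else if p \<in> R1 \<alpha> \<beta> \<gamma> then 1
      else undefined)"


section \<open>Curves and projective convergence\<close>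

text \<open>
  Smoothness is read as: continuously differentiable with nonvanishing derivative, also across
  the base point of the closed curve.
\<close>

definition smooth_simple_closed_curve :: "(real \<Rightarrow> point) \<Rightarrow> bool" where
  "smooth_simple_closed_curve g \<longleftrightarrow>
     simple_path g \<and> pathfinish g = pathstart g \<and>
     g C1_differentiable_on {0..1} \<and>
     (\<forall>t\<in>{0..1}. vector_derivative g (at t) \<noteq> 0) \<and>
     vector_derivative g (at 0) = vector_derivative g (at 1)"

text \<open>
  Convergence \<open>x\<^sub>n : y\<^sub>n : z\<^sub>n \<rightarrow> x : y : z\<close> in the real projective plane, with its topology as
  the quotient of the nonzero vectors by scaling: suitable homogeneous coordinates converge.
\<close>

definition projective_tendsto ::
  "(nat \<Rightarrow> real \<times> real \<times> real) \<Rightarrow> real \<times> real \<times> real \<Rightarrow> bool" where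
  "projective_tendsto X l \<longleftrightarrow>
     l \<noteq> 0 \<and> (\<forall>n. X n \<noteq> 0) \<and>
     (\<exists>r :: nat \<Rightarrow> real. (\<forall>n. r n \<noteq> 0) \<and> (\<lambda>n. r n *\<^sub>R X n) \<longlonglongrightarrow> l)"


section \<open>Unfolding the implicit descriptions\<close>

lemma arccot_eq: "arccot t = pi / 2 - arctan t"
proof -
  have cot_shift: "cot \<theta> = tan (pi / 2 - \<theta>)" for \<theta> :: real
    by (simp add: cot_def tan_def sin_diff cos_diff)
  show ?thesis
    unfolding arccot_def
  proof (rule the_equality)
    show "0 < pi / 2 - arctan t \<and> pi / 2 - arctan t < pi \<and> cot (pi / 2 - arctan t) = t"
      using arctan_lbound[of t] arctan_ubound[of t] by (simp add: cot_shift tan_arctan)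
    show "\<theta> = pi / 2 - arctan t" if "0 < \<theta> \<and> \<theta> < pi \<and> cot \<theta> = t" for \<theta>
      using that arctan_tan[of "pi / 2 - \<theta>"] by (simp add: cot_shift)
  qed
qed

lemma center_parallelogram: "center (parallelogram p u v) = p + (1 / 2) *\<^sub>R (u + v)"
proof -
  let ?L = "parallelogram p u v" and ?m = "p + (1 / 2) *\<^sub>R (u + v)"
  have reflect: "2 *\<^sub>R ?m - q \<in> ?L" if q: "q \<in> ?L" for q
  proof -
    obtain s t where st: "q = p + s *\<^sub>R u + t *\<^sub>R v" "s \<in> {0..1}" "t \<in> {0..1}"
      using q unfolding parallelogram_def by blast
    have "2 *\<^sub>R ?m - q = p + (1 - s) *\<^sub>R u + (1 - t) *\<^sub>R v"
      unfolding st(1) by (simp add: prod_eq_iff algebra_simps)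
    moreover have "1 - s \<in> {0..1}" "1 - t \<in> {0..1}"
      using st by auto
    ultimately show ?thesis
      unfolding parallelogram_def by blast
  qed
  have sym: "q \<in> ?L \<longleftrightarrow> 2 *\<^sub>R ?m - q \<in> ?L" for q
    using reflect[of q] reflect[of "2 *\<^sub>R ?m - q"] by auto
  have bound: "norm q \<le> norm p + norm u + norm v" if q: "q \<in> ?L" for q
  proof -
    obtain s t where st: "q = p + s *\<^sub>R u + t *\<^sub>R v" "s \<in> {0..1}" "t \<in> {0..1}"
      using q unfolding parallelogram_def by blast
    have "norm q \<le> norm p + norm (s *\<^sub>R u) + norm (t *\<^sub>R v)"
      unfolding st(1) by (meson add_mono norm_triangle_ineq norm_triangle_le order_refl)
    also have "\<dots> \<le> norm p + norm u + norm v"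
      using st by (intro add_mono) (auto simp: mult_left_le_one_le)
    finally show ?thesis .
  qed
  have uniq: "m = ?m" if m: "\<forall>q. q \<in> ?L \<longleftrightarrow> 2 *\<^sub>R m - q \<in> ?L" for m
  proof (rule ccontr)
    assume ne: "m \<noteq> ?m"
    define d where "d = 2 *\<^sub>R (m - ?m)"
    have step: "q + d \<in> ?L" if "q \<in> ?L" for q
    proof -
      have "2 *\<^sub>R ?m - q \<in> ?L"
        using that reflect by blast
      then have "2 *\<^sub>R m - (2 *\<^sub>R ?m - q) \<in> ?L"
        using m by blast
      moreover have "2 *\<^sub>R m - (2 *\<^sub>R ?m - q) = q + d"
        unfolding d_def by (simp add: prod_eq_iff algebra_simps)
      ultimately show ?thesis
        by simp
    qed
    have "p = p + 0 *\<^sub>R u + 0 *\<^sub>R v"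
      by simp
    then have base: "p \<in> ?L"
      unfolding parallelogram_def
      by (intro CollectI exI[of _ 0]) simp
    have it: "p + real n *\<^sub>R d \<in> ?L" for n
    proof (induction n)
      case 0
      then show ?case using base by simp
    next
      case (Suc n)
      then show ?case using step[of "p + real n *\<^sub>R d"] by (simp add: algebra_simps)
    qed
    define B where "B = norm p + norm u + norm v + norm p"
    have "norm d > 0"
      using ne by (simp add: d_def)
    then obtain n where n: "B < real n * norm d"
      using reals_Archimedean3 by blast
    have "real n * norm d = norm ((p + real n *\<^sub>R d) - p)"
      by simp
    also have "\<dots> \<le> norm (p + real n *\<^sub>R d) + norm p"
      by (rule norm_triangle_ineq4)
    also have "\<dots> \<le> B"
      unfolding B_def using bound[OF it[of n]] by simp
    finally show False
      using n by simp
  qed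
  show ?thesis
    unfolding center_def by (rule the_equality) (use sym uniq in blast)+
qed

end

theory Submission
  imports Defs "Jordan_Normal_Form.Determinant"
begin

text \<open>
  The vertical lozenges of one horizontal row determine how many tilings extend them upwards and downwards: once the
  frozen particles outside the hexagon are added, each count is a number of Gelfand--Tsetlin patterns, hence a
  Vandermonde product.  The row is therefore distributed as the Hahn orthogonal polynomial ensemble, and the expected
  number of its lozenges in a set is a sum over \<open>k\<close> below the number of particles of the masses that the weights
  \<open>p\<^sub>k\<^sup>2 w / h\<^sub>k\<close> give to the set, where \<open>p\<^sub>k\<close> is the Hahn polynomial, \<open>w\<close> the Hahn weight with parameters \<open>p, q\<close>,
  and \<open>h\<^sub>k\<close> the square norm.

  After scaling, the coefficients of the three-term recurrence vary slowly, so each of these weights converges to an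
  arcsine law.  Summing over \<open>k\<close> and over the rows becomes a double integral; with \<open>u = (k + (p + q) / 2)\<^sup>2\<close> the discriminant
  of the arcsine law is quadratic in \<open>u\<close> and the integral over \<open>k\<close> is elementary, which produces the arccotangent of
  \<open>Q / sqrt E\<close>.  Outside the ellipse \<open>Q\<^sup>2 + E\<close> is a product of four nonnegative linear forms, so \<open>Q\<close> cannot vanish where
  \<open>E < 0\<close>; its sign separates the regions of density 0 and 1.
\<close>

section \<open>Vandermonde determinants, interlacing and orthogonal polynomial ensembles\<close>

text \<open>What is proved about the Hahn weights is weak convergence only, so everything is tested
  against continuous functions; \<open>U\<close> is reached at the very end by sandwiching its
  indicator between cutoffs, and there the smooth boundary enters. The elementary integral over
  \<open>k\<close> rests on a coincidence: with \<open>p\<close>, \<open>q\<close>,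
  \<open>m\<close>, \<open>N\<close> the scaled parameters and particle number of a row,
  \<open>m + (p + q) / 2\<close> and \<open>N + (p + q) / 2\<close> are the same for all rows,
  namely \<open>(\<alpha> + 2 * \<beta> + \<gamma>) / 2\<close> and
  \<open>(\<alpha> + \<gamma>) / 2\<close>. Moreover the discriminant is quadratic in the position
  for fixed \<open>u\<close> as well, so exchanging the integrals turns an arcsine law in the
  position into an arcsine law in \<open>u\<close>, cut off at one end. Finally, the density is
  defined by connected components while the limit only sees the sign of \<open>Q\<close>; the polar
  line of the leftmost vertex bridges the two.\<close>

definition vandermonde :: "nat \<Rightarrow> (nat \<Rightarrow> real) \<Rightarrow> real" where
  "vandermonde n x = (\<Prod>j<n. \<Prod>i<j. x j - x i)"

text \<open>Two choices of nodes matter: at the evaluation points themselves the matrix of values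
  becomes triangular, and the nodes 0, 1, 2, ... (\<open>real\<close>) give the falling
  factorials.\<close>

definition newton_basis :: "(nat \<Rightarrow> real) \<Rightarrow> nat \<Rightarrow> real poly" where
  "newton_basis x j = (\<Prod>i<j. [:- x i, 1:])"

lemma newton_basis_monic: "degree (newton_basis x j) = j" "coeff (newton_basis x j) j = 1"
proof -
  have "degree (newton_basis x j) = j \<and> coeff (newton_basis x j) j = 1"
  proof (induction j)
    case 0
    then show ?case by (simp add: newton_basis_def)
  next
    case (Suc j)
    have eq: "newton_basis x (Suc j) = newton_basis x j * [:- x j, 1:]"
      by (simp add: newton_basis_def)
    have nz: "newton_basis x j \<noteq> 0" using Suc by auto
    have d: "degree (newton_basis x (Suc j)) = Suc j"
      unfolding eq using Suc nz by (subst degree_mult_eq) auto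
    have "lead_coeff (newton_basis x (Suc j)) = 1"
      unfolding eq lead_coeff_mult using Suc by simp
    with d show ?case by simp
  qed
  then show "degree (newton_basis x j) = j" "coeff (newton_basis x j) j = 1" by auto
qed

lemma newton_expansion:
  assumes "degree p \<le> j"
  shows "\<exists>c. p = (\<Sum>l\<le>j. Polynomial.smult (c l) (newton_basis x l)) \<and> c j = coeff p j"
  using assms
proof (induction j arbitrary: p)
  case 0
  then obtain a where "p = [:a:]" using degree_eq_zeroE by auto
  then show ?case by (intro exI[of _ "\<lambda>_. a"]) (simp add: newton_basis_def)
next
  case (Suc j)
  define q where "q = p - Polynomial.smult (coeff p (Suc j)) (newton_basis x (Suc j))"
  have "degree q \<le> Suc j"
    unfolding q_def using Suc.prems newton_basis_monic(1)[of x "Suc j"]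
    by (intro degree_diff_le) (auto intro: order_trans[OF degree_smult_le])
  moreover have "coeff q (Suc j) = 0"
    unfolding q_def using newton_basis_monic(2)[of x "Suc j"] by simp
  ultimately have "degree q \<le> j"
    by (metis degree_0 eq_zero_or_degree_less le_SucE le_zero_eq less_Suc_eq_le not_less_eq_eq zero_le leading_coeff_0_iff)
  then obtain c where c: "q = (\<Sum>l\<le>j. Polynomial.smult (c l) (newton_basis x l))"
    using Suc.IH by blast
  have "p = q + Polynomial.smult (coeff p (Suc j)) (newton_basis x (Suc j))"
    unfolding q_def by simp
  then show ?case
    by (intro exI[of _ "c(Suc j := coeff p (Suc j))"]) (simp add: c)
qed

text \<open>The matrix factors into Newton values and a change of basis: the first factor is lower
  triangular, with the inner products of the Vandermonde product on its diagonal; the second is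
  unitriangular because all the polynomials are monic.\<close>

lemma det_monic_polys:
  assumes p: "\<And>j. j < n \<Longrightarrow> degree (p j) = j \<and> coeff (p j) j = 1"
  shows "det (mat n n (\<lambda>(i, j). poly (p j) (x i))) = vandermonde n x"
proof -
  have "\<exists>c. p j = (\<Sum>l\<le>j. Polynomial.smult (c l) (newton_basis x l)) \<and> c j = 1" if "j < n" for j
    using newton_expansion[of "p j" j x] p[OF that] by auto
  then obtain c where c: "\<And>j. j < n \<Longrightarrow> p j = (\<Sum>l\<le>j. Polynomial.smult (c j l) (newton_basis x l)) \<and> c j j = 1"
    by metis
  define N where "N = mat n n (\<lambda>(i, l). poly (newton_basis x l) (x i))"
  define C where "C = mat n n (\<lambda>(l, j). if l \<le> j then c j l else 0)"
  have carr: "N \<in> carrier_mat n n" "C \<in> carrier_mat n n"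
    by (simp_all add: N_def C_def)
  have "mat n n (\<lambda>(i, j). poly (p j) (x i)) = N * C"
  proof (rule eq_matI)
    fix i j assume "i < dim_row (N * C)" "j < dim_col (N * C)"
    then have ij: "i < n" "j < n" using carr by auto
    have "(N * C) $$ (i, j) = (\<Sum>l\<in>{0..<n}. N $$ (i, l) * C $$ (l, j))"
      using ij carr by (simp add: scalar_prod_def)
    also have "\<dots> = (\<Sum>l\<in>{0..<n}. if l \<le> j then poly (newton_basis x l) (x i) * c j l else 0)"
      using ij by (intro sum.cong) (auto simp: N_def C_def)
    also have "\<dots> = (\<Sum>l\<le>j. poly (newton_basis x l) (x i) * c j l)"
      using ij by (intro sum.mono_neutral_cong_right) auto
    also have "\<dots> = poly (p j) (x i)"
      using c[OF ij(2)] by (simp add: poly_sum mult.commute)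
    finally show "mat n n (\<lambda>(i, j). poly (p j) (x i)) $$ (i, j) = (N * C) $$ (i, j)"
      using ij by simp
  qed (use carr in auto)
  then have "det (mat n n (\<lambda>(i, j). poly (p j) (x i))) = det N * det C"
    using det_mult[OF carr] by simp
  also have "det C = 1"
  proof -
    have "upper_triangular C"
      using carr by (auto simp: C_def upper_triangular_def)
    from det_upper_triangular[OF this carr(2)] show ?thesis
      using carr c by (simp add: prod_list_diag_prod C_def)
  qed
  also have "det N = vandermonde n x"
  proof -
    have "N $$ (i, j) = 0" if "i < j" "j < n" for i j
      using that by (auto simp: N_def newton_basis_def poly_prod)
    from det_lower_triangular[OF this carr(1)] show ?thesis
      using carr
      by (simp add: prod_list_diag_prod N_def vandermonde_def newton_basis_def poly_prod atLeast0LessThan)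
  qed
  finally show ?thesis by simp
qed

text \<open>Subtracting each row from the next leaves \<open>(1, 0, ..., 0)\<close> as the first
  column, which Laplace expansion removes. The row operation is undone by the summation matrix
  \<open>S\<close>, of determinant 1.\<close>

lemma det_differences:
  fixes M :: "nat \<Rightarrow> nat \<Rightarrow> real"
  assumes one: "\<And>i. i \<le> k \<Longrightarrow> M i 0 = 1"
  shows "det (mat k k (\<lambda>(i, j). M (Suc i) (Suc j) - M i (Suc j))) = det (mat (Suc k) (Suc k) (\<lambda>(i, j). M i j))"
proof -
  define S :: "real mat" where "S = mat (Suc k) (Suc k) (\<lambda>(i, l). if l \<le> i then 1 else 0)"
  define A where "A = mat (Suc k) (Suc k) (\<lambda>(i, j). M i j - (if i = 0 then 0 else M (i - 1) j))"
  have carr: "S \<in> carrier_mat (Suc k) (Suc k)" "A \<in> carrier_mat (Suc k) (Suc k)"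
    by (simp_all add: S_def A_def)
  have tel: "(\<Sum>l\<le>i. M l j - (if l = 0 then 0 else M (l - 1) j)) = M i j" for i j
    by (induction i) auto
  have "mat (Suc k) (Suc k) (\<lambda>(i, j). M i j) = S * A"
  proof (rule eq_matI)
    fix i j assume "i < dim_row (S * A)" "j < dim_col (S * A)"
    then have ij: "i < Suc k" "j < Suc k" using carr by auto
    have "(S * A) $$ (i, j) = (\<Sum>l\<in>{0..<Suc k}. S $$ (i, l) * A $$ (l, j))"
      using ij carr by (simp add: scalar_prod_def del: sum.op_ivl_Suc)
    also have "\<dots> = (\<Sum>l\<in>{0..<Suc k}. if l \<le> i then M l j - (if l = 0 then 0 else M (l - 1) j) else 0)"
      using ij by (intro sum.cong) (auto simp: S_def A_def)
    also have "\<dots> = (\<Sum>l\<le>i. M l j - (if l = 0 then 0 else M (l - 1) j))"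
      using ij by (intro sum.mono_neutral_cong_right) auto
    also have "\<dots> = M i j" by (rule tel)
    finally show "mat (Suc k) (Suc k) (\<lambda>(i, j). M i j) $$ (i, j) = (S * A) $$ (i, j)"
      using ij by simp
  qed (use carr in auto)
  then have "det (mat (Suc k) (Suc k) (\<lambda>(i, j). M i j)) = det S * det A"
    using det_mult[OF carr] by simp
  also have "det S = 1"
  proof -
    have "S $$ (i, j) = 0" if "i < j" "j < Suc k" for i j
      using that by (auto simp: S_def)
    from det_lower_triangular[OF this carr(1)] show ?thesis
      using carr by (simp add: prod_list_diag_prod S_def)
  qed
  also have "det A = (\<Sum>i<Suc k. A $$ (i, 0) * cofactor A i 0)"
    by (rule laplace_expansion_column[OF carr(2)]) simp
  also have "\<dots> = (\<Sum>i\<in>{0}. A $$ (i, 0) * cofactor A i 0)"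
  proof (rule sum.mono_neutral_right)
    show "\<forall>i\<in>{..<Suc k} - {0}. A $$ (i, 0) * cofactor A i 0 = 0"
      using one by (auto simp: A_def)
  qed auto
  also have "\<dots> = det (mat_delete A 0 0)"
    using one by (simp add: A_def cofactor_def)
  also have "mat_delete A 0 0 = mat k k (\<lambda>(i, j). M (Suc i) (Suc j) - M i (Suc j))"
    by (rule eq_matI) (auto simp: mat_delete_def A_def)
  finally show ?thesis by simp
qed

abbreviation falling :: "nat \<Rightarrow> real poly" where
  "falling \<equiv> newton_basis real"

lemma falling_Suc: "poly (falling (Suc j)) z = poly (falling j) z * (z - real j)"
  by (simp add: newton_basis_def poly_prod algebra_simps)

lemma falling_shift: "poly (falling (Suc j)) (z + 1) = (z + 1) * poly (falling j) z"
  by (induction j) (simp add: newton_basis_def, simp add: falling_Suc algebra_simps)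

lemma falling_diff: "poly (falling (Suc j)) (z + 1) - poly (falling (Suc j)) z = (real j + 1) * poly (falling j) z"
  unfolding falling_shift by (simp add: falling_Suc algebra_simps)

lemma sum_falling:
  fixes m n :: int
  assumes "m \<le> n"
  shows "(\<Sum>y\<in>{m..<n}. poly (falling j) (of_int y))
    = (poly (falling (Suc j)) (of_int n) - poly (falling (Suc j)) (of_int m)) / (real j + 1)"
  using assms
proof (induction n rule: int_ge_induct)
  case base
  then show ?case by simp
next
  case (step n)
  have "{m..<n + 1} = insert n {m..<n}" using step by auto
  then show ?case
    using step falling_diff[of j "of_int n"] by (simp add: field_simps)
qed

text \<open>Written with falling factorials, the determinant is linear in each row, so the sum over
  the box acts row by row. Each row sum telescopes to a difference of the next falling factorial;
  the factors \<open>1 / (j + 1)\<close> collect to \<open>1 / fact k\<close>, and the differences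
  are those of a determinant one size larger.\<close>

lemma sum_vandermonde_boxes:
  fixes x :: "nat \<Rightarrow> int"
  assumes mono: "\<And>i. i < k \<Longrightarrow> x i \<le> x (Suc i)"
  shows "(\<Sum>y\<in>PiE {..<k} (\<lambda>i. {x i..<x (Suc i)}). vandermonde k (\<lambda>i. of_int (y i)))
    = vandermonde (Suc k) (\<lambda>i. of_int (x i)) / fact k"
proof -
  let ?P = "{p. p permutes {0..<k}}"
  let ?B = "\<lambda>i. {x i..<x (Suc i)}"
  have "(\<Sum>y\<in>PiE {..<k} ?B. vandermonde k (\<lambda>i. of_int (y i)))
      = (\<Sum>y\<in>PiE {..<k} ?B. \<Sum>p\<in>?P. signof p * (\<Prod>i<k. poly (falling (p i)) (of_int (y i))))"
  proof (intro sum.cong refl)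
    fix y :: "nat \<Rightarrow> int"
    have "vandermonde k (\<lambda>i. of_int (y i)) = det (mat k k (\<lambda>(i, j). poly (falling j) (of_int (y i))))"
      by (subst det_monic_polys) (auto simp: newton_basis_monic)
    also have "\<dots> = (\<Sum>p\<in>?P. signof p * (\<Prod>i\<in>{0..<k}. poly (falling (p i)) (of_int (y i))))"
      by (subst det_def'[where n = k]) (auto intro!: sum.cong prod.cong)
    finally show "vandermonde k (\<lambda>i. of_int (y i)) = (\<Sum>p\<in>?P. signof p * (\<Prod>i<k. poly (falling (p i)) (of_int (y i))))"
      by (simp add: atLeast0LessThan)
  qed
  also have "\<dots> = (\<Sum>p\<in>?P. signof p * (\<Sum>y\<in>PiE {..<k} ?B. \<Prod>i<k. poly (falling (p i)) (of_int (y i))))"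
    by (subst sum.swap) (simp add: sum_distrib_left)
  also have "\<dots> = (\<Sum>p\<in>?P. signof p * (\<Prod>i<k. \<Sum>y\<in>?B i. poly (falling (p i)) (of_int y)))"
    by (subst prod_sum_PiE) auto
  also have "\<dots> = (\<Sum>p\<in>?P. signof p * ((\<Prod>i<k. poly (falling (Suc (p i))) (of_int (x (Suc i)))
        - poly (falling (Suc (p i))) (of_int (x i))) / fact k))"
  proof (intro sum.cong refl arg_cong2[where f = times])
    fix p assume "p \<in> ?P"
    then have p: "p permutes {..<k}" by (simp add: atLeast0LessThan)
    have "(\<Prod>i<k. \<Sum>y\<in>?B i. poly (falling (p i)) (of_int y))
      = (\<Prod>i<k. (poly (falling (Suc (p i))) (of_int (x (Suc i)))
        - poly (falling (Suc (p i))) (of_int (x i))) / (real (p i) + 1))"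
      by (intro prod.cong refl sum_falling mono) auto
    also have "\<dots> = (\<Prod>i<k. poly (falling (Suc (p i))) (of_int (x (Suc i)))
        - poly (falling (Suc (p i))) (of_int (x i))) / (\<Prod>i<k. real (p i) + 1)"
      by (rule prod_dividef)
    also have "(\<Prod>i<k. real (p i) + 1) = (\<Prod>i<k. real i + 1)"
      using prod.permute[OF p, of "\<lambda>i. real i + 1"] by (simp add: o_def)
    also have "\<dots> = fact k"
      by (induction k) (auto simp: mult.commute)
    finally show "(\<Prod>i<k. \<Sum>y\<in>?B i. poly (falling (p i)) (of_int y))
      = (\<Prod>i<k. poly (falling (Suc (p i))) (of_int (x (Suc i)))
        - poly (falling (Suc (p i))) (of_int (x i))) / fact k" .
  qed
  also have "\<dots> = det (mat k k (\<lambda>(i, j). poly (falling (Suc j)) (of_int (x (Suc i)))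
        - poly (falling (Suc j)) (of_int (x i)))) / fact k"
    unfolding sum_divide_distrib
    by (subst det_def'[where n = k]) (auto simp: atLeast0LessThan sum_divide_distrib intro!: sum.cong prod.cong)
  also have "\<dots> = vandermonde (Suc k) (\<lambda>i. of_int (x i)) / fact k"
    by (subst det_differences[where M = "\<lambda>i j. poly (falling j) (of_int (x i))"])
       (simp add: newton_basis_def, subst det_monic_polys, auto simp: newton_basis_monic)
  finally show ?thesis .
qed

lemma vandermonde_eq_0_iff: "vandermonde n x = 0 \<longleftrightarrow> \<not> inj_on x {..<n}"
proof
  assume "vandermonde n x = 0"
  then have "\<exists>j\<in>{..<n}. (\<Prod>i<j. x j - x i) = 0"
    unfolding vandermonde_def by (subst (asm) prod_zero_iff) simp_all
  then obtain j where j: "j < n" "(\<Prod>i<j. x j - x i) = 0" by auto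
  then have "\<exists>i\<in>{..<j}. x j - x i = 0"
    by (subst (asm) prod_zero_iff) simp_all
  then obtain i where "i < j" "x j = x i" by auto
  with j(1) show "\<not> inj_on x {..<n}"
    by (intro notI) (drule inj_onD[of _ _ i j], auto)
next
  assume "\<not> inj_on x {..<n}"
  then obtain i j where ij: "i < n" "j < n" "x i = x j" "i \<noteq> j"
    by (auto simp: inj_on_def)
  have *: "vandermonde n x = 0" if "i < j" "j < n" "x i = x j" for i j
  proof -
    have "(\<Prod>i<j. x j - x i) = 0"
      using that by (intro prod_zero[OF _ bexI[of _ i]]) simp_all
    then have "\<exists>j\<in>{..<n}. (\<Prod>i<j. x j - x i) = 0"
      using that(2) by (intro bexI[of _ j]) (assumption, simp)
    then show ?thesis
      unfolding vandermonde_def by (rule prod_zero[OF finite_lessThan])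
  qed
  show "vandermonde n x = 0"
    using ij *[of i j] *[of j i] by (cases "i < j") simp_all
qed

text \<open>The square root compensates for each pair of distinct elements being counted in both orders.\<close>

definition vdm_set :: "int set \<Rightarrow> real" where
  "vdm_set A = sqrt (\<Prod>p\<in>{p \<in> A \<times> A. fst p \<noteq> snd p}. \<bar>of_int (fst p - snd p)\<bar>)"

lemma vdm_set_pos: "finite A \<Longrightarrow> vdm_set A > 0"
  unfolding vdm_set_def by (auto intro!: prod_pos)

lemma prod_pairs_split:
  fixes f :: "nat \<Rightarrow> nat \<Rightarrow> real"
  assumes sym: "\<And>i j. f i j = f j i"
  shows "(\<Prod>p\<in>{p \<in> {..<n} \<times> {..<n}. fst p \<noteq> snd p}. f (fst p) (snd p)) = (\<Prod>j<n. \<Prod>i<j. f j i)\<^sup>2"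
proof (induction n)
  case 0
  then show ?case by simp
next
  case (Suc n)
  let ?D = "\<lambda>n. {p \<in> {..<n} \<times> {..<n}. fst p \<noteq> (snd p :: nat)}"
  have eq: "?D (Suc n) = ?D n \<union> ((\<lambda>i. (n, i)) ` {..<n} \<union> (\<lambda>i. (i, n)) ` {..<n})"
    by auto
  have "(\<Prod>p\<in>?D (Suc n). f (fst p) (snd p))
     = (\<Prod>p\<in>?D n. f (fst p) (snd p)) * ((\<Prod>p\<in>(\<lambda>i. (n, i)) ` {..<n}. f (fst p) (snd p))
        * (\<Prod>p\<in>(\<lambda>i. (i, n)) ` {..<n}. f (fst p) (snd p)))"
    unfolding eq by (subst prod.union_disjoint, simp, simp, force)+ (rule refl)
  also have "(\<Prod>p\<in>(\<lambda>i. (n, i)) ` {..<n}. f (fst p) (snd p)) = (\<Prod>i<n. f n i)"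
    by (subst prod.reindex) (auto simp: inj_on_def)
  also have "(\<Prod>p\<in>(\<lambda>i. (i, n)) ` {..<n}. f (fst p) (snd p)) = (\<Prod>i<n. f n i)"
    by (subst prod.reindex) (auto simp: inj_on_def sym[of n] intro!: prod.cong)
  finally show ?case using Suc by (simp add: power2_eq_square)
qed

lemma vdm_set_image:
  assumes "inj_on x {..<n}"
  shows "vdm_set (x ` {..<n}) = \<bar>vandermonde n (\<lambda>i. of_int (x i))\<bar>"
proof -
  let ?D = "{p \<in> {..<n} \<times> {..<n}. fst p \<noteq> snd p}"
  have "(\<Prod>p\<in>{p \<in> x ` {..<n} \<times> x ` {..<n}. fst p \<noteq> snd p}. \<bar>of_int (fst p - snd p)\<bar>)
     = (\<Prod>p\<in>?D. \<bar>of_int (x (fst p)) - of_int (x (snd p)) :: real\<bar>)"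
    by (rule prod.reindex_bij_witness[of _ "map_prod x x" "map_prod (inv_into {..<n} x) (inv_into {..<n} x)"])
       (use assms in \<open>auto simp: inv_into_f_f f_inv_into_f inj_on_eq_iff\<close>)
  also have "\<dots> = (\<Prod>j<n. \<Prod>i<j. \<bar>of_int (x j) - of_int (x i) :: real\<bar>)\<^sup>2"
    by (rule prod_pairs_split) auto
  finally show ?thesis
    unfolding vdm_set_def vandermonde_def by (simp add: abs_prod real_sqrt_abs)
qed

lemma vdm_set_mono_image:
  assumes "strict_mono_on {..<n} x"
  shows "vdm_set (x ` {..<n}) = vandermonde n (\<lambda>i. of_int (x i))"
proof -
  have "vandermonde n (\<lambda>i. of_int (x i)) \<ge> 0"
    unfolding vandermonde_def
    by (intro prod_nonneg) (use strict_mono_onD[OF assms] in \<open>force intro!: prod_nonneg\<close>)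
  with vdm_set_image[OF strict_mono_on_imp_inj_on[OF assms]] show ?thesis by simp
qed

lemma vdm_set_union:
  assumes "finite A" "finite B" "A \<inter> B = {}"
  shows "vdm_set (A \<union> B) = vdm_set A * vdm_set B * (\<Prod>x\<in>A. \<Prod>y\<in>B. \<bar>of_int (x - y)\<bar>)"
proof -
  let ?D = "\<lambda>A. {p \<in> A \<times> A. fst p \<noteq> (snd p :: int)}" and ?f = "\<lambda>p :: int \<times> int. \<bar>of_int (fst p - snd p)\<bar> :: real"
  have eq: "?D (A \<union> B) = (?D A \<union> ?D B) \<union> (A \<times> B \<union> B \<times> A)"
    using assms(3) by auto
  have fin: "finite (?D A)" "finite (?D B)" "finite (A \<times> B)" "finite (B \<times> A)"
    using assms by auto
  have "prod ?f (?D (A \<union> B)) = prod ?f (?D A) * prod ?f (?D B) * (prod ?f (A \<times> B) * prod ?f (B \<times> A))"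
    unfolding eq using fin assms(3)
    by (subst prod.union_disjoint, simp_all, blast)+
  also have "prod ?f (A \<times> B) = (\<Prod>x\<in>A. \<Prod>y\<in>B. \<bar>of_int (x - y)\<bar>)"
    by (simp add: prod.cartesian_product case_prod_beta)
  also have "prod ?f (B \<times> A) = (\<Prod>x\<in>A. \<Prod>y\<in>B. \<bar>of_int (x - y)\<bar>)"
    by (subst prod.swap) (simp add: prod.cartesian_product case_prod_beta abs_minus_commute)
  finally show ?thesis
    unfolding vdm_set_def
    by (simp add: real_sqrt_mult flip: power2_eq_square) (simp add: abs_prod)
qed

text \<open>Needed for two isometries of the integers: the unit shift between consecutive rows and
  the reflection of a row.\<close>

lemma vdm_set_bij:
  assumes "\<And>x y. \<lbrakk>x \<in> A; y \<in> A\<rbrakk> \<Longrightarrow> \<bar>f x - f y\<bar> = \<bar>x - y\<bar>"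
  shows "vdm_set (f ` A) = vdm_set A"
proof -
  have inj: "inj_on f A"
    using assms by (force simp: inj_on_def)
  have "(\<Prod>p\<in>{p \<in> f ` A \<times> f ` A. fst p \<noteq> snd p}. \<bar>of_int (fst p - snd p)\<bar>)
     = (\<Prod>p\<in>{p \<in> A \<times> A. fst p \<noteq> snd p}. \<bar>of_int (fst p - snd p) :: real\<bar>)"
  proof (rule prod.reindex_bij_witness[of _ "map_prod f f" "map_prod (inv_into A f) (inv_into A f)"])
    fix p assume p: "p \<in> {p \<in> f ` A \<times> f ` A. fst p \<noteq> snd p}"
    then obtain x y where xy: "p = (f x, f y)" "x \<in> A" "y \<in> A" by auto
    show "map_prod f f (map_prod (inv_into A f) (inv_into A f) p) = p"
      using xy inj by simp
    show "map_prod (inv_into A f) (inv_into A f) p \<in> {p \<in> A \<times> A. fst p \<noteq> snd p}"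
      using xy inj p by auto
    have "\<bar>real_of_int (x - y)\<bar> = \<bar>real_of_int (f x - f y)\<bar>"
      using assms[OF xy(2,3)] by (metis of_int_abs)
    then show "\<bar>real_of_int (fst (map_prod (inv_into A f) (inv_into A f) p)
        - snd (map_prod (inv_into A f) (inv_into A f) p))\<bar> = \<bar>real_of_int (fst p - snd p)\<bar>"
      using xy inj by simp
  qed (use inj in \<open>auto simp: inj_on_eq_iff\<close>)
  then show ?thesis unfolding vdm_set_def by simp
qed

section \<open>Interlacing of finite sets of integers\<close>

lemma strict_mono_enum:
  fixes A :: "int set"
  assumes "finite A" "card A = n"
  obtains x where "strict_mono_on {..<n} x" "A = x ` {..<n}"
proof -
  let ?l = "sorted_list_of_set A"
  have l: "length ?l = n" "set ?l = A" "sorted_wrt (<) ?l"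
    using assms by auto
  have "strict_mono_on {..<n} (\<lambda>i. ?l ! i)"
    using l by (auto intro!: strict_mono_onI simp: sorted_wrt_iff_nth_less)
  moreover have "A = (\<lambda>i. ?l ! i) ` {..<n}"
    using l by (metis atLeast0LessThan list.set_map map_nth set_upt)
  ultimately show ?thesis using that by blast
qed

text \<open>Counting functions express interlacing without ordering the sets, and they are additive
  over disjoint unions; increasing enumerations enter only where sums over boxes are needed.\<close>

definition count_below :: "int set \<Rightarrow> int \<Rightarrow> nat" where
  "count_below A z = card {s \<in> A. s < z}"

lemma count_below_enum:
  assumes "strict_mono_on {..<n} x" "i < n"
  shows "count_below (x ` {..<n}) (x i) = i"
proof -
  have inj: "inj_on x {..<n}" using assms(1) by (rule strict_mono_on_imp_inj_on)
  have "{s \<in> x ` {..<n}. s < x i} = x ` {..<i}"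
    using assms by (auto simp: strict_mono_on_less)
  moreover have "card (x ` {..<i}) = i"
    using inj_on_subset[OF inj, of "{..<i}"] assms(2) by (subst card_image) auto
  ultimately show ?thesis by (simp add: count_below_def)
qed

text \<open>Exactly one element of \<open>Y\<close> lies in each interval from an element of \<open>X\<close> (included) to the next one
  (excluded), and there is no other.\<close>

definition interlace :: "int set \<Rightarrow> int set \<Rightarrow> bool" where
  "interlace Y X \<longleftrightarrow> finite Y \<and> card X = Suc (card Y) \<and> (\<forall>z\<in>X. count_below Y z = count_below X z)"

lemma count_below_mono_enum:
  assumes y: "strict_mono_on {..<k} y" and i: "i \<le> k" and c: "count_below (y ` {..<k}) z = i"
  shows "\<And>l. l < i \<Longrightarrow> y l < z" and "\<And>l. \<lbrakk>i \<le> l; l < k\<rbrakk> \<Longrightarrow> z \<le> y l"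
proof -
  have inj: "inj_on y {..<k}" using y by (rule strict_mono_on_imp_inj_on)
  let ?I = "{l. l < k \<and> y l < z}"
  have "{s \<in> y ` {..<k}. s < z} = y ` ?I" by auto
  moreover have "card (y ` ?I) = card ?I"
    by (rule card_image) (rule inj_on_subset[OF inj], auto)
  ultimately have card: "card ?I = i"
    using c by (simp add: count_below_def)
  have down: "l' \<in> ?I" if "l \<in> ?I" "l' \<le> l" for l l'
    using that strict_mono_on_leD[OF y, of l' l] by auto
  show "y l < z" if "l < i" for l
  proof (rule ccontr)
    assume "\<not> y l < z"
    then have "?I \<subseteq> {..<l}"
      using down i that by (metis (mono_tags, lifting) lessThan_iff linorder_not_le mem_Collect_eq subsetI)
    then have "card ?I \<le> l" by (metis card_lessThan card_mono finite_lessThan)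
    with card that show False by simp
  qed
  show "z \<le> y l" if "i \<le> l" "l < k" for l
  proof (rule ccontr)
    assume "\<not> z \<le> y l"
    then have "l \<in> ?I" using that by simp
    then have "{..l} \<subseteq> ?I"
      using down by blast
    then have "card {..l} \<le> card ?I" by (intro card_mono) auto
    then have "Suc l \<le> card ?I" by simp
    with card that show False by simp
  qed
qed

lemma interlace_enum:
  assumes x: "strict_mono_on {..<Suc k} x" and y: "strict_mono_on {..<k} y"
  shows "interlace (y ` {..<k}) (x ` {..<Suc k}) \<longleftrightarrow> (\<forall>i<k. x i \<le> y i \<and> y i < x (Suc i))"
proof -
  have cards: "card (y ` {..<k}) = k" "card (x ` {..<Suc k}) = Suc k"
    using strict_mono_on_imp_inj_on[OF x] strict_mono_on_imp_inj_on[OF y] card_image by fastforce+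
  have cx: "count_below (x ` {..<Suc k}) (x i) = i" if "i \<le> k" for i
    using count_below_enum[OF x] that by simp
  show ?thesis
  proof
    assume "interlace (y ` {..<k}) (x ` {..<Suc k})"
    then have c: "count_below (y ` {..<k}) (x i) = i" if "i \<le> k" for i
      using that cx unfolding interlace_def by (metis imageI lessThan_iff less_Suc_eq_le)
    show "\<forall>i<k. x i \<le> y i \<and> y i < x (Suc i)"
      using count_below_mono_enum[OF y _ c] by (metis Suc_leI lessI less_imp_le_nat order_refl)
  next
    assume b: "\<forall>i<k. x i \<le> y i \<and> y i < x (Suc i)"
    have "count_below (y ` {..<k}) (x i) = i" if i: "i \<le> k" for i
    proof -
      have "y l < x i" if "l < i" for l
      proof -
        have "y l < x (Suc l)" using b that i by simp
        also have "\<dots> \<le> x i" by (rule strict_mono_on_leD[OF x]) (use that i in auto)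
        finally show ?thesis .
      qed
      moreover have "x i \<le> y l" if "i \<le> l" "l < k" for l
      proof -
        have "x i \<le> x l" by (rule strict_mono_on_leD[OF x]) (use that i in auto)
        also have "\<dots> \<le> y l" using b that i by simp
        finally show ?thesis .
      qed
      ultimately have "{s \<in> y ` {..<k}. s < x i} = y ` {..<i}"
        using i by (auto) (metis imageI lessThan_iff linorder_not_le)
      moreover have "card (y ` {..<i}) = i"
        using inj_on_subset[OF strict_mono_on_imp_inj_on[OF y], of "{..<i}"] i by (subst card_image) auto
      ultimately show ?thesis by (simp add: count_below_def)
    qed
    then show "interlace (y ` {..<k}) (x ` {..<Suc k})"
      unfolding interlace_def using cards cx by (auto simp: less_Suc_eq_le simp del: lessThan_Suc)
  qed
qed

text \<open>The interlacing sets are the images of the integer points of the box with sides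
  \<open>{x i..<x (Suc i)}\<close>: the sides are disjoint and ordered, so every point of the box is
  increasing. Iterating this identity counts Gelfand--Tsetlin patterns with a given top row.\<close>

lemma sum_interlace:
  assumes X: "finite X" "card X = Suc k"
  shows "(\<Sum>Y | interlace Y X. vdm_set Y) = vdm_set X / fact k"
proof -
  obtain x where x: "strict_mono_on {..<Suc k} x" and Xx: "X = x ` {..<Suc k}"
    using strict_mono_enum[OF X] .
  let ?P = "PiE {..<k} (\<lambda>i. {x i..<x (Suc i)})"
  have mono: "strict_mono_on {..<k} y" if "y \<in> ?P" for y
  proof (rule strict_mono_onI)
    fix i j assume ij: "i \<in> {..<k}" "j \<in> {..<k}" "i < j"
    have "y i < x (Suc i)" "x j \<le> y j" using that ij by (force simp: PiE_iff)+
    moreover have "x (Suc i) \<le> x j" using ij by (intro strict_mono_on_leD[OF x]) auto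
    ultimately show "y i < y j" by simp
  qed
  have bij: "bij_betw (\<lambda>y. y ` {..<k}) ?P {Y. interlace Y X}"
  proof (rule bij_betwI')
    fix y y' assume yy: "y \<in> ?P" "y' \<in> ?P"
    show "(y ` {..<k} = y' ` {..<k}) = (y = y')"
    proof
      assume eq: "y ` {..<k} = y' ` {..<k}"
      have "y i = y' i" if "i < k" for i
      proof -
        have "y i \<in> y ` {..<k}" using that by simp
        then obtain j where j: "j < k" "y i = y' j" unfolding eq by auto
        have "i = count_below (y ` {..<k}) (y i)"
          using count_below_enum[OF mono[OF yy(1)]] that by simp
        also have "\<dots> = count_below (y' ` {..<k}) (y' j)"
          unfolding eq j(2) ..
        also have "\<dots> = j"
          using count_below_enum[OF mono[OF yy(2)]] j(1) by simp
        finally show ?thesis using j by simp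
      qed
      then show "y = y'" using yy by (auto intro: PiE_ext)
    qed auto
  next
    fix y assume y: "y \<in> ?P"
    then show "y ` {..<k} \<in> {Y. interlace Y X}"
      unfolding Xx using interlace_enum[OF x mono[OF y]] by (auto simp: PiE_iff)
  next
    fix Y assume "Y \<in> {Y. interlace Y X}"
    then have Y: "interlace Y X" by simp
    then have "finite Y" "card Y = k" using X by (auto simp: interlace_def)
    then obtain y where y: "strict_mono_on {..<k} y" "Y = y ` {..<k}"
      using strict_mono_enum by blast
    have "\<forall>i<k. x i \<le> y i \<and> y i < x (Suc i)"
      using Y interlace_enum[OF x y(1)] unfolding Xx y(2) by blast
    then show "\<exists>z\<in>?P. Y = z ` {..<k}"
      using y(2) by (intro bexI[of _ "restrict y {..<k}"]) auto
  qed
  have "(\<Sum>Y | interlace Y X. vdm_set Y) = (\<Sum>y\<in>?P. vdm_set (y ` {..<k}))"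
    by (rule sum.reindex_bij_betw[OF bij, symmetric])
  also have "\<dots> = (\<Sum>y\<in>?P. vandermonde k (\<lambda>i. of_int (y i)))"
    by (intro sum.cong refl vdm_set_mono_image mono)
  also have "\<dots> = vandermonde (Suc k) (\<lambda>i. of_int (x i)) / fact k"
    by (rule sum_vandermonde_boxes) (rule strict_mono_on_leD[OF x], auto)
  also have "vandermonde (Suc k) (\<lambda>i. of_int (x i)) = vdm_set X"
    unfolding Xx by (rule vdm_set_mono_image[OF x, symmetric])
  finally show ?thesis .
qed

text \<open>Both determinants expand over permutations, and the sum over tuples then factors
  coordinate by coordinate. The weight may depend on the index \<open>i\<close>, so that a test
  function can later be inserted at a single coordinate.\<close>

lemma sum_PiE_det_square:
  fixes \<phi> :: "nat \<Rightarrow> 'a \<Rightarrow> real" and W :: "nat \<Rightarrow> 'a \<Rightarrow> real"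
  assumes R: "finite R"
  shows "(\<Sum>x\<in>PiE {..<n} (\<lambda>_. R). (det (mat n n (\<lambda>(i, j). \<phi> j (x i))))\<^sup>2 * (\<Prod>i<n. W i (x i)))
    = (\<Sum>p | p permutes {..<n}. \<Sum>q | q permutes {..<n}. signof p * signof q *
        (\<Prod>i<n. \<Sum>z\<in>R. W i z * \<phi> (p i) z * \<phi> (q i) z))"
proof -
  let ?S = "{p. p permutes {..<n}}"
  have "(\<Sum>x\<in>PiE {..<n} (\<lambda>_. R). (det (mat n n (\<lambda>(i, j). \<phi> j (x i))))\<^sup>2 * (\<Prod>i<n. W i (x i)))
    = (\<Sum>x\<in>PiE {..<n} (\<lambda>_. R). \<Sum>p\<in>?S. \<Sum>q\<in>?S. signof p * signof q *
        (\<Prod>i<n. W i (x i) * \<phi> (p i) (x i) * \<phi> (q i) (x i)))"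
  proof (intro sum.cong refl)
    fix x :: "nat \<Rightarrow> 'a"
    have det: "det (mat n n (\<lambda>(i, j). \<phi> j (x i))) = (\<Sum>p\<in>?S. signof p * (\<Prod>i<n. \<phi> (p i) (x i)))"
      by (subst det_def'[where n = n]) (auto simp: atLeast0LessThan intro!: sum.cong prod.cong)
    show "(det (mat n n (\<lambda>(i, j). \<phi> j (x i))))\<^sup>2 * (\<Prod>i<n. W i (x i))
      = (\<Sum>p\<in>?S. \<Sum>q\<in>?S. signof p * signof q * (\<Prod>i<n. W i (x i) * \<phi> (p i) (x i) * \<phi> (q i) (x i)))"
      unfolding det power2_eq_square unfolding sum_product unfolding sum_distrib_right
      by (intro sum.cong refl) (simp add: prod.distrib)
  qed
  also have "\<dots> = (\<Sum>p\<in>?S. \<Sum>q\<in>?S. signof p * signof q *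
      (\<Sum>x\<in>PiE {..<n} (\<lambda>_. R). \<Prod>i<n. W i (x i) * \<phi> (p i) (x i) * \<phi> (q i) (x i)))"
    by (subst sum.swap, intro sum.cong refl, subst sum.swap) (simp add: sum_distrib_left)
  also have "\<dots> = (\<Sum>p\<in>?S. \<Sum>q\<in>?S. signof p * signof q *
        (\<Prod>i<n. \<Sum>z\<in>R. W i z * \<phi> (p i) z * \<phi> (q i) z))"
    using R by (subst prod_sum_PiE) auto
  finally show ?thesis .
qed

text \<open>A test function at the index \<open>l\<close> spoils orthogonality there; a second index
  with \<open>p i \<noteq> q i\<close> still makes the product vanish.\<close>

lemma permutes_differ_twice:
  assumes "p permutes {..<n}" "q permutes {..<n}" "p \<noteq> q"
  shows "\<exists>i<n. i \<noteq> l \<and> p i \<noteq> q i"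
proof (rule ccontr)
  assume "\<not> (\<exists>i<n. i \<noteq> l \<and> p i \<noteq> q i)"
  then have eq: "p i = q i" if "i \<noteq> l" for i
    using that assms(1,2) by (metis lessThan_iff permutes_not_in)
  have "p l = q l"
  proof (rule ccontr)
    assume ne: "p l \<noteq> q l"
    obtain m where m: "p m = q l" using assms(1) by (metis permutes_def)
    with ne have "m \<noteq> l" by auto
    with eq m have "q m = q l" by metis
    with \<open>m \<noteq> l\<close> show False using permutes_inj[OF assms(2)] by (auto dest: injD)
  qed
  with eq assms(3) show False by (metis ext)
qed

text \<open>Only equal pairs of permutations survive, each contributing the product of all norms.
  With \<open>f\<close> at coordinate \<open>l\<close>, the norm of index \<open>p l\<close> is
  replaced by the sum weighted with \<open>f\<close>; as \<open>l\<close> runs over all coordinates,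
  \<open>p l\<close> runs over all indices, so every permutation contributes the same
  amount.\<close>

lemma sum_PiE_orthogonal:
  fixes \<phi> :: "nat \<Rightarrow> 'a \<Rightarrow> real"
  assumes R: "finite R"
    and orth: "\<And>j k. \<lbrakk>j < n; k < n; j \<noteq> k\<rbrakk> \<Longrightarrow> (\<Sum>z\<in>R. w z * \<phi> j z * \<phi> k z) = 0"
  defines "h \<equiv> \<lambda>j. \<Sum>z\<in>R. w z * (\<phi> j z)\<^sup>2"
  defines "D \<equiv> \<lambda>x. (det (mat n n (\<lambda>(i, j). \<phi> j (x i))))\<^sup>2 * (\<Prod>i<n. w (x i))"
  assumes h0: "\<And>j. j < n \<Longrightarrow> h j \<noteq> 0"
  shows "(\<Sum>x\<in>PiE {..<n} (\<lambda>_. R). D x) = fact n * (\<Prod>j<n. h j)"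
    and "(\<Sum>x\<in>PiE {..<n} (\<lambda>_. R). D x * (\<Sum>l<n. f (x l)))
      = fact n * (\<Prod>j<n. h j) * (\<Sum>j<n. (\<Sum>z\<in>R. f z * w z * (\<phi> j z)\<^sup>2) / h j)"
proof -
  let ?S = "{p. p permutes {..<n}}"
  have finS: "finite ?S" by (simp add: finite_permutations)
  have cardS: "card ?S = fact n" by (simp add: card_permutations)
  have hj: "(\<Sum>z\<in>R. w z * \<phi> j z * \<phi> j z) = h j" for j
    by (simp add: h_def power2_eq_square mult.assoc)
  have perm_lt: "p i < n" if "p permutes {..<n}" "i < n" for p i
    using permutes_in_image[OF that(1), of i] that(2) by simp
  have diag: "(\<Sum>p\<in>?S. \<Sum>q\<in>?S. signof p * signof q * G p q) = (\<Sum>p\<in>?S. G p p)"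
    if "\<And>p q. \<lbrakk>p \<in> ?S; q \<in> ?S; p \<noteq> q\<rbrakk> \<Longrightarrow> G p q = 0" for G :: "(nat \<Rightarrow> nat) \<Rightarrow> (nat \<Rightarrow> nat) \<Rightarrow> real"
  proof (intro sum.cong refl)
    fix p assume p: "p \<in> ?S"
    have "(\<Sum>q\<in>?S. signof p * signof q * G p q) = (\<Sum>q\<in>{p}. signof p * signof q * G p q)"
      using that p finS by (intro sum.mono_neutral_right) auto
    also have "\<dots> = G p p" by (simp add: sign_def)
    finally show "(\<Sum>q\<in>?S. signof p * signof q * G p q) = G p p" .
  qed
  have prod_perm: "(\<Prod>i<n. h (p i)) = (\<Prod>j<n. h j)" if "p \<in> ?S" for p
    using prod.permute[of p "{..<n}" h] that by (simp add: o_def)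
  have "(\<Sum>x\<in>PiE {..<n} (\<lambda>_. R). D x)
      = (\<Sum>p\<in>?S. \<Prod>i<n. \<Sum>z\<in>R. w z * \<phi> (p i) z * \<phi> (p i) z)"
    unfolding D_def sum_PiE_det_square[OF R, where W = "\<lambda>_. w"]
  proof (rule diag)
    fix p q assume pq: "p \<in> ?S" "q \<in> ?S" "p \<noteq> q"
    then obtain i where "i < n" "p i \<noteq> q i" using permutes_differ_twice by blast
    then have "(\<Sum>z\<in>R. w z * \<phi> (p i) z * \<phi> (q i) z) = 0"
      using pq perm_lt by (intro orth) auto
    with \<open>i < n\<close> show "(\<Prod>i<n. \<Sum>z\<in>R. w z * \<phi> (p i) z * \<phi> (q i) z) = 0"
      by (intro prod_zero) auto
  qed
  also have "\<dots> = fact n * (\<Prod>j<n. h j)"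
    unfolding hj by (simp add: prod_perm cardS)
  finally show "(\<Sum>x\<in>PiE {..<n} (\<lambda>_. R). D x) = fact n * (\<Prod>j<n. h j)" .
  define g where "g j = (\<Sum>z\<in>R. f z * w z * (\<phi> j z)\<^sup>2)" for j
  have one: "(\<Sum>x\<in>PiE {..<n} (\<lambda>_. R). D x * f (x l)) = (\<Sum>p\<in>?S. (\<Prod>j<n. h j) * (g (p l) / h (p l)))"
    if l: "l < n" for l
  proof -
    let ?W = "\<lambda>i z. if i = l then f z * w z else w z"
    have "(\<Sum>x\<in>PiE {..<n} (\<lambda>_. R). D x * f (x l))
      = (\<Sum>x\<in>PiE {..<n} (\<lambda>_. R). (det (mat n n (\<lambda>(i, j). \<phi> j (x i))))\<^sup>2 * (\<Prod>i<n. ?W i (x i)))"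
    proof (intro sum.cong refl)
      fix x :: "nat \<Rightarrow> 'a"
      have "(\<Prod>i<n. ?W i (x i)) = ?W l (x l) * (\<Prod>i\<in>{..<n} - {l}. ?W i (x i))"
        using l by (intro prod.remove) auto
      also have "(\<Prod>i\<in>{..<n} - {l}. ?W i (x i)) = (\<Prod>i\<in>{..<n} - {l}. w (x i))"
        by (intro prod.cong) auto
      also have "?W l (x l) * \<dots> = f (x l) * (w (x l) * \<dots>)" by simp
      also have "w (x l) * (\<Prod>i\<in>{..<n} - {l}. w (x i)) = (\<Prod>i<n. w (x i))"
        using l by (intro prod.remove[symmetric]) auto
      finally show "D x * f (x l) = (det (mat n n (\<lambda>(i, j). \<phi> j (x i))))\<^sup>2 * (\<Prod>i<n. ?W i (x i))"
        unfolding D_def by simp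
    qed
    also have "\<dots> = (\<Sum>p\<in>?S. \<Prod>i<n. \<Sum>z\<in>R. ?W i z * \<phi> (p i) z * \<phi> (p i) z)"
      unfolding sum_PiE_det_square[OF R, where W = ?W]
    proof (rule diag)
      fix p q assume pq: "p \<in> ?S" "q \<in> ?S" "p \<noteq> q"
      then obtain i where i: "i < n" "i \<noteq> l" "p i \<noteq> q i" using permutes_differ_twice by blast
      then have "(\<Sum>z\<in>R. w z * \<phi> (p i) z * \<phi> (q i) z) = 0"
        using pq perm_lt by (intro orth) auto
      with i show "(\<Prod>i<n. \<Sum>z\<in>R. ?W i z * \<phi> (p i) z * \<phi> (q i) z) = 0"
        by (intro prod_zero) (auto intro!: bexI[of _ i])
    qed
    also have "\<dots> = (\<Sum>p\<in>?S. (\<Prod>j<n. h j) * (g (p l) / h (p l)))"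
    proof (intro sum.cong refl)
      fix p assume p: "p \<in> ?S"
      have "(\<Prod>i<n. \<Sum>z\<in>R. ?W i z * \<phi> (p i) z * \<phi> (p i) z)
        = (\<Sum>z\<in>R. ?W l z * \<phi> (p l) z * \<phi> (p l) z) * (\<Prod>i\<in>{..<n} - {l}. \<Sum>z\<in>R. ?W i z * \<phi> (p i) z * \<phi> (p i) z)"
        using l by (intro prod.remove) auto
      also have "(\<Prod>i\<in>{..<n} - {l}. \<Sum>z\<in>R. ?W i z * \<phi> (p i) z * \<phi> (p i) z) = (\<Prod>i\<in>{..<n} - {l}. h (p i))"
        by (intro prod.cong) (auto simp: hj)
      also have "(\<Sum>z\<in>R. ?W l z * \<phi> (p l) z * \<phi> (p l) z) = g (p l)"
        by (simp add: g_def power2_eq_square mult.assoc)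
      also have "(\<Prod>i\<in>{..<n} - {l}. h (p i)) = (\<Prod>j<n. h j) / h (p l)"
        using l prod.remove[of "{..<n}" l "\<lambda>i. h (p i)"] prod_perm[OF p] h0[OF perm_lt[of p l]] p
        by (simp add: field_simps)
      finally show "(\<Prod>i<n. \<Sum>z\<in>R. ?W i z * \<phi> (p i) z * \<phi> (p i) z) = (\<Prod>j<n. h j) * (g (p l) / h (p l))"
        by simp
    qed
    finally show ?thesis .
  qed
  have "(\<Sum>x\<in>PiE {..<n} (\<lambda>_. R). D x * (\<Sum>l<n. f (x l))) = (\<Sum>l<n. \<Sum>x\<in>PiE {..<n} (\<lambda>_. R). D x * f (x l))"
    unfolding sum_distrib_left by (rule sum.swap)
  also have "\<dots> = (\<Sum>l<n. \<Sum>p\<in>?S. (\<Prod>j<n. h j) * (g (p l) / h (p l)))"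
    by (intro sum.cong refl one) auto
  also have "\<dots> = (\<Sum>p\<in>?S. \<Sum>l<n. (\<Prod>j<n. h j) * (g (p l) / h (p l)))"
    by (rule sum.swap)
  also have "\<dots> = (\<Sum>p\<in>?S. (\<Prod>j<n. h j) * (\<Sum>j<n. g j / h j))"
  proof (intro sum.cong refl)
    fix p assume "p \<in> ?S"
    then show "(\<Sum>l<n. (\<Prod>j<n. h j) * (g (p l) / h (p l))) = (\<Prod>j<n. h j) * (\<Sum>j<n. g j / h j)"
      using sum.permute[of p "{..<n}" "\<lambda>j. g j / h j"] by (simp add: o_def sum_distrib_left)
  qed
  also have "\<dots> = fact n * (\<Prod>j<n. h j) * (\<Sum>j<n. g j / h j)"
    by (simp add: cardS)
  finally show "(\<Sum>x\<in>PiE {..<n} (\<lambda>_. R). D x * (\<Sum>l<n. f (x l)))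
      = fact n * (\<Prod>j<n. h j) * (\<Sum>j<n. (\<Sum>z\<in>R. f z * w z * (\<phi> j z)\<^sup>2) / h j)"
    unfolding g_def .
qed

lemma sum_inj_PiE_sets:
  fixes F :: "'a set \<Rightarrow> real"
  assumes R: "finite R"
  shows "(\<Sum>x | x \<in> PiE {..<n} (\<lambda>_. R) \<and> inj_on x {..<n}. F (x ` {..<n})) = fact n * (\<Sum>S | S \<subseteq> R \<and> card S = n. F S)"
proof -
  let ?X = "{x. x \<in> PiE {..<n} (\<lambda>_. R) \<and> inj_on x {..<n}}"
  let ?T = "{S. S \<subseteq> R \<and> card S = n}"
  have finX: "finite ?X" by (rule finite_subset[of _ "PiE {..<n} (\<lambda>_. R)"]) (auto intro: finite_PiE R)
  have finT: "finite ?T" using R by (auto intro: finite_subset[of _ "Pow R"])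
  have "(\<Sum>x\<in>?X. F (x ` {..<n})) = (\<Sum>S\<in>?T. \<Sum>x\<in>{x \<in> ?X. x ` {..<n} = S}. F (x ` {..<n}))"
  proof (rule sum.group[OF finX finT, symmetric])
    show "(\<lambda>x. x ` {..<n}) ` ?X \<subseteq> ?T"
    proof
      fix S assume "S \<in> (\<lambda>x. x ` {..<n}) ` ?X"
      then obtain x where x: "x \<in> PiE {..<n} (\<lambda>_. R)" "inj_on x {..<n}" "S = x ` {..<n}" by blast
      then show "S \<in> ?T" using card_image[OF x(2)] by (auto simp: PiE_iff)
    qed
  qed
  also have "\<dots> = (\<Sum>S\<in>?T. fact n * F S)"
  proof (intro sum.cong refl)
    fix S assume S: "S \<in> ?T"
    then have finS: "finite S" using R finite_subset by auto
    have eq: "{x \<in> ?X. x ` {..<n} = S} = {x \<in> extensional_funcset {..<n} S. inj_on x {..<n}}"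
    proof (rule equalityI; rule subsetI)
      fix x assume "x \<in> {x \<in> ?X. x ` {..<n} = S}"
      then show "x \<in> {x \<in> extensional_funcset {..<n} S. inj_on x {..<n}}"
        by (auto simp: PiE_iff)
    next
      fix x assume x: "x \<in> {x \<in> extensional_funcset {..<n} S. inj_on x {..<n}}"
      then have "x ` {..<n} \<subseteq> S" "card (x ` {..<n}) = card S"
        using S by (auto simp: card_image PiE_iff)
      then have "x ` {..<n} = S" using finS by (simp add: card_subset_eq)
      then show "x \<in> {x \<in> ?X. x ` {..<n} = S}"
        using x S by (auto simp: PiE_iff)
    qed
    have "card {x \<in> extensional_funcset {..<n} S. inj_on x {..<n}} = fact n"
      using card_inj_on_subset_funcset[of "{..<n}" S "{..<n}"] S finS by (simp add: fact_prod_rev)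
    then have "card {x \<in> ?X. x ` {..<n} = S} = fact n"
      unfolding eq .
    then show "(\<Sum>x\<in>{x \<in> ?X. x ` {..<n} = S}. F (x ` {..<n})) = fact n * F S"
      by simp
  qed
  finally show ?thesis by (simp add: sum_distrib_left)
qed

text \<open>The determinant of the orthogonal polynomials is the Vandermonde product because they
  are monic; it vanishes on tuples with repetitions, and every set of \<open>n\<close> elements
  comes from \<open>fact n\<close> tuples.\<close>

lemma ensemble_one_point:
  fixes p :: "nat \<Rightarrow> real poly" and w f :: "int \<Rightarrow> real"
  assumes R: "finite R"
    and monic: "\<And>j. j < n \<Longrightarrow> degree (p j) = j \<and> coeff (p j) j = 1"
    and orth: "\<And>j k. \<lbrakk>j < n; k < n; j \<noteq> k\<rbrakk> \<Longrightarrow>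
      (\<Sum>z\<in>R. w z * poly (p j) (of_int z) * poly (p k) (of_int z)) = 0"
  defines "h \<equiv> \<lambda>j. \<Sum>z\<in>R. w z * (poly (p j) (of_int z))\<^sup>2"
  assumes h0: "\<And>j. j < n \<Longrightarrow> h j \<noteq> 0"
  shows "(\<Sum>S | S \<subseteq> R \<and> card S = n. (vdm_set S)\<^sup>2 * (\<Prod>z\<in>S. w z)) = (\<Prod>j<n. h j)"
    and "(\<Sum>S | S \<subseteq> R \<and> card S = n. (vdm_set S)\<^sup>2 * (\<Prod>z\<in>S. w z) * (\<Sum>z\<in>S. f z))
      = (\<Prod>j<n. h j) * (\<Sum>j<n. (\<Sum>z\<in>R. f z * w z * (poly (p j) (of_int z))\<^sup>2) / h j)"
proof -
  let ?P = "PiE {..<n} (\<lambda>_. R)"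
  define D where "D x = (det (mat n n (\<lambda>(i, j). poly (p j) (of_int (x i)))))\<^sup>2 * (\<Prod>i<n. w (x i))" for x :: "nat \<Rightarrow> int"
  have det: "det (mat n n (\<lambda>(i, j). poly (p j) (of_int (x i)))) = vandermonde n (\<lambda>i. of_int (x i))" for x :: "nat \<Rightarrow> int"
    by (rule det_monic_polys[OF monic])
  have inj_of_int: "inj_on (\<lambda>i. real_of_int (x i)) A \<longleftrightarrow> inj_on x A" for x :: "nat \<Rightarrow> int" and A
    by (simp add: inj_on_def)
  have D: "D x = (if inj_on x {..<n} then (vdm_set (x ` {..<n}))\<^sup>2 * (\<Prod>z\<in>x ` {..<n}. w z) else 0)" for x
    unfolding D_def det
    by (auto simp: vdm_set_image vandermonde_eq_0_iff inj_of_int prod.reindex)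
  have sum: "(\<Sum>x\<in>?P. D x * (\<Sum>l<n. g (x l)))
    = fact n * (\<Sum>S | S \<subseteq> R \<and> card S = n. (vdm_set S)\<^sup>2 * (\<Prod>z\<in>S. w z) * (\<Sum>z\<in>S. g z))" for g
  proof -
    have "(\<Sum>x\<in>?P. D x * (\<Sum>l<n. g (x l))) = (\<Sum>x | x \<in> ?P \<and> inj_on x {..<n}. D x * (\<Sum>l<n. g (x l)))"
      using R by (intro sum.mono_neutral_right finite_PiE) (auto simp: D)
    also have "\<dots> = (\<Sum>x | x \<in> ?P \<and> inj_on x {..<n}.
        (\<lambda>S. (vdm_set S)\<^sup>2 * (\<Prod>z\<in>S. w z) * (\<Sum>z\<in>S. g z)) (x ` {..<n}))"
      by (intro sum.cong refl) (auto simp: D sum.reindex)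
    also have "\<dots> = fact n * (\<Sum>S | S \<subseteq> R \<and> card S = n. (vdm_set S)\<^sup>2 * (\<Prod>z\<in>S. w z) * (\<Sum>z\<in>S. g z))"
      by (rule sum_inj_PiE_sets[OF R])
    finally show ?thesis .
  qed
  have orthD: "(\<Sum>x\<in>?P. D x) = fact n * (\<Prod>j<n. h j)"
    "(\<Sum>x\<in>?P. D x * (\<Sum>l<n. f (x l)))
      = fact n * (\<Prod>j<n. h j) * (\<Sum>j<n. (\<Sum>z\<in>R. f z * w z * (poly (p j) (of_int z))\<^sup>2) / h j)"
    unfolding D_def h_def
    by (rule sum_PiE_orthogonal(1)[OF R, where \<phi> = "\<lambda>j z. poly (p j) (of_int z)"],
        rule orth, assumption+, rule h0[unfolded h_def], assumption)
       (rule sum_PiE_orthogonal(2)[OF R, where \<phi> = "\<lambda>j z. poly (p j) (of_int z)"],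
        rule orth, assumption+, rule h0[unfolded h_def], assumption)
  \<comment> \<open>The identity \<open>sum\<close> for the constant function 1 yields this one
    multiplied by \<open>n\<close>, hence \<open>n = 0\<close> is treated apart.\<close>
  have sum1: "(\<Sum>x\<in>?P. D x) = fact n * (\<Sum>S | S \<subseteq> R \<and> card S = n. (vdm_set S)\<^sup>2 * (\<Prod>z\<in>S. w z))"
  proof (cases "n = 0")
    case True
    have "{S. S \<subseteq> R \<and> card S = 0} = {{}}" using R by (auto dest: finite_subset simp: card_eq_0_iff)
    with True show ?thesis by (simp add: D)
  next
    case False
    have "(\<Sum>x\<in>?P. D x) * real n
      = fact n * (\<Sum>S | S \<subseteq> R \<and> card S = n. (vdm_set S)\<^sup>2 * (\<Prod>z\<in>S. w z) * (\<Sum>z\<in>S. 1))"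
      using sum[of "\<lambda>_. 1"] by (simp add: sum_distrib_right)
    also have "\<dots> = fact n * (\<Sum>S | S \<subseteq> R \<and> card S = n. (vdm_set S)\<^sup>2 * (\<Prod>z\<in>S. w z)) * real n"
      by (simp add: sum_distrib_right mult.assoc)
    finally show ?thesis using False by simp
  qed
  show "(\<Sum>S | S \<subseteq> R \<and> card S = n. (vdm_set S)\<^sup>2 * (\<Prod>z\<in>S. w z)) = (\<Prod>j<n. h j)"
    using sum1 orthD(1) by simp
  show "(\<Sum>S | S \<subseteq> R \<and> card S = n. (vdm_set S)\<^sup>2 * (\<Prod>z\<in>S. w z) * (\<Sum>z\<in>S. f z))
      = (\<Prod>j<n. h j) * (\<Sum>j<n. (\<Sum>z\<in>R. f z * w z * (poly (p j) (of_int z))\<^sup>2) / h j)"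
    using sum[of f] orthD(2) by simp
qed

section \<open>Hahn polynomials\<close>

context
  fixes p q M :: nat
begin

text \<open>In the basis of falling factorials these are the coefficients of the terminating series
  \<open>3F2(-k, k + p + q + 1, -x; p + 1, -M; 1)\<close> divided by its leading one. The product
  runs down from the leading coefficient 1, so that \<open>M - l\<close> never stands in a
  denominator and \<open>k > M\<close> needs no exception.\<close>

definition hahn_coeff :: "nat \<Rightarrow> nat \<Rightarrow> real" where
  "hahn_coeff k i = (if i \<le> k then \<Prod>l\<in>{i..<k}.
     (real l + 1) * (real M - real l) * (real p + real l + 1)
       / ((real l - real k) * (real l + real k + real p + real q + 1)) else 0)"

definition hahn_poly :: "nat \<Rightarrow> real poly" where
  "hahn_poly k = (\<Sum>i\<le>k. Polynomial.smult (hahn_coeff k i) (falling i))"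

text \<open>With \<open>hahn_C\<close>, the classical coefficients of the Hahn recurrence for the
  parameters \<open>p\<close>, \<open>q\<close>, \<open>M\<close>. For monic polynomials they enter
  as \<open>hahn_A k + hahn_C k\<close> and \<open>hahn_A (k - 1) * hahn_C k\<close>.\<close>

definition hahn_A :: "nat \<Rightarrow> real" where
  "hahn_A k = (real k + real p + real q + 1) * (real k + real p + 1) * (real M - real k)
     / ((2 * real k + real p + real q + 1) * (2 * real k + real p + real q + 2))"

text \<open>At \<open>k = p = q = 0\<close> the quotient is \<open>0 / 0 = 0\<close>, which is the value needed.\<close>

definition hahn_C :: "nat \<Rightarrow> real" where
  "hahn_C k = real k * (real k + real p + real q + real M + 1) * (real k + real q)
     / ((2 * real k + real p + real q) * (2 * real k + real p + real q + 1))"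

definition hahn_b :: "nat \<Rightarrow> real" where
  "hahn_b k = hahn_A (k - 1) * hahn_C k"

section \<open>Coefficients and the three-term recurrence\<close>

lemma hahn_coeff_self [simp]: "hahn_coeff k k = 1"
  by (simp add: hahn_coeff_def)

lemma hahn_coeff_eq_0 [simp]: "k < i \<Longrightarrow> hahn_coeff k i = 0"
  by (simp add: hahn_coeff_def)

text \<open>One factor of the product is split off. The relation is also the eigenvalue equation of
  the Hahn difference operator, compared at one falling factorial.\<close>

lemma hahn_coeff_step:
  assumes "i < k"
  shows "hahn_coeff k i * ((real k - real i) * (real i + real k + real p + real q + 1))
    = - ((real i + 1) * (real M - real i) * (real p + real i + 1) * hahn_coeff k (Suc i))"
proof -
  have "{i..<k} = insert i {Suc i..<k}" using assms by auto
  then have "hahn_coeff k i = (real i + 1) * (real M - real i) * (real p + real i + 1)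
       / ((real i - real k) * (real i + real k + real p + real q + 1)) * hahn_coeff k (Suc i)"
    using assms by (simp add: hahn_coeff_def)
  moreover have "(real i - real k) * (real i + real k + real p + real q + 1) \<noteq> 0"
    using assms by auto
  ultimately have "hahn_coeff k i * ((real i - real k) * (real i + real k + real p + real q + 1))
    = (real i + 1) * (real M - real i) * (real p + real i + 1) * hahn_coeff k (Suc i)"
    by simp
  then show ?thesis by (simp only: left_diff_distrib right_diff_distrib mult_minus_left)
qed

text \<open>Descending induction from \<open>i = k\<close>: the coefficients of both polynomials
  obey \<open>hahn_coeff_step\<close>, so a relation between them at \<open>Suc i\<close> passes to
  \<open>i\<close>.\<close>

lemma hahn_coeff_raise:
  assumes "i \<le> k"
  shows "hahn_coeff (Suc k) i * ((real k + 1 - real i) * (2 * real k + real p + real q + 1) * (2 * real k + real p + real q + 2))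
    = - ((real k + 1) * (real M - real k) * (real p + real k + 1) * (real k + real i + real p + real q + 1) * hahn_coeff k i)"
  using assms
proof (induction i rule: inc_induct)
  case base
  have "hahn_coeff (Suc k) k * (1 * (2 * real k + real p + real q + 2))
    = - (real k + 1) * (real M - real k) * (real p + real k + 1)"
    using hahn_coeff_step[of k "Suc k"] by (simp add: algebra_simps)
  then have "hahn_coeff (Suc k) k * (1 * (2 * real k + real p + real q + 2)) * (2 * real k + real p + real q + 1)
    = - (real k + 1) * (real M - real k) * (real p + real k + 1) * (2 * real k + real p + real q + 1)"
    by simp
  then show ?case by (simp add: algebra_simps)
next
  case (step i)
  define u where "u = real k - real i"
  define v where "v = real i + real k + real p + real q + 1"
  define N where "N = (real i + 1) * (real M - real i) * (real p + real i + 1)"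
  define Z where "Z = (2 * real k + real p + real q + 1) * (2 * real k + real p + real q + 2)"
  define Y where "Y = (real k + 1) * (real M - real k) * (real p + real k + 1)"
  have pos: "u > 0" "v > 0" using step by (auto simp: u_def v_def)
  have s1: "hahn_coeff k i * (u * v) = - (N * hahn_coeff k (Suc i))"
    using hahn_coeff_step[OF step.hyps(2)] unfolding u_def v_def N_def by (simp add: mult_ac)
  have s2: "hahn_coeff (Suc k) i * ((u + 1) * (v + 1)) = - (N * hahn_coeff (Suc k) (Suc i))"
    using hahn_coeff_step[of i "Suc k"] step.hyps unfolding u_def v_def N_def by (simp add: algebra_simps)
  have s3: "hahn_coeff (Suc k) (Suc i) * (u * Z) = - (Y * (v + 1) * hahn_coeff k (Suc i))"
    using step.IH unfolding u_def v_def Y_def Z_def by (simp add: algebra_simps)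
  \<comment> \<open>The factor \<open>u * (v + 1)\<close> lets the three relations be applied
    without division; it is positive and cancels afterwards.\<close>
  have "hahn_coeff (Suc k) i * ((u + 1) * Z) * (u * (v + 1)) = - (Y * v * hahn_coeff k i) * (u * (v + 1))"
  proof -
    have "hahn_coeff (Suc k) i * ((u + 1) * Z) * (u * (v + 1)) = (hahn_coeff (Suc k) i * ((u + 1) * (v + 1))) * (u * Z)"
      by (simp add: mult_ac)
    also have "\<dots> = - (N * (hahn_coeff (Suc k) (Suc i) * (u * Z)))" unfolding s2 by simp
    also have "\<dots> = Y * (v + 1) * (N * hahn_coeff k (Suc i))" unfolding s3 by simp
    also have "\<dots> = - (Y * (v + 1) * (hahn_coeff k i * (u * v)))" unfolding s1 by simp
    finally show ?thesis by (simp add: mult_ac)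
  qed
  moreover have "u * (v + 1) \<noteq> 0" using pos by simp
  ultimately have "hahn_coeff (Suc k) i * ((u + 1) * Z) = - (Y * v * hahn_coeff k i)"
    by (metis mult_right_cancel)
  then show ?case unfolding u_def v_def Y_def Z_def by (simp add: algebra_simps)
qed

lemma hahn_b_coeff:
  assumes "i \<le> k" "k > 0"
  shows "hahn_b k * hahn_coeff (k - 1) i * ((2 * real k + real p + real q) * (2 * real k + real p + real q + 1) * (real k + real i + real p + real q))
    = - ((real k + real p + real q) * (real k + real q) * (real M + real k + real p + real q + 1) * (real k - real i) * hahn_coeff k i)"
proof -
  obtain m where k: "k = Suc m" using assms(2) gr0_implies_Suc by blast
  define s where "s = real p + real q"
  define B where "B = real k * (real k + s) * (real k + real p) * (real k + real q) * (real M - real k + 1) * (real M + real k + s + 1)"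
  have nz: "2 * real k + s > 0" "2 * real k + s + 1 > 0" "2 * real k + s - 1 > 0" "real k + real i + s > 0"
    using assms by (auto simp: s_def)
  have b: "hahn_b k * ((2 * real k + s - 1) * (2 * real k + s) * (2 * real k + s) * (2 * real k + s + 1)) = B"
  proof -
    have "hahn_A (k - 1) * ((2 * real k + s - 1) * (2 * real k + s)) = (real k + s) * (real k + real p) * (real M - real k + 1)"
      using nz unfolding hahn_A_def k s_def by (simp add: add_ac)
    moreover have "hahn_C k * ((2 * real k + s) * (2 * real k + s + 1)) = real k * (real k + s + real M + 1) * (real k + real q)"
      using nz unfolding hahn_C_def s_def by (simp add: add_ac)
    ultimately have "(hahn_A (k - 1) * ((2 * real k + s - 1) * (2 * real k + s))) * (hahn_C k * ((2 * real k + s) * (2 * real k + s + 1)))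
      = ((real k + s) * (real k + real p) * (real M - real k + 1)) * (real k * (real k + s + real M + 1) * (real k + real q))"
      by simp
    then show ?thesis unfolding hahn_b_def B_def by (simp add: mult_ac add_ac)
  qed
  have r: "hahn_coeff k i * ((real k - real i) * (2 * real k + s - 1) * (2 * real k + s))
    = - (real k * (real M - real k + 1) * (real p + real k) * (real k + real i + s) * hahn_coeff m i)"
  proof (cases "i = k")
    case True
    then show ?thesis by (simp add: k)
  next
    case False
    then have "i \<le> m" using assms k by auto
    from hahn_coeff_raise[OF this] show ?thesis
      unfolding k s_def by (simp add: algebra_simps)
  qed
  have "(hahn_b k * hahn_coeff m i * ((2 * real k + s) * (2 * real k + s + 1) * (real k + real i + s))) * ((2 * real k + s - 1) * (2 * real k + s))
     = B * hahn_coeff m i * (real k + real i + s)"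
    using b by (simp add: mult_ac)
  also have "\<dots> = - ((real k + s) * (real k + real q) * (real M + real k + s + 1))
      * (- (real k * (real M - real k + 1) * (real p + real k) * (real k + real i + s) * hahn_coeff m i))"
    unfolding B_def by (simp add: mult_ac add_ac)
  also have "\<dots> = - ((real k + s) * (real k + real q) * (real M + real k + s + 1) * (real k - real i) * hahn_coeff k i) * ((2 * real k + s - 1) * (2 * real k + s))"
    unfolding r[symmetric] by (simp add: mult_ac)
  finally have "hahn_b k * hahn_coeff m i * ((2 * real k + s) * (2 * real k + s + 1) * (real k + real i + s))
    = - ((real k + s) * (real k + real q) * (real M + real k + s + 1) * (real k - real i) * hahn_coeff k i)"
    using nz by (metis mult_right_cancel mult_eq_0_iff less_irrefl)
  then show ?thesis unfolding k s_def by (simp add: add_ac)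
qed

text \<open>For \<open>i \<le> k\<close> every term is a multiple of
  \<open>x = hahn_coeff k i\<close>. The next polynomial combines with \<open>hahn_A\<close>
  (\<open>t1\<close>) and the previous one with \<open>hahn_C\<close> (\<open>t2\<close>); each
  combination collapses to a single fraction with the factor \<open>real i\<close>, and the left
  side splits into the same two fractions.\<close>

lemma hahn_coeff_recurrence:
  "(if i = 0 then 0 else hahn_coeff k (i - 1)) + real i * hahn_coeff k i
    = hahn_coeff (Suc k) i + (hahn_A k + hahn_C k) * hahn_coeff k i + (if k = 0 then 0 else hahn_b k * hahn_coeff (k - 1) i)"
proof (cases "i \<le> k")
  case False
  then show ?thesis by (cases "i = Suc k") auto
next
  case True
  define s where "s = real p + real q"
  define x where "x = hahn_coeff k i"
  define d where "d = real k + 1 - real i"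
  define e where "e = real k + real i + s"
  define P where "P = (real k + real p + 1) * (real M - real k)"
  define R where "R = (real k + real q) * (real M + real k + s + 1)"
  have d: "d > 0" using True by (simp add: d_def)
  have t1: "hahn_coeff (Suc k) i + hahn_A k * x = - real i * P * x / ((2 * real k + s + 1) * d)"
  proof -
    have pos: "2 * real k + s + 1 > 0" "2 * real k + s + 2 > 0" by (auto simp: s_def)
    have "hahn_coeff (Suc k) i * (d * (2 * real k + s + 1) * (2 * real k + s + 2)) = - ((real k + 1) * P * (e + 1) * x)"
      using hahn_coeff_raise[OF True] unfolding d_def s_def P_def e_def x_def by (simp add: mult_ac add_ac)
    then have c: "hahn_coeff (Suc k) i = - ((real k + 1) * P * (e + 1) * x) / (d * (2 * real k + s + 1) * (2 * real k + s + 2))"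
      by - (rule iffD2[OF nonzero_eq_divide_eq], use pos d in simp, assumption)
    have a: "hahn_A k = (real k + s + 1) * P / ((2 * real k + s + 1) * (2 * real k + s + 2))"
      unfolding hahn_A_def s_def P_def by (simp add: mult_ac add_ac)
    have key: "(real k + s + 1) * d - (real k + 1) * (e + 1) = - real i * (2 * real k + s + 2)"
      unfolding d_def e_def by (simp add: algebra_simps)
    have "hahn_coeff (Suc k) i + hahn_A k * x = P * x * ((real k + s + 1) * d - (real k + 1) * (e + 1)) / (d * (2 * real k + s + 1) * (2 * real k + s + 2))"
      unfolding c a using pos d by (simp add: divide_simps) (simp add: algebra_simps)
    also have "\<dots> = - real i * P * x / ((2 * real k + s + 1) * d)"
      unfolding key using pos d by (simp add: divide_simps)
    finally show ?thesis .
  qed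
  have t2: "hahn_C k * x + (if k = 0 then 0 else hahn_b k * hahn_coeff (k - 1) i) = (if k = 0 then 0 else real i * R * x / ((2 * real k + s + 1) * e))"
  proof (cases "k = 0")
    case True
    then show ?thesis by (simp add: hahn_C_def)
  next
    case False
    then have pos: "2 * real k + s > 0" "2 * real k + s + 1 > 0" "e > 0" by (auto simp: s_def e_def)
    have "hahn_b k * hahn_coeff (k - 1) i * ((2 * real k + s) * (2 * real k + s + 1) * e) = - ((real k + s) * R * (d - 1) * x)"
      using hahn_b_coeff[OF True] False unfolding d_def s_def R_def e_def x_def by (simp add: mult_ac add_ac)
    then have c: "hahn_b k * hahn_coeff (k - 1) i = - ((real k + s) * R * (d - 1) * x) / ((2 * real k + s) * (2 * real k + s + 1) * e)"
      by - (rule iffD2[OF nonzero_eq_divide_eq], use pos d in simp, assumption)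
    have a: "hahn_C k = real k * R / ((2 * real k + s) * (2 * real k + s + 1))"
      unfolding hahn_C_def s_def R_def by (simp add: mult_ac add_ac)
    have key: "real k * e - (real k + s) * (d - 1) = real i * (2 * real k + s)"
      unfolding d_def e_def by (simp add: algebra_simps)
    have "hahn_C k * x + hahn_b k * hahn_coeff (k - 1) i = R * x * (real k * e - (real k + s) * (d - 1)) / ((2 * real k + s) * (2 * real k + s + 1) * e)"
      unfolding c a using pos by (simp add: divide_simps) (simp add: algebra_simps)
    also have "\<dots> = real i * R * x / ((2 * real k + s + 1) * e)"
      unfolding key using pos by (simp add: divide_simps)
    finally show ?thesis using False by simp
  qed
  have "(if i = 0 then 0 else hahn_coeff k (i - 1)) + real i * x
     = - real i * P * x / ((2 * real k + s + 1) * d) + (if k = 0 then 0 else real i * R * x / ((2 * real k + s + 1) * e))"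
  proof (cases "i = 0")
    case True
    then show ?thesis by simp
  next
    case False
    with True have "k \<noteq> 0" by auto
    then have pos: "2 * real k + s + 1 > 0" "e > 0" by (auto simp: s_def e_def)
    have "hahn_coeff k (i - 1) * (d * e) = - (real i * ((real M - real i + 1) * (real p + real i)) * x)"
      using hahn_coeff_step[of "i - 1" k] False True unfolding d_def e_def s_def x_def
      by (simp add: of_nat_diff algebra_simps)
    then have c: "hahn_coeff k (i - 1) = - (real i * ((real M - real i + 1) * (real p + real i)) * x) / (d * e)"
      by - (rule iffD2[OF nonzero_eq_divide_eq], use pos d in simp, assumption)
    have key: "(2 * real k + s + 1) * (d * e - (real M - real i + 1) * (real p + real i)) = R * d - P * e"
      unfolding d_def e_def P_def R_def s_def by (simp add: algebra_simps)
    have "hahn_coeff k (i - 1) + real i * x = real i * x * ((2 * real k + s + 1) * (d * e - (real M - real i + 1) * (real p + real i))) / ((2 * real k + s + 1) * (d * e))"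
      unfolding c using pos d by (simp add: divide_simps) (simp add: algebra_simps)
    also have "\<dots> = - real i * P * x / ((2 * real k + s + 1) * d) + real i * R * x / ((2 * real k + s + 1) * e)"
      unfolding key using pos d by (simp add: divide_simps) (simp add: algebra_simps)
    finally show ?thesis using False \<open>k \<noteq> 0\<close> by simp
  qed
  then show ?thesis
    using t1 t2 unfolding x_def by (simp add: algebra_simps)
qed

lemma poly_hahn: "poly (hahn_poly k) x = (\<Sum>i\<le>k. hahn_coeff k i * poly (falling i) x)"
  by (simp add: hahn_poly_def poly_sum)

lemma hahn_monic: "degree (hahn_poly k) = k \<and> coeff (hahn_poly k) k = 1"
proof -
  have "degree (hahn_poly k) \<le> k"
    unfolding hahn_poly_def
    by (intro degree_sum_le) (auto intro: order_trans[OF degree_smult_le] simp: newton_basis_monic)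
  moreover have "coeff (hahn_poly k) k = (\<Sum>i\<in>{k}. hahn_coeff k i * coeff (falling i) k)"
    unfolding hahn_poly_def coeff_sum coeff_smult
    by (intro sum.mono_neutral_right) (auto intro!: coeff_eq_0 simp: newton_basis_monic)
  ultimately show ?thesis
    using newton_basis_monic[of real k] le_degree[of "hahn_poly k" k] by simp
qed

lemma hahn_three_term:
  "x * poly (hahn_poly k) x = poly (hahn_poly (Suc k)) x + (hahn_A k + hahn_C k) * poly (hahn_poly k) x
    + (if k = 0 then 0 else hahn_b k * poly (hahn_poly (k - 1)) x)"
proof -
  have ext: "poly (hahn_poly j) x = (\<Sum>i\<le>Suc k. hahn_coeff j i * poly (falling i) x)" if "j \<le> Suc k" for j
    unfolding poly_hahn using that by (intro sum.mono_neutral_left) auto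
  have "x * poly (hahn_poly k) x = (\<Sum>i\<le>k. hahn_coeff k i * (poly (falling (Suc i)) x + real i * poly (falling i) x))"
    unfolding poly_hahn sum_distrib_left by (intro sum.cong refl) (simp add: falling_Suc algebra_simps)
  also have "\<dots> = (\<Sum>i\<le>k. hahn_coeff k i * poly (falling (Suc i)) x) + (\<Sum>i\<le>k. real i * hahn_coeff k i * poly (falling i) x)"
    by (simp add: algebra_simps sum.distrib)
  also have "(\<Sum>i\<le>k. hahn_coeff k i * poly (falling (Suc i)) x) = (\<Sum>i\<le>Suc k. (if i = 0 then 0 else hahn_coeff k (i - 1)) * poly (falling i) x)"
    by (simp add: sum.atMost_Suc_shift del: sum.atMost_Suc)
  also have "(\<Sum>i\<le>k. real i * hahn_coeff k i * poly (falling i) x) = (\<Sum>i\<le>Suc k. real i * hahn_coeff k i * poly (falling i) x)"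
    by simp
  also have "(\<Sum>i\<le>Suc k. (if i = 0 then 0 else hahn_coeff k (i - 1)) * poly (falling i) x) + \<dots>
    = (\<Sum>i\<le>Suc k. ((if i = 0 then 0 else hahn_coeff k (i - 1)) + real i * hahn_coeff k i) * poly (falling i) x)"
    by (simp only: sum.distrib[symmetric] distrib_right)
  also have "\<dots> = (\<Sum>i\<le>Suc k. hahn_coeff (Suc k) i * poly (falling i) x)
      + (hahn_A k + hahn_C k) * (\<Sum>i\<le>Suc k. hahn_coeff k i * poly (falling i) x)
      + (if k = 0 then 0 else hahn_b k * (\<Sum>i\<le>Suc k. hahn_coeff (k - 1) i * poly (falling i) x))"
    unfolding hahn_coeff_recurrence distrib_right sum.distrib sum_distrib_left by (auto simp: mult.assoc)
  also have "\<dots> = poly (hahn_poly (Suc k)) x + (hahn_A k + hahn_C k) * poly (hahn_poly k) x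
    + (if k = 0 then 0 else hahn_b k * poly (hahn_poly (k - 1)) x)"
    by (simp only: ext le_refl le_SucI diff_le_self order_trans[OF diff_le_self le_SucI[OF le_refl]])
  finally show ?thesis .
qed

text \<open>The Hahn polynomials are the eigenfunctions of this difference operator, with distinct eigenvalues, and the operator is
  symmetric for a weight satisfying the Pearson relation; orthogonality follows.\<close>

definition hahn_op :: "(real \<Rightarrow> real) \<Rightarrow> real \<Rightarrow> real" where
  "hahn_op f x = (x + real p + 1) * (real M - x) * (f (x + 1) - f x)
     + x * (real M - x + real q + 1) * (f (x - 1) - f x)"

section \<open>The difference operator, orthogonality and norms\<close>

lemma falling_pred: "x * poly (falling j) (x - 1) = poly (falling (Suc j)) x"
  using falling_shift[of j "x - 1"] by simp

text \<open>The operator is bidiagonal in this basis: the factor \<open>x\<close> before the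
  backward difference restores the degree that a backward shift costs, so only the indices
  \<open>i\<close> and \<open>i - 1\<close> remain.\<close>

lemma hahn_op_falling:
  "hahn_op (poly (falling i)) x = - (real i * (real i + real p + real q + 1)) * poly (falling i) x
     + real i * (real M - real i + 1) * (real p + real i) * poly (falling (i - 1)) x"
proof (cases i)
  case 0
  then show ?thesis by (simp add: hahn_op_def newton_basis_def)
next
  case (Suc j)
  define f where "f = poly (falling j) x"
  have a: "poly (falling (Suc j)) (x + 1) = (x + 1) * f" unfolding f_def by (rule falling_shift)
  have b: "poly (falling (Suc j)) x = (x - real j) * f" unfolding f_def falling_Suc by simp
  have c: "x * poly (falling (Suc j)) (x - 1) = (x - real j - 1) * ((x - real j) * f)"
    unfolding falling_pred falling_Suc[of "Suc j"] b by (simp add: algebra_simps)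
  have "hahn_op (poly (falling (Suc j))) x = (x + real p + 1) * (real M - x) * ((x + 1) * f - (x - real j) * f)
     + (real M - x + real q + 1) * (x * poly (falling (Suc j)) (x - 1) - x * ((x - real j) * f))"
    unfolding hahn_op_def a b by (simp add: right_diff_distrib left_diff_distrib mult_ac)
  also have "\<dots> = - (real (Suc j) * (real (Suc j) + real p + real q + 1)) * ((x - real j) * f)
     + real (Suc j) * (real M - real (Suc j) + 1) * (real p + real (Suc j)) * f"
    unfolding c by (simp add: algebra_simps)
  finally show ?thesis using Suc by (simp add: b f_def)
qed

lemma hahn_op_eigen:
  "hahn_op (poly (hahn_poly k)) x = - (real k * (real k + real p + real q + 1)) * poly (hahn_poly k) x"
proof -
  let ?F = "\<lambda>i. poly (falling i) x"
  let ?N = "\<lambda>i. real i * (real M - real i + 1) * (real p + real i)"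
  let ?l = "\<lambda>i. real i * (real i + real p + real q + 1)"
  have "hahn_op (poly (hahn_poly k)) x = (\<Sum>i\<le>k. hahn_coeff k i * hahn_op (poly (falling i)) x)"
    unfolding hahn_op_def poly_hahn sum_subtractf[symmetric] sum_distrib_left sum.distrib[symmetric]
    by (intro sum.cong refl) (simp add: algebra_simps)
  also have "\<dots> = (\<Sum>i\<le>k. - (?l i) * hahn_coeff k i * ?F i) + (\<Sum>i\<le>k. hahn_coeff k i * ?N i * ?F (i - 1))"
    unfolding hahn_op_falling sum.distrib[symmetric]
    by (intro sum.cong refl) (simp only: distrib_left mult_ac)
  also have "(\<Sum>i\<le>k. hahn_coeff k i * ?N i * ?F (i - 1)) = (\<Sum>i\<le>Suc k. hahn_coeff k i * ?N i * ?F (i - 1))"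
    by simp
  also have "\<dots> = (\<Sum>i\<le>k. hahn_coeff k (Suc i) * ?N (Suc i) * ?F i)"
    by (simp only: sum.atMost_Suc_shift) simp
  also have "(\<Sum>i\<le>k. - (?l i) * hahn_coeff k i * ?F i) + \<dots> = (\<Sum>i\<le>k. - (?l k) * (hahn_coeff k i * ?F i))"
    unfolding sum.distrib[symmetric]
  proof (intro sum.cong refl)
    fix i assume "i \<in> {..k}"
    then consider "i < k" | "i = k" by force
    then have "- (?l i) * hahn_coeff k i + hahn_coeff k (Suc i) * ?N (Suc i) = - (?l k) * hahn_coeff k i"
    proof cases
      case 1
      have "hahn_coeff k (Suc i) * ?N (Suc i) = - (hahn_coeff k i * ((real k - real i) * (real i + real k + real p + real q + 1)))"
        unfolding hahn_coeff_step[OF 1] by (simp add: algebra_simps)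
      then show ?thesis by (simp add: algebra_simps)
    qed simp
    then have "(- (?l i) * hahn_coeff k i + hahn_coeff k (Suc i) * ?N (Suc i)) * ?F i = - (?l k) * hahn_coeff k i * ?F i"
      by simp
    then show "- (?l i) * hahn_coeff k i * ?F i + hahn_coeff k (Suc i) * ?N (Suc i) * ?F i = - (?l k) * (hahn_coeff k i * ?F i)"
      by (simp only: distrib_right mult.assoc)
  qed
  finally show ?thesis unfolding poly_hahn sum_distrib_left .
qed

definition hahn_norm :: "(nat \<Rightarrow> real) \<Rightarrow> nat \<Rightarrow> real" where
  "hahn_norm w k = (\<Sum>x\<le>M. w x * (poly (hahn_poly k) (real x))\<^sup>2)"

context
  fixes w :: "nat \<Rightarrow> real"
  assumes w_pos: "\<And>x. x \<le> M \<Longrightarrow> w x > 0"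
    and pearson: "\<And>x. x < M \<Longrightarrow> w (Suc x) * ((real x + 1) * (real M - real x + real q))
      = w x * ((real x + real p + 1) * (real M - real x))"
begin

text \<open>Summation by parts: the backward part is shifted by one and rewritten with the Pearson
  relation. No boundary terms arise, since \<open>real M - real x\<close> vanishes at
  \<open>x = M\<close> and the factor \<open>x\<close> at 0. The right side is symmetric in
  \<open>f\<close> and \<open>g\<close>.\<close>

lemma hahn_op_symmetric:
  "(\<Sum>x\<le>M. w x * hahn_op f (real x) * g (real x))
    = - (\<Sum>x<M. w x * ((real x + real p + 1) * (real M - real x)) * (f (real x + 1) - f (real x)) * (g (real x + 1) - g (real x)))"
proof -
  let ?B = "\<lambda>x. (real x + real p + 1) * (real M - real x)"
  let ?D = "\<lambda>x. real x * (real M - real x + real q + 1)"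
  have "(\<Sum>x\<le>M. w x * hahn_op f (real x) * g (real x))
    = (\<Sum>x\<le>M. w x * ?B x * (f (real x + 1) - f (real x)) * g (real x))
      + (\<Sum>x\<le>M. w x * ?D x * (f (real x - 1) - f (real x)) * g (real x))"
    unfolding sum.distrib[symmetric] hahn_op_def by (intro sum.cong refl) (simp only: distrib_left distrib_right mult_ac)
  also have "(\<Sum>x\<le>M. w x * ?B x * (f (real x + 1) - f (real x)) * g (real x))
    = (\<Sum>x<M. w x * ?B x * (f (real x + 1) - f (real x)) * g (real x))"
    by (simp add: lessThan_Suc_atMost[symmetric])
  also have "(\<Sum>x\<le>M. w x * ?D x * (f (real x - 1) - f (real x)) * g (real x))
    = (\<Sum>x<M. w (Suc x) * ?D (Suc x) * (f (real x) - f (real x + 1)) * g (real x + 1))"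
    by (simp only: lessThan_Suc_atMost[symmetric] sum.lessThan_Suc_shift) (simp add: add.commute)
  also have "\<dots> = (\<Sum>x<M. w x * ?B x * (f (real x) - f (real x + 1)) * g (real x + 1))"
  proof (intro sum.cong refl)
    fix x assume "x \<in> {..<M}"
    then have "w (Suc x) * ?D (Suc x) = w x * ?B x" using pearson[of x] by (simp add: algebra_simps)
    then show "w (Suc x) * ?D (Suc x) * (f (real x) - f (real x + 1)) * g (real x + 1)
      = w x * ?B x * (f (real x) - f (real x + 1)) * g (real x + 1)" by simp
  qed
  finally show ?thesis
    unfolding sum.distrib[symmetric] sum_negf[symmetric]
    by (elim trans) (intro sum.cong refl, simp add: algebra_simps)
qed

lemma hahn_orthogonal:
  assumes "j \<noteq> k"
  shows "(\<Sum>x\<le>M. w x * poly (hahn_poly j) (real x) * poly (hahn_poly k) (real x)) = 0"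
proof -
  let ?l = "\<lambda>i. real i * (real i + real p + real q + 1)"
  let ?I = "\<Sum>x\<le>M. w x * poly (hahn_poly j) (real x) * poly (hahn_poly k) (real x)"
  have "- (?l j) * ?I = (\<Sum>x\<le>M. w x * hahn_op (poly (hahn_poly j)) (real x) * poly (hahn_poly k) (real x))"
    unfolding hahn_op_eigen sum_distrib_left by (intro sum.cong refl) (simp only: mult_ac)
  also have "\<dots> = (\<Sum>x\<le>M. w x * hahn_op (poly (hahn_poly k)) (real x) * poly (hahn_poly j) (real x))"
    unfolding hahn_op_symmetric by (simp only: mult_ac)
  also have "\<dots> = - (?l k) * ?I"
    unfolding hahn_op_eigen sum_distrib_left by (intro sum.cong refl) (simp only: mult_ac)
  finally have "(?l j - ?l k) * ?I = 0" by (simp add: algebra_simps)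
  moreover have "?l j - ?l k = (real j - real k) * (real j + real k + real p + real q + 1)"
    by (simp add: algebra_simps)
  moreover have "(real j - real k) * (real j + real k + real p + real q + 1) \<noteq> 0"
    using assms by (simp add: add_nonneg_eq_0_iff add_eq_0_iff)
  ultimately show ?thesis by simp
qed

text \<open>The inner product of \<open>x * P k\<close> with \<open>P (Suc k)\<close> is computed
  twice, the recurrence acting on either factor.\<close>

lemma hahn_norm_Suc: "hahn_norm w (Suc k) = hahn_b (Suc k) * hahn_norm w k"
proof -
  let ?P = "\<lambda>k x. poly (hahn_poly k) (real x)"
  let ?ip = "\<lambda>j k. \<Sum>x\<le>M. w x * ?P j x * ?P k x"
  have self: "?ip k k = hahn_norm w k" for k
    unfolding hahn_norm_def by (simp add: power2_eq_square mult.assoc)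
  have mult: "(\<Sum>x\<le>M. w x * (real x * ?P k x) * ?P j x) = ?ip (Suc k) j + (hahn_A k + hahn_C k) * ?ip k j
    + (if k = 0 then 0 else hahn_b k * ?ip (k - 1) j)" for j k
    unfolding hahn_three_term by (simp add: distrib_left distrib_right sum.distrib sum_distrib_left mult_ac)
  have "(\<Sum>x\<le>M. w x * (real x * ?P k x) * ?P (Suc k) x) = hahn_norm w (Suc k)"
    unfolding mult by (simp add: hahn_orthogonal self)
  moreover have "(\<Sum>x\<le>M. w x * (real x * ?P (Suc k) x) * ?P k x) = hahn_b (Suc k) * hahn_norm w k"
    unfolding mult by (simp add: hahn_orthogonal self)
  ultimately show ?thesis by (simp add: mult_ac)
qed

lemma hahn_b_pos: "\<lbrakk>0 < k; k \<le> M\<rbrakk> \<Longrightarrow> hahn_b k > 0"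
  unfolding hahn_b_def hahn_A_def hahn_C_def
  by (intro mult_pos_pos divide_pos_pos) (auto simp: of_nat_diff add_pos_nonneg)

lemma hahn_norm_pos: "k \<le> M \<Longrightarrow> hahn_norm w k > 0"
proof (induction k)
  case 0
  have "poly (hahn_poly 0) x = 1" for x
    by (simp add: poly_hahn newton_basis_def)
  then show ?case unfolding hahn_norm_def using w_pos by (auto intro!: sum_pos)
next
  case (Suc k)
  then show ?case by (simp add: hahn_norm_Suc hahn_b_pos)
qed

end

end

section \<open>Tilings as perfect matchings of triangles\<close>

definition vec_s :: "point \<Rightarrow> real" where
  "vec_s u = fst u - snd u / sqrt 3"

definition vec_t :: "point \<Rightarrow> real" where
  "vec_t u = 2 * snd u / sqrt 3"

lemma vec_st_linear:
  "vec_s (u + v) = vec_s u + vec_s v" "vec_t (u + v) = vec_t u + vec_t v"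
  "vec_s (u - v) = vec_s u - vec_s v" "vec_t (u - v) = vec_t u - vec_t v"
  "vec_s (r *\<^sub>R u) = r * vec_s u" "vec_t (r *\<^sub>R u) = r * vec_t u"
  by (simp_all add: vec_s_def vec_t_def field_simps)

lemma vec_st_eq_iff: "u = v \<longleftrightarrow> vec_s u = vec_s v \<and> vec_t u = vec_t v"
  by (auto simp: vec_s_def vec_t_def prod_eq_iff)

text \<open>\<open>vec_s\<close> and \<open>vec_t\<close> are the coordinates in the lattice basis
  \<open>(1, 0)\<close>, \<open>(1 / 2, sqrt 3 / 2)\<close>. In them the squared length is the norm
  form of the Eisenstein integers, \<open>s\<^sup>2 + s * t + t\<^sup>2\<close>.\<close>

lemma vec_st_inner: "inner u v = vec_s u * vec_s v + vec_t u * vec_t v + (vec_s u * vec_t v + vec_t u * vec_s v) / 2"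
proof -
  have "snd u = vec_t u * sqrt 3 / 2" "fst u = vec_s u + vec_t u / 2"
       "snd v = vec_t v * sqrt 3 / 2" "fst v = vec_s v + vec_t v / 2"
    by (simp_all add: vec_s_def vec_t_def field_simps)
  then have "inner u v = (vec_s u + vec_t u / 2) * (vec_s v + vec_t v / 2) + (vec_t u * sqrt 3 / 2) * (vec_t v * sqrt 3 / 2)"
    by (simp only: inner_prod_def inner_real_def)
  then show ?thesis
    by (simp add: algebra_simps)
qed

text \<open>Cramer's rule; a determinant 1 or -1 is its own inverse, so multiplication by
  \<open>d\<close> replaces division by it.\<close>

lemma parallelogram_coordinates:
  assumes d: "d = vec_s u * vec_t v - vec_t u * vec_s v" "d = 1 \<or> d = -1"
  shows "z \<in> parallelogram p u v \<longleftrightarrow>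
    (vec_t v * vec_s (z - p) - vec_s v * vec_t (z - p)) * d \<in> {0..1} \<and>
    (vec_s u * vec_t (z - p) - vec_t u * vec_s (z - p)) * d \<in> {0..1}"
proof -
  have dd: "d * d = 1" using d(2) by auto
  have "z = p + s *\<^sub>R u + t *\<^sub>R v \<longleftrightarrow>
    s = (vec_t v * vec_s (z - p) - vec_s v * vec_t (z - p)) * d \<and>
    t = (vec_s u * vec_t (z - p) - vec_t u * vec_s (z - p)) * d" for s t
  proof -
    define x y where "x = vec_s (z - p)" and "y = vec_t (z - p)"
    have "z = p + s *\<^sub>R u + t *\<^sub>R v \<longleftrightarrow> z - p = s *\<^sub>R u + t *\<^sub>R v"
      by (auto simp: algebra_simps)
    also have "\<dots> \<longleftrightarrow> x = s * vec_s u + t * vec_s v \<and> y = s * vec_t u + t * vec_t v"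
      unfolding vec_st_eq_iff[of "z - p"] x_def y_def by (simp add: vec_st_linear)
    also have "\<dots> \<longleftrightarrow> s = (vec_t v * x - vec_s v * y) * d \<and> t = (vec_s u * y - vec_t u * x) * d"
    proof safe
      assume x: "x = s * vec_s u + t * vec_s v" and y: "y = s * vec_t u + t * vec_t v"
      have "(vec_t v * x - vec_s v * y) * d = s * (d * d)"
        unfolding x y d(1) by (simp add: algebra_simps)
      then show "s = (vec_t v * (s * vec_s u + t * vec_s v) - vec_s v * (s * vec_t u + t * vec_t v)) * d"
        using dd x y by simp
      have "(vec_s u * y - vec_t u * x) * d = t * (d * d)"
        unfolding x y d(1) by (simp add: algebra_simps)
      then show "t = (vec_s u * (s * vec_t u + t * vec_t v) - vec_t u * (s * vec_s u + t * vec_s v)) * d"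
        using dd x y by simp
    next
      have "((vec_t v * x - vec_s v * y) * d) * vec_s u + ((vec_s u * y - vec_t u * x) * d) * vec_s v = x * (d * d)"
        unfolding d(1) by (simp add: algebra_simps)
      then show "x = ((vec_t v * x - vec_s v * y) * d) * vec_s u + ((vec_s u * y - vec_t u * x) * d) * vec_s v"
        using dd by simp
      have "((vec_t v * x - vec_s v * y) * d) * vec_t u + ((vec_s u * y - vec_t u * x) * d) * vec_t v = y * (d * d)"
        unfolding d(1) by (simp add: algebra_simps)
      then show "y = ((vec_t v * x - vec_s v * y) * d) * vec_t u + ((vec_s u * y - vec_t u * x) * d) * vec_t v"
        using dd by simp
    qed
    finally show ?thesis unfolding x_def y_def .
  qed
  then show ?thesis unfolding parallelogram_def by auto
qed

text \<open>A lozenge is named by its type and by the upward triangle it contains: \<^term>\<open>i\<close> and \<^term>\<open>j\<close>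
  are the lattice coordinates of the lower left corner of that triangle.\<close>

datatype tile = TileA int int | TileB int int | TileV int int

datatype triangle = Up int int | Down int int

fun triangles :: "tile \<Rightarrow> triangle set" where
  "triangles (TileA i j) = {Up i j, Down i j}"
| "triangles (TileB i j) = {Up i j, Down (i - 1) j}"
| "triangles (TileV i j) = {Up i j, Down i (j - 1)}"

context
  fixes a b c :: nat
begin

definition base_point :: point where
  "base_point = (- (real a + 2 * real b + real c) / 4, sqrt 3 / 4 * (real c - real a))"

definition pos_s :: "point \<Rightarrow> real" where "pos_s z = vec_s (z - base_point)"
definition pos_t :: "point \<Rightarrow> real" where "pos_t z = vec_t (z - base_point)"

definition at_pos :: "real \<Rightarrow> real \<Rightarrow> point" where
  "at_pos s t = base_point + s *\<^sub>R (1, 0) + t *\<^sub>R (1 / 2, sqrt 3 / 2)"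

lemma pos_at_pos [simp]: "pos_s (at_pos s t) = s" "pos_t (at_pos s t) = t"
  by (simp_all add: pos_s_def pos_t_def at_pos_def vec_s_def vec_t_def field_simps)

lemma at_pos_pos [simp]: "at_pos (pos_s z) (pos_t z) = z"
  by (simp add: pos_s_def pos_t_def at_pos_def vec_s_def vec_t_def prod_eq_iff field_simps)

lemma continuous_pos: "continuous_on UNIV pos_s" "continuous_on UNIV pos_t"
  unfolding pos_s_def pos_t_def vec_s_def vec_t_def by (auto intro!: continuous_intros)

lemma hexagon_pos:
  "z \<in> hexagon (real a) (real b) (real c) \<longleftrightarrow>
    0 \<le> pos_s z \<and> pos_s z \<le> real b + real c \<and> - real c \<le> pos_t z \<and> pos_t z \<le> real a
    \<and> 0 \<le> pos_s z + pos_t z \<and> pos_s z + pos_t z \<le> real a + real b"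
proof -
  define s t where "s = pos_s z" and "t = pos_t z"
  have z: "z = at_pos s t" by (simp add: s_def t_def)
  define r :: real where "r = sqrt 3"
  have r: "r > 0" by (simp add: r_def)
  define X Y where "X = - (real a + 2 * real b + real c) / 4 + s + t / 2" and "Y = (real c - real a) / 4 + t / 2"
  have zXY: "z = (X, r * Y)"
    unfolding z at_pos_def base_point_def r_def X_def Y_def by (simp add: algebra_simps)
  have m: "r * Y \<le> r / 2 * W \<longleftrightarrow> 2 * Y \<le> W" "r * Y \<le> r / 4 * W \<longleftrightarrow> 4 * Y \<le> W"
    "r / 2 * W \<le> r * Y \<longleftrightarrow> W \<le> 2 * Y" "- r / 4 * W \<le> r * Y \<longleftrightarrow> - W \<le> 4 * Y" for W
    using mult_le_cancel_left_pos[OF r, of Y "W / 2"] mult_le_cancel_left_pos[OF r, of Y "W / 4"]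
      mult_le_cancel_left_pos[OF r, of "W / 2" Y] mult_le_cancel_left_pos[OF r, of "- W / 4" Y]
    by auto
  have "z \<in> hexagon (real a) (real b) (real c) \<longleftrightarrow> 0 \<le> s \<and> s \<le> real b + real c \<and> - real c \<le> t \<and> t \<le> real a \<and> 0 \<le> s + t \<and> s + t \<le> real a + real b"
    unfolding zXY hexagon_def r_def[symmetric] mem_Collect_eq prod.case m unfolding X_def Y_def
    by (auto simp: field_simps)
  then show ?thesis unfolding s_def t_def .
qed

lemma tri_lattice_pos: "z \<in> tri_lattice a b c \<longleftrightarrow> pos_s z \<in> \<int> \<and> pos_t z \<in> \<int>"
proof
  assume "z \<in> tri_lattice a b c"
  then obtain i j where "z = at_pos (of_int i) (of_int j)"
    unfolding tri_lattice_def at_pos_def base_point_def by auto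
  then show "pos_s z \<in> \<int> \<and> pos_t z \<in> \<int>" by simp
next
  assume "pos_s z \<in> \<int> \<and> pos_t z \<in> \<int>"
  then obtain i j where "pos_s z = of_int i" "pos_t z = of_int j" by (auto elim!: Ints_cases)
  then have "z = at_pos (of_int i) (of_int j)" by (metis at_pos_pos)
  then show "z \<in> tri_lattice a b c"
    unfolding tri_lattice_def at_pos_def base_point_def by blast
qed

text \<open>The three kinds correspond to the three choices of two among the functions
  \<open>s\<close>, \<open>t\<close>, \<open>s + t\<close>. Every lattice line is an integer level
  of one of these, so membership becomes a question about floors.\<close>

fun region :: "tile \<Rightarrow> point set" where
  "region (TileA i j) = {z. of_int i \<le> pos_s z \<and> pos_s z \<le> of_int i + 1 \<and> of_int j \<le> pos_t z \<and> pos_t z \<le> of_int j + 1}"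
| "region (TileB i j) = {z. of_int j \<le> pos_t z \<and> pos_t z \<le> of_int j + 1
     \<and> of_int (i + j) \<le> pos_s z + pos_t z \<and> pos_s z + pos_t z \<le> of_int (i + j) + 1}"
| "region (TileV i j) = {z. of_int i \<le> pos_s z \<and> pos_s z \<le> of_int i + 1
     \<and> of_int (i + j) \<le> pos_s z + pos_t z \<and> pos_s z + pos_t z \<le> of_int (i + j) + 1}"

lemma lozenge_frame_unit:
  assumes "lozenge_frame u v" "vec_s u = of_int u1" "vec_t u = of_int u2" "vec_s v = of_int v1" "vec_t v = of_int v2"
  shows "u1 * u1 + u1 * u2 + u2 * u2 = 1" "v1 * v1 + v1 * v2 + v2 * v2 = 1"
    "2 * u1 * v1 + 2 * u2 * v2 + u1 * v2 + u2 * v1 = 1"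
proof -
  have "inner u u = 1" "inner v v = 1" "inner u v = 1 / 2"
    using assms(1) by (auto simp: lozenge_frame_def dot_square_norm cos_60)
  then have "real_of_int (u1 * u1 + u1 * u2 + u2 * u2) = of_int 1" "real_of_int (v1 * v1 + v1 * v2 + v2 * v2) = of_int 1"
    "real_of_int (2 * u1 * v1 + 2 * u2 * v2 + u1 * v2 + u2 * v1) = of_int 1"
    unfolding vec_st_inner assms by (simp_all add: field_simps)
  then show "u1 * u1 + u1 * u2 + u2 * u2 = 1" "v1 * v1 + v1 * v2 + v2 * v2 = 1"
    "2 * u1 * v1 + 2 * u2 * v2 + u1 * v2 + u2 * v1 = 1"
    by (simp_all only: of_int_eq_iff)
qed

text \<open>Four times the form is \<open>(2 * x + y)\<^sup>2 + 3 * y\<^sup>2\<close>, which bounds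
  \<open>\<bar>y\<bar>\<close> by 1 and, symmetrically, \<open>\<bar>x\<bar>\<close>; a finite check
  remains.\<close>

lemma eisenstein_unit:
  fixes x y :: int
  assumes "x * x + x * y + y * y = 1"
  shows "(x, y) \<in> {(1, 0), (-1, 0), (0, 1), (0, -1), (1, -1), (-1, 1)}"
proof -
  have "(2 * x + y) * (2 * x + y) + 3 * (y * y) = 4" "(2 * y + x) * (2 * y + x) + 3 * (x * x) = 4"
  proof -
    have "(2 * x + y) * (2 * x + y) + 3 * (y * y) = 4 * (x * x + x * y + y * y)"
      "(2 * y + x) * (2 * y + x) + 3 * (x * x) = 4 * (x * x + x * y + y * y)"
      by (simp_all add: algebra_simps)
    then show "(2 * x + y) * (2 * x + y) + 3 * (y * y) = 4" "(2 * y + x) * (2 * y + x) + 3 * (x * x) = 4"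
      unfolding assms by simp_all
  qed
  moreover have "(2 * x + y) * (2 * x + y) \<ge> 0" "(2 * y + x) * (2 * y + x) \<ge> 0" by auto
  ultimately have "y * y < 2 * 2" "x * x < 2 * 2" by linarith+
  then have "\<bar>y\<bar> < 2" "\<bar>x\<bar> < 2" by (metis abs_mult_self_eq abs_mult_less abs_ge_zero abs_numeral not_less mult_mono zero_le_numeral)+
  then have "x \<in> {-1, 0, 1}" "y \<in> {-1, 0, 1}" by auto
  with assms show ?thesis by auto
qed

lemma lozenges_eq: "lozenges (tri_lattice a b c) = range region"
proof (rule equalityI; rule subsetI)
  fix L assume "L \<in> lozenges (tri_lattice a b c)"
  then obtain p u v where L: "L = parallelogram p u v" and fr: "lozenge_frame u v"
    and lat: "p \<in> tri_lattice a b c" "p + u \<in> tri_lattice a b c" "p + v \<in> tri_lattice a b c"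
    unfolding lozenges_def by auto
  have diff: "pos_s (p + w) = pos_s p + vec_s w" "pos_t (p + w) = pos_t p + vec_t w" for w
    unfolding pos_s_def pos_t_def by (simp_all add: vec_st_linear)
  obtain i j where ij: "pos_s p = of_int i" "pos_t p = of_int j"
    using lat(1) unfolding tri_lattice_pos by (auto elim!: Ints_cases)
  have "vec_s u \<in> \<int>" "vec_t u \<in> \<int>" "vec_s v \<in> \<int>" "vec_t v \<in> \<int>"
    using lat unfolding tri_lattice_pos diff by (metis Ints_diff add_diff_cancel_left')+
  then obtain u1 u2 v1 v2 where uv: "vec_s u = of_int u1" "vec_t u = of_int u2" "vec_s v = of_int v1" "vec_t v = of_int v2"
    by (metis Ints_cases)
  note eq = lozenge_frame_unit[OF fr uv]
  have uc: "(u1, u2) \<in> {(1, 0), (-1, 0), (0, 1), (0, -1), (1, -1), (-1, 1)}"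
    using eisenstein_unit[OF eq(1)] .
  have vc: "(v1, v2) \<in> {(1, 0), (-1, 0), (0, 1), (0, -1), (1, -1), (-1, 1)}"
    using eisenstein_unit[OF eq(2)] .
  define d where "d = u1 * v2 - u2 * v1"
  have d1: "d = 1 \<or> d = -1" using uc vc eq(3) unfolding d_def by auto
  have mem: "z \<in> L \<longleftrightarrow>
    (of_int v2 * (pos_s z - of_int i) - of_int v1 * (pos_t z - of_int j)) * of_int d \<in> {0..1::real} \<and>
    (of_int u1 * (pos_t z - of_int j) - of_int u2 * (pos_s z - of_int i)) * of_int d \<in> {0..1::real}" for z
  proof -
    have "vec_s (z - p) = pos_s z - of_int i" "vec_t (z - p) = pos_t z - of_int j"
      using ij unfolding pos_s_def pos_t_def by (simp_all add: vec_st_linear)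
    moreover have "real_of_int d = vec_s u * vec_t v - vec_t u * vec_s v" by (simp add: d_def uv)
    moreover have "real_of_int d = 1 \<or> real_of_int d = - 1" using d1 by auto
    ultimately show ?thesis
      unfolding L by (subst parallelogram_coordinates[where d = "of_int d"]) (simp_all add: uv)
  qed
  \<comment> \<open>The frames are the ordered pairs of neighbouring units: twelve, grouped here in
    pairs that differ by the order of \<open>u\<close> and \<open>v\<close>. Opposite acute corners
    give the same kind of lozenge, so the six groups produce three kinds.\<close>
  have "(u1, u2, v1, v2) \<in> {(1, 0, 0, 1), (0, 1, 1, 0)} \<or> (u1, u2, v1, v2) \<in> {(0, 1, -1, 1), (-1, 1, 0, 1)} \<or> (u1, u2, v1, v2) \<in> {(-1, 1, -1, 0), (-1, 0, -1, 1)} \<or> (u1, u2, v1, v2) \<in> {(-1, 0, 0, -1), (0, -1, -1, 0)} \<or> (u1, u2, v1, v2) \<in> {(0, -1, 1, -1), (1, -1, 0, -1)} \<or> (u1, u2, v1, v2) \<in> {(1, -1, 1, 0), (1, 0, 1, -1)}"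
    using uc vc eq(3) by (simp only: insert_iff empty_iff prod.inject) (elim disjE conjE FalseE; simp)
  moreover have "L = region (TileA i j)" if "(u1, u2, v1, v2) \<in> {(1, 0, 0, 1), (0, 1, 1, 0)}"
    using that unfolding set_eq_iff mem d_def by auto
  moreover have "L = region (TileV (i - 1) (j + 1))" if "(u1, u2, v1, v2) \<in> {(0, 1, -1, 1), (-1, 1, 0, 1)}"
    using that unfolding set_eq_iff mem d_def by auto
  moreover have "L = region (TileB (i - 1) j)" if "(u1, u2, v1, v2) \<in> {(-1, 1, -1, 0), (-1, 0, -1, 1)}"
    using that unfolding set_eq_iff mem d_def by auto
  moreover have "L = region (TileA (i - 1) (j - 1))" if "(u1, u2, v1, v2) \<in> {(-1, 0, 0, -1), (0, -1, -1, 0)}"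
    using that unfolding set_eq_iff mem d_def by auto
  moreover have "L = region (TileV i (j - 1))" if "(u1, u2, v1, v2) \<in> {(0, -1, 1, -1), (1, -1, 0, -1)}"
    using that unfolding set_eq_iff mem d_def by auto
  moreover have "L = region (TileB (i + 1) (j - 1))" if "(u1, u2, v1, v2) \<in> {(1, -1, 1, 0), (1, 0, 1, -1)}"
    using that unfolding set_eq_iff mem d_def by auto
  ultimately have "L = region (TileA i j) \<or> L = region (TileV (i - 1) (j + 1)) \<or> L = region (TileB (i - 1) j) \<or> L = region (TileA (i - 1) (j - 1)) \<or> L = region (TileV i (j - 1)) \<or> L = region (TileB (i + 1) (j - 1))"
    by argo
  then show "L \<in> range region" by blast
next
  fix L assume "L \<in> range region"
  then obtain l where L: "L = region l" by blast
  have mem: "L \<in> lozenges (tri_lattice a b c)"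
    if uv: "vec_s u = of_int u1" "vec_t u = of_int u2" "vec_s v = of_int v1" "vec_t v = of_int v2"
      and n: "u1 * u1 + u1 * u2 + u2 * u2 = 1" "v1 * v1 + v1 * v2 + v2 * v2 = 1"
      "2 * u1 * v1 + 2 * u2 * v2 + u1 * v2 + u2 * v1 = 1"
      and d: "u1 * v2 - u2 * v1 = 1"
      and m: "\<And>z. z \<in> L \<longleftrightarrow> (of_int v2 * (pos_s z - of_int i) - of_int v1 * (pos_t z - of_int j)) \<in> {0..1::real} \<and>
          (of_int u1 * (pos_t z - of_int j) - of_int u2 * (pos_s z - of_int i)) \<in> {0..1::real}"
    for u v u1 u2 v1 v2 i j
  proof -
    define p where "p = at_pos (of_int i) (of_int j)"
    have "real_of_int (u1 * u1 + u1 * u2 + u2 * u2) = 1" "real_of_int (v1 * v1 + v1 * v2 + v2 * v2) = 1"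
      "real_of_int (2 * u1 * v1 + 2 * u2 * v2 + u1 * v2 + u2 * v1) = 1"
      unfolding n by simp_all
    then have "inner u u = 1" "inner v v = 1" "inner u v = 1 / 2"
      unfolding vec_st_inner uv by (simp_all add: field_simps)
    then have fr: "lozenge_frame u v"
      by (simp add: lozenge_frame_def norm_eq_1 cos_60)
    have dr: "1 = vec_s u * vec_t v - vec_t u * vec_s v"
      unfolding uv using d by (metis of_int_1 of_int_diff of_int_mult)
    have "vec_s (z - p) = pos_s z - of_int i" "vec_t (z - p) = pos_t z - of_int j" for z
      using pos_at_pos[of "of_int i" "of_int j"] unfolding p_def pos_s_def pos_t_def
      by (simp_all add: vec_st_linear)
    then have "L = parallelogram p u v"
      unfolding set_eq_iff m by (subst parallelogram_coordinates[OF dr]) (auto simp: uv)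
    moreover have "{p, p + u, p + v, p + u + v} \<subseteq> tri_lattice a b c"
    proof -
      have "pos_s (p + w) = of_int i + vec_s w" "pos_t (p + w) = of_int j + vec_t w" for w
        using pos_at_pos[of "of_int i" "of_int j"] unfolding p_def pos_s_def pos_t_def by (simp_all add: vec_st_linear)
      then show ?thesis
        using pos_at_pos[of "of_int i" "of_int j"]
        by (simp add: tri_lattice_pos uv vec_st_linear add.assoc p_def[symmetric])
    qed
    ultimately show ?thesis unfolding lozenges_def using fr by blast
  qed
  have vecs: "vec_s (1, 0) = 1" "vec_t (1, 0) = 0" "vec_s (1 / 2, sqrt 3 / 2) = 0" "vec_t (1 / 2, sqrt 3 / 2) = 1"
    "vec_s (- (1 / 2), sqrt 3 / 2) = -1" "vec_t (- (1 / 2), sqrt 3 / 2) = 1"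
    by (simp_all add: vec_s_def vec_t_def)
  show "L \<in> lozenges (tri_lattice a b c)"
  proof (cases l)
    case (TileA i j)
    show ?thesis
      by (rule mem[of "(1, 0)" 1 0 "(1 / 2, sqrt 3 / 2)" 0 1 i j]) (auto simp: vecs L TileA)
  next
    case (TileB i j)
    show ?thesis
      by (rule mem[of "(- (1 / 2), sqrt 3 / 2)" "-1" 1 "(- 1, 0)" "-1" 0 "i + 1" j])
         (auto simp: vecs L TileB vec_s_def vec_t_def)
  next
    case (TileV i j)
    show ?thesis
      by (rule mem[of "(1 / 2, sqrt 3 / 2)" 0 1 "(- (1 / 2), sqrt 3 / 2)" "-1" 1 "i + 1" "j - 1"])
         (auto simp: vecs L TileV)
  qed
qed

section \<open>Unit triangles and perfect matchings\<close>

fun closed_triangle :: "triangle \<Rightarrow> point set" where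
  "closed_triangle (Up i j) = {z. of_int i \<le> pos_s z \<and> of_int j \<le> pos_t z \<and> pos_s z + pos_t z \<le> of_int i + of_int j + 1}"
| "closed_triangle (Down i j) = {z. pos_s z \<le> of_int i + 1 \<and> pos_t z \<le> of_int j + 1 \<and> of_int i + of_int j + 1 \<le> pos_s z + pos_t z}"

fun open_triangle :: "triangle \<Rightarrow> point set" where
  "open_triangle (Up i j) = {z. of_int i < pos_s z \<and> of_int j < pos_t z \<and> pos_s z + pos_t z < of_int i + of_int j + 1}"
| "open_triangle (Down i j) = {z. pos_s z < of_int i + 1 \<and> pos_t z < of_int j + 1 \<and> of_int i + of_int j + 1 < pos_s z + pos_t z}"

fun centroid :: "triangle \<Rightarrow> point" where
  "centroid (Up i j) = at_pos (of_int i + 1 / 3) (of_int j + 1 / 3)"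
| "centroid (Down i j) = at_pos (of_int i + 2 / 3) (of_int j + 2 / 3)"

fun in_hex :: "triangle \<Rightarrow> bool" where
  "in_hex (Up i j) \<longleftrightarrow> 0 \<le> i \<and> i < int b + int c \<and> - int c \<le> j \<and> j < int a \<and> 0 \<le> i + j \<and> i + j < int a + int b"
| "in_hex (Down i j) \<longleftrightarrow> 0 \<le> i \<and> i < int b + int c \<and> - int c \<le> j \<and> j < int a \<and> -1 \<le> i + j \<and> i + j + 1 < int a + int b"

definition perfect_matching :: "tile set \<Rightarrow> bool" where
  "perfect_matching M \<longleftrightarrow> (\<forall>l\<in>M. \<forall>\<tau>\<in>triangles l. in_hex \<tau>) \<and> (\<forall>\<tau>. in_hex \<tau> \<longrightarrow> (\<exists>!l. l \<in> M \<and> \<tau> \<in> triangles l))"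

lemma unit_interval_floor:
  "\<lbrakk>of_int i < r; r < of_int i + 1\<rbrakk> \<Longrightarrow> (of_int x \<le> r \<and> r \<le> of_int x + 1) \<longleftrightarrow> x = i" for r :: real
proof safe
  assume r: "of_int i < r" "r < of_int i + 1" and x: "of_int x \<le> r" "r \<le> of_int x + 1"
  have "real_of_int x < of_int (i + 1)" "real_of_int i < of_int (x + 1)" using r x by simp_all
  then show "x = i" unfolding of_int_less_iff by simp
qed simp_all

text \<open>Inside an open triangle none of \<open>s\<close>, \<open>t\<close>, \<open>s + t\<close>
  is an integer, so each of them determines its unit strip. A single point, usually the centroid,
  therefore decides whether a lozenge contains the triangle.\<close>

lemma open_triangle_region:
  assumes "z \<in> open_triangle \<tau>"
  shows "z \<in> region l \<longleftrightarrow> \<tau> \<in> triangles l"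
proof (cases \<tau>)
  case (Up i j)
  define S T where "S = pos_s z" and "T = pos_t z"
  have h: "of_int i < S" "of_int j < T" "S + T < of_int i + of_int j + 1"
    using assms unfolding Up S_def T_def by auto
  have S: "(of_int x \<le> S \<and> S \<le> of_int x + 1) \<longleftrightarrow> x = i" for x
    by (rule unit_interval_floor) (use h in linarith)+
  have T: "(of_int x \<le> T \<and> T \<le> of_int x + 1) \<longleftrightarrow> x = j" for x
    by (rule unit_interval_floor) (use h in linarith)+
  have ST: "(of_int x \<le> S + T \<and> S + T \<le> of_int x + 1) \<longleftrightarrow> x = i + j" for x
    by (rule unit_interval_floor) (use h in simp_all)
  have r: "z \<in> region (TileA x y) \<longleftrightarrow> (of_int x \<le> S \<and> S \<le> of_int x + 1) \<and> (of_int y \<le> T \<and> T \<le> of_int y + 1)"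
    "z \<in> region (TileB x y) \<longleftrightarrow> (of_int y \<le> T \<and> T \<le> of_int y + 1) \<and> (of_int (x + y) \<le> S + T \<and> S + T \<le> of_int (x + y) + 1)"
    "z \<in> region (TileV x y) \<longleftrightarrow> (of_int x \<le> S \<and> S \<le> of_int x + 1) \<and> (of_int (x + y) \<le> S + T \<and> S + T \<le> of_int (x + y) + 1)" for x y
    unfolding S_def T_def by auto
  show ?thesis unfolding Up by (cases l) (auto simp only: r S T ST triangles.simps insert_iff empty_iff triangle.inject triangle.distinct)
next
  case (Down i j)
  define S T where "S = pos_s z" and "T = pos_t z"
  have h: "S < of_int i + 1" "T < of_int j + 1" "of_int i + of_int j + 1 < S + T"
    using assms unfolding Down S_def T_def by auto
  have S: "(of_int x \<le> S \<and> S \<le> of_int x + 1) \<longleftrightarrow> x = i" for x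
    by (rule unit_interval_floor) (use h in linarith)+
  have T: "(of_int x \<le> T \<and> T \<le> of_int x + 1) \<longleftrightarrow> x = j" for x
    by (rule unit_interval_floor) (use h in linarith)+
  have ST: "(of_int x \<le> S + T \<and> S + T \<le> of_int x + 1) \<longleftrightarrow> x = i + j + 1" for x
    by (rule unit_interval_floor) (use h in simp_all)
  have r: "z \<in> region (TileA x y) \<longleftrightarrow> (of_int x \<le> S \<and> S \<le> of_int x + 1) \<and> (of_int y \<le> T \<and> T \<le> of_int y + 1)"
    "z \<in> region (TileB x y) \<longleftrightarrow> (of_int y \<le> T \<and> T \<le> of_int y + 1) \<and> (of_int (x + y) \<le> S + T \<and> S + T \<le> of_int (x + y) + 1)"
    "z \<in> region (TileV x y) \<longleftrightarrow> (of_int x \<le> S \<and> S \<le> of_int x + 1) \<and> (of_int (x + y) \<le> S + T \<and> S + T \<le> of_int (x + y) + 1)" for x y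
    unfolding S_def T_def by auto
  show ?thesis unfolding Down by (cases l) (auto simp: r S T ST simp del: region.simps of_int_add)
qed

lemma centroid_in_open: "centroid \<tau> \<in> open_triangle \<tau>"
  by (cases \<tau>) auto

lemma centroid_in_hexagon: "centroid \<tau> \<in> hexagon (real a) (real b) (real c) \<longleftrightarrow> in_hex \<tau>"
proof (cases \<tau>)
  case (Up i j)
  show ?thesis unfolding hexagon_pos Up by simp linarith
next
  case (Down i j)
  show ?thesis unfolding hexagon_pos Down by simp linarith
qed

lemma closed_triangle_subset_hexagon: "in_hex \<tau> \<Longrightarrow> closed_triangle \<tau> \<subseteq> hexagon (real a) (real b) (real c)"
proof
  fix z assume hex: "in_hex \<tau>" and z: "z \<in> closed_triangle \<tau>"
  show "z \<in> hexagon (real a) (real b) (real c)"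
  proof (cases \<tau>)
    case (Up i j)
    have "0 \<le> real_of_int i" "real_of_int i + 1 \<le> real b + real c" "- real c \<le> real_of_int j" "real_of_int j + 1 \<le> real a"
      "0 \<le> real_of_int i + of_int j" "real_of_int i + of_int j + 1 \<le> real a + real b"
      using hex unfolding Up by simp_all
    then show ?thesis using z unfolding Up hexagon_pos by simp
  next
    case (Down i j)
    have "0 \<le> real_of_int i" "real_of_int i + 1 \<le> real b + real c" "- real c \<le> real_of_int j" "real_of_int j + 1 \<le> real a"
      "- 1 \<le> real_of_int i + of_int j" "real_of_int i + of_int j + 2 \<le> real a + real b"
      using hex unfolding Down by simp_all
    then show ?thesis using z unfolding Down hexagon_pos by simp
  qed
qed

lemma region_triangles: "region l = (\<Union>\<tau>\<in>triangles l. closed_triangle \<tau>)"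
  by (cases l) auto

lemma open_open_triangle: "open (open_triangle \<tau>)"
  by (cases \<tau>) (auto intro!: open_Collect_conj open_Collect_less continuous_intros
      continuous_on_subset[OF continuous_pos(1)] continuous_on_subset[OF continuous_pos(2)])

lemma region_inj: "region l = region l' \<Longrightarrow> l = l'"
proof -
  assume "region l = region l'"
  then have "triangles l = triangles l'"
    using open_triangle_region[OF centroid_in_open] by blast
  then show "l = l'" by (cases l; cases l') (auto simp: doubleton_eq_iff)
qed

lemma interior_regions_disjoint:
  "interior (region l) \<inter> interior (region l') = {} \<longleftrightarrow> triangles l \<inter> triangles l' = {}"
proof
  assume dis: "interior (region l) \<inter> interior (region l') = {}"
  show "triangles l \<inter> triangles l' = {}"
  proof (rule ccontr)
    assume "triangles l \<inter> triangles l' \<noteq> {}"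
    then obtain \<tau> where \<tau>: "\<tau> \<in> triangles l" "\<tau> \<in> triangles l'" by blast
    have "open_triangle \<tau> \<subseteq> interior (region l'')" if "\<tau> \<in> triangles l''" for l''
      using that open_triangle_region by (intro interior_maximal open_open_triangle) auto
    with \<tau> centroid_in_open dis show False by blast
  qed
next
  assume dis: "triangles l \<inter> triangles l' = {}"
  show "interior (region l) \<inter> interior (region l') = {}"
  proof (rule ccontr)
    assume "interior (region l) \<inter> interior (region l') \<noteq> {}"
    then obtain z where z: "z \<in> interior (region l) \<inter> interior (region l')" by blast
    \<comment> \<open>In lattice coordinates all three of \<open>s\<close>, \<open>t\<close>,
      \<open>s + t\<close> increase strictly along (1, 1), so a small positive step leaves every
      lattice line through \<open>z\<close> and ends in an open triangle.\<close>
    define h where "h \<delta> = at_pos (pos_s z + \<delta>) (pos_t z + \<delta>)" for \<delta>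
    have "(h \<longlongrightarrow> h 0) (at_right 0)"
      unfolding h_def at_pos_def by (auto intro!: tendsto_eq_intros)
    moreover have "h 0 = z" by (simp add: h_def)
    ultimately have ev: "eventually (\<lambda>\<delta>. h \<delta> \<in> interior (region l) \<inter> interior (region l')) (at_right 0)"
      using z by (metis open_Int open_interior topological_tendstoD)
    have gen: "eventually (\<lambda>\<delta>. of_int \<lfloor>r\<rfloor> < r + k * \<delta> \<and> r + k * \<delta> < of_int \<lfloor>r\<rfloor> + 1) (at_right 0)" if "k > 0" for r k :: real
    proof -
      have "eventually (\<lambda>\<delta>. \<delta> < (of_int \<lfloor>r\<rfloor> + 1 - r) / k) (at_right 0)"
        using eventually_at_right_real[of 0 "(of_int \<lfloor>r\<rfloor> + 1 - r) / k"] that by (auto elim: eventually_mono)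
      moreover have "eventually (\<lambda>\<delta>::real. \<delta> > 0) (at_right 0)"
        by (rule eventually_at_right_less)
      ultimately show ?thesis
      proof eventually_elim
        case (elim \<delta>)
        have "k * \<delta> > 0" using elim that by simp
        moreover have "k * \<delta> < of_int \<lfloor>r\<rfloor> + 1 - r" using elim that by (simp add: field_simps)
        ultimately show ?case using of_int_floor_le[of r] by linarith
      qed
    qed
    have "eventually (\<lambda>\<delta>. \<exists>\<tau>. h \<delta> \<in> open_triangle \<tau>) (at_right 0)"
      using gen[OF less_numeral_extra(1), of "pos_s z"] gen[OF less_numeral_extra(1), of "pos_t z"] gen[OF zero_less_two, of "pos_s z + pos_t z"]
    proof eventually_elim
      case (elim \<delta>)
      define i j m where "i = \<lfloor>pos_s z\<rfloor>" and "j = \<lfloor>pos_t z\<rfloor>" and "m = \<lfloor>pos_s z + pos_t z\<rfloor>"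
      have e: "of_int i < pos_s z + \<delta>" "pos_s z + \<delta> < of_int i + 1" "of_int j < pos_t z + \<delta>" "pos_t z + \<delta> < of_int j + 1"
        "of_int m < pos_s z + pos_t z + 2 * \<delta>" "pos_s z + pos_t z + 2 * \<delta> < of_int m + 1"
        using elim unfolding i_def j_def m_def by simp_all
      then have "m = i + j \<or> m = i + j + 1" by linarith
      then have "h \<delta> \<in> open_triangle (Up i j) \<or> h \<delta> \<in> open_triangle (Down i j)"
        using e by (auto simp: h_def)
      then show ?case by blast
    qed
    with ev have "eventually (\<lambda>\<delta>. (\<exists>\<tau>. h \<delta> \<in> open_triangle \<tau>) \<and> h \<delta> \<in> interior (region l) \<inter> interior (region l')) (at_right 0)"
      by (rule eventually_conj[rotated])
    then have "\<exists>\<delta>. (\<exists>\<tau>. h \<delta> \<in> open_triangle \<tau>) \<and> h \<delta> \<in> interior (region l) \<inter> interior (region l')"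
      by (rule eventually_happens'[OF trivial_limit_at_right_real])
    then obtain \<delta> \<tau> where "h \<delta> \<in> open_triangle \<tau>" "h \<delta> \<in> region l" "h \<delta> \<in> region l'"
      using interior_subset by blast
    with dis show False using open_triangle_region by blast
  qed
qed

lemma finite_in_hex: "finite {\<tau>. in_hex \<tau>}"
proof -
  let ?I = "{0..<int b + int c} \<times> {- int c..<int a}"
  have "{\<tau>. in_hex \<tau>} \<subseteq> (\<lambda>(i, j). Up i j) ` ?I \<union> (\<lambda>(i, j). Down i j) ` ?I"
  proof
    fix \<tau> assume "\<tau> \<in> {\<tau>. in_hex \<tau>}"
    then show "\<tau> \<in> (\<lambda>(i, j). Up i j) ` ?I \<union> (\<lambda>(i, j). Down i j) ` ?I"
      by (cases \<tau>) (auto simp: image_iff)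
  qed
  then show ?thesis by (rule finite_subset) auto
qed

lemma finite_matchings: "finite {M. perfect_matching M}"
proof -
  let ?L = "{l. \<forall>\<tau>\<in>triangles l. in_hex \<tau>}"
  have "triangles ` ?L \<subseteq> Pow {\<tau>. in_hex \<tau>}" by auto
  then have "finite (triangles ` ?L)"
    using finite_in_hex by (meson finite_Pow_iff finite_subset)
  moreover have "inj_on triangles ?L"
  proof (rule inj_onI)
    fix l l' assume "triangles l = triangles l'"
    then show "l = l'" by (cases l; cases l') (auto simp: doubleton_eq_iff)
  qed
  ultimately have "finite ?L" by (rule finite_imageD)
  moreover have "{M. perfect_matching M} \<subseteq> Pow ?L" by (auto simp: perfect_matching_def)
  ultimately show ?thesis by (meson finite_Pow_iff finite_subset)
qed

text \<open>The cell of \<open>z\<close> comes from the floors, except on the sides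
  \<open>s = b + c\<close> and \<open>t = a\<close>, where the preceding cell is taken. At the sides
  \<open>s + t = 0\<close> and \<open>s + t = a + b\<close> the triangle found in this way may lie
  outside the hexagon; then \<open>z\<close> lies on that side and a neighbouring triangle contains
  it.\<close>

lemma hexagon_triangles:
  assumes "a > 0" "b > 0" "c > 0" "z \<in> hexagon (real a) (real b) (real c)"
  shows "\<exists>\<tau>. in_hex \<tau> \<and> z \<in> closed_triangle \<tau>"
proof -
  define S T where "S = pos_s z" and "T = pos_t z"
  have h: "0 \<le> S" "S \<le> real b + real c" "- real c \<le> T" "T \<le> real a" "0 \<le> S + T" "S + T \<le> real a + real b"
    using assms(4) unfolding hexagon_pos S_def T_def by auto
  define i where "i = (if S = real b + real c then int b + int c - 1 else \<lfloor>S\<rfloor>)"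
  define j where "j = (if T = real a then int a - 1 else \<lfloor>T\<rfloor>)"
  have i: "of_int i \<le> S" "S \<le> of_int i + 1" "0 \<le> i" "i < int b + int c" "S = of_int i + 1 \<longrightarrow> S = real b + real c"
    unfolding i_def using h(1,2) assms by (auto split: if_splits) linarith+
  have j: "of_int j \<le> T" "T \<le> of_int j + 1" "- int c \<le> j" "j < int a" "T = of_int j + 1 \<longrightarrow> T = real a"
    unfolding j_def using h(3,4) assms by (auto split: if_splits) linarith+
  show ?thesis
  proof (cases "S + T \<le> of_int i + of_int j + 1")
    case True
    consider "0 \<le> i + j \<and> i + j < int a + int b" | "i + j < 0" | "i + j \<ge> int a + int b" by linarith
    then show ?thesis
    proof cases
      case 1
      then show ?thesis using True i j by (intro exI[of _ "Up i j"]) (auto simp: S_def T_def)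
    next
      case 2
      have "real_of_int i + real_of_int j + 1 \<ge> 0" using True h(5) by linarith
      then have "i + j = -1" using 2 by linarith
      then have "real_of_int i + of_int j = -1" by linarith
      then have "in_hex (Down i j)" "z \<in> closed_triangle (Down i j)"
        using \<open>i + j = -1\<close> i j h assms by (simp_all add: S_def T_def)
      then show ?thesis by blast
    next
      case 3
      have "real_of_int (i + j) \<le> real a + real b" using i(1) j(1) h(6) by simp
      then have eq: "i + j = int a + int b" using 3 by linarith
      then have "real_of_int i + real_of_int j = real a + real b" by linarith
      then have ST: "S = of_int i" "T = of_int j" using i(1) j(1) h(6) by linarith+
      have "in_hex (Down (i - 1) (j - 1))"
        using eq i j assms by auto
      moreover have "z \<in> closed_triangle (Down (i - 1) (j - 1))"
        using ST by (auto simp: S_def T_def)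
      ultimately show ?thesis by blast
    qed
  next
    case False
    have "real_of_int i + real_of_int j + 1 < real a + real b" using False h(6) by linarith
    then have 1: "i + j + 1 < int a + int b" by linarith
    show ?thesis
    proof (cases "i + j \<ge> -1")
      case True
      then show ?thesis using 1 False i j by (intro exI[of _ "Down i j"]) (auto simp: S_def T_def)
    next
      case f: False
      then have "real_of_int i + real_of_int j + 2 \<le> 0" by linarith
      then have "S = of_int i + 1" "T = of_int j + 1" "i + j = -2" using i(2) j(2) h(5) f by linarith+
      then have "S = real b + real c" "T = real a" using i(5) j(5) by auto
      then show ?thesis using h(6) assms \<open>S = of_int i + 1\<close> \<open>T = of_int j + 1\<close> \<open>i + j = -2\<close> by linarith
    qed
  qed
qed

text \<open>Centroids test coverage and overlap triangle by triangle. Conversely, lozenges are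
  unions of their triangles, and the triangles \<open>in_hex\<close> fill the hexagon.\<close>

lemma tilings_eq:
  assumes "a > 0" "b > 0" "c > 0"
  shows "tilings a b c = (\<lambda>M. region ` M) ` {M. perfect_matching M}"
proof (rule equalityI; rule subsetI)
  fix T assume "T \<in> tilings a b c"
  then have T: "T \<subseteq> range region" "\<Union>T = hexagon (real a) (real b) (real c)"
    "pairwise (\<lambda>L M. interior L \<inter> interior M = {}) T"
    by (auto simp: tilings_def lozenges_eq)
  define M where "M = {l. region l \<in> T}"
  have TM: "T = region ` M" using T(1) unfolding M_def by auto
  have "perfect_matching M"
    unfolding perfect_matching_def
  proof safe
    fix l \<tau> assume "l \<in> M" "\<tau> \<in> triangles l"
    then have "centroid \<tau> \<in> hexagon (real a) (real b) (real c)"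
      using T(2) open_triangle_region[OF centroid_in_open] unfolding M_def by auto
    then show "in_hex \<tau>" by (simp add: centroid_in_hexagon)
  next
    fix \<tau> assume "in_hex \<tau>"
    then have "centroid \<tau> \<in> \<Union>T" unfolding T(2) by (simp add: centroid_in_hexagon)
    then show "\<exists>l. l \<in> M \<and> \<tau> \<in> triangles l"
      unfolding TM using open_triangle_region[OF centroid_in_open] by blast
  next
    fix \<tau> l l' assume *: "l \<in> M" "l' \<in> M" "\<tau> \<in> triangles l" "\<tau> \<in> triangles l'"
    show "l = l'"
    proof (rule ccontr)
      assume "l \<noteq> l'"
      then have "region l \<noteq> region l'" using region_inj by blast
      then have "interior (region l) \<inter> interior (region l') = {}"
        using T(3) * unfolding M_def pairwise_def by blast
      with * show False unfolding interior_regions_disjoint by blast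
    qed
  qed
  then show "T \<in> (\<lambda>M. region ` M) ` {M. perfect_matching M}" using TM by blast
next
  fix T assume "T \<in> (\<lambda>M. region ` M) ` {M. perfect_matching M}"
  then obtain M where M: "perfect_matching M" and T: "T = region ` M" by blast
  have "\<Union>T = hexagon (real a) (real b) (real c)"
  proof (rule equalityI; rule subsetI)
    fix z assume "z \<in> \<Union>T"
    then show "z \<in> hexagon (real a) (real b) (real c)"
      using M closed_triangle_subset_hexagon unfolding T perfect_matching_def region_triangles by blast
  next
    fix z assume "z \<in> hexagon (real a) (real b) (real c)"
    then obtain \<tau> where "in_hex \<tau>" "z \<in> closed_triangle \<tau>" using hexagon_triangles assms by blast
    then show "z \<in> \<Union>T" using M unfolding T perfect_matching_def region_triangles by blast
  qed
  moreover have "interior (region l) \<inter> interior (region l') = {}" if "l \<in> M" "l' \<in> M" "region l \<noteq> region l'" for l l'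
    using that M unfolding interior_regions_disjoint perfect_matching_def by blast
  ultimately show "T \<in> tilings a b c"
    unfolding tilings_def lozenges_eq T pairwise_def by blast
qed

lemma inj_regions: "inj_on (\<lambda>M. region ` M) X"
  by (rule inj_onI) (metis inj_def inj_image_eq_iff region_inj)

lemma region_TileV_parallelogram:
  "region (TileV i j) = parallelogram (at_pos (of_int i + 1) (of_int j - 1)) (1 / 2, sqrt 3 / 2) (- (1 / 2), sqrt 3 / 2)"
proof -
  have vecs: "vec_s (1 / 2, sqrt 3 / 2) = 0" "vec_t (1 / 2, sqrt 3 / 2) = 1"
    "vec_s (- (1 / 2), sqrt 3 / 2) = -1" "vec_t (- (1 / 2), sqrt 3 / 2) = 1"
    by (simp_all add: vec_s_def vec_t_def)
  have "vec_s (z - at_pos s t) = pos_s z - s" "vec_t (z - at_pos s t) = pos_t z - t" for z s t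
    using pos_at_pos[of s t] unfolding pos_s_def pos_t_def by (simp_all add: vec_st_linear)
  then show ?thesis
    unfolding set_eq_iff by (subst parallelogram_coordinates[where d = 1]) (auto simp: vecs)
qed

lemma center_TileV: "center (region (TileV i j)) = at_pos (of_int i + 1 / 2) (of_int j)"
  unfolding region_TileV_parallelogram center_parallelogram at_pos_def
  by (simp add: prod_eq_iff field_simps)

text \<open>Along a vertical long diagonal, of length \<open>sqrt 3\<close>, the coordinate
  \<open>pos_t\<close> changes by 2, whereas the other two kinds of lozenge lie in a horizontal
  strip where it varies by at most 1.\<close>

lemma vertical_region: "vertical (region l) \<longleftrightarrow> (\<exists>i j. l = TileV i j)"
proof
  assume "\<exists>i j. l = TileV i j"
  then obtain i j where l: "l = TileV i j" by blast
  have "lozenge_frame (1 / 2, sqrt 3 / 2) (- (1 / 2), sqrt 3 / 2)"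
    by (simp add: lozenge_frame_def norm_prod_def cos_60 power_divide)
  then show "vertical (region l)"
    unfolding l vertical_def region_TileV_parallelogram by (intro exI conjI) (rule refl, assumption, simp)
next
  assume "vertical (region l)"
  then obtain p u v where L: "region l = parallelogram p u v" and fr: "lozenge_frame u v" and v0: "fst (u + v) = 0"
    unfolding vertical_def by blast
  have "inner u u = 1" "inner v v = 1" "inner u v = 1 / 2"
    using fr by (auto simp: lozenge_frame_def dot_square_norm cos_60)
  then have "inner (u + v) (u + v) = 3"
    by (simp add: inner_add_left inner_add_right inner_commute)
  then have s3: "(snd (u + v))\<^sup>2 = 3" using v0 by (simp add: inner_prod_def power2_eq_square)
  have t2: "(vec_t w)\<^sup>2 = 4 / 3 * (snd w)\<^sup>2" for w
    by (simp add: vec_t_def power_divide power_mult_distrib)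
  have "(vec_t (u + v))\<^sup>2 = 2\<^sup>2" unfolding t2 s3 by simp
  then have "\<bar>vec_t (u + v)\<bar> = 2"
    unfolding power2_eq_iff by auto
  moreover have "pos_t (p + w) = pos_t p + vec_t w" for w
    unfolding pos_t_def by (simp add: vec_st_linear)
  ultimately have t2: "\<bar>pos_t (p + (u + v)) - pos_t p\<bar> = 2" by simp
  have "p = p + 0 *\<^sub>R u + 0 *\<^sub>R v" "p + (u + v) = p + 1 *\<^sub>R u + 1 *\<^sub>R v" by (simp_all add: add.assoc)
  moreover have "p + r *\<^sub>R u + r *\<^sub>R v \<in> region l" if "r \<in> {0..1}" for r
    unfolding L parallelogram_def using that by blast
  ultimately have "p \<in> region l" "p + (u + v) \<in> region l"
    by (metis atLeastAtMost_iff order_refl zero_le_one)+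
  with t2 show "\<exists>i j. l = TileV i j"
    by (cases l) auto
qed

lemma expected_vertical_matchings:
  assumes "a > 0" "b > 0" "c > 0" and ne: "{M. perfect_matching M} \<noteq> {}"
  shows "expected_vertical a b c \<sigma> U
    = (\<Sum>M | perfect_matching M. real (card {(i, j). TileV i j \<in> M \<and> (1 / \<sigma>) *\<^sub>R at_pos (of_int i + 1 / 2) (of_int j) \<in> U}))
      / real (card {M. perfect_matching M})"
proof -
  have card: "card {L \<in> region ` M. vertical L \<and> (1 / \<sigma>) *\<^sub>R center L \<in> U}
    = card {(i, j). TileV i j \<in> M \<and> (1 / \<sigma>) *\<^sub>R at_pos (of_int i + 1 / 2) (of_int j) \<in> U}" (is "card ?A = card ?B") for M
  proof -
    have "?A = (\<lambda>(i, j). region (TileV i j)) ` ?B"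
    proof (rule equalityI; rule subsetI)
      fix L assume "L \<in> ?A"
      then obtain l where l: "l \<in> M" "L = region l" "vertical (region l)" "(1 / \<sigma>) *\<^sub>R center (region l) \<in> U" by blast
      then obtain i j where "l = TileV i j" unfolding vertical_region by blast
      with l show "L \<in> (\<lambda>(i, j). region (TileV i j)) ` ?B"
        by (intro image_eqI[of _ _ "(i, j)"]) (auto simp: center_TileV simp del: region.simps)
    next
      fix L assume "L \<in> (\<lambda>(i, j). region (TileV i j)) ` ?B"
      then show "L \<in> ?A" using vertical_region by (auto simp: center_TileV simp del: region.simps)
    qed
    moreover have "inj_on (\<lambda>(i, j). region (TileV i j)) ?B"
      by (rule inj_onI) (auto dest!: region_inj simp del: region.simps)
    ultimately show ?thesis by (simp only: card_image)
  qed
  have "finite (tilings a b c)" "tilings a b c \<noteq> {}"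
    unfolding tilings_eq[OF assms(1-3)] using finite_matchings ne by auto
  then have "expected_vertical a b c \<sigma> U = (\<Sum>T\<in>tilings a b c. real (card {L \<in> T. vertical L \<and> (1 / \<sigma>) *\<^sub>R center L \<in> U})) / real (card (tilings a b c))"
    unfolding expected_vertical_def by (subst integral_pmf_of_set) auto
  also have "real (card (tilings a b c)) = real (card {M. perfect_matching M})"
    unfolding tilings_eq[OF assms(1-3)] by (subst card_image[OF inj_regions]) simp
  also have "(\<Sum>T\<in>tilings a b c. real (card {L \<in> T. vertical L \<and> (1 / \<sigma>) *\<^sub>R center L \<in> U}))
    = (\<Sum>M | perfect_matching M. real (card {(i, j). TileV i j \<in> M \<and> (1 / \<sigma>) *\<^sub>R at_pos (of_int i + 1 / 2) (of_int j) \<in> U}))"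
    unfolding tilings_eq[OF assms(1-3)] by (subst sum.reindex[OF inj_regions]) (simp add: card)
  finally show ?thesis .
qed

end

section \<open>Rows of vertical lozenges\<close>

definition chains :: "(int \<Rightarrow> 's \<Rightarrow> 's \<Rightarrow> bool) \<Rightarrow> int \<Rightarrow> int \<Rightarrow> 's \<Rightarrow> 's \<Rightarrow> (int \<Rightarrow> 's) set" where
  "chains R m n s t = {x \<in> extensional {m..n}. x m = s \<and> x n = t \<and> (\<forall>k\<in>{m..<n}. R k (x k) (x (k + 1)))}"

text \<open>Transfer-matrix factorisation: once the state at \<open>k\<close> is fixed, the parts
  before and after it are independent. As chains are \<open>extensional\<close>, they are determined
  by their values on the index range, so cutting and gluing are inverse to each other.\<close>

lemma card_chains_split:
  assumes "m \<le> k" "k \<le> n"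
  shows "card {x \<in> chains R m n s t. x k = u} = card (chains R m k s u) * card (chains R k n u t)"
proof -
  let ?f = "\<lambda>x. (restrict x {m..k}, restrict x {k..n})"
  let ?g = "\<lambda>(y, z) i. if i \<le> k then y i else z i"
  have "bij_betw ?f {x \<in> chains R m n s t. x k = u} (chains R m k s u \<times> chains R k n u t)"
  proof (rule bij_betw_byWitness[where f' = ?g])
    show "\<forall>x\<in>{x \<in> chains R m n s t. x k = u}. ?g (?f x) = x"
      using assms by (auto simp: chains_def extensional_def fun_eq_iff)
    show "\<forall>p\<in>chains R m k s u \<times> chains R k n u t. ?f (?g p) = p"
      using assms by (auto simp: chains_def extensional_def fun_eq_iff restrict_def)
    show "?f ` {x \<in> chains R m n s t. x k = u} \<subseteq> chains R m k s u \<times> chains R k n u t"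
      using assms by (auto simp: chains_def)
    show "?g ` (chains R m k s u \<times> chains R k n u t) \<subseteq> {x \<in> chains R m n s t. x k = u}"
    proof
      fix x assume "x \<in> ?g ` (chains R m k s u \<times> chains R k n u t)"
      then obtain y z where y: "y \<in> chains R m k s u" and z: "z \<in> chains R k n u t" and x: "x = ?g (y, z)" by blast
      have zx: "x i = z i" if "k \<le> i" for i using that y z x by (auto simp: chains_def)
      have yx: "x i = y i" if "i \<le> k" for i using that x by auto
      have "R i (x i) (x (i + 1))" if "i \<in> {m..<n}" for i
      proof (cases "i < k")
        case True
        then show ?thesis using that y yx[of i] yx[of "i + 1"] by (auto simp: chains_def)
      next
        case False
        then show ?thesis using that z zx[of i] zx[of "i + 1"] by (auto simp: chains_def)
      qed
      moreover have "x \<in> extensional {m..n}" using assms x y z by (auto simp: chains_def extensional_def)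
      moreover have "x m = s" "x k = u" "x n = t" using yx[of m] yx[of k] zx[of n] assms y z by (auto simp: chains_def)
      ultimately show "x \<in> {x \<in> chains R m n s t. x k = u}" by (auto simp: chains_def)
    qed
  qed
  then show ?thesis by (simp add: bij_betw_same_card card_cartesian_product)
qed

lemma chains_refl: "chains R m m s t = (if s = t then {\<lambda>i\<in>{m}. s} else {})"
  by (auto simp: chains_def extensional_def fun_eq_iff)

lemma card_chains_step: "card (chains R m (m + 1) s t) = of_bool (R m s t)"
proof (cases "R m s t")
  case True
  let ?x = "\<lambda>i\<in>{m..m + 1}. if i = m then s else t"
  have "x = ?x" if "x \<in> chains R m (m + 1) s t" for x
  proof (rule extensionalityI[of _ "{m..m + 1}"])
    fix i assume "i \<in> {m..m + 1}"
    then have "i = m \<or> i = m + 1" by auto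
    then show "x i = ?x i" using that by (auto simp: chains_def)
  qed (use that in \<open>auto simp: chains_def\<close>)
  moreover have "?x \<in> chains R m (m + 1) s t"
    using True by (auto simp: chains_def)
  ultimately have "chains R m (m + 1) s t = {?x}" by blast
  with True show ?thesis by simp
next
  case False
  then have "chains R m (m + 1) s t = {}" by (auto simp: chains_def)
  with False show ?thesis by simp
qed

lemma card_chains_last:
  assumes "m \<le> n" and fin: "finite {u. R n u t}"
  shows "finite (chains R m (n + 1) s t) \<Longrightarrow> card (chains R m (n + 1) s t) = (\<Sum>u | R n u t. card (chains R m n s u))"
proof -
  assume finC: "finite (chains R m (n + 1) s t)"
  have "card (chains R m (n + 1) s t) = (\<Sum>u | R n u t. card {x \<in> chains R m (n + 1) s t. x n = u})"
    unfolding card_eq_sum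
    by (rule sum.group[symmetric, OF finC fin]) (use assms in \<open>auto simp: chains_def\<close>)
  also have "\<dots> = (\<Sum>u | R n u t. card (chains R m n s u))"
    using assms by (intro sum.cong refl) (simp add: card_chains_split card_chains_step)
  finally show ?thesis .
qed

lemma finite_chains:
  assumes "m \<le> n" "\<And>k t. \<lbrakk>m \<le> k; k < n\<rbrakk> \<Longrightarrow> finite {u. R k u t}"
  shows "finite (chains R m n s t)"
  using assms
proof (induction n arbitrary: t rule: int_ge_induct)
  case base
  then show ?case by (simp add: chains_refl)
next
  case (step n)
  have "(\<lambda>x. restrict x {m..n}) ` chains R m (n + 1) s t \<subseteq> (\<Union>u\<in>{u. R n u t}. chains R m n s u)"
    using step.hyps by (auto simp: chains_def)
  moreover have "finite (\<Union>u\<in>{u. R n u t}. chains R m n s u)"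
    using step by auto
  ultimately have "finite ((\<lambda>x. restrict x {m..n}) ` chains R m (n + 1) s t)"
    by (rule finite_subset)
  moreover have "inj_on (\<lambda>x. restrict x {m..n}) (chains R m (n + 1) s t)"
  proof (rule inj_onI)
    fix x y assume x: "x \<in> chains R m (n + 1) s t" and y: "y \<in> chains R m (n + 1) s t"
      and eq: "restrict x {m..n} = restrict y {m..n}"
    show "x = y"
    proof (rule extensionalityI[of _ "{m..n + 1}"])
      fix i assume "i \<in> {m..n + 1}"
      then show "x i = y i"
        using x y fun_cong[OF eq, of i] by (cases "i = n + 1") (auto simp: chains_def)
    qed (use x y in \<open>auto simp: chains_def\<close>)
  qed
  ultimately show ?case by (rule finite_imageD)
qed

lemma count_below_Suc: "finite S \<Longrightarrow> int (count_below S (i + 1)) = int (count_below S i) + of_bool (i \<in> S)"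
proof -
  assume fin: "finite S"
  have "{s \<in> S. s < i + 1} = {s \<in> S. s < i} \<union> (if i \<in> S then {i} else {})" by (auto simp: le_less)
  moreover have "card \<dots> = card {s \<in> S. s < i} + of_bool (i \<in> S)"
    using fin by (subst card_Un_disjoint) auto
  ultimately show ?thesis by (simp add: count_below_def)
qed

lemma count_below_eq_0: "(\<And>s. s \<in> S \<Longrightarrow> i \<le> s) \<Longrightarrow> count_below S i = 0"
  unfolding count_below_def by (rule card_eq_0_iff[THEN iffD2], rule disjI1) (force simp: not_less)

lemma count_below_eq_card: "(\<And>s. s \<in> S \<Longrightarrow> s < i) \<Longrightarrow> count_below S i = card S"
  unfolding count_below_def by (rule arg_cong[where f = card]) auto

section \<open>Matchings as sequences of rows\<close>

context
  fixes a b c :: nat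
begin

text \<open>A vertical lozenge of row \<open>j\<close> consists of an upward triangle above and a
  downward triangle below that row, and both must lie in the hexagon; hence the rows
  \<open>- c\<close> and \<open>a\<close>, the horizontal sides, are empty.\<close>

definition row_range :: "int \<Rightarrow> int set" where
  "row_range j = (if - int c < j \<and> j < int a then {max 0 (- j)..<min (int b + int c) (int a + int b - j)} else {})"

text \<open>Along the strip above row \<^term>\<open>j\<close>, the value at \<^term>\<open>i\<close> is 1 if the upward triangle there
  is joined to its left neighbour and 0 otherwise.\<close>

definition strip_state :: "int \<Rightarrow> int set \<Rightarrow> int set \<Rightarrow> int \<Rightarrow> int" where
  "strip_state j S S' i = of_bool (j < 0) + int (count_below S i) - int (count_below S' i)"

text \<open>Far to the left \<open>strip_state\<close> has the value \<open>of_bool (j < 0)\<close>;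
  the cardinality equation says that far to the right its value is
  \<open>of_bool (int a - int c \<le> j)\<close>. The two values tell whether the strip begins with
  a downward and ends with an upward triangle.\<close>

definition row_step :: "int \<Rightarrow> int set \<Rightarrow> int set \<Rightarrow> bool" where
  "row_step j S S' \<longleftrightarrow> S \<subseteq> row_range j \<and> S' \<subseteq> row_range (j + 1)
     \<and> int (card S') + of_bool (int a - int c \<le> j) = int (card S) + of_bool (j < 0)
     \<and> (\<forall>i. strip_state j S S' i \<in> {0, 1} \<and> (i \<in> S \<longrightarrow> strip_state j S S' i = 0))"

lemma row_rangeD:
  "\<lbrakk>S \<subseteq> row_range j; s \<in> S\<rbrakk> \<Longrightarrow> - int c < j \<and> j < int a \<and> 0 \<le> s \<and> - j \<le> s \<and> s < int b + int c \<and> s + j < int a + int b"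
  by (drule (1) subsetD) (auto simp: row_range_def split: if_splits)

lemma finite_row_range: "finite (row_range j)"
  by (simp add: row_range_def)

lemma strip_state_Suc:
  assumes "S \<subseteq> row_range j" "S' \<subseteq> row_range k"
  shows "strip_state j S S' (i + 1) = strip_state j S S' i + of_bool (i \<in> S) - of_bool (i \<in> S')"
proof -
  have "finite S" "finite S'" using assms finite_row_range finite_subset by blast+
  then show ?thesis by (simp add: strip_state_def count_below_Suc)
qed

definition row :: "tile set \<Rightarrow> int \<Rightarrow> int set" where
  "row M j = {i. TileV i j \<in> M}"

context
  fixes M
  assumes M: "perfect_matching a b c M"
begin

lemma matching_in_hex: "\<lbrakk>l \<in> M; \<tau> \<in> triangles l\<rbrakk> \<Longrightarrow> in_hex a b c \<tau>"
  using M by (auto simp: perfect_matching_def)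

lemma matching_up:
  "of_bool (TileA i j \<in> M) + of_bool (TileB i j \<in> M) + of_bool (TileV i j \<in> M) = (of_bool (in_hex a b c (Up i j)) :: int)"
proof (cases "in_hex a b c (Up i j)")
  case True
  then obtain l where l: "l \<in> M" "Up i j \<in> triangles l" and u: "\<And>l'. \<lbrakk>l' \<in> M; Up i j \<in> triangles l'\<rbrakk> \<Longrightarrow> l' = l"
    using M unfolding perfect_matching_def by blast
  have "l = TileA i j \<or> l = TileB i j \<or> l = TileV i j" using l(2) by (cases l) auto
  then show ?thesis using l True u[of "TileA i j"] u[of "TileB i j"] u[of "TileV i j"] by auto
next
  case False
  then have "TileA i j \<notin> M" "TileB i j \<notin> M" "TileV i j \<notin> M" using matching_in_hex by force+
  with False show ?thesis by simp
qed

lemma matching_down: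
  "of_bool (TileA i j \<in> M) + of_bool (TileB (i + 1) j \<in> M) + of_bool (TileV i (j + 1) \<in> M) = (of_bool (in_hex a b c (Down i j)) :: int)"
proof (cases "in_hex a b c (Down i j)")
  case True
  then obtain l where l: "l \<in> M" "Down i j \<in> triangles l" and u: "\<And>l'. \<lbrakk>l' \<in> M; Down i j \<in> triangles l'\<rbrakk> \<Longrightarrow> l' = l"
    using M unfolding perfect_matching_def by blast
  have "l = TileA i j \<or> l = TileB (i + 1) j \<or> l = TileV i (j + 1)" using l(2) by (cases l) auto
  then show ?thesis using l True u[of "TileA i j"] u[of "TileB (i + 1) j"] u[of "TileV i (j + 1)"] by auto
next
  case False
  then have "TileA i j \<notin> M" "TileB (i + 1) j \<notin> M" "TileV i (j + 1) \<notin> M" using matching_in_hex by force+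
  with False show ?thesis by simp
qed

lemma row_subset: "row M j \<subseteq> row_range j"
proof
  fix i assume "i \<in> row M j"
  then have "in_hex a b c (Up i j)" "in_hex a b c (Down i (j - 1))"
    using matching_in_hex[of "TileV i j" "Up i j"] matching_in_hex[of "TileV i j" "Down i (j - 1)"] by (auto simp: row_def)
  then show "i \<in> row_range j" by (auto simp: row_range_def)
qed

text \<open>The difference of \<open>matching_up\<close> and \<open>matching_down\<close> gives the
  increment of the \<open>TileB\<close> indicator along the strip, which is also the increment of
  the two counts. Both sides have the same constant value left of the hexagon. The correction
  \<open>\<rho>\<close> extends the equation to triangles outside the hexagon.\<close>

lemma matching_strip_state:
  assumes j: "- int c \<le> j" "j < int a"
  shows "strip_state j (row M j) (row M (j + 1)) i = of_bool (if in_hex a b c (Up i j) then TileB i j \<in> M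
      else if i < max 0 (- j) then j < 0 else int a - int c \<le> j)"
proof -
  define Bx where "Bx i = (of_bool (if in_hex a b c (Up i j) then TileB i j \<in> M
      else if i < max 0 (- j) then j < 0 else int a - int c \<le> j) :: int)" for i
  define \<rho> where "\<rho> i = (of_bool (\<not> in_hex a b c (Up i j) \<and> (if i < max 0 (- j) then j < 0 else int a - int c \<le> j)) :: int)" for i
  have Bx: "Bx i = of_bool (TileB i j \<in> M) + \<rho> i" for i
    using matching_in_hex[of "TileB i j" "Up i j"] unfolding Bx_def \<rho>_def by auto
  have \<rho>: "\<rho> (i + 1) - \<rho> i = of_bool (in_hex a b c (Up i j)) - of_bool (in_hex a b c (Down i j))" for i
    using j unfolding \<rho>_def by (cases "j < 0"; cases "int a - int c \<le> j") (auto simp: of_bool_def)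
  have rec: "Bx (i + 1) = Bx i + of_bool (i \<in> row M j) - of_bool (i \<in> row M (j + 1))" for i
    using matching_up[of i j] matching_down[of i j] \<rho>[of i] unfolding Bx row_def mem_Collect_eq by linarith
  define i0 where "i0 = max 0 (- j) - 1"
  have low: "strip_state j (row M j) (row M (j + 1)) i = of_bool (j < 0)" if "i \<le> i0" for i
  proof -
    have "count_below (row M j) i = 0"
      by (rule count_below_eq_0, drule row_rangeD[OF row_subset]) (use that in \<open>auto simp: i0_def\<close>)
    moreover have "count_below (row M (j + 1)) i = 0"
      by (rule count_below_eq_0, drule row_rangeD[OF row_subset]) (use that in \<open>auto simp: i0_def\<close>)
    ultimately show ?thesis by (simp add: strip_state_def)
  qed
  have lowB: "Bx i = of_bool (j < 0)" if "i \<le> i0" for i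
    using that unfolding Bx_def i0_def by auto
  have "strip_state j (row M j) (row M (j + 1)) i = Bx i"
  proof (cases "i \<le> i0")
    case True
    then show ?thesis using low lowB by simp
  next
    case False
    then have "i0 \<le> i" by simp
    then show ?thesis
    proof (induction i rule: int_ge_induct)
      case base
      then show ?case using low lowB by simp
    next
      case (step i)
      then show ?case unfolding strip_state_Suc[OF row_subset row_subset] rec by simp
    qed
  qed
  then show ?thesis unfolding Bx_def .
qed

lemma row_step_matching:
  assumes j: "- int c \<le> j" "j < int a"
  shows "row_step j (row M j) (row M (j + 1))"
proof -
  have "strip_state j (row M j) (row M (j + 1)) i = 0" if "i \<in> row M j" for i
  proof -
    have "TileV i j \<in> M" using that by (simp add: row_def)
    then have "in_hex a b c (Up i j)" using matching_in_hex by force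
    then show ?thesis unfolding matching_strip_state[OF j] using matching_up[of i j] \<open>TileV i j \<in> M\<close> by (auto simp: of_bool_def split: if_splits)
  qed
  moreover have "strip_state j (row M j) (row M (j + 1)) i \<in> {0, 1}" for i
    unfolding matching_strip_state[OF j] by auto
  moreover have "int (card (row M (j + 1))) + of_bool (int a - int c \<le> j) = int (card (row M j)) + of_bool (j < 0)"
  proof -
    define i where "i = int a + int b + int c + \<bar>j\<bar>"
    have "count_below (row M j) i = card (row M j)"
      by (rule count_below_eq_card, drule row_rangeD[OF row_subset]) (auto simp: i_def)
    moreover have "count_below (row M (j + 1)) i = card (row M (j + 1))"
      by (rule count_below_eq_card, drule row_rangeD[OF row_subset]) (auto simp: i_def)
    moreover have "\<not> in_hex a b c (Up i j)" "\<not> i < max 0 (- j)" unfolding i_def by auto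
    then have "strip_state j (row M j) (row M (j + 1)) i = of_bool (int a - int c \<le> j)"
      unfolding matching_strip_state[OF j] by (simp del: in_hex.simps)
    ultimately show ?thesis by (simp add: strip_state_def)
  qed
  ultimately show ?thesis
    unfolding row_step_def using row_subset by blast
qed

end

text \<open>The rows are the \<open>TileV\<close>, the counts along each strip fix the
  \<open>TileB\<close>, and every remaining upward triangle must belong to a
  \<open>TileA\<close>.\<close>

lemma matching_eqI:
  assumes M: "perfect_matching a b c M" and M': "perfect_matching a b c M'"
    and eq: "\<And>j. - int c \<le> j \<Longrightarrow> j \<le> int a \<Longrightarrow> row M j = row M' j"
  shows "M = M'"
proof -
  have rows: "row M j = row M' j" for j
  proof (cases "- int c \<le> j \<and> j \<le> int a")
    case False
    then have "row_range j = {}" by (auto simp: row_range_def)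
    then show ?thesis using row_subset[OF M, of j] row_subset[OF M', of j] by simp
  qed (use eq in auto)
  have V: "TileV i j \<in> M \<longleftrightarrow> TileV i j \<in> M'" for i j
    using rows[of j] unfolding row_def by blast
  have B: "TileB i j \<in> M \<longleftrightarrow> TileB i j \<in> M'" for i j
  proof (cases "in_hex a b c (Up i j)")
    case True
    then have j: "- int c \<le> j" "j < int a" by auto
    show ?thesis
      using matching_strip_state[OF M j, of i] matching_strip_state[OF M' j, of i] True unfolding rows by (auto simp: of_bool_def split: if_splits)
  next
    case False
    then show ?thesis using matching_in_hex[OF M, of "TileB i j" "Up i j"] matching_in_hex[OF M', of "TileB i j" "Up i j"] by auto
  qed
  have A: "TileA i j \<in> M \<longleftrightarrow> TileA i j \<in> M'" for i j
    using matching_up[OF M, of i j] matching_up[OF M', of i j] V[of i j] B[of i j] by (auto simp: of_bool_def split: if_splits)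
  have "l \<in> M \<longleftrightarrow> l \<in> M'" for l by (cases l) (simp_all add: A B V)
  then show ?thesis by blast
qed

definition matching_of :: "(int \<Rightarrow> int set) \<Rightarrow> tile set" where
  "matching_of x = {TileV i j | i j. i \<in> x j \<and> - int c \<le> j \<and> j \<le> int a}
     \<union> {TileB i j | i j. in_hex a b c (Up i j) \<and> strip_state j (x j) (x (j + 1)) i = 1}
     \<union> {TileA i j | i j. in_hex a b c (Up i j) \<and> i \<notin> x j \<and> strip_state j (x j) (x (j + 1)) i = 0}"

text \<open>Away from the sides the states assign each triangle its lozenge; care is needed at the
  ends of a strip. The values of the state that \<open>left\<close> and \<open>right\<close> impose
  there exclude the lozenges that would stick out of the hexagon.\<close>

lemma perfect_matching_of:
  assumes x: "x \<in> chains row_step (- int c) (int a) {} {}" and pos: "a > 0" "b > 0" "c > 0"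
  shows "perfect_matching a b c (matching_of x)"
proof -
  have step: "row_step j (x j) (x (j + 1))" if "- int c \<le> j" "j < int a" for j
    using x that by (auto simp: chains_def)
  have ends: "x (- int c) = {}" "x (int a) = {}" using x by (auto simp: chains_def)
  have sub: "x j \<subseteq> row_range j" if "- int c \<le> j" "j \<le> int a" for j
    using step[of j] that ends by (cases "j = int a") (auto simp: row_step_def)
  have mem: "TileV i j \<in> matching_of x \<longleftrightarrow> i \<in> x j \<and> - int c \<le> j \<and> j \<le> int a"
    "TileB i j \<in> matching_of x \<longleftrightarrow> in_hex a b c (Up i j) \<and> strip_state j (x j) (x (j + 1)) i = 1"
    "TileA i j \<in> matching_of x \<longleftrightarrow> in_hex a b c (Up i j) \<and> i \<notin> x j \<and> strip_state j (x j) (x (j + 1)) i = 0" for i j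
    unfolding matching_of_def by auto
  have left: "strip_state j (x j) (x (j + 1)) i = of_bool (j < 0)"
    if j: "- int c \<le> j" "j < int a" and i: "i < max 0 (- j) \<or> i = 0 \<and> j \<ge> 0" for i j
  proof -
    have "count_below (x j) i = 0"
      by (rule count_below_eq_0, drule row_rangeD[OF sub, rotated -1]) (use i j in auto)
    moreover have "count_below (x (j + 1)) i = 0"
      by (rule count_below_eq_0, drule row_rangeD[OF sub, rotated -1]) (use i j in auto)
    ultimately show ?thesis by (simp add: strip_state_def)
  qed
  have right: "strip_state j (x j) (x (j + 1)) i = of_bool (int a - int c \<le> j)"
    if j: "- int c \<le> j" "j < int a" and i: "i \<ge> int b + int c \<or> i + j \<ge> int a + int b" for i j
  proof -
    have "count_below (x j) i = card (x j)"
      by (rule count_below_eq_card, drule row_rangeD[OF sub, rotated -1]) (use i j in auto)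
    moreover have "count_below (x (j + 1)) i = card (x (j + 1))"
      by (rule count_below_eq_card, drule row_rangeD[OF sub, rotated -1]) (use i j in auto)
    ultimately show ?thesis using step[OF j] by (simp add: strip_state_def row_step_def)
  qed
  have Suc: "strip_state j (x j) (x (j + 1)) (i + 1) = strip_state j (x j) (x (j + 1)) i + of_bool (i \<in> x j) - of_bool (i \<in> x (j + 1))"
    if j: "- int c \<le> j" "j < int a" for i j
    using step[OF j] by (intro strip_state_Suc) (auto simp: row_step_def)
  have st: "strip_state j (x j) (x (j + 1)) i \<in> {0, 1}" "i \<in> x j \<Longrightarrow> strip_state j (x j) (x (j + 1)) i = 0"
    if j: "- int c \<le> j" "j < int a" for i j
    using step[OF j] by (auto simp: row_step_def)
  have hex: "in_hex a b c \<tau>" if l: "l \<in> matching_of x" "\<tau> \<in> triangles l" for l \<tau>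
  proof (cases l)
    case (TileV i j)
    then have "i \<in> row_range j" using l mem sub by blast
    then show ?thesis using l(2) TileV by (auto simp: row_range_def split: if_splits)
  next
    case (TileB i j)
    then have u: "in_hex a b c (Up i j)" "strip_state j (x j) (x (j + 1)) i = 1" using l mem by auto
    then have j: "- int c \<le> j" "j < int a" by auto
    have "\<not> (i = 0 \<and> j \<ge> 0)" using left[OF j, of i] u(2) by auto
    then show ?thesis using u l(2) TileB by auto
  next
    case (TileA i j)
    then have u: "in_hex a b c (Up i j)" "i \<notin> x j" "strip_state j (x j) (x (j + 1)) i = 0" using l mem by auto
    then have j: "- int c \<le> j" "j < int a" by auto
    have "i + j + 1 < int a + int b"
    proof (rule ccontr)
      assume n: "\<not> i + j + 1 < int a + int b"
      then have "strip_state j (x j) (x (j + 1)) (i + 1) = of_bool (int a - int c \<le> j)"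
        by (intro right j) auto
      moreover have "i \<notin> x (j + 1)" using sub[of "j + 1"] n j by (auto simp: row_range_def split: if_splits)
      moreover have "int a - int c \<le> j" using n u(1) by auto
      ultimately show False using Suc[OF j, of i] u by simp
    qed
    then show ?thesis using u l(2) TileA by auto
  qed
  have uniq: "\<exists>!l. l \<in> matching_of x \<and> \<tau> \<in> triangles l" if "in_hex a b c \<tau>" for \<tau>
  proof (cases \<tau>)
    case (Up i j)
    have j: "- int c \<le> j" "j < int a" using that Up by auto
    define B where "B = strip_state j (x j) (x (j + 1)) i"
    have tri: "\<tau> \<in> triangles l \<longleftrightarrow> l = TileA i j \<or> l = TileB i j \<or> l = TileV i j" for l
      unfolding Up by (cases l) auto
    have m: "TileV i j \<in> matching_of x \<longleftrightarrow> i \<in> x j" "TileB i j \<in> matching_of x \<longleftrightarrow> B = 1"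
      "TileA i j \<in> matching_of x \<longleftrightarrow> i \<notin> x j \<and> B = 0"
      using mem that Up j unfolding B_def by auto
    have "B = 0 \<or> B = 1" "i \<in> x j \<Longrightarrow> B = 0" using st[OF j, of i] unfolding B_def by auto
    then show ?thesis unfolding tri using m by (cases "i \<in> x j"; cases "B = 0") auto
  next
    case (Down i j)
    have j: "- int c \<le> j" "j < int a" using that Down by auto
    have tri: "\<tau> \<in> triangles l \<longleftrightarrow> l = TileA i j \<or> l = TileB (i + 1) j \<or> l = TileV i (j + 1)" for l
      unfolding Down by (cases l) auto
    define B B' where "B = strip_state j (x j) (x (j + 1)) i" and "B' = strip_state j (x j) (x (j + 1)) (i + 1)"
    have A: "TileA i j \<in> matching_of x \<longleftrightarrow> i \<notin> x j \<and> B = 0"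
    proof (cases "in_hex a b c (Up i j)")
      case False
      then have "i + j = -1" using that Down by auto
      then have "j < 0" "i < max 0 (- j)" using that Down by auto
      then have "B = 1" using left[OF j, of i] unfolding B_def by simp
      then show ?thesis using False mem by auto
    qed (auto simp: mem B_def)
    have B: "TileB (i + 1) j \<in> matching_of x \<longleftrightarrow> B' = 1"
    proof (cases "in_hex a b c (Up (i + 1) j)")
      case False
      then have "i + 1 = int b + int c" using that Down by auto
      moreover from this have "\<not> int a - int c \<le> j" using that Down by auto
      ultimately have "B' = 0" using right[OF j, of "i + 1"] unfolding B'_def by simp
      then show ?thesis using False mem by auto
    qed (auto simp: mem B'_def)
    have V: "TileV i (j + 1) \<in> matching_of x \<longleftrightarrow> i \<in> x (j + 1)" using mem j by auto
    have "B = 0 \<or> B = 1" "i \<in> x j \<Longrightarrow> B = 0" "B' = 0 \<or> B' = 1" "B' = B + of_bool (i \<in> x j) - of_bool (i \<in> x (j + 1))"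
      using st[OF j, of i] st[OF j, of "i + 1"] Suc[OF j, of i] unfolding B_def B'_def by auto
    then show ?thesis unfolding tri using A B V by (cases "i \<in> x j"; cases "i \<in> x (j + 1)"; cases "B = 0"; cases "B' = 0") auto
  qed
  show ?thesis unfolding perfect_matching_def using hex uniq by blast
qed

lemma bij_betw_matchings_chains:
  assumes pos: "a > 0" "b > 0" "c > 0"
  shows "bij_betw (\<lambda>M. restrict (row M) {- int c..int a}) {M. perfect_matching a b c M} (chains row_step (- int c) (int a) {} {})"
proof (rule bij_betw_imageI)
  show "inj_on (\<lambda>M. restrict (row M) {- int c..int a}) {M. perfect_matching a b c M}"
  proof (rule inj_onI)
    fix M M' assume *: "M \<in> {M. perfect_matching a b c M}" "M' \<in> {M. perfect_matching a b c M}"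
      "restrict (row M) {- int c..int a} = restrict (row M') {- int c..int a}"
    have "row M j = row M' j" if "- int c \<le> j" "j \<le> int a" for j
      using fun_cong[OF *(3), of j] that by simp
    with * show "M = M'" using matching_eqI by blast
  qed
  show "(\<lambda>M. restrict (row M) {- int c..int a}) ` {M. perfect_matching a b c M} = chains row_step (- int c) (int a) {} {}"
  proof (rule equalityI; rule subsetI)
    fix x assume "x \<in> (\<lambda>M. restrict (row M) {- int c..int a}) ` {M. perfect_matching a b c M}"
    then obtain M where M: "perfect_matching a b c M" and x: "x = restrict (row M) {- int c..int a}" by blast
    have "row M (- int c) = {}" "row M (int a) = {}"
      using row_subset[OF M, of "- int c"] row_subset[OF M, of "int a"] by (auto simp: row_range_def)
    then show "x \<in> chains row_step (- int c) (int a) {} {}"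
      unfolding chains_def x using row_step_matching[OF M] by auto
  next
    fix x assume x: "x \<in> chains row_step (- int c) (int a) {} {}"
    have "x = restrict (row (matching_of x)) {- int c..int a}"
      by (rule extensionalityI[of _ "{- int c..int a}"])
         (use x in \<open>auto simp: chains_def row_def matching_of_def\<close>)
    then show "x \<in> (\<lambda>M. restrict (row M) {- int c..int a}) ` {M. perfect_matching a b c M}"
      using perfect_matching_of[OF x pos] by blast
  qed
qed

end

section \<open>The distribution of a row\<close>

lemma count_below_union:
  assumes "finite S" "finite T" "S \<inter> T = {}"
  shows "count_below (S \<union> T) i = count_below S i + count_below T i"
proof -
  have "{s \<in> S \<union> T. s < i} = {s \<in> S. s < i} \<union> {s \<in> T. s < i}" by auto
  then show ?thesis unfolding count_below_def using assms by (auto simp: card_Un_disjoint disjoint_iff)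
qed

lemma count_below_interval: "int (count_below {l..<h} i) = max 0 (min i h - l)"
proof -
  have "{s \<in> {l..<h}. s < i} = {l..<min i h}" by auto
  then show ?thesis by (auto simp: count_below_def min_def max_def)
qed

lemma count_below_mono: "\<lbrakk>finite S; i \<le> k\<rbrakk> \<Longrightarrow> count_below S i \<le> count_below S k"
  unfolding count_below_def by (intro card_mono) auto

lemma count_below_eq_0D: "\<lbrakk>count_below S i = 0; finite S; s \<in> S\<rbrakk> \<Longrightarrow> i \<le> s"
  by (fastforce simp: count_below_def)

lemma count_below_eq_cardD: "\<lbrakk>count_below S i = card S; finite S; s \<in> S\<rbrakk> \<Longrightarrow> s < i"
proof -
  assume "count_below S i = card S" "finite S" "s \<in> S"
  then have "{s \<in> S. s < i} = S" unfolding count_below_def by (intro card_subset_eq) auto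
  with \<open>s \<in> S\<close> show "s < i" by blast
qed

lemma count_below_le_card: "finite S \<Longrightarrow> count_below S i \<le> card S"
  unfolding count_below_def by (intro card_mono) auto

text \<open>The counts are known to match only at elements of \<open>X\<close>. An arbitrary
  \<open>i\<close> is compared with the nearest element of \<open>X\<close> at or above it and with
  the nearest one below it: up to these the count of \<open>X\<close> is controlled, and the count
  of \<open>Y\<close> is monotone.\<close>

lemma interlace_shift_state:
  assumes fin: "finite X" "finite Y" and card: "card X = Suc (card Y)"
    and eq: "\<And>x. x \<in> X \<Longrightarrow> count_below Y (x + 1) = count_below X x"
  shows "int (count_below X i) - int (count_below Y i) \<in> {0, 1}"
    "i \<in> Y \<Longrightarrow> int (count_below X i) - int (count_below Y i) = 1"
proof -
  have low: "count_below Y i \<le> count_below X i"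
  proof (cases "\<exists>x\<in>X. i \<le> x")
    case True
    define x where "x = Min {x \<in> X. i \<le> x}"
    have x: "x \<in> X" "i \<le> x" "\<And>x'. \<lbrakk>x' \<in> X; i \<le> x'\<rbrakk> \<Longrightarrow> x \<le> x'"
    proof -
      have "x \<in> {x \<in> X. i \<le> x}" unfolding x_def by (rule Min_in) (use fin(1) True in auto)
      then show "x \<in> X" "i \<le> x" by auto
      show "x \<le> x'" if "x' \<in> X" "i \<le> x'" for x'
        unfolding x_def by (rule Min_le) (use fin(1) that in auto)
    qed
    have "{s \<in> X. s < x} = {s \<in> X. s < i}" using x by force
    then have "count_below X x = count_below X i" by (simp add: count_below_def)
    then show ?thesis using eq[OF x(1)] count_below_mono[OF fin(2), of i "x + 1"] x(2) by simp
  next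
    case False
    then have "count_below X i = card X" by (intro count_below_eq_card) auto
    then show ?thesis using card count_below_le_card[OF fin(2), of i] by simp
  qed
  have upY: "count_below Y i < count_below X i" if "i \<in> Y"
  proof (cases "\<exists>x\<in>X. i \<le> x")
    case True
    define x where "x = Min {x \<in> X. i \<le> x}"
    have x: "x \<in> X" "i \<le> x" "\<And>x'. \<lbrakk>x' \<in> X; i \<le> x'\<rbrakk> \<Longrightarrow> x \<le> x'"
    proof -
      have "x \<in> {x \<in> X. i \<le> x}" unfolding x_def by (rule Min_in) (use fin(1) True in auto)
      then show "x \<in> X" "i \<le> x" by auto
      show "x \<le> x'" if "x' \<in> X" "i \<le> x'" for x'
        unfolding x_def by (rule Min_le) (use fin(1) that in auto)
    qed
    have "{s \<in> X. s < x} = {s \<in> X. s < i}" using x by force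
    then have "count_below X x = count_below X i" by (simp add: count_below_def)
    moreover have "int (count_below Y (i + 1)) = int (count_below Y i) + 1"
      using count_below_Suc[OF fin(2), of i] that by simp
    ultimately show ?thesis using eq[OF x(1)] count_below_mono[OF fin(2), of "i + 1" "x + 1"] x(2) by simp
  next
    case False
    then have "count_below X i = card X" by (intro count_below_eq_card) auto
    then show ?thesis using card count_below_le_card[OF fin(2), of i] by simp
  qed
  have up: "count_below X i \<le> Suc (count_below Y i)"
  proof (cases "\<exists>x\<in>X. x < i")
    case True
    define x where "x = Max {x \<in> X. x < i}"
    have x: "x \<in> X" "x < i" "\<And>x'. \<lbrakk>x' \<in> X; x' < i\<rbrakk> \<Longrightarrow> x' \<le> x"
    proof -
      have "x \<in> {x \<in> X. x < i}" unfolding x_def by (rule Max_in) (use fin(1) True in auto)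
      then show "x \<in> X" "x < i" by auto
      show "x' \<le> x" if "x' \<in> X" "x' < i" for x'
        unfolding x_def by (rule Max_ge) (use fin(1) that in auto)
    qed
    have "{s \<in> X. s < i} = {s \<in> X. s < x + 1}" using x by force
    then have "int (count_below X i) = int (count_below X x) + 1"
      using count_below_Suc[OF fin(1), of x] x(1) by (simp add: count_below_def)
    then show ?thesis using eq[OF x(1)] count_below_mono[OF fin(2), of "x + 1" i] x(2) by simp
  next
    case False
    then have "count_below X i = 0" by (intro count_below_eq_0) (auto simp: not_less)
    then show ?thesis by simp
  qed
  show "int (count_below X i) - int (count_below Y i) \<in> {0, 1}" using low up by auto
  show "int (count_below X i) - int (count_below Y i) = 1" if "i \<in> Y" using up upY[OF that] by auto
qed

lemma count_below_shift: "count_below ((\<lambda>y. y - 1) ` Y) z = count_below Y (z + 1)"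
proof -
  have "{s \<in> (\<lambda>y. y - 1) ` Y. s < z} = (\<lambda>y. y - 1) ` {s \<in> Y. s < z + 1}" by auto
  then show ?thesis unfolding count_below_def by (simp add: card_image inj_on_def)
qed

text \<open>In oblique coordinates a particle of the lower row lies between one particle of the
  upper row (excluded) and the next (included). Translation by 1 brings this to the convention of
  \<open>interlace\<close>.\<close>

lemma interlace_shift:
  "interlace ((\<lambda>y. y - 1) ` Y) X \<longleftrightarrow> finite Y \<and> card X = Suc (card Y) \<and> (\<forall>x\<in>X. count_below Y (x + 1) = count_below X x)"
  unfolding interlace_def count_below_shift
  by (simp add: card_image inj_on_def finite_image_iff)

section \<open>Frozen particles and the count of patterns on either side of a row\<close>

context
  fixes a b c :: nat
begin

text \<open>Particles frozen outside the hexagon, which turn the rows into a Gelfand--Tsetlin pattern.\<close>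

definition forced :: "int \<Rightarrow> int set" where
  "forced j = {- j..<0} \<union> {int a + int b - j..<int b + int c}"

definition row_size :: "int \<Rightarrow> int" where
  "row_size j = j + int c - max 0 j - max 0 (j - (int a - int c))"

lemma finite_forced: "finite (forced j)"
  by (simp add: forced_def)

lemma count_below_forced:
  assumes "j \<le> int a"
  shows "int (count_below (forced j) i) = max 0 (min i 0 + j) + max 0 (min i (int b + int c) - (int a + int b - j))"
proof -
  have "{- j..<0} \<inter> {int a + int b - j..<int b + int c} = {}" using assms by auto
  then have "int (count_below (forced j) i) = int (count_below {- j..<0} i) + int (count_below {int a + int b - j..<int b + int c} i)"
    unfolding forced_def by (subst count_below_union) auto
  then show ?thesis unfolding count_below_interval by simp
qed

lemma card_forced:
  assumes "j \<le> int a"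
  shows "int (card (forced j)) = max 0 j + max 0 (j - (int a - int c))"
proof -
  have "{- j..<0} \<inter> {int a + int b - j..<int b + int c} = {}" using assms by auto
  then have "int (card (forced j)) = int (card {- j..<0}) + int (card {int a + int b - j..<int b + int c})"
    unfolding forced_def by (subst card_Un_disjoint) auto
  then show ?thesis by simp
qed

lemma row_forced_disjoint: "S \<subseteq> row_range a b c j \<Longrightarrow> S \<inter> forced j = {}"
  using row_rangeD by (fastforce simp: forced_def)

lemma finite_row: "S \<subseteq> row_range a b c j \<Longrightarrow> finite S"
  using finite_row_range finite_subset by blast

lemma row_step_next:
  assumes "row_step a b c j S S'" "x \<in> S'"
  shows "strip_state j S S' (x + 1) = 0" "strip_state j S S' x + of_bool (x \<in> S) = 1"
proof -
  have "strip_state j S S' (x + 1) = strip_state j S S' x + of_bool (x \<in> S) - of_bool (x \<in> S')"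
    using assms by (intro strip_state_Suc) (auto simp: row_step_def)
  moreover have "strip_state j S S' (x + 1) \<in> {0, 1}" "strip_state j S S' x \<in> {0, 1}" "x \<in> S \<longrightarrow> strip_state j S S' x = 0"
    using assms(1) unfolding row_step_def by blast+
  ultimately show "strip_state j S S' (x + 1) = 0" "strip_state j S S' x + of_bool (x \<in> S) = 1"
    using assms(2) by (auto split: if_splits)
qed

lemma row_step_interlace:
  assumes st: "row_step a b c j S S'" and j: "- int c \<le> j" "j < int a"
  shows "interlace ((\<lambda>y. y - 1) ` (S \<union> forced j)) (S' \<union> forced (j + 1))"
proof -
  have sub: "S \<subseteq> row_range a b c j" "S' \<subseteq> row_range a b c (j + 1)" using st by (auto simp: row_step_def)
  have fin: "finite S" "finite S'" using sub finite_row by auto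
  have card: "int (card S') + of_bool (int a - int c \<le> j) = int (card S) + of_bool (j < 0)"
    using st by (auto simp: row_step_def)
  have cY: "int (count_below (S \<union> forced j) i) = int (count_below S i) + int (count_below (forced j) i)" for i
    using count_below_union[OF fin(1) finite_forced row_forced_disjoint[OF sub(1)]] by simp
  have cX: "int (count_below (S' \<union> forced (j + 1)) i) = int (count_below S' i) + int (count_below (forced (j + 1)) i)" for i
    using count_below_union[OF fin(2) finite_forced row_forced_disjoint[OF sub(2)]] by simp
  have "card (S' \<union> forced (j + 1)) = Suc (card (S \<union> forced j))"
  proof -
    have "int (card (S' \<union> forced (j + 1))) = int (card S') + int (card (forced (j + 1)))"
      using fin finite_forced row_forced_disjoint[OF sub(2)] by (simp add: card_Un_disjoint)
    moreover have "int (card (S \<union> forced j)) = int (card S) + int (card (forced j))"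
      using fin finite_forced row_forced_disjoint[OF sub(1)] by (simp add: card_Un_disjoint)
    ultimately have "int (card (S' \<union> forced (j + 1))) = int (Suc (card (S \<union> forced j)))"
      using card j card_forced[of j] card_forced[of "j + 1"] by (auto simp: of_bool_def split: if_splits)
    then show ?thesis by (simp only: of_nat_eq_iff)
  qed
  moreover have "count_below (S \<union> forced j) (x + 1) = count_below (S' \<union> forced (j + 1)) x" if x: "x \<in> S' \<union> forced (j + 1)" for x
  proof -
    have cF: "int (count_below (forced j) (x + 1)) = max 0 (min (x + 1) 0 + j) + max 0 (min (x + 1) (int b + int c) - (int a + int b - j))"
      "int (count_below (forced (j + 1)) x) = max 0 (min x 0 + (j + 1)) + max 0 (min x (int b + int c) - (int a + int b - (j + 1)))"
      using j by (simp_all add: count_below_forced)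
    consider "x \<in> S'" | "- (j + 1) \<le> x" "x < 0" | "int a + int b - (j + 1) \<le> x" "x < int b + int c"
      using x by (auto simp: forced_def)
    then have "int (count_below (S \<union> forced j) (x + 1)) = int (count_below (S' \<union> forced (j + 1)) x)"
    proof cases
      case 1
      have "int (count_below S (x + 1)) + of_bool (j < 0) = int (count_below S' (x + 1))"
        using row_step_next(1)[OF st 1] by (simp add: strip_state_def)
      also have "\<dots> = int (count_below S' x) + 1"
        using count_below_Suc[OF fin(2), of x] 1 by simp
      finally show ?thesis
        unfolding cY cX cF using row_rangeD[OF sub(2) 1] by (auto simp: of_bool_def split: if_splits)
    next
      case 2
      have "count_below S (x + 1) = 0" "count_below S' x = 0"
        by (rule count_below_eq_0, use row_rangeD[OF sub(1)] row_rangeD[OF sub(2)] 2 in fastforce)+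
      then show ?thesis unfolding cY cX cF using 2 j by auto
    next
      case 3
      have "count_below S (x + 1) = card S" "count_below S' x = card S'"
        by (rule count_below_eq_card, use row_rangeD[OF sub(1)] row_rangeD[OF sub(2)] 3 in fastforce)+
      then show ?thesis unfolding cY cX cF using 3 j card by (auto simp: of_bool_def split: if_splits)
    qed
    then show ?thesis by simp
  qed
  ultimately show ?thesis
    unfolding interlace_shift using fin finite_forced by blast
qed

lemma interlace_row_step:
  assumes il: "interlace ((\<lambda>y. y - 1) ` Y) (S' \<union> forced (j + 1))"
    and sub: "S' \<subseteq> row_range a b c (j + 1)" and card': "int (card S') = row_size (j + 1)"
    and j: "- int c \<le> j" "j < int a"
  defines "S \<equiv> Y \<inter> {max 0 (- j)..<min (int b + int c) (int a + int b - j)}"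
  shows "Y = S \<union> forced j" "row_step a b c j S S'"
proof -
  define X where "X = S' \<union> forced (j + 1)"
  have finS': "finite S'" using sub finite_row by auto
  have finX: "finite X" unfolding X_def using finS' finite_forced by auto
  have finY: "finite Y" and cXY: "card X = Suc (card Y)" and eq: "\<And>x. x \<in> X \<Longrightarrow> count_below Y (x + 1) = count_below X x"
    using il unfolding interlace_shift X_def by auto
  have cX: "int (count_below X i) = int (count_below S' i) + int (count_below (forced (j + 1)) i)" for i
    unfolding X_def using count_below_union[OF finS' finite_forced row_forced_disjoint[OF sub]] by simp
  have cF: "int (count_below (forced (j + 1)) i) = max 0 (min i 0 + (j + 1)) + max 0 (min i (int b + int c) - (int a + int b - (j + 1)))"
    "int (count_below (forced j) i) = max 0 (min i 0 + j) + max 0 (min i (int b + int c) - (int a + int b - j))" for i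
    using j by (simp_all add: count_below_forced)
  have cardX: "int (card X) = j + 1 + int c"
  proof -
    have "int (card X) = int (card S') + int (card (forced (j + 1)))"
      unfolding X_def using finS' finite_forced row_forced_disjoint[OF sub] by (simp add: card_Un_disjoint)
    then show ?thesis using card' card_forced[of "j + 1"] j by (simp add: row_size_def)
  qed
  have Xne: "X \<noteq> {}" using cXY by auto
  have Xb: "- j - 1 \<le> x \<and> x < int b + int c" if "x \<in> X" for x
    using that row_rangeD[OF sub, of x] j unfolding X_def forced_def by auto
  have Ylow: "- j \<le> y" if "y \<in> Y" for y
  proof -
    have "Min X \<in> X" using finX Xne by simp
    moreover have "count_below X (Min X) = 0" by (rule count_below_eq_0) (use finX in simp)
    ultimately have "count_below Y (Min X + 1) = 0" using eq by simp
    then have "Min X + 1 \<le> y" using finY that by (rule count_below_eq_0D)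
    then show ?thesis using Xb[OF \<open>Min X \<in> X\<close>] by linarith
  qed
  have Yup: "y < int b + int c" if "y \<in> Y" for y
  proof -
    have m: "Max X \<in> X" using finX Xne by simp
    have "int (count_below X (Max X + 1)) = int (count_below X (Max X)) + 1"
      using count_below_Suc[OF finX, of "Max X"] m by simp
    moreover have "count_below X (Max X + 1) = card X"
      by (rule count_below_eq_card) (use finX Max_ge in \<open>fastforce simp: zless_add1_eq le_less\<close>)
    ultimately have "count_below Y (Max X + 1) = card Y" using eq[OF m] cXY by simp
    then have "y < Max X + 1" using finY that by (rule count_below_eq_cardD)
    then show ?thesis using Xb[OF m] by linarith
  qed
  have S'0: "count_below S' i = 0" if "i \<le> 0" for i
    by (rule count_below_eq_0) (use row_rangeD[OF sub] that in fastforce)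
  have S'1: "count_below S' i = card S'" if "int a + int b - (j + 1) \<le> i" for i
    by (rule count_below_eq_card) (use row_rangeD[OF sub] that in fastforce)
  \<comment> \<open>Between the adjacent integers \<open>m - 1\<close> and \<open>m\<close> of
    \<open>X\<close> there is room for one element of \<open>Y\<close> only, namely
    \<open>m\<close>.\<close>
  have inY: "m \<in> Y" if "m \<in> X" "m - 1 \<in> X" "int (count_below X m) = int (count_below X (m - 1)) + 1" for m
    using eq[OF that(1)] eq[OF that(2)] that(3) count_below_Suc[OF finY, of m] by (auto split: if_splits)
  have Fsub: "forced j \<subseteq> Y"
  proof
    fix m assume "m \<in> forced j"
    then consider "- j \<le> m" "m < 0" | "int a + int b - j \<le> m" "m < int b + int c" by (auto simp: forced_def)
    then show "m \<in> Y"
    proof cases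
      case 1
      then have "m \<in> X" "m - 1 \<in> X" unfolding X_def forced_def by auto
      then show ?thesis by (rule inY) (use 1 j in \<open>simp add: cX cF S'0\<close>)
    next
      case 2
      then have "m \<in> X" "m - 1 \<in> X" unfolding X_def forced_def by auto
      then show ?thesis by (rule inY) (use 2 j in \<open>simp add: cX cF S'1\<close>)
    qed
  qed
  show YS: "Y = S \<union> forced j"
  proof (rule equalityI; rule subsetI)
    fix y assume y: "y \<in> Y"
    then show "y \<in> S \<union> forced j"
      using Ylow[OF y] Yup[OF y] unfolding S_def forced_def by auto
  qed (use Fsub in \<open>auto simp: S_def\<close>)
  have Srange: "S \<subseteq> row_range a b c j"
  proof (cases "j = - int c")
    case True
    then have "card Y = 0" using cardX cXY by simp
    then show ?thesis using finY by (auto simp: S_def)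
  qed (use j in \<open>auto simp: S_def row_range_def\<close>)
  have finS: "finite S" using Srange finite_row by auto
  have cY: "int (count_below Y i) = int (count_below S i) + int (count_below (forced j) i)" for i
    using count_below_union[OF finS finite_forced row_forced_disjoint[OF Srange]] YS by simp
  have cardS: "int (card S') + of_bool (int a - int c \<le> j) = int (card S) + of_bool (j < 0)"
  proof -
    have "int (card Y) = int (card S) + int (card (forced j))"
      using finS finite_forced row_forced_disjoint[OF Srange] YS by (metis card_Un_disjoint of_nat_add)
    then show ?thesis
      using card_forced[of j] j cardX cXY card' by (auto simp: row_size_def of_bool_def split: if_splits)
  qed
  have "strip_state j S S' i \<in> {0, 1} \<and> (i \<in> S \<longrightarrow> strip_state j S S' i = 0)" for i
  proof -
    have g: "int (count_below X i) - int (count_below Y i) \<in> {0, 1}"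
      "i \<in> Y \<Longrightarrow> int (count_below X i) - int (count_below Y i) = 1"
      using interlace_shift_state[OF finX finY cXY eq] by blast+
    \<comment> \<open>In the first case the state is 1 minus the difference of the two counts
      bounded in \<open>g\<close>. In the other two cases \<open>i\<close> lies left or right of the
      hexagon, where the counts of \<open>S\<close> and \<open>S'\<close> are 0 or complete.\<close>
    consider "(j < 0 \<or> i \<ge> 0) \<and> (j < int a - int c \<or> i < int a + int b - j)" | "j \<ge> 0" "i < 0"
      | "int a - int c \<le> j" "int a + int b - j \<le> i" by linarith
    then show ?thesis
    proof cases
      case 1
      then have "strip_state j S S' i = 1 + int (count_below Y i) - int (count_below X i)"
        unfolding strip_state_def cX cY cF using j by (auto simp: of_bool_def)
      then show ?thesis using g YS by auto
    next
      case 2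
      have "count_below S i = 0"
        by (rule count_below_eq_0) (use row_rangeD[OF Srange] 2 in fastforce)
      then show ?thesis using S'0[of i] 2 row_rangeD[OF Srange, of i] by (auto simp: strip_state_def)
    next
      case 3
      have "count_below S i = card S"
        by (rule count_below_eq_card) (use row_rangeD[OF Srange] 3 in fastforce)
      then show ?thesis using S'1[of i] 3 cardS row_rangeD[OF Srange, of i] by (auto simp: strip_state_def)
    qed
  qed
  then show "row_step a b c j S S'"
    unfolding row_step_def using Srange sub cardS by blast
qed

lemma bij_betw_row_step:
  assumes sub: "S' \<subseteq> row_range a b c (j + 1)" and card': "int (card S') = row_size (j + 1)"
    and j: "- int c \<le> j" "j < int a"
  shows "bij_betw (\<lambda>S. (\<lambda>y. y - 1) ` (S \<union> forced j)) {S. row_step a b c j S S'} {Z. interlace Z (S' \<union> forced (j + 1))}"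
proof (rule bij_betw_byWitness[where f' = "\<lambda>Z. (\<lambda>z. z + 1) ` Z \<inter> {max 0 (- j)..<min (int b + int c) (int a + int b - j)}"])
  have img: "(\<lambda>z. z + 1) ` (\<lambda>y. y - 1) ` Y = Y" "(\<lambda>y. y - 1) ` (\<lambda>z. z + 1) ` Y = Y" for Y :: "int set"
    by (simp_all add: image_image)
  show "\<forall>S\<in>{S. row_step a b c j S S'}. (\<lambda>z. z + 1) ` (\<lambda>y. y - 1) ` (S \<union> forced j) \<inter> {max 0 (- j)..<min (int b + int c) (int a + int b - j)} = S"
  proof
    fix S assume "S \<in> {S. row_step a b c j S S'}"
    then have "S \<subseteq> row_range a b c j" by (auto simp: row_step_def)
    then have "S \<subseteq> {max 0 (- j)..<min (int b + int c) (int a + int b - j)}" by (auto simp: row_range_def split: if_splits)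
    moreover have "forced j \<inter> {max 0 (- j)..<min (int b + int c) (int a + int b - j)} = {}" by (auto simp: forced_def)
    ultimately show "(\<lambda>z. z + 1) ` (\<lambda>y. y - 1) ` (S \<union> forced j) \<inter> {max 0 (- j)..<min (int b + int c) (int a + int b - j)} = S"
      unfolding img by blast
  qed
  show "\<forall>Z\<in>{Z. interlace Z (S' \<union> forced (j + 1))}.
      (\<lambda>y. y - 1) ` ((\<lambda>z. z + 1) ` Z \<inter> {max 0 (- j)..<min (int b + int c) (int a + int b - j)} \<union> forced j) = Z"
  proof
    fix Z assume "Z \<in> {Z. interlace Z (S' \<union> forced (j + 1))}"
    then have "interlace ((\<lambda>y. y - 1) ` (\<lambda>z. z + 1) ` Z) (S' \<union> forced (j + 1))" unfolding img by simp
    from interlace_row_step(1)[OF this sub card' j]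
    show "(\<lambda>y. y - 1) ` ((\<lambda>z. z + 1) ` Z \<inter> {max 0 (- j)..<min (int b + int c) (int a + int b - j)} \<union> forced j) = Z"
      using img(2)[of Z] by simp
  qed
  show "(\<lambda>S. (\<lambda>y. y - 1) ` (S \<union> forced j)) ` {S. row_step a b c j S S'} \<subseteq> {Z. interlace Z (S' \<union> forced (j + 1))}"
    using row_step_interlace[OF _ j] by blast
  show "(\<lambda>Z. (\<lambda>z. z + 1) ` Z \<inter> {max 0 (- j)..<min (int b + int c) (int a + int b - j)}) ` {Z. interlace Z (S' \<union> forced (j + 1))} \<subseteq> {S. row_step a b c j S S'}"
  proof
    fix S assume "S \<in> (\<lambda>Z. (\<lambda>z. z + 1) ` Z \<inter> {max 0 (- j)..<min (int b + int c) (int a + int b - j)}) ` {Z. interlace Z (S' \<union> forced (j + 1))}"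
    then obtain Z where Z: "interlace Z (S' \<union> forced (j + 1))" and S: "S = (\<lambda>z. z + 1) ` Z \<inter> {max 0 (- j)..<min (int b + int c) (int a + int b - j)}"
      by blast
    have "interlace ((\<lambda>y. y - 1) ` (\<lambda>z. z + 1) ` Z) (S' \<union> forced (j + 1))" using Z unfolding img by simp
    from interlace_row_step(2)[OF this sub card' j] show "S \<in> {S. row_step a b c j S S'}"
      unfolding S by simp
  qed
qed

lemma finite_row_step: "finite {S. row_step a b c j S S'}"
  by (rule finite_subset[of _ "Pow (row_range a b c j)"]) (auto simp: row_step_def finite_row_range)

text \<open>Induction over the rows: each step is a sum over interlacing sets, so the Vandermonde
  product of the row with its frozen particles reproduces itself up to a factorial. The lowest row
  is empty, with empty product 1.\<close>

lemma lower_count: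
  assumes "- int c \<le> j" "j \<le> int a" "S \<subseteq> row_range a b c j" "int (card S) = row_size j"
  shows "real (card (chains (row_step a b c) (- int c) j {} S)) = vdm_set (S \<union> forced j) / (\<Prod>k<nat (j + int c). fact k)"
  using assms
proof (induction j arbitrary: S rule: int_ge_induct)
  case base
  then have "S = {}" by (simp add: row_range_def)
  moreover have "forced (- int c) = {}" by (auto simp: forced_def)
  ultimately show ?case by (simp add: chains_refl vdm_set_def)
next
  case (step j)
  define k where "k = nat (j + int c)"
  define X where "X = S \<union> forced (j + 1)"
  have j: "- int c \<le> j" "j < int a" using step by auto
  have card: "card (chains (row_step a b c) (- int c) (j + 1) {} S) = (\<Sum>u | row_step a b c j u S. card (chains (row_step a b c) (- int c) j {} u))"
    by (rule card_chains_last[OF j(1) finite_row_step]) (use j finite_row_step in \<open>intro finite_chains, auto\<close>)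
  have IH: "real (card (chains (row_step a b c) (- int c) j {} u)) = vdm_set ((\<lambda>y. y - 1) ` (u \<union> forced j)) / (\<Prod>k<nat (j + int c). fact k)"
    if u: "row_step a b c j u S" for u
  proof -
    have "int (card u) = row_size j"
      using u step.prems(3) by (auto simp: row_step_def row_size_def of_bool_def split: if_splits)
    then have "real (card (chains (row_step a b c) (- int c) j {} u)) = vdm_set (u \<union> forced j) / (\<Prod>k<nat (j + int c). fact k)"
      using u j by (intro step.IH) (auto simp: row_step_def)
    then show ?thesis by (subst vdm_set_bij) auto
  qed
  have fin: "finite S" using step.prems(2) finite_row by auto
  have cardX: "card X = Suc k"
  proof -
    have "int (card X) = int (card S) + int (card (forced (j + 1)))"
      unfolding X_def using fin finite_forced row_forced_disjoint[OF step.prems(2)] by (simp add: card_Un_disjoint)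
    also have "\<dots> = j + 1 + int c" using step.prems(3) card_forced[of "j + 1"] j by (simp add: row_size_def)
    finally show ?thesis using j unfolding k_def by simp
  qed
  have "real (card (chains (row_step a b c) (- int c) (j + 1) {} S))
    = (\<Sum>u | row_step a b c j u S. vdm_set ((\<lambda>y. y - 1) ` (u \<union> forced j))) / (\<Prod>k<nat (j + int c). fact k)"
    unfolding card of_nat_sum sum_divide_distrib by (intro sum.cong refl IH) simp
  also have "(\<Sum>u | row_step a b c j u S. vdm_set ((\<lambda>y. y - 1) ` (u \<union> forced j))) = (\<Sum>Z | interlace Z X. vdm_set Z)"
    unfolding X_def by (rule sum.reindex_bij_betw[OF bij_betw_row_step[OF step.prems(2,3) j]])
  also have "\<dots> = vdm_set X / fact k"
    by (rule sum_interlace) (use fin finite_forced cardX in \<open>auto simp: X_def\<close>)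
  also have "vdm_set X / fact k / (\<Prod>k<nat (j + int c). fact k) = vdm_set X / (\<Prod>k<nat (j + 1 + int c). fact k)"
  proof -
    have "nat (j + 1 + int c) = Suc k" using j unfolding k_def by simp
    then show ?thesis unfolding k_def by (simp add: mult.commute)
  qed
  finally show ?case unfolding X_def .
qed

text \<open>Rotation of the hexagon by the angle \<open>\<pi>\<close> turns the part of a tiling above a row into a part below a row.\<close>

definition reflect :: "int set \<Rightarrow> int set" where
  "reflect S = (\<lambda>i. int b + int c - 1 - i) ` S"

lemma reflect_reflect [simp]: "reflect (reflect S) = S"
  by (simp add: reflect_def image_image)

lemma card_reflect [simp]: "card (reflect S) = card S"
  unfolding reflect_def by (rule card_image) (auto simp: inj_on_def)

lemma finite_reflect [simp]: "finite (reflect S) = finite S"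
  unfolding reflect_def by (rule finite_image_iff) (auto simp: inj_on_def)

lemma reflect_row_range: "reflect (row_range a b c j) = row_range a b c (int a - int c - j)"
proof (rule equalityI; rule subsetI)
  fix i assume "i \<in> reflect (row_range a b c j)"
  then show "i \<in> row_range a b c (int a - int c - j)"
    by (auto simp: reflect_def row_range_def split: if_splits)
next
  fix i assume "i \<in> row_range a b c (int a - int c - j)"
  then show "i \<in> reflect (row_range a b c j)"
    unfolding reflect_def
    by (intro image_eqI[of _ _ "int b + int c - 1 - i"]) (auto simp: row_range_def split: if_splits)
qed

lemma count_below_reflect:
  assumes "finite S"
  shows "int (count_below (reflect S) i) = int (card S) - int (count_below S (int b + int c - i))"
proof -
  have "{s \<in> reflect S. s < i} = reflect {s \<in> S. int b + int c - i \<le> s}"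
    by (auto simp: reflect_def)
  then have "count_below (reflect S) i = card {s \<in> S. int b + int c - i \<le> s}"
    by (simp add: count_below_def)
  moreover have "card {s \<in> S. s < int b + int c - i} + card {s \<in> S. int b + int c - i \<le> s} = card S"
  proof -
    have "{s \<in> S. s < int b + int c - i} \<union> {s \<in> S. int b + int c - i \<le> s} = S" by auto
    moreover have "{s \<in> S. s < int b + int c - i} \<inter> {s \<in> S. int b + int c - i \<le> s} = {}" by auto
    ultimately show ?thesis using assms by (metis (no_types, lifting) card_Un_disjoint finite_Un)
  qed
  ultimately show ?thesis by (simp add: count_below_def)
qed

text \<open>The reflection turns counts from the left into counts from the right, so the strip state
  at \<open>i\<close> equals the old state at \<open>int b + int c - i\<close>; the cardinality
  equation accounts for the exchange of the two end values.\<close>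

lemma row_step_reflect:
  assumes st: "row_step a b c j S S'"
  shows "row_step a b c (int a - int c - 1 - j) (reflect S') (reflect S)"
proof -
  have sub: "S \<subseteq> row_range a b c j" "S' \<subseteq> row_range a b c (j + 1)" using st by (auto simp: row_step_def)
  have fin: "finite S" "finite S'" using sub finite_row by auto
  have card: "int (card S') + of_bool (int a - int c \<le> j) = int (card S) + of_bool (j < 0)"
    using st by (auto simp: row_step_def)
  have "reflect S' \<subseteq> reflect (row_range a b c (j + 1))" "reflect S \<subseteq> reflect (row_range a b c j)"
    using sub unfolding reflect_def by (auto intro: image_mono)
  then have sub': "reflect S' \<subseteq> row_range a b c (int a - int c - 1 - j)" "reflect S \<subseteq> row_range a b c (int a - int c - 1 - j + 1)"
    unfolding reflect_row_range by (simp_all add: algebra_simps)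
  have eq: "strip_state (int a - int c - 1 - j) (reflect S') (reflect S) i = strip_state j S S' (int b + int c - i)" for i
    using card unfolding strip_state_def count_below_reflect[OF fin(1)] count_below_reflect[OF fin(2)]
    by (auto simp: of_bool_def split: if_splits)
  have "strip_state (int a - int c - 1 - j) (reflect S') (reflect S) i = 0" if "i \<in> reflect S'" for i
  proof -
    from that obtain s where s: "s \<in> S'" "i = int b + int c - 1 - s" unfolding reflect_def by (rule imageE)
    then have "int b + int c - i = s + 1" by simp
    then show ?thesis unfolding eq using row_step_next(1)[OF st s(1)] by simp
  qed
  moreover have "strip_state (int a - int c - 1 - j) (reflect S') (reflect S) i \<in> {0, 1}" for i
    unfolding eq using st by (auto simp: row_step_def)
  ultimately show ?thesis
    unfolding row_step_def using sub' card by (auto simp: of_bool_def split: if_splits)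
qed

lemma chains_reflect_subset:
  "(\<lambda>x. \<lambda>k\<in>{int a - int c - n..int a - int c - m}. reflect (x (int a - int c - k))) ` chains (row_step a b c) m n s t
    \<subseteq> chains (row_step a b c) (int a - int c - n) (int a - int c - m) (reflect t) (reflect s)" if "m \<le> n"
proof
  fix y assume "y \<in> (\<lambda>x. \<lambda>k\<in>{int a - int c - n..int a - int c - m}. reflect (x (int a - int c - k))) ` chains (row_step a b c) m n s t"
  then obtain x where x: "x \<in> chains (row_step a b c) m n s t"
    and y: "y = (\<lambda>k\<in>{int a - int c - n..int a - int c - m}. reflect (x (int a - int c - k)))" by blast
  have "row_step a b c k (y k) (y (k + 1))" if k: "k \<in> {int a - int c - n..<int a - int c - m}" for k
  proof -
    define k' where "k' = int a - int c - 1 - k"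
    have "k' \<in> {m..<n}" using k unfolding k'_def by simp
    then have "row_step a b c k' (x k') (x (k' + 1))" using x by (simp add: chains_def)
    from row_step_reflect[OF this] show ?thesis
      using k unfolding y k'_def by (auto simp: algebra_simps)
  qed
  then show "y \<in> chains (row_step a b c) (int a - int c - n) (int a - int c - m) (reflect t) (reflect s)"
    using x that unfolding y chains_def by auto
qed

lemma card_chains_reflect:
  assumes "m \<le> n"
  shows "card (chains (row_step a b c) m n s t) = card (chains (row_step a b c) (int a - int c - n) (int a - int c - m) (reflect t) (reflect s))"
proof -
  let ?f = "\<lambda>m n x. \<lambda>k\<in>{int a - int c - n..int a - int c - m}. reflect (x (int a - int c - k))"
  let ?N = "int a - int c"
  have inv: "?f (?N - n) (?N - m) (?f m n x) = x" if "x \<in> extensional {m..n}" for x m n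
    using that by (auto simp: fun_eq_iff extensional_def)
  have "bij_betw (?f m n) (chains (row_step a b c) m n s t) (chains (row_step a b c) (?N - n) (?N - m) (reflect t) (reflect s))"
  proof (rule bij_betw_byWitness[where f' = "?f (?N - n) (?N - m)"])
    show "\<forall>x\<in>chains (row_step a b c) m n s t. ?f (?N - n) (?N - m) (?f m n x) = x"
      using inv by (auto simp: chains_def)
    show "\<forall>y\<in>chains (row_step a b c) (?N - n) (?N - m) (reflect t) (reflect s). ?f m n (?f (?N - n) (?N - m) y) = y"
      using inv[where m = "?N - n" and n = "?N - m"] by (auto simp: chains_def)
    show "?f m n ` chains (row_step a b c) m n s t \<subseteq> chains (row_step a b c) (?N - n) (?N - m) (reflect t) (reflect s)"
      using assms by (rule chains_reflect_subset)
    show "?f (?N - n) (?N - m) ` chains (row_step a b c) (?N - n) (?N - m) (reflect t) (reflect s) \<subseteq> chains (row_step a b c) m n s t"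
      using chains_reflect_subset[of "?N - n" "?N - m" "reflect t" "reflect s"] assms by simp
  qed
  then show ?thesis by (rule bij_betw_same_card)
qed

lemma row_size_reflect: "row_size (int a - int c - j) = row_size j"
  unfolding row_size_def by linarith

lemma upper_count:
  assumes "- int c \<le> j" "j \<le> int a" "S \<subseteq> row_range a b c j" "int (card S) = row_size j"
  shows "real (card (chains (row_step a b c) j (int a) S {})) = vdm_set (reflect S \<union> forced (int a - int c - j)) / (\<Prod>k<nat (int a - j). fact k)"
proof -
  have r0: "reflect {} = {}" by (simp add: reflect_def)
  have "reflect S \<subseteq> row_range a b c (int a - int c - j)"
    unfolding reflect_row_range[symmetric] reflect_def using assms(3) by (rule image_mono)
  then have "real (card (chains (row_step a b c) (- int c) (int a - int c - j) {} (reflect S)))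
    = vdm_set (reflect S \<union> forced (int a - int c - j)) / (\<Prod>k<nat (int a - int c - j + int c). fact k)"
    by (intro lower_count) (use assms in \<open>simp_all add: row_size_reflect\<close>)
  moreover have "card (chains (row_step a b c) j (int a) S {}) = card (chains (row_step a b c) (- int c) (int a - int c - j) {} (reflect S))"
    using card_chains_reflect[OF assms(2), of S "{}"] r0 by simp
  ultimately show ?thesis by simp
qed

definition row_weight :: "int \<Rightarrow> int \<Rightarrow> real" where
  "row_weight j s = (\<Prod>f\<in>forced j. \<bar>of_int (s - f)\<bar>) * (\<Prod>f\<in>forced (int a - int c - j). \<bar>of_int (int b + int c - 1 - s - f)\<bar>)"

text \<open>The patterns below and above the row each contribute the Vandermonde product of
  \<open>S\<close>: this is the origin of the square, and hence of an orthogonal polynomial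
  ensemble. Factors that involve frozen particles only go into \<open>K\<close>.\<close>

lemma row_count:
  assumes "- int c \<le> j" "j \<le> int a"
  obtains K where "K > 0" "\<And>S. \<lbrakk>S \<subseteq> row_range a b c j; int (card S) = row_size j\<rbrakk> \<Longrightarrow>
    real (card {x \<in> chains (row_step a b c) (- int c) (int a) {} {}. x j = S}) = K * ((vdm_set S)\<^sup>2 * (\<Prod>s\<in>S. row_weight j s))"
proof
  let ?F = "forced j" and ?F' = "forced (int a - int c - j)"
  let ?K = "vdm_set ?F * vdm_set ?F' / ((\<Prod>k<nat (j + int c). fact k) * (\<Prod>k<nat (int a - j). fact k))"
  show "?K > 0" using vdm_set_pos[OF finite_forced] by (auto intro!: divide_pos_pos mult_pos_pos prod_pos)
  fix S assume S: "S \<subseteq> row_range a b c j" "int (card S) = row_size j"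
  have fin: "finite S" using S finite_row by auto
  have S': "reflect S \<subseteq> row_range a b c (int a - int c - j)"
    unfolding reflect_row_range[symmetric] reflect_def using S(1) by (rule image_mono)
  have v1: "vdm_set (S \<union> ?F) = vdm_set S * vdm_set ?F * (\<Prod>s\<in>S. \<Prod>f\<in>?F. \<bar>of_int (s - f)\<bar>)"
    by (rule vdm_set_union[OF fin finite_forced row_forced_disjoint[OF S(1)]])
  have "vdm_set (reflect S \<union> ?F') = vdm_set (reflect S) * vdm_set ?F' * (\<Prod>s\<in>reflect S. \<Prod>f\<in>?F'. \<bar>of_int (s - f)\<bar>)"
    by (rule vdm_set_union) (use fin finite_forced row_forced_disjoint[OF S'] in auto)
  also have "vdm_set (reflect S) = vdm_set S"
    unfolding reflect_def by (rule vdm_set_bij) auto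
  also have "(\<Prod>s\<in>reflect S. \<Prod>f\<in>?F'. \<bar>of_int (s - f)\<bar> :: real) = (\<Prod>s\<in>S. \<Prod>f\<in>?F'. \<bar>of_int (int b + int c - 1 - s - f)\<bar>)"
    unfolding reflect_def by (subst prod.reindex) (auto simp: inj_on_def)
  finally have v2: "vdm_set (reflect S \<union> ?F') = vdm_set S * vdm_set ?F' * (\<Prod>s\<in>S. \<Prod>f\<in>?F'. \<bar>of_int (int b + int c - 1 - s - f)\<bar>)" .
  have "real (card {x \<in> chains (row_step a b c) (- int c) (int a) {} {}. x j = S})
    = real (card (chains (row_step a b c) (- int c) j {} S)) * real (card (chains (row_step a b c) j (int a) S {}))"
    using assms by (simp add: card_chains_split)
  also have "\<dots> = ?K * ((vdm_set S)\<^sup>2 * (\<Prod>s\<in>S. row_weight j s))"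
    unfolding lower_count[OF assms S] upper_count[OF assms S] v1 v2 row_weight_def prod.distrib power2_eq_square
    by simp
  finally show "real (card {x \<in> chains (row_step a b c) (- int c) (int a) {} {}. x j = S}) = ?K * ((vdm_set S)\<^sup>2 * (\<Prod>s\<in>S. row_weight j s))" .
qed

lemma chains_row:
  assumes x: "x \<in> chains (row_step a b c) (- int c) (int a) {} {}" and j: "- int c \<le> j" "j \<le> int a"
  shows "x j \<subseteq> row_range a b c j" "int (card (x j)) = row_size j"
proof -
  have step: "row_step a b c j (x j) (x (j + 1))" if "- int c \<le> j" "j < int a" for j
    using x that by (auto simp: chains_def)
  show "x j \<subseteq> row_range a b c j"
    using step[of j] j x by (cases "j = int a") (auto simp: row_step_def chains_def)
  show "int (card (x j)) = row_size j"
    using j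
  proof (induction j rule: int_ge_induct)
    case base
    then show ?case using x by (simp add: chains_def row_size_def)
  next
    case (step j)
    then show ?case using \<open>\<And>j. \<lbrakk>- int c \<le> j; j < int a\<rbrakk> \<Longrightarrow> row_step a b c j (x j) (x (j + 1))\<close>[of j]
      by (auto simp: row_step_def row_size_def of_bool_def split: if_splits)
  qed
qed

definition row_lo :: "int \<Rightarrow> int" where "row_lo j = max 0 (- j)"
definition row_hi :: "int \<Rightarrow> int" where "row_hi j = min (int b + int c) (int a + int b - j)"

lemma row_hi_lo: "row_hi j - row_lo j = row_size j + int b"
  unfolding row_hi_def row_lo_def row_size_def by linarith

text \<open>Whatever the sign of \<open>j\<close>, one of the two patterns places its frozen
  particles in a block of length \<open>\<bar>j\<bar>\<close> that ends just left of the row, and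
  one of them fills a block of length \<open>\<bar>j - (int a - int c)\<bar>\<close> that starts
  just right of it. The product of the distances to a block is a Pochhammer symbol, which explains
  the parameters of the Hahn weight.\<close>

lemma row_weight_eq:
  assumes j: "- int c < j" "j < int a" and x: "int x < row_hi j - row_lo j"
  shows "row_weight j (row_lo j + int x)
    = pochhammer (real x + 1) (nat \<bar>j\<bar>) * pochhammer (of_int (row_hi j - row_lo j) - real x) (nat \<bar>j - (int a - int c)\<bar>)"
proof -
  let ?s = "row_lo j + int x"
  let ?L = "{row_lo j - \<bar>j\<bar>..<row_lo j}" and ?R = "{row_hi j..<row_hi j + \<bar>j - (int a - int c)\<bar>}"
  have "(\<Prod>f\<in>forced (int a - int c - j). \<bar>of_int (int b + int c - 1 - ?s - f)\<bar> :: real) = (\<Prod>f\<in>reflect (forced (int a - int c - j)). \<bar>of_int (?s - f)\<bar>)"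
    unfolding reflect_def by (subst prod.reindex) (auto simp: inj_on_def abs_minus_commute algebra_simps intro!: prod.cong)
  moreover have dis: "forced j \<inter> reflect (forced (int a - int c - j)) = {}"
    using j by (auto simp: forced_def reflect_def)
  ultimately have "row_weight j ?s = (\<Prod>f\<in>forced j \<union> reflect (forced (int a - int c - j)). \<bar>of_int (?s - f)\<bar>)"
    unfolding row_weight_def by (subst prod.union_disjoint) (auto simp: finite_forced)
  also have "forced j \<union> reflect (forced (int a - int c - j)) = ?L \<union> ?R"
  proof -
    have "reflect (forced (int a - int c - j)) = {int b + int c..<int a + int b - j} \<union> {0..<- j}"
    proof (rule equalityI; rule subsetI)
      fix f assume "f \<in> {int b + int c..<int a + int b - j} \<union> {0..<- j}"
      then show "f \<in> reflect (forced (int a - int c - j))"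
        unfolding reflect_def by (intro image_eqI[of _ _ "int b + int c - 1 - f"]) (auto simp: forced_def)
    qed (auto simp: forced_def reflect_def)
    then have eq: "forced j \<union> reflect (forced (int a - int c - j))
      = ({- j..<0} \<union> {0..<- j}) \<union> ({int a + int b - j..<int b + int c} \<union> {int b + int c..<int a + int b - j})"
      unfolding forced_def by blast
    have "{- j..<0} \<union> {0..<- j} = ?L"
      by (cases "j \<ge> 0") (simp_all add: row_lo_def)
    moreover have "{int a + int b - j..<int b + int c} \<union> {int b + int c..<int a + int b - j} = ?R"
      by (cases "j \<ge> int a - int c") (simp_all add: row_hi_def algebra_simps)
    ultimately show ?thesis unfolding eq by simp
  qed
  also have "(\<Prod>f\<in>?L \<union> ?R. \<bar>of_int (?s - f)\<bar> :: real) = (\<Prod>f\<in>?L. \<bar>of_int (?s - f)\<bar>) * (\<Prod>f\<in>?R. \<bar>of_int (?s - f)\<bar>)"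
    using x by (intro prod.union_disjoint) auto
  also have "(\<Prod>f\<in>?L. \<bar>of_int (?s - f)\<bar> :: real) = pochhammer (real x + 1) (nat \<bar>j\<bar>)"
    unfolding pochhammer_prod
    by (rule prod.reindex_bij_witness[of _ "\<lambda>i. row_lo j - 1 - int i" "\<lambda>f. nat (row_lo j - 1 - f)"]) auto
  also have "(\<Prod>f\<in>?R. \<bar>of_int (?s - f)\<bar> :: real) = pochhammer (of_int (row_hi j - row_lo j) - real x) (nat \<bar>j - (int a - int c)\<bar>)"
    unfolding pochhammer_prod
    by (rule prod.reindex_bij_witness[of _ "\<lambda>i. row_hi j + int i" "\<lambda>f. nat (f - row_hi j)"]) (use x in auto)
  finally show ?thesis .
qed

end

section \<open>The one-point function\<close>

definition hahn_weight :: "nat \<Rightarrow> nat \<Rightarrow> nat \<Rightarrow> nat \<Rightarrow> real" where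
  "hahn_weight p q M x = pochhammer (real x + 1) p * pochhammer (real M + 1 - real x) q"

definition hahn_mass :: "nat \<Rightarrow> nat \<Rightarrow> nat \<Rightarrow> nat \<Rightarrow> nat \<Rightarrow> real" where
  "hahn_mass p q M k x = hahn_weight p q M x * (poly (hahn_poly p q M k) (real x))\<^sup>2
     / hahn_norm p q M (hahn_weight p q M) k"

lemma hahn_weight_pos: "x \<le> M \<Longrightarrow> hahn_weight p q M x > 0"
  unfolding hahn_weight_def by (intro mult_pos_pos pochhammer_pos) auto

lemma hahn_weight_pearson:
  assumes "x < M"
  shows "hahn_weight p q M (Suc x) * ((real x + 1) * (real M - real x + real q))
      = hahn_weight p q M x * ((real x + real p + 1) * (real M - real x))"
proof -
  have 1: "pochhammer (real x + 2) p * (real x + 1) = pochhammer (real x + 1) p * (real x + real p + 1)"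
    using pochhammer_rec[of "real x + 1" p] pochhammer_rec'[of "real x + 1" p] by (simp add: algebra_simps)
  have 2: "pochhammer (real M - real x) q * (real M - real x + real q) = pochhammer (real M + 1 - real x) q * (real M - real x)"
    using pochhammer_rec[of "real M - real x" q] pochhammer_rec'[of "real M - real x" q] by (simp add: algebra_simps)
  have "hahn_weight p q M (Suc x) = pochhammer (real x + 2) p * pochhammer (real M - real x) q"
    unfolding hahn_weight_def by (simp add: algebra_simps)
  then have "hahn_weight p q M (Suc x) * ((real x + 1) * (real M - real x + real q))
    = (pochhammer (real x + 2) p * (real x + 1)) * (pochhammer (real M - real x) q * (real M - real x + real q))"
    by simp
  also have "\<dots> = hahn_weight p q M x * ((real x + real p + 1) * (real M - real x))"
    unfolding 1 2 hahn_weight_def by simp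
  finally show ?thesis .
qed

lemma hahn_mass_sum:
  assumes "k \<le> M"
  shows "(\<Sum>x\<le>M. hahn_mass p q M k x) = 1"
proof -
  have "(\<Sum>x\<le>M. hahn_mass p q M k x) = hahn_norm p q M (hahn_weight p q M) k / hahn_norm p q M (hahn_weight p q M) k"
    unfolding hahn_mass_def sum_divide_distrib[symmetric] by (simp add: hahn_norm_def)
  then show ?thesis
    using hahn_norm_pos[OF hahn_weight_pos[of _ M p q] hahn_weight_pearson[of _ M p q] assms] by simp
qed

lemma hahn_mass_nonneg:
  assumes "k \<le> M" "x \<le> M"
  shows "hahn_mass p q M k x \<ge> 0"
  unfolding hahn_mass_def
  using hahn_norm_pos[OF hahn_weight_pos[of _ M p q] hahn_weight_pearson[of _ M p q] assms(1)] hahn_weight_pos[OF assms(2), of p q]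
  by (intro divide_nonneg_pos mult_nonneg_nonneg) auto

lemma hahn_mass_sum_bound:
  assumes "k \<le> M" "\<And>x. x \<le> M \<Longrightarrow> \<bar>h x\<bar> \<le> e"
  shows "\<bar>\<Sum>x\<le>M. h x * hahn_mass p q M k x\<bar> \<le> e"
proof -
  have "\<bar>\<Sum>x\<le>M. h x * hahn_mass p q M k x\<bar> \<le> (\<Sum>x\<le>M. e * hahn_mass p q M k x)"
    by (intro order_trans[OF sum_abs] sum_mono)
       (use assms hahn_mass_nonneg[OF assms(1)] in \<open>auto simp: abs_mult intro: mult_right_mono\<close>)
  then show ?thesis by (simp add: sum_distrib_left[symmetric] hahn_mass_sum[OF assms(1)])
qed

context
  fixes a b c :: nat
  assumes pos: "a > 0" "b > 0" "c > 0"
begin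

abbreviation "row_p j \<equiv> nat \<bar>j\<bar>"
abbreviation "row_q j \<equiv> nat \<bar>j - (int a - int c)\<bar>"
abbreviation "row_M j \<equiv> nat (row_hi a b c j - row_lo j) - 1"
abbreviation "row_n j \<equiv> nat (row_size a c j)"

lemma row_size_pos:
  assumes "- int c < j" "j < int a"
  shows "row_size a c j > 0"
  using assms pos unfolding row_size_def by (auto simp: max_def)

lemma row_M_n:
  assumes "- int c < j" "j < int a"
  shows "Suc (row_M j) = row_n j + b" "int (row_M j) = row_hi a b c j - row_lo j - 1"
  using row_hi_lo[of a b c j] row_size_pos[OF assms] pos by auto

text \<open>The fibres over the rows are weighted by the Hahn weight translated to the interval of
  the row, with orthogonal polynomials \<open>P k\<close>. The number of all matchings is the same
  sum without \<open>f\<close>, namely \<open>K * h\<close>; its positivity shows in passing that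
  tilings exist.\<close>

lemma row_one_point:
  fixes f :: "int \<Rightarrow> real"
  assumes j: "- int c < j" "j < int a"
  shows "(\<Sum>M | perfect_matching a b c M. \<Sum>i\<in>row M j. f i)
    = real (card {M. perfect_matching a b c M})
      * (\<Sum>k<row_n j. \<Sum>x\<le>row_M j. f (row_lo j + int x) * hahn_mass (row_p j) (row_q j) (row_M j) k x)"
    and "card {M. perfect_matching a b c M} > 0"
proof -
  let ?C = "chains (row_step a b c) (- int c) (int a) {} {}"
  define p q M n where "p = row_p j" and "q = row_q j" and "M = row_M j" and "n = row_n j"
  define lo where "lo = row_lo j"
  define R where "R = row_range a b c j"
  define w where "w z = row_weight a b c j z" for z
  define P where "P k = pcompose (hahn_poly p q M k) [:- of_int lo, 1:]" for k
  have Rint: "R = {lo..<lo + int M + 1}"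
    using j row_M_n(2)[OF j] unfolding R_def row_range_def lo_def M_def row_lo_def row_hi_def by auto
  have bij: "bij_betw (\<lambda>x. lo + int x) {..M} R"
    unfolding Rint by (rule bij_betw_byWitness[where f' = "\<lambda>z. nat (z - lo)"]) auto
  have sumR: "(\<Sum>z\<in>R. g z) = (\<Sum>x\<le>M. g (lo + int x))" for g :: "int \<Rightarrow> real"
    by (rule sum.reindex_bij_betw[OF bij, symmetric])
  have finR: "finite R" by (simp add: R_def finite_row_range)
  have wx: "w (lo + int x) = hahn_weight p q M x" if "x \<le> M" for x
    unfolding w_def lo_def p_def q_def hahn_weight_def
    using that row_M_n(2)[OF j] by (subst row_weight_eq[OF j]) (auto simp: M_def)
  have Px: "poly (P k) (of_int (lo + int x)) = poly (hahn_poly p q M k) (real x)" for k x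
    by (simp add: P_def poly_pcompose)
  have monic: "degree (P k) = k \<and> coeff (P k) k = 1" for k
  proof -
    have "degree (P k) = k" using hahn_monic[of p q M k] by (simp add: P_def degree_pcompose)
    moreover have "lead_coeff (P k) = 1"
      using hahn_monic[of p q M k] unfolding P_def by (subst lead_coeff_comp) auto
    ultimately show ?thesis by simp
  qed
  note hw = hahn_weight_pos[of _ M p q] hahn_weight_pearson[of _ M p q]
  have orth: "(\<Sum>z\<in>R. w z * poly (P i) (of_int z) * poly (P k) (of_int z)) = 0" if "i \<noteq> k" for i k
  proof -
    have "(\<Sum>z\<in>R. w z * poly (P i) (of_int z) * poly (P k) (of_int z))
      = (\<Sum>x\<le>M. hahn_weight p q M x * poly (hahn_poly p q M i) (real x) * poly (hahn_poly p q M k) (real x))"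
      unfolding sumR Px by (intro sum.cong refl) (simp add: wx)
    also have "\<dots> = 0" by (rule hahn_orthogonal[OF hw that])
    finally show ?thesis .
  qed
  have norm: "(\<Sum>z\<in>R. w z * (poly (P k) (of_int z))\<^sup>2) = hahn_norm p q M (hahn_weight p q M) k" for k
    unfolding sumR Px hahn_norm_def by (intro sum.cong refl) (simp add: wx)
  have kM: "k \<le> M" if "k < n" for k
    using row_M_n(1)[OF j] that pos unfolding M_def n_def by simp
  have h0: "(\<Sum>z\<in>R. w z * (poly (P k) (of_int z))\<^sup>2) \<noteq> 0" if "k < n" for k
    unfolding norm using hahn_norm_pos[OF hw kM[OF that]] by simp
  note ens = ensemble_one_point[OF finR monic orth h0, of n]
  define h where "h = (\<Prod>k<n. \<Sum>z\<in>R. w z * (poly (P k) (of_int z))\<^sup>2)"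
  have hpos: "h > 0"
    unfolding h_def norm by (intro prod_pos) (use hahn_norm_pos[OF hw kM] in auto)
  have one: "(\<Sum>S | S \<subseteq> R \<and> card S = n. (vdm_set S)\<^sup>2 * (\<Prod>z\<in>S. w z)) = h"
    unfolding h_def by (rule ens(1)) auto
  have two: "(\<Sum>S | S \<subseteq> R \<and> card S = n. (vdm_set S)\<^sup>2 * (\<Prod>z\<in>S. w z) * (\<Sum>z\<in>S. f z))
    = h * (\<Sum>k<n. \<Sum>x\<le>M. f (lo + int x) * hahn_mass p q M k x)"
  proof -
    have "(\<Sum>S | S \<subseteq> R \<and> card S = n. (vdm_set S)\<^sup>2 * (\<Prod>z\<in>S. w z) * (\<Sum>z\<in>S. f z))
      = h * (\<Sum>k<n. (\<Sum>z\<in>R. f z * w z * (poly (P k) (of_int z))\<^sup>2) / (\<Sum>z\<in>R. w z * (poly (P k) (of_int z))\<^sup>2))"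
      unfolding h_def by (rule ens(2)) auto
    also have "(\<Sum>k<n. (\<Sum>z\<in>R. f z * w z * (poly (P k) (of_int z))\<^sup>2) / (\<Sum>z\<in>R. w z * (poly (P k) (of_int z))\<^sup>2))
      = (\<Sum>k<n. \<Sum>x\<le>M. f (lo + int x) * hahn_mass p q M k x)"
    proof (intro sum.cong refl)
      fix k
      have "(\<Sum>z\<in>R. f z * w z * (poly (P k) (of_int z))\<^sup>2) = (\<Sum>x\<le>M. f (lo + int x) * hahn_weight p q M x * (poly (hahn_poly p q M k) (real x))\<^sup>2)"
        unfolding sumR Px by (intro sum.cong refl) (simp add: wx)
      then show "(\<Sum>z\<in>R. f z * w z * (poly (P k) (of_int z))\<^sup>2) / (\<Sum>z\<in>R. w z * (poly (P k) (of_int z))\<^sup>2)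
        = (\<Sum>x\<le>M. f (lo + int x) * hahn_mass p q M k x)"
        unfolding norm hahn_mass_def by (simp add: sum_divide_distrib mult.assoc)
    qed
    finally show ?thesis .
  qed
  have jle: "- int c \<le> j" "j \<le> int a" using j by auto
  obtain K where K: "K > 0" "\<And>S. \<lbrakk>S \<subseteq> R; int (card S) = row_size a c j\<rbrakk> \<Longrightarrow>
    real (card {x \<in> ?C. x j = S}) = K * ((vdm_set S)\<^sup>2 * (\<Prod>s\<in>S. w s))"
    using row_count[OF jle] unfolding R_def w_def by blast
  let ?T = "{S. S \<subseteq> R \<and> card S = n}"
  have finC: "finite ?C"
    by (rule finite_chains) (auto simp: finite_row_step)
  have finT: "finite ?T" using finR by (auto intro: finite_subset[of _ "Pow R"])
  have nint: "int n = row_size a c j" using row_size_pos[OF j] by (simp add: n_def)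
  have maps: "(\<lambda>x. x j) ` ?C \<subseteq> ?T"
  proof
    fix S assume "S \<in> (\<lambda>x. x j) ` ?C"
    then obtain x where "x \<in> ?C" "S = x j" by blast
    then show "S \<in> ?T" using chains_row[OF _ jle, of x b] nint unfolding R_def by simp
  qed
  have sumC: "(\<Sum>x\<in>?C. g (x j)) = K * (\<Sum>S\<in>?T. (vdm_set S)\<^sup>2 * (\<Prod>z\<in>S. w z) * g S)" for g :: "int set \<Rightarrow> real"
  proof -
    have "(\<Sum>x\<in>?C. g (x j)) = (\<Sum>S\<in>?T. \<Sum>x\<in>{x \<in> ?C. x j = S}. g (x j))"
      by (rule sum.group[OF finC finT maps, symmetric])
    also have "\<dots> = (\<Sum>S\<in>?T. real (card {x \<in> ?C. x j = S}) * g S)"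
      by (intro sum.cong refl) simp
    also have "\<dots> = (\<Sum>S\<in>?T. K * ((vdm_set S)\<^sup>2 * (\<Prod>z\<in>S. w z)) * g S)"
      by (intro sum.cong refl) (use K(2) nint in auto)
    finally show ?thesis by (simp add: sum_distrib_left mult.assoc)
  qed
  have bijC: "bij_betw (\<lambda>M. restrict (row M) {- int c..int a}) {M. perfect_matching a b c M} ?C"
    by (rule bij_betw_matchings_chains[OF pos])
  have cardC: "real (card {M. perfect_matching a b c M}) = K * h"
    using sumC[of "\<lambda>_. 1"] one bij_betw_same_card[OF bijC] by simp
  then show "card {M. perfect_matching a b c M} > 0"
    using K(1) hpos by (metis card_gt_0_iff mult_pos_pos of_nat_0_less_iff)
  have "(\<Sum>M | perfect_matching a b c M. \<Sum>i\<in>row M j. f i) = (\<Sum>M | perfect_matching a b c M. \<Sum>i\<in>(restrict (row M) {- int c..int a}) j. f i)"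
    using jle by simp
  also have "\<dots> = (\<Sum>x\<in>?C. \<Sum>i\<in>x j. f i)"
    by (rule sum.reindex_bij_betw[OF bijC])
  also have "\<dots> = K * (h * (\<Sum>k<n. \<Sum>x\<le>M. f (lo + int x) * hahn_mass p q M k x))"
    using sumC[of "\<lambda>S. \<Sum>i\<in>S. f i"] two by simp
  finally show "(\<Sum>M | perfect_matching a b c M. \<Sum>i\<in>row M j. f i)
    = real (card {M. perfect_matching a b c M})
      * (\<Sum>k<row_n j. \<Sum>x\<le>row_M j. f (row_lo j + int x) * hahn_mass (row_p j) (row_q j) (row_M j) k x)"
    unfolding cardC n_def M_def lo_def p_def q_def by simp
qed

lemma expected_vertical_exact:
  "expected_vertical a b c \<sigma> U
    = (\<Sum>j\<in>{- int c<..<int a}. \<Sum>k<row_n j. \<Sum>x\<le>row_M j.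
        indicator U ((1 / \<sigma>) *\<^sub>R at_pos a b c (of_int (row_lo j) + real x + 1 / 2) (of_int j))
          * hahn_mass (row_p j) (row_q j) (row_M j) k x)"
proof -
  let ?z = "\<lambda>i j. (1 / \<sigma>) *\<^sub>R at_pos a b c (of_int i + 1 / 2) (of_int j)"
  let ?J = "{- int c<..<int a}"
  have card: "real (card {(i, j). TileV i j \<in> M \<and> ?z i j \<in> U}) = (\<Sum>j\<in>?J. \<Sum>i\<in>row M j. indicator U (?z i j))"
    if M: "perfect_matching a b c M" for M
  proof -
    have fin: "finite (row M j)" for j using row_subset[OF M] finite_row_range finite_subset by blast
    have "{(i, j). TileV i j \<in> M \<and> ?z i j \<in> U} = (\<lambda>(j, i). (i, j)) ` (SIGMA j : ?J. {i \<in> row M j. ?z i j \<in> U})"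
    proof (rule equalityI; rule subsetI)
      fix s assume "s \<in> {(i, j). TileV i j \<in> M \<and> ?z i j \<in> U}"
      then obtain i j where s: "s = (i, j)" "TileV i j \<in> M" "?z i j \<in> U" by blast
      then have "i \<in> row M j" by (simp add: row_def)
      then have "j \<in> ?J" using row_subset[OF M, of j] by (auto simp: row_range_def split: if_splits)
      then show "s \<in> (\<lambda>(j, i). (i, j)) ` (SIGMA j : ?J. {i \<in> row M j. ?z i j \<in> U})"
        using s \<open>i \<in> row M j\<close> by (intro image_eqI[of _ _ "(j, i)"]) auto
    qed (auto simp: row_def)
    then have "card {(i, j). TileV i j \<in> M \<and> ?z i j \<in> U} = card (SIGMA j : ?J. {i \<in> row M j. ?z i j \<in> U})"
      by (simp only:) (rule card_image, auto simp: inj_on_def)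
    also have "\<dots> = (\<Sum>j\<in>?J. card {i \<in> row M j. ?z i j \<in> U})"
      using fin by (subst card_SigmaI) auto
    also have "real \<dots> = (\<Sum>j\<in>?J. \<Sum>i\<in>row M j. indicator U (?z i j))"
      unfolding of_nat_sum
    proof (intro sum.cong refl)
      fix j
      have "{i \<in> row M j. ?z i j \<in> U} = row M j \<inter> {i. ?z i j \<in> U}" by auto
      then show "real (card {i \<in> row M j. ?z i j \<in> U}) = (\<Sum>i\<in>row M j. indicator U (?z i j))"
        using fin[of j] by (simp add: indicator_def sum.If_cases)
    qed
    finally show ?thesis .
  qed
  have "- int c < 0" "0 < int a" using pos by auto
  from row_one_point(2)[OF this] have ne: "card {M. perfect_matching a b c M} > 0" .
  have "expected_vertical a b c \<sigma> U = (\<Sum>M | perfect_matching a b c M. \<Sum>j\<in>?J. \<Sum>i\<in>row M j. indicator U (?z i j)) / real (card {M. perfect_matching a b c M})"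
  proof (subst expected_vertical_matchings[OF pos])
    show "{M. perfect_matching a b c M} \<noteq> {}" using ne by (metis card.empty less_irrefl)
  qed (use card in \<open>auto intro!: sum.cong arg_cong2[where f = "(/)"]\<close>)
  also have "(\<Sum>M | perfect_matching a b c M. \<Sum>j\<in>?J. \<Sum>i\<in>row M j. indicator U (?z i j))
     = (\<Sum>j\<in>?J. \<Sum>M | perfect_matching a b c M. \<Sum>i\<in>row M j. indicator U (?z i j) :: real)"
    by (rule sum.swap)
  also have "\<dots> = (\<Sum>j\<in>?J. real (card {M. perfect_matching a b c M}) * (\<Sum>k<row_n j. \<Sum>x\<le>row_M j.
        indicator U (?z (row_lo j + int x) j) * hahn_mass (row_p j) (row_q j) (row_M j) k x))"
    by (intro sum.cong refl row_one_point(1)) auto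
  finally show ?thesis
    using ne by (simp add: sum_distrib_left[symmetric])
qed

end

section \<open>The arcsine limit of the Hahn weights\<close>

text \<open>The expectation of \<open>g\<close> under the arcsine law on
  \<open>[\<mu> - r, \<mu> + r]\<close>. The form with an angle avoids the unbounded
  density.\<close>

definition arcsine_mean :: "real \<Rightarrow> real \<Rightarrow> (real \<Rightarrow> real) \<Rightarrow> real" where
  "arcsine_mean \<mu> r g = (1 / pi) * integral {0..pi} (\<lambda>\<theta>. g (\<mu> + r * cos \<theta>))"

lemma arcsine_mean_diff:
  assumes g: "continuous_on UNIV g" and h: "continuous_on UNIV h" and r: "r \<ge> 0"
    and e: "\<And>x. \<bar>x - \<mu>\<bar> \<le> r \<Longrightarrow> \<bar>g x - h x\<bar> \<le> e"
  shows "\<bar>arcsine_mean \<mu> r g - arcsine_mean \<mu> r h\<bar> \<le> e"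
proof -
  have int: "(\<lambda>\<theta>. f (\<mu> + r * cos \<theta>)) integrable_on {0..pi}" if "continuous_on UNIV f" for f :: "real \<Rightarrow> real"
    by (intro integrable_continuous_interval continuous_on_compose2[OF that] continuous_intros) auto
  have "norm (integral {0..pi} (\<lambda>\<theta>. g (\<mu> + r * cos \<theta>) - h (\<mu> + r * cos \<theta>))) \<le> integral {0..pi} (\<lambda>\<theta>::real. e)"
  proof (rule integral_norm_bound_integral)
    show "(\<lambda>\<theta>. g (\<mu> + r * cos \<theta>) - h (\<mu> + r * cos \<theta>)) integrable_on {0..pi}"
      by (intro integrable_diff int g h)
    fix \<theta> :: real
    have "\<bar>r * cos \<theta>\<bar> \<le> r * 1" unfolding abs_mult using r by (intro mult_mono) auto
    then show "norm (g (\<mu> + r * cos \<theta>) - h (\<mu> + r * cos \<theta>)) \<le> e"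
      using e[of "\<mu> + r * cos \<theta>"] by simp
  qed (auto intro!: integrable_continuous_interval)
  then have "\<bar>integral {0..pi} (\<lambda>\<theta>. g (\<mu> + r * cos \<theta>)) - integral {0..pi} (\<lambda>\<theta>. h (\<mu> + r * cos \<theta>))\<bar> \<le> pi * e"
    by (simp add: integral_diff int g h)
  then show ?thesis
    unfolding arcsine_mean_def right_diff_distrib[symmetric] by (simp add: abs_mult field_simps)
qed

lemma arcsine_mean_poly:
  "arcsine_mean \<mu> r (\<lambda>x. \<Sum>i\<le>N. c i * x ^ i) = (\<Sum>i\<le>N. c i * arcsine_mean \<mu> r (\<lambda>x. x ^ i))"
proof -
  have "integral {0..pi} (\<lambda>\<theta>. \<Sum>i\<le>N. c i * (\<mu> + r * cos \<theta>) ^ i) = (\<Sum>i\<le>N. integral {0..pi} (\<lambda>\<theta>. c i * (\<mu> + r * cos \<theta>) ^ i))"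
    by (rule integral_sum) (auto intro!: integrable_continuous_interval continuous_intros)
  then show ?thesis unfolding arcsine_mean_def by (simp add: sum_distrib_left mult_ac)
qed

lemma integral_cos_int: "integral {0..pi} (\<lambda>\<theta>. cos (of_int d * \<theta>)) = (if d = 0 then pi else 0)"
proof (cases "d = 0")
  case False
  have "((\<lambda>\<theta>. cos (of_int d * \<theta>)) has_integral (sin (of_int d * pi) / of_int d - sin (of_int d * 0) / of_int d)) {0..pi}"
    by (rule fundamental_theorem_of_calculus)
       (use False in \<open>auto intro!: derivative_eq_intros simp: has_real_derivative_iff_has_vector_derivative[symmetric]\<close>)
  then show ?thesis
    using False by (simp add: integral_unique sin_int_times_real mult.commute)
qed simp

text \<open>With \<open>lim_C\<close>, the limits of \<open>hahn_A / s\<close> and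
  \<open>hahn_C / s\<close> when the parameters and the degree grow like \<open>p * s\<close>,
  \<open>q * s\<close>, \<open>m * s\<close> and \<open>t * s\<close>; the additive constants 1 and
  2 disappear.\<close>

definition lim_A :: "real \<Rightarrow> real \<Rightarrow> real \<Rightarrow> real \<Rightarrow> real" where
  "lim_A p q m t = (t + p + q) * (t + p) * (m - t) / (2 * t + p + q)\<^sup>2"

definition lim_C :: "real \<Rightarrow> real \<Rightarrow> real \<Rightarrow> real \<Rightarrow> real" where
  "lim_C p q m t = t * (t + p + q + m) * (t + q) / (2 * t + p + q)\<^sup>2"

context
  fixes s :: "nat \<Rightarrow> real" and p q M k :: "nat \<Rightarrow> nat" and p' q' m t :: real
  assumes s_pos: "\<And>n. s n > 0" and s_lim: "filterlim s at_top sequentially"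
    and p_lim: "(\<lambda>n. real (p n) / s n) \<longlonglongrightarrow> p'" and q_lim: "(\<lambda>n. real (q n) / s n) \<longlonglongrightarrow> q'"
    and M_lim: "(\<lambda>n. real (M n) / s n) \<longlonglongrightarrow> m" and k_lim: "(\<lambda>n. real (k n) / s n) \<longlonglongrightarrow> t"
    and t_pos: "0 < t" and t_less: "t < m"
begin

lemma pq_nonneg: "p' \<ge> 0" "q' \<ge> 0"
  using s_pos by (auto intro!: LIMSEQ_le_const[OF p_lim] LIMSEQ_le_const[OF q_lim] divide_nonneg_pos)

lemma lim_AC_pos: "(lim_A p' q' m t) > 0" "(lim_C p' q' m t) > 0"
  unfolding lim_A_def lim_C_def using pq_nonneg t_pos t_less by (auto intro!: divide_pos_pos mult_pos_pos)

lemma const_over_s: "(\<lambda>n. c / s n) \<longlonglongrightarrow> 0"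
  using s_lim by (rule real_tendsto_divide_at_top[OF tendsto_const])

text \<open>Since \<open>t > 0\<close>, the degree tends to infinity; for a fixed shift
  \<open>d\<close> the truncation in \<open>nat (int (k n) + d)\<close> is therefore eventually
  harmless.\<close>

lemma eventually_k_ge: "eventually (\<lambda>n. int (k n) + d \<ge> 1) sequentially"
proof -
  have "filterlim (\<lambda>n. real (k n) / s n * s n) at_top sequentially"
    by (rule filterlim_tendsto_pos_mult_at_top[OF k_lim t_pos s_lim])
  then have "filterlim (\<lambda>n. real (k n)) at_top sequentially"
    using s_pos by (simp add: less_imp_neq[symmetric])
  then have "eventually (\<lambda>n. real (k n) \<ge> 1 - of_int d) sequentially"
    by (auto simp: filterlim_at_top)
  then show ?thesis by eventually_elim linarith
qed

lemma eventually_k_le: "eventually (\<lambda>n. k n \<le> M n) sequentially"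
proof -
  have "eventually (\<lambda>n. real (k n) / s n < real (M n) / s n) sequentially"
    using order_tendstoD(1)[OF tendsto_diff[OF M_lim k_lim], of 0] t_less by simp
  then show ?thesis using s_pos by (auto elim!: eventually_mono simp: divide_less_cancel)
qed

lemma k_shift_lim: "(\<lambda>n. real (nat (int (k n) + d)) / s n) \<longlonglongrightarrow> t"
proof -
  have "(\<lambda>n. real (k n) / s n + of_int d / s n) \<longlonglongrightarrow> t + 0"
    by (intro tendsto_intros k_lim const_over_s)
  moreover have "eventually (\<lambda>n. real (k n) / s n + of_int d / s n = real (nat (int (k n) + d)) / s n) sequentially"
    using eventually_k_ge[of d] by eventually_elim (simp add: add_divide_distrib)
  ultimately show ?thesis by (simp add: tendsto_cong)
qed

lemma hahn_A_lim: "(\<lambda>n. hahn_A (p n) (q n) (M n) (nat (int (k n) + d)) / s n) \<longlonglongrightarrow> (lim_A p' q' m t)"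
proof -
  let ?k = "\<lambda>n. real (nat (int (k n) + d)) / s n" and ?p = "\<lambda>n. real (p n) / s n" and ?q = "\<lambda>n. real (q n) / s n" and ?M = "\<lambda>n. real (M n) / s n"
  have "(\<lambda>n. (?k n + ?p n + ?q n + 1 / s n) * (?k n + ?p n + 1 / s n) * (?M n - ?k n)
      / ((2 * ?k n + ?p n + ?q n + 1 / s n) * (2 * ?k n + ?p n + ?q n + 2 / s n)))
    \<longlonglongrightarrow> (t + p' + q' + 0) * (t + p' + 0) * (m - t) / ((2 * t + p' + q' + 0) * (2 * t + p' + q' + 0))"
    by (intro tendsto_intros k_shift_lim p_lim q_lim M_lim const_over_s) (use pq_nonneg t_pos in auto)
  moreover have "(?k n + ?p n + ?q n + 1 / s n) * (?k n + ?p n + 1 / s n) * (?M n - ?k n)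
      / ((2 * ?k n + ?p n + ?q n + 1 / s n) * (2 * ?k n + ?p n + ?q n + 2 / s n)) = hahn_A (p n) (q n) (M n) (nat (int (k n) + d)) / s n" for n
  proof -
    define K where "K = real (nat (int (k n) + d))"
    have eq: "K / s n + ?p n + ?q n + 1 / s n = (K + p n + q n + 1) / s n" "K / s n + ?p n + 1 / s n = (K + p n + 1) / s n"
      "?M n - K / s n = (M n - K) / s n" "2 * (K / s n) + ?p n + ?q n + 1 / s n = (2 * K + p n + q n + 1) / s n"
      "2 * (K / s n) + ?p n + ?q n + 2 / s n = (2 * K + p n + q n + 2) / s n"
      by (simp_all add: add_divide_distrib diff_divide_distrib)
    show ?thesis unfolding K_def[symmetric] eq hahn_A_def using s_pos[of n] by simp
  qed
  ultimately show ?thesis unfolding lim_A_def power2_eq_square by simp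
qed

lemma hahn_C_lim: "(\<lambda>n. hahn_C (p n) (q n) (M n) (nat (int (k n) + d)) / s n) \<longlonglongrightarrow> (lim_C p' q' m t)"
proof -
  let ?k = "\<lambda>n. real (nat (int (k n) + d)) / s n" and ?p = "\<lambda>n. real (p n) / s n" and ?q = "\<lambda>n. real (q n) / s n" and ?M = "\<lambda>n. real (M n) / s n"
  have "(\<lambda>n. ?k n * (?k n + ?p n + ?q n + ?M n + 1 / s n) * (?k n + ?q n)
      / ((2 * ?k n + ?p n + ?q n) * (2 * ?k n + ?p n + ?q n + 1 / s n)))
    \<longlonglongrightarrow> t * (t + p' + q' + m + 0) * (t + q') / ((2 * t + p' + q') * (2 * t + p' + q' + 0))"
    by (intro tendsto_intros k_shift_lim p_lim q_lim M_lim const_over_s) (use pq_nonneg t_pos in auto)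
  moreover have "?k n * (?k n + ?p n + ?q n + ?M n + 1 / s n) * (?k n + ?q n)
      / ((2 * ?k n + ?p n + ?q n) * (2 * ?k n + ?p n + ?q n + 1 / s n)) = hahn_C (p n) (q n) (M n) (nat (int (k n) + d)) / s n" for n
  proof -
    define K where "K = real (nat (int (k n) + d))"
    have eq: "K / s n + ?p n + ?q n + ?M n + 1 / s n = (K + p n + q n + M n + 1) / s n" "K / s n + ?q n = (K + q n) / s n"
      "2 * (K / s n) + ?p n + ?q n + 1 / s n = (2 * K + p n + q n + 1) / s n"
      by (simp_all add: add_divide_distrib diff_divide_distrib)
    have eq': "2 * (K / s n) + ?p n + ?q n = (2 * K + p n + q n) / s n"
      by (simp add: add_divide_distrib)
    show ?thesis unfolding hahn_C_def K_def[symmetric] eq unfolding eq' using s_pos[of n] by (simp add: mult_ac)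
  qed
  ultimately show ?thesis unfolding lim_C_def power2_eq_square by simp
qed

lemma hahn_b_lim: "(\<lambda>n. hahn_b (p n) (q n) (M n) (nat (int (k n) + d)) / (s n)\<^sup>2) \<longlonglongrightarrow> (lim_A p' q' m t) * (lim_C p' q' m t)"
proof -
  have "(\<lambda>n. (hahn_A (p n) (q n) (M n) (nat (int (k n) + (d - 1))) / s n) * (hahn_C (p n) (q n) (M n) (nat (int (k n) + d)) / s n)) \<longlonglongrightarrow> (lim_A p' q' m t) * (lim_C p' q' m t)"
    by (intro tendsto_mult hahn_A_lim hahn_C_lim)
  moreover have "nat (int (k n) + (d - 1)) = nat (int (k n) + d) - 1" for n by simp
  ultimately show ?thesis by (simp add: hahn_b_def power2_eq_square)
qed

text \<open>Normalised by powers of \<open>s n\<close>, these quantities converge to the coefficients of powers of a Laurent polynomial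
  in \<open>exp (i \<theta>)\<close>: multiplication by \<open>x\<close> acts through the three-term recurrence, whose coefficients become constant.\<close>

definition shifted_moment :: "nat \<Rightarrow> nat \<Rightarrow> int \<Rightarrow> real" where
  "shifted_moment n r d = (\<Sum>x\<le>M n. hahn_weight (p n) (q n) (M n) x * real x ^ r
     * poly (hahn_poly (p n) (q n) (M n) (k n)) (real x) * poly (hahn_poly (p n) (q n) (M n) (nat (int (k n) + d))) (real x))
     / hahn_norm (p n) (q n) (M n) (hahn_weight (p n) (q n) (M n)) (k n)"

lemma shifted_moment_Suc:
  assumes "int (k n) + d \<ge> 1"
  shows "shifted_moment n (Suc r) d = shifted_moment n r (d + 1)
    + (hahn_A (p n) (q n) (M n) (nat (int (k n) + d)) + hahn_C (p n) (q n) (M n) (nat (int (k n) + d))) * shifted_moment n r d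
    + hahn_b (p n) (q n) (M n) (nat (int (k n) + d)) * shifted_moment n r (d - 1)"
proof -
  define K where "K = nat (int (k n) + d)"
  have K: "nat (int (k n) + (d + 1)) = Suc K" "nat (int (k n) + (d - 1)) = K - 1" "K \<noteq> 0"
    using assms unfolding K_def by auto
  let ?P = "\<lambda>i x. poly (hahn_poly (p n) (q n) (M n) i) (real x)"
  let ?w = "hahn_weight (p n) (q n) (M n)"
  have "(\<Sum>x\<le>M n. ?w x * real x ^ Suc r * ?P (k n) x * ?P K x)
    = (\<Sum>x\<le>M n. ?w x * real x ^ r * ?P (k n) x * (real x * ?P K x))"
    by (intro sum.cong refl) (simp add: mult_ac)
  also have "\<dots> = (\<Sum>x\<le>M n. ?w x * real x ^ r * ?P (k n) x * ?P (Suc K) x)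
     + (hahn_A (p n) (q n) (M n) K + hahn_C (p n) (q n) (M n) K) * (\<Sum>x\<le>M n. ?w x * real x ^ r * ?P (k n) x * ?P K x)
     + hahn_b (p n) (q n) (M n) K * (\<Sum>x\<le>M n. ?w x * real x ^ r * ?P (k n) x * ?P (K - 1) x)"
    unfolding hahn_three_term sum_distrib_left sum.distrib[symmetric] using K(3)
    by (intro sum.cong refl) (simp add: algebra_simps)
  finally show ?thesis
    unfolding shifted_moment_def K K_def[symmetric] by (simp add: add_divide_distrib)
qed

lemma shifted_moment_0:
  assumes "k n \<le> M n" "int (k n) + d \<ge> 0"
  shows "shifted_moment n 0 d = (if d = 0 then 1 else 0)"
proof -
  note hw = hahn_weight_pos[of _ "M n" "p n" "q n"] hahn_weight_pearson[of _ "M n" "p n" "q n"]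
  show ?thesis
  proof (cases "d = 0")
    case True
    then show ?thesis
      using hahn_norm_pos[OF hw assms(1)] unfolding shifted_moment_def
      by (simp add: hahn_norm_def power2_eq_square mult.assoc)
  next
    case False
    then have "k n \<noteq> nat (int (k n) + d)" using assms(2) by auto
    from hahn_orthogonal[OF hw this] show ?thesis
      using False unfolding shifted_moment_def by simp
  qed
qed

text \<open>Induction on \<open>r\<close> for all shifts \<open>d\<close> at once. The integrals
  obey the limiting recurrence because \<open>2 * cos \<theta> * cos (d * \<theta>)\<close> is the
  sum of the cosines at \<open>d + 1\<close> and \<open>d - 1\<close>. The powers of the square root
  reflect that the polynomials are monic rather than normalised, and \<open>r + d\<close> is the
  degree of homogeneity in \<open>s\<close>.\<close>

lemma shifted_moment_lim:
  "(\<lambda>n. shifted_moment n r d / s n powi (int r + d)) \<longlonglongrightarrow>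
    (1 / pi) * integral {0..pi} (\<lambda>\<theta>. ((lim_A p' q' m t) + (lim_C p' q' m t) + 2 * sqrt ((lim_A p' q' m t) * (lim_C p' q' m t)) * cos \<theta>) ^ r
      * (sqrt ((lim_A p' q' m t) * (lim_C p' q' m t)) powi d * cos (of_int d * \<theta>)))"
proof (induction r arbitrary: d)
  case 0
  have "eventually (\<lambda>n. shifted_moment n 0 d / s n powi (int 0 + d) = (if d = 0 then 1 else 0)) sequentially"
    using eventually_k_ge[of d] eventually_k_le by eventually_elim (auto simp: shifted_moment_0)
  then have "(\<lambda>n. shifted_moment n 0 d / s n powi (int 0 + d)) \<longlonglongrightarrow> (if d = 0 then 1 else 0)"
    by (rule tendsto_eventually)
  moreover have "(1 / pi) * integral {0..pi} (\<lambda>\<theta>. sqrt ((lim_A p' q' m t) * (lim_C p' q' m t)) powi d * cos (of_int d * \<theta>)) = (if d = 0 then 1 else 0)"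
    by (simp add: integral_cos_int)
  ultimately show ?case by simp
next
  case (Suc r)
  define A where "A = sqrt ((lim_A p' q' m t) * (lim_C p' q' m t))"
  define B where "B = (lim_A p' q' m t) + (lim_C p' q' m t)"
  have A: "A > 0" "A\<^sup>2 = (lim_A p' q' m t) * (lim_C p' q' m t)" using lim_AC_pos by (auto simp: A_def)
  let ?I = "\<lambda>r d. integral {0..pi} (\<lambda>\<theta>. (B + 2 * A * cos \<theta>) ^ r * (A powi d * cos (of_int d * \<theta>)))"
  have int: "(\<lambda>\<theta>. (B + 2 * A * cos \<theta>) ^ r * (A powi d * cos (of_int d * \<theta>))) integrable_on {0..pi}" for r d
    by (intro integrable_continuous_interval continuous_intros)
  have "(\<lambda>n. shifted_moment n r (d + 1) / s n powi (int r + (d + 1))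
      + (hahn_A (p n) (q n) (M n) (nat (int (k n) + d)) / s n + hahn_C (p n) (q n) (M n) (nat (int (k n) + d)) / s n) * (shifted_moment n r d / s n powi (int r + d))
      + (hahn_b (p n) (q n) (M n) (nat (int (k n) + d)) / (s n)\<^sup>2) * (shifted_moment n r (d - 1) / s n powi (int r + (d - 1))))
    \<longlonglongrightarrow> (1 / pi) * ?I r (d + 1) + ((lim_A p' q' m t) + (lim_C p' q' m t)) * ((1 / pi) * ?I r d) + ((lim_A p' q' m t) * (lim_C p' q' m t)) * ((1 / pi) * ?I r (d - 1))"
    unfolding A_def B_def by (intro tendsto_intros Suc.IH hahn_A_lim hahn_C_lim hahn_b_lim)
  moreover have "eventually (\<lambda>n. shifted_moment n r (d + 1) / s n powi (int r + (d + 1))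
      + (hahn_A (p n) (q n) (M n) (nat (int (k n) + d)) / s n + hahn_C (p n) (q n) (M n) (nat (int (k n) + d)) / s n) * (shifted_moment n r d / s n powi (int r + d))
      + (hahn_b (p n) (q n) (M n) (nat (int (k n) + d)) / (s n)\<^sup>2) * (shifted_moment n r (d - 1) / s n powi (int r + (d - 1)))
      = shifted_moment n (Suc r) d / s n powi (int (Suc r) + d)) sequentially"
    using eventually_k_ge[of d]
  proof eventually_elim
    case (elim n)
    define z where "z = s n powi (int r + d)"
    have sz: "s n \<noteq> 0" "z \<noteq> 0" using s_pos[of n] by (auto simp: z_def)
    have e: "s n powi (int r + (d + 1)) = z * s n" "s n powi (int r + (d - 1)) = z / s n" "s n powi (int (Suc r) + d) = z * s n"
      using sz unfolding z_def by (simp_all add: power_int_add power_int_diff algebra_simps)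
    show ?case
      unfolding shifted_moment_Suc[OF elim] e z_def[symmetric] using sz
      by (simp add: field_simps power2_eq_square)
  qed
  ultimately have "(\<lambda>n. shifted_moment n (Suc r) d / s n powi (int (Suc r) + d)) \<longlonglongrightarrow>
     (1 / pi) * ?I r (d + 1) + ((lim_A p' q' m t) + (lim_C p' q' m t)) * ((1 / pi) * ?I r d) + ((lim_A p' q' m t) * (lim_C p' q' m t)) * ((1 / pi) * ?I r (d - 1))"
    by (rule Lim_transform_eventually)
  also have "(1 / pi) * ?I r (d + 1) + ((lim_A p' q' m t) + (lim_C p' q' m t)) * ((1 / pi) * ?I r d) + ((lim_A p' q' m t) * (lim_C p' q' m t)) * ((1 / pi) * ?I r (d - 1))
     = (1 / pi) * (?I r (d + 1) + B * ?I r d + A\<^sup>2 * ?I r (d - 1))"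
    unfolding A(2) B_def[symmetric] by (simp only: distrib_left mult_ac)
  also have "?I r (d + 1) + B * ?I r d + A\<^sup>2 * ?I r (d - 1) = ?I (Suc r) d"
  proof -
    have "?I r (d + 1) + B * ?I r d + A\<^sup>2 * ?I r (d - 1)
      = integral {0..pi} (\<lambda>\<theta>. ((B + 2 * A * cos \<theta>) ^ r * (A powi (d + 1) * cos (of_int (d + 1) * \<theta>))
        + B * ((B + 2 * A * cos \<theta>) ^ r * (A powi d * cos (of_int d * \<theta>))))
        + A\<^sup>2 * ((B + 2 * A * cos \<theta>) ^ r * (A powi (d - 1) * cos (of_int (d - 1) * \<theta>))))"
      by (simp only: integral_add integral_mult_right[symmetric] int integrable_add integrable_on_mult_right)
    also have "\<dots> = ?I (Suc r) d"
    proof (rule integral_cong)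
      fix \<theta> :: real
      have c: "cos (of_int (d + 1) * \<theta>) + cos (of_int (d - 1) * \<theta>) = 2 * cos \<theta> * cos (of_int d * \<theta>)"
        by (simp add: distrib_right left_diff_distrib cos_add cos_diff)
      have pw: "A powi (d + 1) = A powi d * A" "A\<^sup>2 * A powi (d - 1) = A powi d * A"
        using A(1) by (simp_all add: power_int_add power_int_diff power2_eq_square)
      have "(B + 2 * A * cos \<theta>) ^ r * (A powi (d + 1) * cos (of_int (d + 1) * \<theta>))
        + B * ((B + 2 * A * cos \<theta>) ^ r * (A powi d * cos (of_int d * \<theta>)))
        + A\<^sup>2 * ((B + 2 * A * cos \<theta>) ^ r * (A powi (d - 1) * cos (of_int (d - 1) * \<theta>)))
        = (B + 2 * A * cos \<theta>) ^ r * (A powi d * (B * cos (of_int d * \<theta>) + A * (cos (of_int (d + 1) * \<theta>) + cos (of_int (d - 1) * \<theta>))))"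
        using pw(2) unfolding pw(1) by (simp add: algebra_simps)
      also have "\<dots> = (B + 2 * A * cos \<theta>) ^ Suc r * (A powi d * cos (of_int d * \<theta>))"
        unfolding c by (simp add: algebra_simps)
      finally show "(B + 2 * A * cos \<theta>) ^ r * (A powi (d + 1) * cos (of_int (d + 1) * \<theta>))
        + B * ((B + 2 * A * cos \<theta>) ^ r * (A powi d * cos (of_int d * \<theta>)))
        + A\<^sup>2 * ((B + 2 * A * cos \<theta>) ^ r * (A powi (d - 1) * cos (of_int (d - 1) * \<theta>)))
        = (B + 2 * A * cos \<theta>) ^ Suc r * (A powi d * cos (of_int d * \<theta>))" .
    qed
    finally show ?thesis .
  qed
  finally show ?case unfolding A_def B_def .
qed

lemma hahn_moment_lim:
  "(\<lambda>n. \<Sum>x\<le>M n. (real x / s n) ^ r * hahn_mass (p n) (q n) (M n) (k n) x)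
    \<longlonglongrightarrow> arcsine_mean ((lim_A p' q' m t) + (lim_C p' q' m t)) (2 * sqrt ((lim_A p' q' m t) * (lim_C p' q' m t))) (\<lambda>x. x ^ r)"
proof -
  have "(\<Sum>x\<le>M n. (real x / s n) ^ r * hahn_mass (p n) (q n) (M n) (k n) x) = shifted_moment n r 0 / s n powi (int r + 0)" for n
    unfolding shifted_moment_def hahn_mass_def sum_divide_distrib
    by (intro sum.cong refl) (simp add: power_divide power2_eq_square mult_ac)
  then show ?thesis
    using shifted_moment_lim[of r 0] unfolding arcsine_mean_def by simp
qed

text \<open>The scaled positions stay in a fixed compact interval, so by Weierstrass approximation
  the moments suffice. The test function varies with \<open>n\<close>, as does the place of a row in
  the hexagon. Four errors of size \<open>e / 5\<close> stay below \<open>e\<close>.\<close>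

lemma hahn_weak_limit:
  assumes g: "continuous_on UNIV g"
    and unif: "\<And>e. e > 0 \<Longrightarrow> eventually (\<lambda>n. \<forall>x\<in>{0..B}. \<bar>gs n x - g x\<bar> \<le> e) sequentially"
    and B: "m < B"
  shows "(\<lambda>n. \<Sum>x\<le>M n. gs n (real x / s n) * hahn_mass (p n) (q n) (M n) (k n) x)
    \<longlonglongrightarrow> arcsine_mean ((lim_A p' q' m t) + (lim_C p' q' m t)) (2 * sqrt ((lim_A p' q' m t) * (lim_C p' q' m t))) g"
proof (rule tendstoI)
  fix e :: real assume e: "e > 0"
  define \<mu> r where "\<mu> = (lim_A p' q' m t) + (lim_C p' q' m t)" and "r = 2 * sqrt ((lim_A p' q' m t) * (lim_C p' q' m t))"
  have r: "r \<ge> 0" using lim_AC_pos by (simp add: r_def)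
  define L where "L = \<bar>B\<bar> + \<bar>\<mu>\<bar> + r"
  have "continuous_on {-L..L} g" by (rule continuous_on_subset[OF g]) auto
  then obtain h where h: "real_polynomial_function h" "\<And>x. x \<in> {-L..L} \<Longrightarrow> \<bar>g x - h x\<bar> < e / 5"
    using Stone_Weierstrass_real_polynomial_function[of "{-L..L}" g "e / 5"] e by auto
  then obtain c N where hc: "h = (\<lambda>x. \<Sum>i\<le>N. c i * x ^ i)"
    unfolding real_polynomial_function_iff_sum by blast
  have conth: "continuous_on UNIV h" unfolding hc by (intro continuous_intros)
  have "(\<lambda>n. \<Sum>i\<le>N. c i * (\<Sum>x\<le>M n. (real x / s n) ^ i * hahn_mass (p n) (q n) (M n) (k n) x))
    \<longlonglongrightarrow> (\<Sum>i\<le>N. c i * arcsine_mean \<mu> r (\<lambda>x. x ^ i))"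
    unfolding \<mu>_def r_def by (intro tendsto_intros hahn_moment_lim)
  also have "(\<lambda>n. \<Sum>i\<le>N. c i * (\<Sum>x\<le>M n. (real x / s n) ^ i * hahn_mass (p n) (q n) (M n) (k n) x))
    = (\<lambda>n. \<Sum>x\<le>M n. h (real x / s n) * hahn_mass (p n) (q n) (M n) (k n) x)"
    unfolding hc sum_distrib_left sum_distrib_right by (subst sum.swap) (simp add: mult_ac)
  also have "(\<Sum>i\<le>N. c i * arcsine_mean \<mu> r (\<lambda>x. x ^ i)) = arcsine_mean \<mu> r h"
    unfolding hc by (rule arcsine_mean_poly[symmetric])
  finally have lim: "(\<lambda>n. \<Sum>x\<le>M n. h (real x / s n) * hahn_mass (p n) (q n) (M n) (k n) x) \<longlonglongrightarrow> arcsine_mean \<mu> r h" .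
  have "eventually (\<lambda>n. \<bar>(\<Sum>x\<le>M n. h (real x / s n) * hahn_mass (p n) (q n) (M n) (k n) x) - arcsine_mean \<mu> r h\<bar> < e / 5) sequentially"
    using tendstoD[OF lim, of "e / 5"] e by (simp add: dist_real_def)
  moreover have "eventually (\<lambda>n. \<forall>x\<in>{0..B}. \<bar>gs n x - g x\<bar> \<le> e / 5) sequentially"
    using unif[of "e / 5"] e by simp
  moreover have "eventually (\<lambda>n. real (M n) / s n < B) sequentially"
    using order_tendstoD(2)[OF M_lim B] .
  ultimately show "eventually (\<lambda>n. dist (\<Sum>x\<le>M n. gs n (real x / s n) * hahn_mass (p n) (q n) (M n) (k n) x)
    (arcsine_mean ((lim_A p' q' m t) + (lim_C p' q' m t)) (2 * sqrt ((lim_A p' q' m t) * (lim_C p' q' m t))) g) < e) sequentially"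
    using eventually_k_le
  proof eventually_elim
    case (elim n)
    have xB: "real x / s n \<in> {0..B}" if "x \<le> M n" for x
    proof -
      have "real x / s n \<le> real (M n) / s n" using that s_pos[of n] by (simp add: divide_right_mono)
      then show ?thesis using elim(3) s_pos[of n] by simp
    qed
    have xL: "real x / s n \<in> {-L..L}" if "x \<le> M n" for x
      using xB[OF that] r unfolding L_def by auto
    let ?S = "\<lambda>f. \<Sum>x\<le>M n. f (real x / s n) * hahn_mass (p n) (q n) (M n) (k n) x"
    have "\<bar>?S (\<lambda>x. gs n x - g x)\<bar> \<le> e / 5"
      by (rule hahn_mass_sum_bound[OF elim(4)]) (use elim(2) xB in auto)
    then have 1: "\<bar>?S (gs n) - ?S g\<bar> \<le> e / 5" by (simp add: left_diff_distrib sum_subtractf)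
    have "\<bar>?S (\<lambda>x. g x - h x)\<bar> \<le> e / 5"
      by (rule hahn_mass_sum_bound[OF elim(4)]) (use h(2) xL less_imp_le in blast)
    then have 2: "\<bar>?S g - ?S h\<bar> \<le> e / 5" by (simp add: left_diff_distrib sum_subtractf)
    have 3: "\<bar>arcsine_mean \<mu> r g - arcsine_mean \<mu> r h\<bar> \<le> e / 5"
    proof (rule arcsine_mean_diff[OF g conth r])
      fix x assume "\<bar>x - \<mu>\<bar> \<le> r"
      then have "x \<in> {-L..L}" unfolding L_def by auto
      then show "\<bar>g x - h x\<bar> \<le> e / 5" using h(2) less_imp_le by blast
    qed
    have "\<bar>?S (gs n) - arcsine_mean \<mu> r g\<bar> < e"
      using 1 2 3 elim(1) e by linarith
    then show ?case unfolding dist_real_def \<mu>_def r_def .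
  qed
qed

end

section \<open>Riemann sums over rows and degrees\<close>

text \<open>Sums over integer indices are written as integrals of step functions of a scaled
  variable, so that dominated convergence replaces estimates of Riemann sums.\<close>

lemma step_function_integral:
  fixes h :: "int \<Rightarrow> real"
  assumes J: "finite J" and s: "s > 0"
  shows "integrable lborel (\<lambda>t. if \<lfloor>s * t\<rfloor> \<in> J then h \<lfloor>s * t\<rfloor> else 0)"
    and "(LINT t|lborel. (if \<lfloor>s * t\<rfloor> \<in> J then h \<lfloor>s * t\<rfloor> else 0)) = (\<Sum>j\<in>J. h j) / s"
proof -
  let ?I = "\<lambda>j::int. {of_int j / s..<(of_int j + 1) / s}"
  have mem: "t \<in> ?I j \<longleftrightarrow> \<lfloor>s * t\<rfloor> = j" for t j
    using s by (simp add: floor_eq_iff divide_le_eq less_divide_eq mult.commute)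
  have eq: "(if \<lfloor>s * t\<rfloor> \<in> J then h \<lfloor>s * t\<rfloor> else 0) = (\<Sum>j\<in>J. h j * indicator (?I j) t)" for t
  proof -
    have "(\<Sum>j\<in>J. h j * indicator (?I j) t) = (\<Sum>j\<in>J. if j = \<lfloor>s * t\<rfloor> then h j else 0)"
      by (intro sum.cong refl) (auto simp: indicator_def mem simp del: atLeastLessThan_iff)
    then show ?thesis using J by simp
  qed
  have "has_bochner_integral lborel (\<lambda>t. h j * indicator (?I j) t) (h j * (1 / s))" for j
  proof (rule has_bochner_integral_mult_right)
    have "measure lborel (?I j) = 1 / s" using s by (simp add: divide_right_mono add_divide_distrib)
    moreover have "emeasure lborel (?I j) < \<infinity>" using s by (simp add: divide_right_mono)
    ultimately show "has_bochner_integral lborel (indicat_real (?I j)) (1 / s)"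
      using has_bochner_integral_real_indicator[of "?I j" lborel] by simp
  qed
  then have "has_bochner_integral lborel (\<lambda>t. \<Sum>j\<in>J. h j * indicator (?I j) t) (\<Sum>j\<in>J. h j * (1 / s))"
    by (intro has_bochner_integral_sum) auto
  then show "integrable lborel (\<lambda>t. if \<lfloor>s * t\<rfloor> \<in> J then h \<lfloor>s * t\<rfloor> else 0)"
    and "(LINT t|lborel. (if \<lfloor>s * t\<rfloor> \<in> J then h \<lfloor>s * t\<rfloor> else 0)) = (\<Sum>j\<in>J. h j) / s"
    unfolding eq by (auto simp: has_bochner_integral_iff sum_divide_distrib)
qed

lemma floor_scaled_lim:
  assumes "filterlim s at_top sequentially" "\<And>n. s n > (0::real)"
  shows "(\<lambda>n. of_int \<lfloor>s n * t\<rfloor> / s n) \<longlonglongrightarrow> t"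
proof (rule tendsto_sandwich)
  show "(\<lambda>n. t - 1 / s n) \<longlonglongrightarrow> t"
    using tendsto_diff[OF tendsto_const[of t] real_tendsto_divide_at_top[OF tendsto_const assms(1)]] by simp
  show "eventually (\<lambda>n. t - 1 / s n \<le> of_int \<lfloor>s n * t\<rfloor> / s n) sequentially"
  proof (intro always_eventually allI)
    fix n
    have "s n * t - 1 \<le> of_int \<lfloor>s n * t\<rfloor>" by linarith
    then have "(s n * t - 1) / s n \<le> of_int \<lfloor>s n * t\<rfloor> / s n"
      by (rule divide_right_mono) (use assms(2)[of n] in simp)
    then show "t - 1 / s n \<le> of_int \<lfloor>s n * t\<rfloor> / s n"
      using assms(2)[of n] by (simp add: diff_divide_distrib)
  qed
  show "eventually (\<lambda>n. of_int \<lfloor>s n * t\<rfloor> / s n \<le> t) sequentially"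
    using assms(2) by (intro always_eventually allI) (simp add: divide_le_eq mult.commute)
qed simp

lemma max_0_divide: "s > 0 \<Longrightarrow> max 0 (z / s) = max 0 z / (s::real)"
  by (simp add: max_def zero_le_divide_iff)

lemma real_of_int_max: "real_of_int (max x y) = max (of_int x) (of_int y)"
  by (simp add: max_def)

text \<open>The points of a row are translated by amounts \<open>u n\<close>, \<open>v n\<close>
  that merely converge; uniform continuity on a compact square supplies the uniformity asked for by
  \<open>hahn_weak_limit\<close>.\<close>

lemma uniform_shift:
  fixes f :: "real \<times> real \<Rightarrow> real"
  assumes f: "continuous_on UNIV f" and u: "u \<longlonglongrightarrow> u'" and v: "v \<longlonglongrightarrow> v'" and e: "e > 0"
  shows "eventually (\<lambda>n. \<forall>X\<in>{0..B}. \<bar>f (X + u n, v n) - f (X + u', v')\<bar> \<le> e) sequentially"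
proof -
  define L where "L = \<bar>B\<bar> + \<bar>u'\<bar> + \<bar>v'\<bar> + 1"
  let ?K = "{-L..L} \<times> {-L..L}"
  have "uniformly_continuous_on ?K f"
    by (intro compact_uniformly_continuous continuous_on_subset[OF f] compact_Times) auto
  then obtain d where d: "d > 0" "\<And>z z'. \<lbrakk>z \<in> ?K; z' \<in> ?K; dist z' z < d\<rbrakk> \<Longrightarrow> dist (f z') (f z) < e"
    using e unfolding uniformly_continuous_on_def by metis
  define d' where "d' = min 1 (d / 2)"
  have d': "d' > 0" using d by (simp add: d'_def)
  show ?thesis
    using tendstoD[OF u d'] tendstoD[OF v d']
  proof eventually_elim
    case (elim n)
    show ?case
    proof
      fix X assume X: "X \<in> {0..B}"
      have "dist (X + u n, v n) (X + u', v') \<le> dist (u n) u' + dist (v n) v'"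
        unfolding dist_prod_def dist_real_def using sqrt_sum_squares_le_sum_abs by force
      also have "\<dots> < d" using elim unfolding d'_def by linarith
      finally have "dist (X + u n, v n) (X + u', v') < d" .
      moreover have "(X + u n, v n) \<in> ?K" "(X + u', v') \<in> ?K"
        using X elim unfolding L_def d'_def dist_real_def by auto
      ultimately show "\<bar>f (X + u n, v n) - f (X + u', v')\<bar> \<le> e"
        using d(2) unfolding dist_real_def by (meson less_imp_le)
    qed
  qed
qed

text \<open>The share of degree \<open>k\<close> in row \<open>j\<close>. The summand
  \<open>1 / 2\<close> is the offset, in the first lattice coordinate, from the index of a vertical
  lozenge to its centre.\<close>

definition inner_sum :: "(point \<Rightarrow> real) \<Rightarrow> nat \<Rightarrow> nat \<Rightarrow> nat \<Rightarrow> real \<Rightarrow> int \<Rightarrow> int \<Rightarrow> real" where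
  "inner_sum f a b c s j k = (\<Sum>x\<le>row_M a b c j.
     f ((1 / s) *\<^sub>R at_pos a b c (of_int (row_lo j) + real x + 1 / 2) (of_int j))
       * hahn_mass (row_p j) (row_q a c j) (row_M a b c j) (nat k) x)"

definition size_lim :: "real \<Rightarrow> real \<Rightarrow> real \<Rightarrow> real" where
  "size_lim \<alpha> \<gamma> Y = Y + \<gamma> - max 0 Y - max 0 (Y - (\<alpha> - \<gamma>))"

text \<open>The horizontal translation is the limiting left end of the row: its first index
  \<open>max 0 (- Y)\<close> and the contribution \<open>Y / 2\<close> of the slanted lattice axis
  add up to \<open>\<bar>Y\<bar> / 2\<close>, counted from the leftmost vertex.\<close>

definition arc_lim :: "(point \<Rightarrow> real) \<Rightarrow> real \<Rightarrow> real \<Rightarrow> real \<Rightarrow> real \<Rightarrow> real \<Rightarrow> real" where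
  "arc_lim f \<alpha> \<beta> \<gamma> Y t = (let p = \<bar>Y\<bar>; q = \<bar>Y - (\<alpha> - \<gamma>)\<bar>; m = size_lim \<alpha> \<gamma> Y + \<beta> in
     arcsine_mean (lim_A p q m t + lim_C p q m t) (2 * sqrt (lim_A p q m t * lim_C p q m t))
       (\<lambda>X. f (X + (\<bar>Y\<bar> / 2 - (\<alpha> + 2 * \<beta> + \<gamma>) / 4), sqrt 3 / 4 * (\<gamma> - \<alpha>) + sqrt 3 / 2 * Y)))"

lemma inner_sum_bound:
  assumes f: "\<And>z. \<bar>f z\<bar> \<le> Cf" and pos: "a > 0" "b > 0" "c > 0"
    and j: "- int c < j" "j < int a" and k: "k \<in> {0..<row_size a c j}"
  shows "\<bar>inner_sum f a b c s j k\<bar> \<le> Cf"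
  unfolding inner_sum_def
proof (rule hahn_mass_sum_bound[OF _ f])
  have "nat k < row_n a c j" using k by auto
  then show "nat k \<le> row_M a b c j" using row_M_n(1)[OF pos j] pos(2) by linarith
qed

context
  fixes a b c :: "nat \<Rightarrow> nat" and s :: "nat \<Rightarrow> real" and \<alpha> \<beta> \<gamma> :: real and f :: "point \<Rightarrow> real" and Cf :: real
  assumes abc: "\<And>n. a n > 0" "\<And>n. b n > 0" "\<And>n. c n > 0"
    and s_pos: "\<And>n. s n > 0" and s_lim: "filterlim s at_top sequentially"
    and a_lim: "(\<lambda>n. real (a n) / s n) \<longlonglongrightarrow> \<alpha>" and b_lim: "(\<lambda>n. real (b n) / s n) \<longlonglongrightarrow> \<beta>" and c_lim: "(\<lambda>n. real (c n) / s n) \<longlonglongrightarrow> \<gamma>"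
    and greek: "\<alpha> > 0" "\<beta> > 0" "\<gamma> > 0"
    and f_cont: "continuous_on UNIV f" and f_bound: "\<And>z. \<bar>f z\<bar> \<le> Cf"
begin

lemma Cf_nonneg: "Cf \<ge> 0"
  using f_bound[of 0] by linarith

lemma inverse_s_lim: "(\<lambda>n. 1 / s n) \<longlonglongrightarrow> 0"
  by (rule real_tendsto_divide_at_top[OF tendsto_const s_lim])

context
  fixes Y :: real
  assumes Y: "- \<gamma> < Y" "Y < \<alpha>"
begin

lemma j_lim: "(\<lambda>n. of_int \<lfloor>s n * Y\<rfloor> / s n) \<longlonglongrightarrow> Y"
  by (rule floor_scaled_lim[OF s_lim s_pos])

lemma eventually_row: "eventually (\<lambda>n. - int (c n) < \<lfloor>s n * Y\<rfloor> \<and> \<lfloor>s n * Y\<rfloor> < int (a n)) sequentially"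
proof -
  have "eventually (\<lambda>n. 0 < of_int \<lfloor>s n * Y\<rfloor> / s n + real (c n) / s n) sequentially"
    using order_tendstoD(1)[OF tendsto_add[OF j_lim c_lim], of 0] Y by simp
  moreover have "eventually (\<lambda>n. 0 < real (a n) / s n - of_int \<lfloor>s n * Y\<rfloor> / s n) sequentially"
    using order_tendstoD(1)[OF tendsto_diff[OF a_lim j_lim], of 0] Y by simp
  ultimately show ?thesis
  proof eventually_elim
    case (elim n)
    have "0 < (of_int \<lfloor>s n * Y\<rfloor> + real (c n)) / s n" "0 < (real (a n) - of_int \<lfloor>s n * Y\<rfloor>) / s n"
      using elim by (simp_all add: add_divide_distrib diff_divide_distrib)
    then have "0 < of_int \<lfloor>s n * Y\<rfloor> + real (c n)" "0 < real (a n) - of_int \<lfloor>s n * Y\<rfloor>"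
      using s_pos[of n] by (simp_all add: zero_less_divide_iff)
    then show ?case by linarith
  qed
qed

lemma row_size_scaled_lim: "(\<lambda>n. of_int (row_size (a n) (c n) \<lfloor>s n * Y\<rfloor>) / s n) \<longlonglongrightarrow> size_lim \<alpha> \<gamma> Y"
proof -
  let ?j = "\<lambda>n. of_int \<lfloor>s n * Y\<rfloor> / s n"
  have "(\<lambda>n. ?j n + real (c n) / s n - max 0 (?j n) - max 0 (?j n - (real (a n) / s n - real (c n) / s n))) \<longlonglongrightarrow> size_lim \<alpha> \<gamma> Y"
    unfolding size_lim_def by (intro tendsto_intros j_lim c_lim a_lim)
  moreover have "?j n + real (c n) / s n - max 0 (?j n) - max 0 (?j n - (real (a n) / s n - real (c n) / s n))
    = of_int (row_size (a n) (c n) \<lfloor>s n * Y\<rfloor>) / s n" for n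
  proof -
    have e: "?j n - (real (a n) / s n - real (c n) / s n) = (of_int \<lfloor>s n * Y\<rfloor> - (real (a n) - real (c n))) / s n"
      by (simp add: diff_divide_distrib)
    show ?thesis
      unfolding e max_0_divide[OF s_pos] row_size_def by (simp add: real_of_int_max add_divide_distrib diff_divide_distrib)
  qed
  ultimately show ?thesis by simp
qed

lemma inner_sum_lim:
  assumes t: "0 < t" "t < size_lim \<alpha> \<gamma> Y"
  shows "(\<lambda>n. inner_sum f (a n) (b n) (c n) (s n) \<lfloor>s n * Y\<rfloor> \<lfloor>s n * t\<rfloor>) \<longlonglongrightarrow> arc_lim f \<alpha> \<beta> \<gamma> Y t"
proof -
  define j where "j n = \<lfloor>s n * Y\<rfloor>" for n
  note jl = j_lim[folded j_def]
  have p: "(\<lambda>n. real (row_p (j n)) / s n) \<longlonglongrightarrow> \<bar>Y\<bar>"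
  proof -
    have "(\<lambda>n. \<bar>of_int (j n) / s n\<bar>) \<longlonglongrightarrow> \<bar>Y\<bar>" by (intro tendsto_intros jl)
    moreover have "\<bar>of_int (j n) / s n\<bar> = real (row_p (j n)) / s n" for n
      by (simp add: abs_divide abs_of_pos[OF s_pos])
    ultimately show ?thesis by (simp only:)
  qed
  have q: "(\<lambda>n. real (row_q (a n) (c n) (j n)) / s n) \<longlonglongrightarrow> \<bar>Y - (\<alpha> - \<gamma>)\<bar>"
  proof -
    have "(\<lambda>n. \<bar>of_int (j n) / s n - (real (a n) / s n - real (c n) / s n)\<bar>) \<longlonglongrightarrow> \<bar>Y - (\<alpha> - \<gamma>)\<bar>"
      by (intro tendsto_intros jl a_lim c_lim)
    moreover have "\<bar>of_int (j n) / s n - (real (a n) / s n - real (c n) / s n)\<bar> = real (row_q (a n) (c n) (j n)) / s n" for n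
    proof -
      have "of_int (j n) / s n - (real (a n) / s n - real (c n) / s n) = of_int (j n - (int (a n) - int (c n))) / s n"
        by (simp add: diff_divide_distrib)
      then show ?thesis using s_pos[of n] by (simp add: abs_divide)
    qed
    ultimately show ?thesis by simp
  qed
  have M: "(\<lambda>n. real (row_M (a n) (b n) (c n) (j n)) / s n) \<longlonglongrightarrow> size_lim \<alpha> \<gamma> Y + \<beta>"
  proof -
    have "(\<lambda>n. of_int (row_size (a n) (c n) (j n)) / s n + real (b n) / s n - 1 / s n) \<longlonglongrightarrow> size_lim \<alpha> \<gamma> Y + \<beta> - 0"
      unfolding j_def by (intro tendsto_intros row_size_scaled_lim b_lim inverse_s_lim)
    moreover have "eventually (\<lambda>n. of_int (row_size (a n) (c n) (j n)) / s n + real (b n) / s n - 1 / s n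
      = real (row_M (a n) (b n) (c n) (j n)) / s n) sequentially"
      using eventually_row
    proof eventually_elim
      case (elim n)
      then have j: "- int (c n) < j n" "j n < int (a n)" unfolding j_def by auto
      have "int (row_M (a n) (b n) (c n) (j n)) = row_size (a n) (c n) (j n) + int (b n) - 1"
        using row_M_n(2)[OF abc[of n] j] row_hi_lo[of "a n" "b n" "c n" "j n"] by simp
      then have "real (row_M (a n) (b n) (c n) (j n)) = of_int (row_size (a n) (c n) (j n)) + real (b n) - 1" by linarith
      then show ?case by (simp only: add_divide_distrib diff_divide_distrib)
    qed
    ultimately show ?thesis by (simp add: tendsto_cong)
  qed
  have k: "(\<lambda>n. real (nat \<lfloor>s n * t\<rfloor>) / s n) \<longlonglongrightarrow> t"
  proof -
    have "real (nat \<lfloor>s n * t\<rfloor>) = of_int \<lfloor>s n * t\<rfloor>" for n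
    proof -
      have "s n * t \<ge> 0" using s_pos[of n] t(1) by simp
      then show ?thesis by simp
    qed
    then show ?thesis using floor_scaled_lim[OF s_lim s_pos, of t] by simp
  qed
  define u where "u n = - (real (a n) / s n + 2 * (real (b n) / s n) + real (c n) / s n) / 4 + max 0 (- (of_int (j n) / s n)) + (of_int (j n) / s n) / 2 + (1 / s n) / 2" for n
  define v where "v n = sqrt 3 / 4 * (real (c n) / s n - real (a n) / s n) + sqrt 3 / 2 * (of_int (j n) / s n)" for n
  have u: "u \<longlonglongrightarrow> \<bar>Y\<bar> / 2 - (\<alpha> + 2 * \<beta> + \<gamma>) / 4"
  proof -
    have "u \<longlonglongrightarrow> - (\<alpha> + 2 * \<beta> + \<gamma>) / 4 + max 0 (- Y) + Y / 2 + 0 / 2"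
      unfolding u_def by (intro tendsto_intros jl a_lim b_lim c_lim inverse_s_lim) auto
    moreover have "- (\<alpha> + 2 * \<beta> + \<gamma>) / 4 + max 0 (- Y) + Y / 2 + 0 / 2 = \<bar>Y\<bar> / 2 - (\<alpha> + 2 * \<beta> + \<gamma>) / 4"
      by (auto simp: max_def field_simps)
    ultimately show ?thesis by simp
  qed
  have v: "v \<longlonglongrightarrow> sqrt 3 / 4 * (\<gamma> - \<alpha>) + sqrt 3 / 2 * Y"
    unfolding v_def by (intro tendsto_intros jl a_lim c_lim)
  define gs where "gs n X = f (X + u n, v n)" for n X
  define g where "g X = f (X + (\<bar>Y\<bar> / 2 - (\<alpha> + 2 * \<beta> + \<gamma>) / 4), sqrt 3 / 4 * (\<gamma> - \<alpha>) + sqrt 3 / 2 * Y)" for X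
  have pt: "(1 / s n) *\<^sub>R at_pos (a n) (b n) (c n) (of_int (row_lo (j n)) + real x + 1 / 2) (of_int (j n)) = (real x / s n + u n, v n)" for n x
  proof -
    have lo: "real_of_int (row_lo (j n)) / s n = max 0 (- (of_int (j n) / s n))"
      unfolding row_lo_def minus_divide_left max_0_divide[OF s_pos] by (simp add: real_of_int_max)
    have "fst ((1 / s n) *\<^sub>R at_pos (a n) (b n) (c n) (of_int (row_lo (j n)) + real x + 1 / 2) (of_int (j n)))
      = (- (real (a n) + 2 * real (b n) + real (c n)) / 4 + of_int (row_lo (j n)) + real x + 1 / 2 + of_int (j n) / 2) / s n"
      by (simp add: at_pos_def base_point_def)
    also have "\<dots> = real x / s n + u n"
      unfolding u_def lo[symmetric] by (simp add: add_divide_distrib diff_divide_distrib)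
    finally have 1: "fst ((1 / s n) *\<^sub>R at_pos (a n) (b n) (c n) (of_int (row_lo (j n)) + real x + 1 / 2) (of_int (j n))) = real x / s n + u n" .
    have 2: "snd ((1 / s n) *\<^sub>R at_pos (a n) (b n) (c n) (of_int (row_lo (j n)) + real x + 1 / 2) (of_int (j n))) = v n"
      unfolding v_def by (simp add: at_pos_def base_point_def add_divide_distrib diff_divide_distrib algebra_simps)
    show ?thesis using 1 2 by (simp add: prod_eq_iff)
  qed
  have "(\<lambda>n. \<Sum>x\<le>row_M (a n) (b n) (c n) (j n). gs n (real x / s n)
      * hahn_mass (row_p (j n)) (row_q (a n) (c n) (j n)) (row_M (a n) (b n) (c n) (j n)) (nat \<lfloor>s n * t\<rfloor>) x)
    \<longlonglongrightarrow> arcsine_mean (lim_A \<bar>Y\<bar> \<bar>Y - (\<alpha> - \<gamma>)\<bar> (size_lim \<alpha> \<gamma> Y + \<beta>) t + lim_C \<bar>Y\<bar> \<bar>Y - (\<alpha> - \<gamma>)\<bar> (size_lim \<alpha> \<gamma> Y + \<beta>) t)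
      (2 * sqrt (lim_A \<bar>Y\<bar> \<bar>Y - (\<alpha> - \<gamma>)\<bar> (size_lim \<alpha> \<gamma> Y + \<beta>) t * lim_C \<bar>Y\<bar> \<bar>Y - (\<alpha> - \<gamma>)\<bar> (size_lim \<alpha> \<gamma> Y + \<beta>) t)) g"
  proof (rule hahn_weak_limit[OF s_pos s_lim p q M k t(1)])
    show "t < size_lim \<alpha> \<gamma> Y + \<beta>" using t greek by simp
    show "continuous_on UNIV g" unfolding g_def
      by (intro continuous_on_compose2[OF f_cont] continuous_intros) auto
    show "eventually (\<lambda>n. \<forall>x\<in>{0..size_lim \<alpha> \<gamma> Y + \<beta> + 1}. \<bar>gs n x - g x\<bar> \<le> e) sequentially" if "e > 0" for e
      unfolding gs_def g_def by (rule uniform_shift[OF f_cont u v that])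
  qed simp
  then show ?thesis
    unfolding arc_lim_def Let_def inner_sum_def j_def[symmetric] pt gs_def g_def .
qed

end

lemma L_bound: "\<exists>L\<ge>0. \<forall>n. (real (a n) + real (c n)) / s n \<le> L"
proof -
  have "convergent (\<lambda>n. real (a n) / s n + real (c n) / s n)"
    by (rule convergentI[OF tendsto_add[OF a_lim c_lim]])
  then have "Bseq (\<lambda>n. real (a n) / s n + real (c n) / s n)" by (rule convergent_imp_Bseq)
  then obtain L where "L > 0" "\<And>n. norm (real (a n) / s n + real (c n) / s n) \<le> L"
    by (auto elim!: BseqE)
  then show ?thesis
    by (intro exI[of _ L]) (auto simp: add_divide_distrib abs_le_iff)
qed

lemma row_size_le: "row_size (a n) (c n) j \<le> int (a n) + int (c n)" if "j < int (a n)"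
  using that unfolding row_size_def by (auto simp: max_def)

abbreviation "k_range n j \<equiv> (if - int (c n) < j \<and> j < int (a n) then {0..<row_size (a n) (c n) j} else {})"

abbreviation "row_sum n j \<equiv> (\<Sum>k\<in>k_range n j. inner_sum f (a n) (b n) (c n) (s n) j k) / s n"

text \<open>Dominated convergence in the scaled degree: the step functions are bounded by
  \<open>Cf\<close> and vanish outside \<open>{0..L}\<close>, and the two endpoints where
  convergence may fail form a null set. The limit is measurable as a pointwise limit of step
  functions, so \<open>arc_lim\<close> itself need not be inspected.\<close>

lemma row_sum_lim:
  assumes Y: "- \<gamma> < Y" "Y < \<alpha>"
  shows "(\<lambda>n. row_sum n \<lfloor>s n * Y\<rfloor>) \<longlonglongrightarrow> (LINT t|lborel. (if 0 < t \<and> t < size_lim \<alpha> \<gamma> Y then arc_lim f \<alpha> \<beta> \<gamma> Y t else 0))"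
    and "(\<lambda>t. if 0 < t \<and> t < size_lim \<alpha> \<gamma> Y then arc_lim f \<alpha> \<beta> \<gamma> Y t else 0) \<in> borel_measurable lborel"
proof -
  define F where "F n t = (if \<lfloor>s n * t\<rfloor> \<in> k_range n \<lfloor>s n * Y\<rfloor>
    then inner_sum f (a n) (b n) (c n) (s n) \<lfloor>s n * Y\<rfloor> \<lfloor>s n * t\<rfloor> else 0)" for n t
  define F' where "F' t = (if 0 < t \<and> t < size_lim \<alpha> \<gamma> Y then arc_lim f \<alpha> \<beta> \<gamma> Y t else 0)" for t
  have fin: "finite (k_range n j)" for n j by simp
  note st = step_function_integral[OF fin s_pos, of _ _ _ "inner_sum f (a n) (b n) (c n) (s n) \<lfloor>s n * Y\<rfloor>" for n]
  have Fint: "(LINT t|lborel. F n t) = row_sum n \<lfloor>s n * Y\<rfloor>" for n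
    unfolding F_def by (rule st(2))
  have Fmeas: "F n \<in> borel_measurable lborel" for n
    unfolding F_def using st(1) by (rule borel_measurable_integrable)
  have size: "(\<lambda>n. of_int (row_size (a n) (c n) \<lfloor>s n * Y\<rfloor>) / s n) \<longlonglongrightarrow> size_lim \<alpha> \<gamma> Y"
    by (rule row_size_scaled_lim[OF Y])
  have lim_in: "(\<lambda>n. F n t) \<longlonglongrightarrow> arc_lim f \<alpha> \<beta> \<gamma> Y t" if t: "0 < t" "t < size_lim \<alpha> \<gamma> Y" for t
  proof -
    have "eventually (\<lambda>n. of_int (row_size (a n) (c n) \<lfloor>s n * Y\<rfloor>) / s n > t) sequentially"
      using order_tendstoD(1)[OF size t(2)] .
    with eventually_row[OF Y] have "eventually (\<lambda>n. inner_sum f (a n) (b n) (c n) (s n) \<lfloor>s n * Y\<rfloor> \<lfloor>s n * t\<rfloor> = F n t) sequentially"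
    proof eventually_elim
      case (elim n)
      have "s n * t < of_int (row_size (a n) (c n) \<lfloor>s n * Y\<rfloor>)"
        using elim(2) s_pos[of n] by (simp add: field_simps)
      then have "\<lfloor>s n * t\<rfloor> < row_size (a n) (c n) \<lfloor>s n * Y\<rfloor>" by (simp add: floor_less_iff)
      moreover have "s n * t \<ge> 0" using s_pos[of n] t by simp
      ultimately show ?case using elim(1) unfolding F_def by simp
    qed
    then show ?thesis
      using inner_sum_lim[OF Y t] by (rule Lim_transform_eventually[rotated])
  qed
  have lim_out: "(\<lambda>n. F n t) \<longlonglongrightarrow> 0" if t: "t < 0 \<or> size_lim \<alpha> \<gamma> Y < t" for t
  proof -
    have "eventually (\<lambda>n. F n t = 0) sequentially"
    proof (cases "t < 0")
      case True
      have "F n t = 0" for n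
      proof -
        have "s n * t < 0" using s_pos[of n] True by (simp add: mult_pos_neg)
        then have "\<lfloor>s n * t\<rfloor> < 0" by simp
        then show ?thesis unfolding F_def by auto
      qed
      then show ?thesis by simp
    next
      case False
      then have gt: "size_lim \<alpha> \<gamma> Y < t" using t by simp
      have "eventually (\<lambda>n. of_int \<lfloor>s n * t\<rfloor> / s n - of_int (row_size (a n) (c n) \<lfloor>s n * Y\<rfloor>) / s n > 0) sequentially"
        using order_tendstoD(1)[OF tendsto_diff[OF floor_scaled_lim[OF s_lim s_pos, of t] size], of 0] gt by simp
      then show ?thesis
      proof eventually_elim
        case (elim n)
        then have "of_int \<lfloor>s n * t\<rfloor> > real_of_int (row_size (a n) (c n) \<lfloor>s n * Y\<rfloor>)"
          using s_pos[of n] by (simp add: divide_less_cancel)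
        then show ?case unfolding F_def by auto
      qed
    qed
    then show ?thesis by (rule tendsto_eventually)
  qed
  show meas: "(\<lambda>t. if 0 < t \<and> t < size_lim \<alpha> \<gamma> Y then arc_lim f \<alpha> \<beta> \<gamma> Y t else 0) \<in> borel_measurable lborel"
  proof (rule borel_measurable_LIMSEQ_real)
    show "(\<lambda>t. if 0 < t \<and> t < size_lim \<alpha> \<gamma> Y then F n t else 0) \<in> borel_measurable lborel" for n
      using Fmeas[of n] by measurable
    show "(\<lambda>n. if 0 < t \<and> t < size_lim \<alpha> \<gamma> Y then F n t else 0) \<longlonglongrightarrow> (if 0 < t \<and> t < size_lim \<alpha> \<gamma> Y then arc_lim f \<alpha> \<beta> \<gamma> Y t else 0)" for t
      using lim_in[of t] by auto
  qed
  obtain L where L: "L \<ge> 0" "\<And>n. (real (a n) + real (c n)) / s n \<le> L" using L_bound by blast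
  have "(\<lambda>n. LINT t|lborel. F n t) \<longlonglongrightarrow> (LINT t|lborel. F' t)"
  proof (rule integral_dominated_convergence[where w = "\<lambda>t. Cf * indicator {0..L} t"])
    show "F' \<in> borel_measurable lborel" using meas unfolding F'_def[abs_def] .
    show "integrable lborel (\<lambda>t. Cf * indicat_real {0..L} t)"
      by (intro integrable_mult_right integrable_real_indicator) (auto simp: emeasure_lborel_Icc_eq)
    have "AE t in lborel. t \<noteq> 0 \<and> t \<noteq> size_lim \<alpha> \<gamma> Y"
      using AE_lborel_singleton[of 0] AE_lborel_singleton[of "size_lim \<alpha> \<gamma> Y"] by eventually_elim simp
    then show "AE t in lborel. (\<lambda>n. F n t) \<longlonglongrightarrow> F' t"
    proof eventually_elim
      case (elim t)
      then consider "0 < t \<and> t < size_lim \<alpha> \<gamma> Y" | "t < 0 \<or> size_lim \<alpha> \<gamma> Y < t" by linarith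
      then show ?case
      proof cases
        case 1
        then show ?thesis using lim_in[of t] unfolding F'_def by simp
      next
        case 2
        then show ?thesis using lim_out[OF 2] unfolding F'_def by auto
      qed
    qed
    show "AE t in lborel. norm (F n t) \<le> Cf * indicat_real {0..L} t" for n
    proof (rule AE_I2)
      fix t
      show "norm (F n t) \<le> Cf * indicat_real {0..L} t"
      proof (cases "\<lfloor>s n * t\<rfloor> \<in> k_range n \<lfloor>s n * Y\<rfloor>")
        case True
        then have j: "- int (c n) < \<lfloor>s n * Y\<rfloor>" "\<lfloor>s n * Y\<rfloor> < int (a n)" and k: "\<lfloor>s n * t\<rfloor> \<in> {0..<row_size (a n) (c n) \<lfloor>s n * Y\<rfloor>}"
          by (auto split: if_splits)
        have "0 \<le> s n * t" using k by simp
        then have "t \<ge> 0" using s_pos[of n] by (simp add: zero_le_mult_iff)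
        have "\<lfloor>s n * t\<rfloor> < int (a n) + int (c n)" using k row_size_le[OF j(2)] by auto
        then have "s n * t \<le> real (a n) + real (c n)" by linarith
        then have "t \<le> (real (a n) + real (c n)) / s n" using s_pos[of n] by (simp add: field_simps)
        then have "t \<in> {0..L}" using L(2)[of n] \<open>t \<ge> 0\<close> by simp
        then show ?thesis using True inner_sum_bound[OF f_bound abc j k] unfolding F_def by simp
      qed (use Cf_nonneg in \<open>simp add: F_def\<close>)
    qed
  qed (rule Fmeas)
  then show "(\<lambda>n. row_sum n \<lfloor>s n * Y\<rfloor>) \<longlonglongrightarrow> (LINT t|lborel. (if 0 < t \<and> t < size_lim \<alpha> \<gamma> Y then arc_lim f \<alpha> \<beta> \<gamma> Y t else 0))"
    unfolding Fint F'_def .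
qed

lemma row_sum_bound:
  assumes j: "- int (c n) < j" "j < int (a n)" and L: "(real (a n) + real (c n)) / s n \<le> L"
  shows "\<bar>row_sum n j\<bar> \<le> Cf * L"
proof -
  have "\<bar>\<Sum>k\<in>k_range n j. inner_sum f (a n) (b n) (c n) (s n) j k\<bar> \<le> (\<Sum>k\<in>k_range n j. Cf)"
    by (intro order_trans[OF sum_abs] sum_mono inner_sum_bound[OF f_bound abc j]) (use j in auto)
  also have "\<dots> = real (card (k_range n j)) * Cf" by simp
  also have "\<dots> \<le> (real (a n) + real (c n)) * Cf"
    using j row_size_le[OF j(2)] by (intro mult_right_mono Cf_nonneg) auto
  finally have "\<bar>row_sum n j\<bar> \<le> (real (a n) + real (c n)) * Cf / s n"
    using s_pos[of n] by (simp add: abs_divide divide_right_mono)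
  also have "\<dots> = Cf * ((real (a n) + real (c n)) / s n)" by simp
  also have "\<dots> \<le> Cf * L" by (intro mult_left_mono L Cf_nonneg)
  finally show ?thesis .
qed

text \<open>The same argument in the scaled row index. The two summations, over rows and degrees,
  account for \<open>(s n)\<^sup>2\<close>.\<close>

lemma tiling_sum_lim:
  "(\<lambda>n. (\<Sum>j\<in>{- int (c n)<..<int (a n)}. \<Sum>k\<in>{0..<row_size (a n) (c n) j}. inner_sum f (a n) (b n) (c n) (s n) j k) / (s n)\<^sup>2)
    \<longlonglongrightarrow> (LINT Y|lborel. (if - \<gamma> < Y \<and> Y < \<alpha> then
        (LINT t|lborel. (if 0 < t \<and> t < size_lim \<alpha> \<gamma> Y then arc_lim f \<alpha> \<beta> \<gamma> Y t else 0)) else 0))"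
proof -
  define G where "G Y = (LINT t|lborel. (if 0 < t \<and> t < size_lim \<alpha> \<gamma> Y then arc_lim f \<alpha> \<beta> \<gamma> Y t else 0))" for Y
  define F where "F n Y = (if \<lfloor>s n * Y\<rfloor> \<in> {- int (c n)<..<int (a n)} then row_sum n \<lfloor>s n * Y\<rfloor> else 0)" for n Y
  have fin: "finite {- int (c n)<..<int (a n)}" for n by simp
  have Fint: "(LINT Y|lborel. F n Y) = (\<Sum>j\<in>{- int (c n)<..<int (a n)}. row_sum n j) / s n" for n
    unfolding F_def by (rule step_function_integral(2)[OF fin s_pos])
  have Fmeas: "F n \<in> borel_measurable lborel" for n
    unfolding F_def using step_function_integral(1)[OF fin s_pos] by (rule borel_measurable_integrable)
  have lim_in: "(\<lambda>n. F n Y) \<longlonglongrightarrow> G Y" if Y: "- \<gamma> < Y" "Y < \<alpha>" for Y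
  proof -
    have "eventually (\<lambda>n. row_sum n \<lfloor>s n * Y\<rfloor> = F n Y) sequentially"
      using eventually_row[OF Y] by eventually_elim (simp add: F_def)
    then show ?thesis using row_sum_lim(1)[OF Y] unfolding G_def by (rule Lim_transform_eventually[rotated])
  qed
  have lim_out: "(\<lambda>n. F n Y) \<longlonglongrightarrow> 0" if Y: "Y < - \<gamma> \<or> \<alpha> < Y" for Y
  proof -
    have "eventually (\<lambda>n. F n Y = 0) sequentially"
    proof (cases "Y < - \<gamma>")
      case True
      have "eventually (\<lambda>n. of_int \<lfloor>s n * Y\<rfloor> / s n + real (c n) / s n < 0) sequentially"
        using order_tendstoD(2)[OF tendsto_add[OF floor_scaled_lim[OF s_lim s_pos, of Y] c_lim], of 0] True by simp
      then show ?thesis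
      proof eventually_elim
        case (elim n)
        then have "(of_int \<lfloor>s n * Y\<rfloor> + real (c n)) / s n < 0" by (simp add: add_divide_distrib)
        then have "of_int \<lfloor>s n * Y\<rfloor> + real (c n) < 0" using s_pos[of n] by (simp add: divide_less_0_iff)
        then show ?case unfolding F_def by auto
      qed
    next
      case False
      have "eventually (\<lambda>n. of_int \<lfloor>s n * Y\<rfloor> / s n - real (a n) / s n > 0) sequentially"
        using order_tendstoD(1)[OF tendsto_diff[OF floor_scaled_lim[OF s_lim s_pos, of Y] a_lim], of 0] False Y by simp
      then show ?thesis
      proof eventually_elim
        case (elim n)
        then have "of_int \<lfloor>s n * Y\<rfloor> > real (a n)" using s_pos[of n] by (simp add: divide_less_cancel)
        then show ?case unfolding F_def by auto
      qed
    qed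
    then show ?thesis by (rule tendsto_eventually)
  qed
  obtain L where L: "L \<ge> 0" "\<And>n. (real (a n) + real (c n)) / s n \<le> L" using L_bound by blast
  have "(\<lambda>n. LINT Y|lborel. F n Y) \<longlonglongrightarrow> (LINT Y|lborel. (if - \<gamma> < Y \<and> Y < \<alpha> then G Y else 0))"
  proof (rule integral_dominated_convergence[where w = "\<lambda>Y. (Cf * L) * indicator {-L..L} Y"])
    show "(\<lambda>Y. if - \<gamma> < Y \<and> Y < \<alpha> then G Y else 0) \<in> borel_measurable lborel"
    proof (rule borel_measurable_LIMSEQ_real)
      show "(\<lambda>Y. if - \<gamma> < Y \<and> Y < \<alpha> then F n Y else 0) \<in> borel_measurable lborel" for n
        using Fmeas[of n] by measurable
      show "(\<lambda>n. if - \<gamma> < Y \<and> Y < \<alpha> then F n Y else 0) \<longlonglongrightarrow> (if - \<gamma> < Y \<and> Y < \<alpha> then G Y else 0)" for Y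
        using lim_in[of Y] by auto
    qed
    show "integrable lborel (\<lambda>Y. (Cf * L) * indicat_real {-L..L} Y)"
      by (intro integrable_mult_right integrable_real_indicator) (auto simp: emeasure_lborel_Icc_eq)
    have "AE Y in lborel. Y \<noteq> - \<gamma> \<and> Y \<noteq> \<alpha>"
      using AE_lborel_singleton[of "- \<gamma>"] AE_lborel_singleton[of \<alpha>] by eventually_elim simp
    then show "AE Y in lborel. (\<lambda>n. F n Y) \<longlonglongrightarrow> (if - \<gamma> < Y \<and> Y < \<alpha> then G Y else 0)"
    proof eventually_elim
      case (elim Y)
      then consider "- \<gamma> < Y \<and> Y < \<alpha>" | "Y < - \<gamma> \<or> \<alpha> < Y" by linarith
      then show ?case
      proof cases
        case 1
        then show ?thesis using lim_in[of Y] by simp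
      next
        case 2
        then show ?thesis using lim_out[OF 2] by auto
      qed
    qed
    show "AE Y in lborel. norm (F n Y) \<le> (Cf * L) * indicat_real {-L..L} Y" for n
    proof (rule AE_I2)
      fix Y
      show "norm (F n Y) \<le> (Cf * L) * indicat_real {-L..L} Y"
      proof (cases "\<lfloor>s n * Y\<rfloor> \<in> {- int (c n)<..<int (a n)}")
        case True
        then have j: "- int (c n) < \<lfloor>s n * Y\<rfloor>" "\<lfloor>s n * Y\<rfloor> < int (a n)" by auto
        have "- (real (a n) + real (c n)) \<le> s n * Y" "s n * Y \<le> real (a n) + real (c n)" using j by linarith+
        then have "- ((real (a n) + real (c n)) / s n) \<le> Y" "Y \<le> (real (a n) + real (c n)) / s n"
          using s_pos[of n] by (simp_all add: field_simps)
        then have "Y \<in> {-L..L}" using L(2)[of n] by auto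
        then show ?thesis using True row_sum_bound[OF j L(2)] unfolding F_def by simp
      next
        case False
        then have "F n Y = 0" unfolding F_def by (simp only: if_False)
        then show ?thesis using Cf_nonneg L(1) by simp
      qed
    qed
  qed (rule Fmeas)
  moreover have "(\<Sum>j\<in>{- int (c n)<..<int (a n)}. row_sum n j) / s n
    = (\<Sum>j\<in>{- int (c n)<..<int (a n)}. \<Sum>k\<in>{0..<row_size (a n) (c n) j}. inner_sum f (a n) (b n) (c n) (s n) j k) / (s n)\<^sup>2" for n
    by (simp add: sum_divide_distrib power2_eq_square)
  ultimately show ?thesis unfolding Fint G_def by simp
qed

end

section \<open>The limit integral\<close>

text \<open>The increasing substitution \<open>x = \<mu> - r * cos \<theta>\<close> cancels the
  density; replacing \<open>\<theta>\<close> by \<open>pi - \<theta>\<close> then restores the sign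
  of the cosine.\<close>

lemma arcsine_substitution:
  fixes h :: "real \<Rightarrow> real"
  assumes [measurable]: "h \<in> borel_measurable borel" and h: "\<And>x. h x \<ge> 0" and r: "r > 0"
  shows "(\<integral>\<^sup>+x. ennreal (h x * (if \<bar>x - \<mu>\<bar> < r then 1 / sqrt (r\<^sup>2 - (x - \<mu>)\<^sup>2) else 0)) \<partial>lborel)
    = (\<integral>\<^sup>+\<theta>. ennreal (h (\<mu> + r * cos \<theta>)) * indicator {0..pi} \<theta> \<partial>lborel)"
proof -
  define F where "F x = h x * (if \<bar>x - \<mu>\<bar> < r then 1 / sqrt (r\<^sup>2 - (x - \<mu>)\<^sup>2) else 0)" for x
  have [measurable]: "F \<in> borel_measurable borel" unfolding F_def by measurable
  let ?g = "\<lambda>\<theta>. \<mu> - r * cos \<theta>"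
  have "(\<integral>\<^sup>+x. ennreal (F x) \<partial>lborel) = (\<integral>\<^sup>+x. F x * indicator {?g 0..?g pi} x \<partial>lborel)"
    by (intro nn_integral_cong) (auto simp: F_def indicator_def)
  also have "\<dots> = (\<integral>\<^sup>+\<theta>. F (?g \<theta>) * (r * sin \<theta>) * indicator {0..pi} \<theta> \<partial>lborel)"
  proof (rule nn_integral_substitution)
    show "set_borel_measurable borel {?g 0..?g pi} F"
      unfolding set_borel_measurable_def by measurable
    show "(?g has_real_derivative r * sin \<theta>) (at \<theta>)" for \<theta>
      by (auto intro!: derivative_eq_intros)
    show "continuous_on {0..pi} (\<lambda>\<theta>. r * sin \<theta>)" by (intro continuous_intros)
    show "r * sin \<theta> \<ge> 0" if "\<theta> \<in> {0..pi}" for \<theta> using that r sin_ge_zero[of \<theta>] by simp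
  qed simp
  also have "\<dots> = (\<integral>\<^sup>+\<theta>. ennreal (h (?g \<theta>)) * indicator {0..pi} \<theta> \<partial>lborel)"
  proof (rule nn_integral_cong_AE)
    have "AE \<theta> in lborel. \<theta> \<noteq> 0 \<and> \<theta> \<noteq> pi"
      using AE_lborel_singleton[of 0] AE_lborel_singleton[of pi] by eventually_elim simp
    then show "AE \<theta> in lborel. ennreal (F (?g \<theta>) * (r * sin \<theta>) * indicator {0..pi} \<theta>) = ennreal (h (?g \<theta>)) * indicator {0..pi} \<theta>"
    proof eventually_elim
      case (elim \<theta>)
      show ?case
      proof (cases "\<theta> \<in> {0..pi}")
        case True
        then have \<theta>: "0 < \<theta>" "\<theta> < pi" using elim by auto
        then have s: "sin \<theta> > 0" by (rule sin_gt_zero)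
        have "(sin \<theta>)\<^sup>2 > 0" using s by simp
        then have "(cos \<theta>)\<^sup>2 < 1" using sin_squared_eq[of \<theta>] by linarith
        then have "\<bar>cos \<theta>\<bar> < 1" by (simp add: abs_square_less_1)
        then have lt: "\<bar>?g \<theta> - \<mu>\<bar> < r" using r by (simp add: abs_mult)
        have "r\<^sup>2 - (?g \<theta> - \<mu>)\<^sup>2 = (r * sin \<theta>)\<^sup>2"
          by (simp add: power_mult_distrib sin_squared_eq algebra_simps)
        then have "sqrt (r\<^sup>2 - (?g \<theta> - \<mu>)\<^sup>2) = r * sin \<theta>" using r s by (simp add: real_sqrt_unique)
        then have "F (?g \<theta>) * (r * sin \<theta>) = h (?g \<theta>)" unfolding F_def using lt r s by simp
        then show ?thesis using True by simp
      qed simp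
    qed
  qed
  also have "\<dots> = (\<integral>\<^sup>+\<theta>. ennreal (h (?g (pi + - 1 * \<theta>))) * indicator {0..pi} (pi + - 1 * \<theta>) \<partial>lborel)"
    by (subst nn_integral_real_affine[where c = "- 1" and t = pi]) auto
  also have "\<dots> = (\<integral>\<^sup>+\<theta>. ennreal (h (\<mu> + r * cos \<theta>)) * indicator {0..pi} \<theta> \<partial>lborel)"
    by (intro nn_integral_cong) (auto simp: indicator_def)
  finally show ?thesis unfolding F_def .
qed

text \<open>For \<open>e = R\<^sup>2 - w\<^sup>2\<close>, the length of the set of angles in
  \<open>[0, pi]\<close> with \<open>w + R * cos \<theta> \<le> 0\<close>. For \<open>e > 0\<close>
  it is the inverse cotangent of \<open>w / sqrt e\<close>.\<close>

definition angle :: "real \<Rightarrow> real \<Rightarrow> real" where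
  "angle w e = (if e > 0 then pi / 2 - arctan (w / sqrt e) else if w < 0 then pi else 0)"

lemma angle_measure:
  assumes R: "R > 0"
  shows "(\<integral>\<^sup>+\<theta>. ennreal (indicator {x. w + x \<le> 0} (R * cos \<theta>)) * indicator {0..pi} \<theta> \<partial>lborel) = ennreal (angle w (R\<^sup>2 - w\<^sup>2))"
proof -
  have eq: "(\<integral>\<^sup>+\<theta>. ennreal (indicator {x. w + x \<le> 0} (R * cos \<theta>)) * indicator {0..pi} \<theta> \<partial>lborel)
    = emeasure lborel {\<theta> \<in> {0..pi}. R * cos \<theta> \<le> - w}"
  proof -
    have "(\<integral>\<^sup>+\<theta>. ennreal (indicator {x. w + x \<le> 0} (R * cos \<theta>)) * indicator {0..pi} \<theta> \<partial>lborel)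
      = (\<integral>\<^sup>+\<theta>. indicator {\<theta> \<in> {0..pi}. R * cos \<theta> \<le> - w} \<theta> \<partial>lborel)"
      by (intro nn_integral_cong) (auto simp: indicator_def)
    also have "\<dots> = emeasure lborel {\<theta> \<in> {0..pi}. R * cos \<theta> \<le> - w}"
      by (rule nn_integral_indicator) simp
    finally show ?thesis .
  qed
  define c where "c = - w / R"
  have le: "R * cos \<theta> \<le> - w \<longleftrightarrow> cos \<theta> \<le> c" for \<theta> using R by (simp add: c_def field_simps)
  consider "\<bar>c\<bar> < 1" | "c \<ge> 1" | "c \<le> -1" by linarith
  then show ?thesis
  proof cases
    case 1
    have "{\<theta> \<in> {0..pi}. R * cos \<theta> \<le> - w} = {arccos c..pi}"
    proof -
      have "cos \<theta> \<le> c \<longleftrightarrow> arccos c \<le> \<theta>" if "\<theta> \<in> {0..pi}" for \<theta>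
        using that 1 arccos_lbound[of c] arccos_ubound[of c] cos_mono_le_eq[of \<theta> "arccos c"] by (simp add: abs_less_iff)
      moreover have "0 \<le> arccos c" using 1 by (intro arccos_lbound) auto
      ultimately show ?thesis unfolding le by auto
    qed
    moreover have "arccos c \<le> pi" using 1 by (intro arccos_ubound) auto
    ultimately have em: "emeasure lborel {\<theta> \<in> {0..pi}. R * cos \<theta> \<le> - w} = ennreal (pi - arccos c)" by simp
    have w2: "R\<^sup>2 - w\<^sup>2 = R\<^sup>2 * (1 - c\<^sup>2)" using R by (simp add: c_def power_divide field_simps)
    have "c\<^sup>2 < 1" using 1 by (simp add: abs_square_less_1)
    then have pos: "R\<^sup>2 - w\<^sup>2 > 0" unfolding w2 using R by simp
    have "pi - arccos c = pi / 2 + arcsin c" using 1 by (simp add: arccos_arcsin_eq abs_less_iff)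
    also have "arcsin c = arctan (c / sqrt (1 - c\<^sup>2))" using 1 by (intro arcsin_arctan) auto
    also have "c / sqrt (1 - c\<^sup>2) = - (w / sqrt (R\<^sup>2 - w\<^sup>2))"
      unfolding w2 real_sqrt_mult using R by (simp add: c_def)
    finally have "pi - arccos c = angle w (R\<^sup>2 - w\<^sup>2)" unfolding angle_def using pos by (simp add: arctan_minus)
    then show ?thesis unfolding eq em by simp
  next
    case 2
    have "{\<theta> \<in> {0..pi}. R * cos \<theta> \<le> - w} = {0..pi}" unfolding le using 2 by (auto intro: order_trans[OF cos_le_one])
    moreover have "- w \<ge> R" using 2 R by (simp add: c_def field_simps)
    then have "w < 0" "R\<^sup>2 \<le> w\<^sup>2" using R by (auto intro: power2_le_iff_abs_le[THEN iffD2] simp: abs_le_square_iff[symmetric])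
    ultimately show ?thesis unfolding eq by (simp add: angle_def)
  next
    case 3
    have "w \<ge> R" using 3 R by (simp add: c_def field_simps)
    then have w: "w > 0" "R\<^sup>2 \<le> w\<^sup>2" using R by (auto simp: abs_le_square_iff[symmetric])
    have "{\<theta> \<in> {0..pi}. R * cos \<theta> \<le> - w} \<subseteq> {pi}"
    proof
      fix \<theta> assume \<theta>: "\<theta> \<in> {\<theta> \<in> {0..pi}. R * cos \<theta> \<le> - w}"
      then have "cos \<theta> \<le> cos pi" using le 3 by simp
      then have "pi \<le> \<theta>" using \<theta> cos_mono_le_eq[of \<theta> pi] by simp
      then show "\<theta> \<in> {pi}" using \<theta> by simp
    qed
    then have "emeasure lborel {\<theta> \<in> {0..pi}. R * cos \<theta> \<le> - w} \<le> emeasure lborel {pi}"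
      by (rule emeasure_mono) simp
    then show ?thesis unfolding eq using w by (simp add: angle_def)
  qed
qed

text \<open>With \<open>radius_sq\<close>, the centre and the squared half-length of the interval of
  values \<open>u\<close> allowed at a fixed position. Here \<open>H\<close> stands for
  \<open>m + (p + q) / 2\<close>, and \<open>x\<close> is measured from the centre of the
  hexagon.\<close>

definition midpoint_u :: "real \<Rightarrow> real \<Rightarrow> real \<Rightarrow> real \<Rightarrow> real" where
  "midpoint_u H p q x = (H\<^sup>2 + (p\<^sup>2 + q\<^sup>2) / 2) / 2 - 2 * x\<^sup>2"

definition radius_sq :: "real \<Rightarrow> real \<Rightarrow> real \<Rightarrow> real \<Rightarrow> real" where
  "radius_sq H p q x = ((H - 2 * x)\<^sup>2 - q\<^sup>2) * ((H + 2 * x)\<^sup>2 - p\<^sup>2) / 4"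

text \<open>The arcsine law of index \<open>t\<close> is supported where this polynomial is nonnegative at \<open>u = (t + (p + q) / 2)\<^sup>2\<close>.\<close>

definition discr :: "real \<Rightarrow> real \<Rightarrow> real \<Rightarrow> real \<Rightarrow> real \<Rightarrow> real" where
  "discr H p q x u = radius_sq H p q x - (u - midpoint_u H p q x)\<^sup>2"

text \<open>In terms of \<open>S = (p + q) / 2\<close> and \<open>d = (p - q) / 2\<close> the
  numerators of \<open>A\<close> and \<open>C\<close> are exchanged when \<open>\<kappa>\<close>
  changes sign; hence \<open>A + C\<close> and \<open>A * C\<close> depend on
  \<open>\<kappa>\<^sup>2\<close> only, and \<open>discr\<close> is quadratic in \<open>x\<close> as
  well as in \<open>\<kappa>\<^sup>2\<close>.\<close>

lemma lim_AC_identity: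
  assumes \<kappa>: "\<kappa> = t + (p + q) / 2" "\<kappa> > 0" and m: "m = H - (p + q) / 2"
  defines "A \<equiv> lim_A p q m t" and "C \<equiv> lim_C p q m t"
  shows "4 * (A * C) - (x - (A + C + p / 2 - H / 2))\<^sup>2 = discr H p q x (\<kappa>\<^sup>2) / (4 * \<kappa>\<^sup>2)"
proof -
  define S d where "S = (p + q) / 2" and "d = (p - q) / 2"
  have pq: "p = S + d" "q = S - d" "t = \<kappa> - S" "m = H - S" using \<kappa> m by (simp_all add: S_def d_def field_simps)
  have A: "A * (4 * \<kappa>\<^sup>2) = (\<kappa> + S) * (\<kappa> + d) * (H - \<kappa>)"
  proof -
    have "2 * (\<kappa> - S) + (S + d) + (S - d) = 2 * \<kappa>" by simp
    then show ?thesis unfolding A_def lim_A_def pq using \<kappa>(2) by (simp add: power2_eq_square)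
  qed
  have C: "C * (4 * \<kappa>\<^sup>2) = (\<kappa> - S) * (\<kappa> - d) * (H + \<kappa>)"
  proof -
    have "2 * (\<kappa> - S) + (S + d) + (S - d) = 2 * \<kappa>" "\<kappa> - S + (S + d) + (S - d) + (H - S) = H + \<kappa>" "\<kappa> - S + (S - d) = \<kappa> - d" by simp_all
    then show ?thesis unfolding C_def lim_C_def pq using \<kappa>(2) by (simp add: power2_eq_square mult_ac)
  qed
  have AC: "(A + C + p / 2 - H / 2) * (2 * \<kappa>\<^sup>2) = H * S * d"
  proof -
    have "(A + C + p / 2 - H / 2) * (4 * \<kappa>\<^sup>2) = A * (4 * \<kappa>\<^sup>2) + C * (4 * \<kappa>\<^sup>2) + (p - H) * (2 * \<kappa>\<^sup>2)"
      by (simp add: algebra_simps)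
    also have "\<dots> = 2 * (H * S * d)" unfolding A C pq by (simp add: algebra_simps power2_eq_square)
    finally have e: "(A + C + p / 2 - H / 2) * (4 * \<kappa>\<^sup>2) = 2 * (H * S * d)" .
    have "(A + C + p / 2 - H / 2) * (2 * \<kappa>\<^sup>2) = ((A + C + p / 2 - H / 2) * (4 * \<kappa>\<^sup>2)) / 2" by simp
    then show ?thesis unfolding e by simp
  qed
  have "(4 * (A * C) - (x - (A + C + p / 2 - H / 2))\<^sup>2) * (4 * \<kappa>\<^sup>2 * \<kappa>\<^sup>2)
    = (A * (4 * \<kappa>\<^sup>2)) * (C * (4 * \<kappa>\<^sup>2)) - (x * (2 * \<kappa>\<^sup>2) - (A + C + p / 2 - H / 2) * (2 * \<kappa>\<^sup>2))\<^sup>2"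
    by (simp add: power2_eq_square algebra_simps)
  also have "\<dots> = discr H p q x (\<kappa>\<^sup>2) * \<kappa>\<^sup>2"
    unfolding A C AC discr_def radius_sq_def midpoint_u_def unfolding pq by (simp add: field_simps power2_eq_square)
  finally have "(4 * (A * C) - (x - (A + C + p / 2 - H / 2))\<^sup>2) * (4 * \<kappa>\<^sup>2) * \<kappa>\<^sup>2 = discr H p q x (\<kappa>\<^sup>2) * \<kappa>\<^sup>2"
    by (simp add: mult_ac)
  then have "(4 * (A * C) - (x - (A + C + p / 2 - H / 2))\<^sup>2) * (4 * \<kappa>\<^sup>2) = discr H p q x (\<kappa>\<^sup>2)"
    using \<kappa>(2) by simp
  then show ?thesis using \<kappa>(2) by (intro iffD2[OF nonzero_eq_divide_eq]) auto
qed

context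
  fixes H p q :: real
  assumes pq: "p \<ge> 0" "q \<ge> 0" and H: "p + q < 2 * H"
begin

text \<open>At \<open>t = 0\<close> the arcsine law degenerates to a point mass, so the discriminant
  is minus a square there. The start of the integration thus never lies inside the interval of
  allowed \<open>u\<close>.\<close>

lemma discr_start: "discr H p q x (((p + q) / 2)\<^sup>2) \<le> 0"
proof -
  have "discr H p q x (((p + q) / 2)\<^sup>2) = - (x * (p + q) - H * (p - q) / 2)\<^sup>2"
    unfolding discr_def radius_sq_def midpoint_u_def by (simp add: field_simps power2_eq_square)
  then show ?thesis by simp
qed

lemma midpoint_start: "2 * midpoint_u H p q x - 2 * ((p + q) / 2)\<^sup>2 = H\<^sup>2 - (2 * x)\<^sup>2 - p * q"
  unfolding midpoint_u_def by (simp add: field_simps power2_eq_square)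

text \<open>By \<open>discr_start\<close>, an interval of allowed \<open>u\<close> that reaches
  beyond the start value has its midpoint beyond it, which gives
  \<open>\<bar>2 * x\<bar> < H\<close>. Positivity of \<open>radius_sq\<close> then leaves two sign
  patterns, one of which contradicts \<open>p + q < 2 * H\<close>.\<close>

lemma discr_pos_inside:
  assumes u: "u \<ge> ((p + q) / 2)\<^sup>2" and D: "discr H p q x u > 0"
  shows "p - H < 2 * x" "2 * x < H - q"
proof -
  define B where "B = midpoint_u H p q x"
  define S2 where "S2 = ((p + q) / 2)\<^sup>2"
  have "(u - B)\<^sup>2 < radius_sq H p q x" using D unfolding discr_def B_def by simp
  then have R: "radius_sq H p q x > 0" using zero_le_power2[of "u - B"] by linarith
  have "B > S2"
  proof (rule ccontr)
    assume "\<not> B > S2"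
    then have "(S2 - B)\<^sup>2 \<le> (u - B)\<^sup>2" using u unfolding S2_def[symmetric] by (intro power_mono) auto
    then have "discr H p q x u \<le> discr H p q x S2" unfolding discr_def B_def by simp
    then show False using D discr_start[of x] unfolding S2_def by simp
  qed
  then have "H\<^sup>2 - (2 * x)\<^sup>2 - p * q > 0" using midpoint_start[of x] unfolding B_def S2_def by linarith
  then have "(2 * x)\<^sup>2 < H\<^sup>2" using mult_nonneg_nonneg[OF pq] by linarith
  moreover have Hpos: "H > 0" using pq H by linarith
  ultimately have x: "\<bar>2 * x\<bar> < H" by (metis abs_of_pos power2_less_imp_less abs_ge_zero power2_abs)
  have sq: "(H - 2 * x)\<^sup>2 - q\<^sup>2 = (H - 2 * x - q) * (H - 2 * x + q)" "(H + 2 * x)\<^sup>2 - p\<^sup>2 = (H + 2 * x - p) * (H + 2 * x + p)"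
    by (simp_all add: power2_eq_square algebra_simps)
  have pos: "H - 2 * x + q > 0" "H + 2 * x + p > 0" using x pq by auto
  have "((H - 2 * x)\<^sup>2 - q\<^sup>2) * ((H + 2 * x)\<^sup>2 - p\<^sup>2) > 0" using R unfolding radius_sq_def by simp
  then have "(H - 2 * x - q) * (H + 2 * x - p) * ((H - 2 * x + q) * (H + 2 * x + p)) > 0"
    unfolding sq by (simp add: mult_ac)
  then have "(H - 2 * x - q) * (H + 2 * x - p) > 0"
    by (rule zero_less_mult_pos2) (use pos in simp)
  then have "(H - 2 * x - q > 0 \<and> H + 2 * x - p > 0) \<or> (H - 2 * x - q < 0 \<and> H + 2 * x - p < 0)"
    by (simp add: zero_less_mult_iff)
  then show "p - H < 2 * x" "2 * x < H - q" using H by linarith+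
qed

text \<open>For a position inside the row the whole interval of allowed \<open>u\<close> lies above
  the start of the integration, so that only the upper limit can truncate it.\<close>

lemma inside_radius:
  assumes x: "p - H < 2 * x" "2 * x < H - q"
  shows "radius_sq H p q x > 0" "((p + q) / 2)\<^sup>2 \<le> midpoint_u H p q x - sqrt (radius_sq H p q x)"
proof -
  have q: "q\<^sup>2 < (H - 2 * x)\<^sup>2" "p\<^sup>2 < (H + 2 * x)\<^sup>2" using x pq by (auto intro: power_strict_mono)
  then show R: "radius_sq H p q x > 0" unfolding radius_sq_def by simp
  have "p * q < (H + 2 * x) * (H - 2 * x)" using x pq
    by (intro mult_strict_mono') auto
  then have B: "midpoint_u H p q x > ((p + q) / 2)\<^sup>2"
  proof -
    have "(H + 2 * x) * (H - 2 * x) = H\<^sup>2 - (2 * x)\<^sup>2" by (simp add: power2_eq_square algebra_simps)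
    then show ?thesis using midpoint_start[of x] \<open>p * q < (H + 2 * x) * (H - 2 * x)\<close> by linarith
  qed
  have "radius_sq H p q x \<le> (midpoint_u H p q x - ((p + q) / 2)\<^sup>2)\<^sup>2"
    using discr_start[of x] unfolding discr_def by (simp add: power2_commute)
  then have "sqrt (radius_sq H p q x) \<le> midpoint_u H p q x - ((p + q) / 2)\<^sup>2"
    using B by (intro real_le_lsqrt) auto
  then show "((p + q) / 2)\<^sup>2 \<le> midpoint_u H p q x - sqrt (radius_sq H p q x)" by simp
qed

text \<open>For \<open>u = (t + (p + q) / 2)\<^sup>2\<close> the numerator times \<open>dt\<close>
  is \<open>du\<close>, which leaves an arcsine law in \<open>u\<close> cut off at
  \<open>K\<^sup>2\<close>; \<open>pi\<close> times its mass is \<open>angle\<close>.\<close>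

lemma level_integral:
  assumes K: "(p + q) / 2 \<le> K"
  shows "(\<integral>\<^sup>+t. ennreal (if 0 < t \<and> t < K - (p + q) / 2 \<and> discr H p q x ((t + (p + q) / 2)\<^sup>2) > 0
      then 2 * (t + (p + q) / 2) / sqrt (discr H p q x ((t + (p + q) / 2)\<^sup>2)) else 0) \<partial>lborel)
    = (if p - H < 2 * x \<and> 2 * x < H - q
       then ennreal (angle (midpoint_u H p q x - K\<^sup>2) (radius_sq H p q x - (midpoint_u H p q x - K\<^sup>2)\<^sup>2)) else 0)"
proof (cases "p - H < 2 * x \<and> 2 * x < H - q")
  case False
  then have "\<not> discr H p q x ((t + (p + q) / 2)\<^sup>2) > 0" if "0 < t" for t
    using discr_pos_inside[of "(t + (p + q) / 2)\<^sup>2" x] that pq by (auto intro: power_mono)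
  then have "(if 0 < t \<and> t < K - (p + q) / 2 \<and> discr H p q x ((t + (p + q) / 2)\<^sup>2) > 0
      then 2 * (t + (p + q) / 2) / sqrt (discr H p q x ((t + (p + q) / 2)\<^sup>2)) else 0) = 0" for t
    by auto
  with False show ?thesis by (simp only: if_False) simp
next
  case True
  define S where "S = (p + q) / 2"
  define B where "B = midpoint_u H p q x"
  define R where "R = sqrt (radius_sq H p q x)"
  have S: "S \<ge> 0" using pq by (simp add: S_def)
  have R: "R > 0" "R\<^sup>2 = radius_sq H p q x" "S\<^sup>2 \<le> B - R" using inside_radius[of x] True unfolding R_def B_def S_def by auto
  have D: "discr H p q x u = R\<^sup>2 - (u - B)\<^sup>2" for u unfolding discr_def R(2) B_def ..
  have sq: "(u - B)\<^sup>2 < R\<^sup>2 \<longleftrightarrow> \<bar>u - B\<bar> < R" for u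
    using abs_le_square_iff[of R "u - B"] R(1) by (auto simp: not_le[symmetric])
  have Dpos: "discr H p q x u > 0 \<longleftrightarrow> \<bar>u - B\<bar> < R" for u
    unfolding D using sq by simp
  define F where "F u = (if \<bar>u - B\<bar> < R then 1 / sqrt (R\<^sup>2 - (u - B)\<^sup>2) else 0)" for u
  have [measurable]: "F \<in> borel_measurable borel" unfolding F_def by measurable
  have "(\<integral>\<^sup>+t. ennreal (if 0 < t \<and> t < K - S \<and> discr H p q x ((t + S)\<^sup>2) > 0
      then 2 * (t + S) / sqrt (discr H p q x ((t + S)\<^sup>2)) else 0) \<partial>lborel)
    = (\<integral>\<^sup>+t. F ((t + S)\<^sup>2) * (2 * (t + S)) * indicator {0..K - S} t \<partial>lborel)"
  proof (rule nn_integral_cong_AE)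
    have "AE t in lborel. t \<noteq> 0 \<and> t \<noteq> K - S"
      using AE_lborel_singleton[of 0] AE_lborel_singleton[of "K - S"] by eventually_elim simp
    then show "AE t in lborel. ennreal (if 0 < t \<and> t < K - S \<and> discr H p q x ((t + S)\<^sup>2) > 0
      then 2 * (t + S) / sqrt (discr H p q x ((t + S)\<^sup>2)) else 0) = ennreal (F ((t + S)\<^sup>2) * (2 * (t + S)) * indicator {0..K - S} t)"
      by eventually_elim (auto simp: F_def indicator_def D sq)
  qed
  also have "\<dots> = (\<integral>\<^sup>+u. F u * indicator {(0 + S)\<^sup>2..(K - S + S)\<^sup>2} u \<partial>lborel)"
  proof (rule nn_integral_substitution[symmetric])
    show "set_borel_measurable borel {(0 + S)\<^sup>2..(K - S + S)\<^sup>2} F"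
      unfolding set_borel_measurable_def by measurable
    show "((\<lambda>t. (t + S)\<^sup>2) has_real_derivative 2 * (t + S)) (at t)" for t
      by (auto intro!: derivative_eq_intros)
    show "continuous_on {0..K - S} (\<lambda>t. 2 * (t + S))" by (intro continuous_intros)
    show "2 * (t + S) \<ge> 0" if "t \<in> {0..K - S}" for t using that S by simp
    show "0 \<le> K - S" using K by (simp add: S_def)
  qed
  also have "\<dots> = (\<integral>\<^sup>+u. ennreal (indicator {..K\<^sup>2} u * (if \<bar>u - B\<bar> < R then 1 / sqrt (R\<^sup>2 - (u - B)\<^sup>2) else 0)) \<partial>lborel)"
    by (intro nn_integral_cong) (use R(3) in \<open>auto simp: F_def indicator_def\<close>)
  also have "\<dots> = (\<integral>\<^sup>+\<theta>. ennreal (indicator {..K\<^sup>2} (B + R * cos \<theta>)) * indicator {0..pi} \<theta> \<partial>lborel)"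
    by (rule arcsine_substitution) (use R in auto)
  also have "\<dots> = (\<integral>\<^sup>+\<theta>. ennreal (indicator {z. (B - K\<^sup>2) + z \<le> 0} (R * cos \<theta>)) * indicator {0..pi} \<theta> \<partial>lborel)"
    by (intro nn_integral_cong) (auto simp: indicator_def)
  also have "\<dots> = ennreal (angle (B - K\<^sup>2) (R\<^sup>2 - (B - K\<^sup>2)\<^sup>2))"
    by (rule angle_measure[OF R(1)])
  finally show ?thesis using True unfolding R(2) B_def S_def by simp
qed

end

lemma angle_bounds: "0 \<le> angle w e" "angle w e \<le> pi"
  using arctan_lbound[of "w / sqrt e"] arctan_ubound[of "w / sqrt e"] by (auto simp: angle_def)

lemma angle_measurable [measurable]:
  assumes [measurable]: "w \<in> borel_measurable M" "e \<in> borel_measurable M"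
  shows "(\<lambda>z. angle (w z) (e z)) \<in> borel_measurable M"
proof -
  have "arctan \<in> borel_measurable borel"
    by (intro borel_measurable_continuous_onI continuous_intros)
  from measurable_compose[OF _ this] have [measurable]: "(\<lambda>z. arctan (w z / sqrt (e z))) \<in> borel_measurable M"
    by simp
  show ?thesis unfolding angle_def by measurable
qed

text \<open>The density in the form produced by the integral: outside the ellipse the sign of
  \<open>Q_form\<close> decides. The constants \<open>sqrt 3\<close> and \<open>3\<close> come from
  \<open>forms_level\<close> and cancel in the quotient \<open>Q_form / sqrt E_form\<close>.\<close>

definition limit_density :: "real \<Rightarrow> real \<Rightarrow> real \<Rightarrow> point \<Rightarrow> real" where
  "limit_density \<alpha> \<beta> \<gamma> z = angle (Q_form \<alpha> \<beta> \<gamma> z / sqrt 3) (E_form \<alpha> \<beta> \<gamma> z / 3) / pi"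

lemma continuous_forms: "continuous_on A (E_form \<alpha> \<beta> \<gamma>)" "continuous_on A (Q_form \<alpha> \<beta> \<gamma>)"
  unfolding E_form_def Q_form_def case_prod_beta by (intro continuous_intros)+

lemma limit_density_bounds: "0 \<le> limit_density \<alpha> \<beta> \<gamma> z" "limit_density \<alpha> \<beta> \<gamma> z \<le> 1"
  unfolding limit_density_def using angle_bounds by (auto simp: field_simps)

lemma limit_density_measurable [measurable]: "limit_density \<alpha> \<beta> \<gamma> \<in> borel_measurable borel"
proof -
  have [measurable]: "E_form \<alpha> \<beta> \<gamma> \<in> borel_measurable borel" "Q_form \<alpha> \<beta> \<gamma> \<in> borel_measurable borel"
    by (intro borel_measurable_continuous_onI continuous_forms)+
  show ?thesis unfolding limit_density_def[abs_def] by measurable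
qed

lemma closed_hexagon: "closed (hexagon \<alpha> \<beta> \<gamma>)"
  unfolding hexagon_def case_prod_beta
  by (intro closed_Collect_conj closed_Collect_le continuous_intros)

section \<open>The double integral over the hexagon\<close>

context
  fixes \<alpha> \<beta> \<gamma> :: real
  assumes greek: "\<alpha> > 0" "\<beta> > 0" "\<gamma> > 0"
begin

abbreviation (input) "half_H \<equiv> (\<alpha> + 2 * \<beta> + \<gamma>) / 2"
abbreviation (input) "half_K \<equiv> (\<alpha> + \<gamma>) / 2"
abbreviation (input) "level Y \<equiv> sqrt 3 / 4 * (\<gamma> - \<alpha>) + sqrt 3 / 2 * Y"

text \<open>Origin of the two forms: \<open>half_K\<^sup>2\<close> is the value of \<open>u\<close>
  at the largest degree of a row. Up to constants, \<open>Q_form\<close> is the signed distance from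
  there to the midpoint and \<open>E_form\<close> the discriminant there. The auxiliary
  \<open>w\<close> is the height in units of \<open>sqrt 3 / 2\<close>; squares remove the absolute
  values.\<close>

lemma forms_level:
  "midpoint_u half_H \<bar>Y\<bar> \<bar>Y - (\<alpha> - \<gamma>)\<bar> x - half_K\<^sup>2 = Q_form \<alpha> \<beta> \<gamma> (x, level Y) / sqrt 3"
  "radius_sq half_H \<bar>Y\<bar> \<bar>Y - (\<alpha> - \<gamma>)\<bar> x - (midpoint_u half_H \<bar>Y\<bar> \<bar>Y - (\<alpha> - \<gamma>)\<bar> x - half_K\<^sup>2)\<^sup>2
    = E_form \<alpha> \<beta> \<gamma> (x, level Y) / 3"
proof -
  define w where "w = Y + (\<gamma> - \<alpha>) / 2"
  have y: "level Y = sqrt 3 / 2 * w" unfolding w_def by (simp add: algebra_simps)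
  have y2: "(level Y)\<^sup>2 = 3 / 4 * w\<^sup>2" unfolding y by (simp add: power_mult_distrib power_divide)
  have Y: "Y = w - (\<gamma> - \<alpha>) / 2" unfolding w_def by simp
  show 1: "midpoint_u half_H \<bar>Y\<bar> \<bar>Y - (\<alpha> - \<gamma>)\<bar> x - half_K\<^sup>2 = Q_form \<alpha> \<beta> \<gamma> (x, level Y) / sqrt 3"
    unfolding midpoint_u_def Q_form_def prod.case y2 unfolding Y by (simp add: field_simps power2_eq_square)
  have xy: "2 * sqrt 3 * (\<alpha> + 2 * \<beta> + \<gamma>) * (\<alpha> - \<gamma>) * x * level Y = 3 * (\<alpha> + 2 * \<beta> + \<gamma>) * (\<alpha> - \<gamma>) * x * w"
  proof -
    have e: "2 * r * k * l * x * (r / 2 * w) = (r * r) * (k * l * x * w)" for r k l :: real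
      by (simp add: field_simps)
    show ?thesis unfolding y e by simp
  qed
  show "radius_sq half_H \<bar>Y\<bar> \<bar>Y - (\<alpha> - \<gamma>)\<bar> x - (midpoint_u half_H \<bar>Y\<bar> \<bar>Y - (\<alpha> - \<gamma>)\<bar> x - half_K\<^sup>2)\<^sup>2
    = E_form \<alpha> \<beta> \<gamma> (x, level Y) / 3"
    unfolding radius_sq_def midpoint_u_def E_form_def prod.case y2 xy power2_abs unfolding Y
    by (simp add: field_simps power2_eq_square)
qed

lemma hexagon_level:
  "(x, level Y) \<in> hexagon \<alpha> \<beta> \<gamma> \<longleftrightarrow> - \<gamma> \<le> Y \<and> Y \<le> \<alpha> \<and> \<bar>Y\<bar> - half_H \<le> 2 * x \<and> 2 * x \<le> half_H - \<bar>Y - (\<alpha> - \<gamma>)\<bar>"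
proof -
  define r :: real where "r = sqrt 3"
  have r: "r > 0" by (simp add: r_def)
  define Z where "Z = (\<gamma> - \<alpha>) / 4 + Y / 2"
  have y: "level Y = r * Z" unfolding Z_def r_def by (simp add: algebra_simps)
  have m: "r * Z \<le> r / 2 * W \<longleftrightarrow> 2 * Z \<le> W" "r * Z \<le> r / 4 * W \<longleftrightarrow> 4 * Z \<le> W"
    "r / 2 * W \<le> r * Z \<longleftrightarrow> W \<le> 2 * Z" "- r / 4 * W \<le> r * Z \<longleftrightarrow> - W \<le> 4 * Z" for W
    using mult_le_cancel_left_pos[OF r, of Z "W / 2"] mult_le_cancel_left_pos[OF r, of Z "W / 4"]
      mult_le_cancel_left_pos[OF r, of "W / 2" Z] mult_le_cancel_left_pos[OF r, of "- W / 4" Z]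
    by auto
  show ?thesis
    unfolding y unfolding hexagon_def r_def[symmetric] mem_Collect_eq prod.case m unfolding Z_def by (auto simp: field_simps abs_if split: if_splits)
qed

text \<open>On each linear piece \<open>size_lim\<close> falls short of \<open>half_K\<close> by
  exactly \<open>(p + q) / 2\<close>; in the variable \<open>u\<close> the cut-off is therefore the
  same for all rows.\<close>

lemma half_facts:
  assumes "- \<gamma> < Y" "Y < \<alpha>"
  shows "\<bar>Y\<bar> + \<bar>Y - (\<alpha> - \<gamma>)\<bar> < 2 * half_H" "(\<bar>Y\<bar> + \<bar>Y - (\<alpha> - \<gamma>)\<bar>) / 2 \<le> half_K"
    "size_lim \<alpha> \<gamma> Y = half_K - (\<bar>Y\<bar> + \<bar>Y - (\<alpha> - \<gamma>)\<bar>) / 2"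
    "size_lim \<alpha> \<gamma> Y + \<beta> = half_H - (\<bar>Y\<bar> + \<bar>Y - (\<alpha> - \<gamma>)\<bar>) / 2"
  using assms greek by (auto simp: size_lim_def abs_if max_def field_simps split: if_splits)

context
  fixes f :: "point \<Rightarrow> real" and Cf :: real
  assumes f_cont: "continuous_on UNIV f" and f_nonneg: "\<And>z. f z \<ge> 0" and f_bound: "\<And>z. f z \<le> Cf"
begin

lemma f_measurable [measurable]: "f \<in> borel_measurable borel"
  by (rule borel_measurable_continuous_onI[OF f_cont])

text \<open>By \<open>lim_AC_identity\<close> this is \<open>pi\<close> times the density at
  \<open>x\<close> of the arcsine law of index \<open>t\<close>, written so that it can also be
  integrated over \<open>t\<close> with \<open>x\<close> fixed.\<close>

definition kernel :: "real \<Rightarrow> real \<Rightarrow> real \<Rightarrow> real" where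
  "kernel Y t x = (let p = \<bar>Y\<bar>; q = \<bar>Y - (\<alpha> - \<gamma>)\<bar> in
     if discr half_H p q x ((t + (p + q) / 2)\<^sup>2) > 0 then 2 * (t + (p + q) / 2) / sqrt (discr half_H p q x ((t + (p + q) / 2)\<^sup>2)) else 0)"

lemma kernel_measurable [measurable]:
  "(\<lambda>(t, x). kernel Y t x) \<in> borel_measurable (borel \<Otimes>\<^sub>M borel)"
  unfolding kernel_def discr_def radius_sq_def midpoint_u_def Let_def by measurable

lemma arc_lim_kernel:
  assumes Y: "- \<gamma> < Y" "Y < \<alpha>" and t: "t > 0" "t < size_lim \<alpha> \<gamma> Y"
  shows "ennreal (arc_lim f \<alpha> \<beta> \<gamma> Y t) = (\<integral>\<^sup>+x. ennreal (f (x, level Y) / pi * kernel Y t x) \<partial>lborel)"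
    "arc_lim f \<alpha> \<beta> \<gamma> Y t \<ge> 0"
proof -
  define p q m where "p = \<bar>Y\<bar>" and "q = \<bar>Y - (\<alpha> - \<gamma>)\<bar>" and "m = size_lim \<alpha> \<gamma> Y + \<beta>"
  define \<kappa> where "\<kappa> = t + (p + q) / 2"
  define A C where "A = lim_A p q m t" and "C = lim_C p q m t"
  define r where "r = 2 * sqrt (A * C)"
  define \<mu> where "\<mu> = A + C + p / 2 - half_H / 2"
  have pq: "p \<ge> 0" "q \<ge> 0" by (simp_all add: p_def q_def)
  have \<kappa>: "\<kappa> > 0" using t pq by (simp add: \<kappa>_def add_pos_nonneg)
  have m: "m = half_H - (p + q) / 2" using half_facts(4)[OF Y] by (simp add: m_def p_def q_def)
  have tm: "t < m" using t greek by (simp add: m_def)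
  have AC: "A * C > 0" unfolding A_def C_def lim_A_def lim_C_def
    using pq t tm by (intro mult_pos_pos divide_pos_pos zero_less_power) auto
  have r: "r > 0" "r\<^sup>2 = 4 * (A * C)" using AC by (simp_all add: r_def power_mult_distrib)
  have id: "r\<^sup>2 - (x - \<mu>)\<^sup>2 = discr half_H p q x (\<kappa>\<^sup>2) / (4 * \<kappa>\<^sup>2)" for x
    unfolding r(2) \<mu>_def A_def C_def by (rule lim_AC_identity[OF \<kappa>_def \<kappa> m])
  define g where "g x = f (x, level Y)" for x
  have [measurable]: "g \<in> borel_measurable borel" unfolding g_def by measurable
  have cont: "continuous_on {0..pi} (\<lambda>\<theta>. g (\<mu> + r * cos \<theta>))"
    unfolding g_def by (intro continuous_on_compose2[OF f_cont] continuous_intros) auto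
  have am: "arc_lim f \<alpha> \<beta> \<gamma> Y t = (1 / pi) * integral {0..pi} (\<lambda>\<theta>. g (\<mu> + r * cos \<theta>))"
  proof -
    have e: "A + C + r * cos \<theta> + (p / 2 - (\<alpha> + 2 * \<beta> + \<gamma>) / 4) = \<mu> + r * cos \<theta>" for \<theta> by (simp add: \<mu>_def)
    show ?thesis
      unfolding arc_lim_def arcsine_mean_def Let_def g_def p_def[symmetric] q_def[symmetric] m_def[symmetric] A_def[symmetric] C_def[symmetric] r_def[symmetric] e
      by (rule refl)
  qed
  have "set_integrable lborel {0..pi} (\<lambda>\<theta>. g (\<mu> + r * cos \<theta>))"
    unfolding set_integrable_def by (rule borel_integrable_compact[OF compact_Icc cont])
  then have int: "integrable lborel (\<lambda>\<theta>. indicator {0..pi} \<theta> *\<^sub>R g (\<mu> + r * cos \<theta>))"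
    and eqi: "(LINT \<theta>:{0..pi}|lborel. g (\<mu> + r * cos \<theta>)) = integral {0..pi} (\<lambda>\<theta>. g (\<mu> + r * cos \<theta>))"
    by (auto simp: set_integrable_def intro: set_borel_integral_eq_integral)
  have g0: "g x \<ge> 0" for x by (simp add: g_def f_nonneg)
  have I0: "integral {0..pi} (\<lambda>\<theta>. g (\<mu> + r * cos \<theta>)) \<ge> 0"
    unfolding eqi[symmetric] set_lebesgue_integral_def by (rule integral_nonneg_AE) (simp add: g0)
  then show "arc_lim f \<alpha> \<beta> \<gamma> Y t \<ge> 0" unfolding am by simp
  have "ennreal (arc_lim f \<alpha> \<beta> \<gamma> Y t) = ennreal (1 / pi) * ennreal (integral {0..pi} (\<lambda>\<theta>. g (\<mu> + r * cos \<theta>)))"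
    unfolding am by (rule ennreal_mult) (use I0 in auto)
  also have "ennreal (integral {0..pi} (\<lambda>\<theta>. g (\<mu> + r * cos \<theta>))) = (\<integral>\<^sup>+\<theta>. ennreal (indicator {0..pi} \<theta> *\<^sub>R g (\<mu> + r * cos \<theta>)) \<partial>lborel)"
    unfolding eqi[symmetric] set_lebesgue_integral_def
    by (rule nn_integral_eq_integral[symmetric, OF int]) (simp add: g0)
  also have "\<dots> = (\<integral>\<^sup>+\<theta>. ennreal (g (\<mu> + r * cos \<theta>)) * indicator {0..pi} \<theta> \<partial>lborel)"
    by (intro nn_integral_cong) (auto simp: indicator_def)
  also have "\<dots> = (\<integral>\<^sup>+x. ennreal (g x * (if \<bar>x - \<mu>\<bar> < r then 1 / sqrt (r\<^sup>2 - (x - \<mu>)\<^sup>2) else 0)) \<partial>lborel)"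
    by (rule arcsine_substitution[symmetric]) (use g0 r in auto)
  also have "\<dots> = (\<integral>\<^sup>+x. ennreal (g x * kernel Y t x) \<partial>lborel)"
  proof (intro nn_integral_cong arg_cong[where f = ennreal] arg_cong2[where f = times] refl)
    fix x
    define D where "D = discr half_H p q x (\<kappa>\<^sup>2)"
    have "\<bar>x - \<mu>\<bar> < r \<longleftrightarrow> r\<^sup>2 - (x - \<mu>)\<^sup>2 > 0"
      using abs_le_square_iff[of r "x - \<mu>"] r(1) by (auto simp: not_le[symmetric])
    also have "\<dots> \<longleftrightarrow> D > 0" unfolding id D_def[symmetric] using \<kappa> by (simp add: zero_less_divide_iff)
    finally have iff: "\<bar>x - \<mu>\<bar> < r \<longleftrightarrow> D > 0" .
    have "sqrt (4 * \<kappa>\<^sup>2) = 2 * \<kappa>" using \<kappa> by (simp add: real_sqrt_mult)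
    then show "(if \<bar>x - \<mu>\<bar> < r then 1 / sqrt (r\<^sup>2 - (x - \<mu>)\<^sup>2) else 0) = kernel Y t x"
      unfolding iff id kernel_def Let_def p_def[symmetric] q_def[symmetric] \<kappa>_def[symmetric] D_def[symmetric]
      by (simp add: real_sqrt_divide)
  qed
  also have "ennreal (1 / pi) * \<dots> = (\<integral>\<^sup>+x. ennreal (f (x, level Y) / pi * kernel Y t x) \<partial>lborel)"
  proof -
    have km: "(\<lambda>x. kernel Y t x) \<in> borel_measurable borel"
      using measurable_compose[OF _ kernel_measurable, of "\<lambda>x. (t, x)" borel Y] by simp
    have k0: "kernel Y t x \<ge> 0" for x
      unfolding kernel_def Let_def using t by auto
    show ?thesis
      using km g0 k0
      by (subst nn_integral_cmult[symmetric]) (auto intro!: nn_integral_cong simp: ennreal_mult[symmetric] g_def)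
  qed
  finally show "ennreal (arc_lim f \<alpha> \<beta> \<gamma> Y t) = (\<integral>\<^sup>+x. ennreal (f (x, level Y) / pi * kernel Y t x) \<partial>lborel)" .
qed

definition density_on :: "point \<Rightarrow> real" where
  "density_on z = f z * limit_density \<alpha> \<beta> \<gamma> z * indicator (hexagon \<alpha> \<beta> \<gamma>) z"

lemma density_on_measurable [measurable]: "density_on \<in> borel_measurable borel"
proof -
  have [measurable]: "hexagon \<alpha> \<beta> \<gamma> \<in> sets borel" by (rule borel_closed[OF closed_hexagon])
  show ?thesis unfolding density_on_def[abs_def] by measurable
qed

lemma density_on_bounds: "0 \<le> density_on z" "density_on z \<le> Cf"
proof -
  show "0 \<le> density_on z" unfolding density_on_def using f_nonneg limit_density_bounds by simp
  have "f z * (limit_density \<alpha> \<beta> \<gamma> z * indicator (hexagon \<alpha> \<beta> \<gamma>) z) \<le> Cf * 1"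
    using f_nonneg[of z] f_bound[of z] limit_density_bounds[of \<alpha> \<beta> \<gamma> z]
    by (intro mult_mono) (auto simp: indicator_def)
  then show "density_on z \<le> Cf" unfolding density_on_def by (simp add: mult.assoc)
qed

lemma level_measurable [measurable]: "(\<lambda>x. density_on (x, y)) \<in> borel_measurable borel"
  by measurable

abbreviation (input) "row_mass Y \<equiv> (\<integral>\<^sup>+x. ennreal (density_on (x, level Y)) \<partial>lborel)"

lemma row_mass_finite: "row_mass Y < \<infinity>"
proof -
  have "row_mass Y \<le> (\<integral>\<^sup>+x. ennreal Cf * indicator {- half_H / 2..half_H / 2} x \<partial>lborel)"
  proof (intro nn_integral_mono)
    fix x
    show "ennreal (density_on (x, level Y)) \<le> ennreal Cf * indicator {- half_H / 2..half_H / 2} x"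
    proof (cases "(x, level Y) \<in> hexagon \<alpha> \<beta> \<gamma>")
      case True
      then have "\<bar>Y\<bar> - half_H \<le> 2 * x" "2 * x \<le> half_H - \<bar>Y - (\<alpha> - \<gamma>)\<bar>"
        unfolding hexagon_level by auto
      then have "x \<in> {- half_H / 2..half_H / 2}"
        using abs_ge_zero[of Y] abs_ge_zero[of "Y - (\<alpha> - \<gamma>)"] by (simp only: atLeastAtMost_iff) linarith
      then show ?thesis using density_on_bounds(2) by (simp add: ennreal_leI)
    qed (simp add: density_on_def)
  qed
  also have "\<dots> < \<infinity>"
    by (subst nn_integral_cmult_indicator) (auto simp: emeasure_lborel_Icc_eq ennreal_mult_less_top)
  finally show ?thesis .
qed

text \<open>The arcsine densities are integrated over \<open>t\<close> first, at fixed
  \<open>x\<close>, by \<open>level_integral\<close>. The ends of the row are left out as a null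
  set, because the inequalities there are strict whereas the hexagon is closed.\<close>

lemma row_mass_eq:
  assumes Y: "- \<gamma> < Y" "Y < \<alpha>"
  shows "(\<integral>\<^sup>+t. ennreal (if 0 < t \<and> t < size_lim \<alpha> \<gamma> Y then arc_lim f \<alpha> \<beta> \<gamma> Y t else 0) \<partial>lborel) = row_mass Y"
    "(\<lambda>t. if 0 < t \<and> t < size_lim \<alpha> \<gamma> Y then arc_lim f \<alpha> \<beta> \<gamma> Y t else 0) \<in> borel_measurable lborel"
proof -
  define p q N where "p = \<bar>Y\<bar>" and "q = \<bar>Y - (\<alpha> - \<gamma>)\<bar>" and "N = size_lim \<alpha> \<gamma> Y"
  define Ft where "Ft t x = (if 0 < t \<and> t < N then kernel Y t x else 0)" for t x
  have [measurable]: "(\<lambda>(t, x). Ft t x) \<in> borel_measurable (borel \<Otimes>\<^sub>M borel)"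
  proof -
    have "(\<lambda>(t, x). Ft t x) = (\<lambda>z. if 0 < fst z \<and> fst z < N then (\<lambda>(t, x). kernel Y t x) z else 0)"
      by (auto simp: Ft_def fun_eq_iff)
    then show ?thesis using kernel_measurable[of Y] by (simp only:) measurable
  qed
  have [measurable]: "(\<lambda>x. f (x, level Y)) \<in> borel_measurable borel" by measurable
  have joint: "(\<lambda>(t, x). ennreal (f (x, level Y) / pi * Ft t x)) \<in> borel_measurable (lborel \<Otimes>\<^sub>M lborel)"
    by measurable
  have F0: "Ft t x \<ge> 0" for t x unfolding Ft_def kernel_def Let_def by auto
  have eq: "ennreal (if 0 < t \<and> t < N then arc_lim f \<alpha> \<beta> \<gamma> Y t else 0) = (\<integral>\<^sup>+x. ennreal (f (x, level Y) / pi * Ft t x) \<partial>lborel)" for t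
    using arc_lim_kernel(1)[OF Y, of t] unfolding Ft_def N_def by auto
  have "(\<lambda>t. enn2real (\<integral>\<^sup>+x. ennreal (f (x, level Y) / pi * Ft t x) \<partial>lborel)) \<in> borel_measurable lborel"
    using lborel.borel_measurable_nn_integral[OF joint] by measurable
  also have "(\<lambda>t. enn2real (\<integral>\<^sup>+x. ennreal (f (x, level Y) / pi * Ft t x) \<partial>lborel)) = (\<lambda>t. if 0 < t \<and> t < N then arc_lim f \<alpha> \<beta> \<gamma> Y t else 0)"
    unfolding eq[symmetric] using arc_lim_kernel(2)[OF Y] by (auto simp: fun_eq_iff N_def)
  finally show "(\<lambda>t. if 0 < t \<and> t < size_lim \<alpha> \<gamma> Y then arc_lim f \<alpha> \<beta> \<gamma> Y t else 0) \<in> borel_measurable lborel"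
    unfolding N_def .
  have "(\<integral>\<^sup>+t. ennreal (if 0 < t \<and> t < N then arc_lim f \<alpha> \<beta> \<gamma> Y t else 0) \<partial>lborel)
    = (\<integral>\<^sup>+t. \<integral>\<^sup>+x. ennreal (f (x, level Y) / pi * Ft t x) \<partial>lborel \<partial>lborel)"
    unfolding eq ..
  also have "\<dots> = (\<integral>\<^sup>+x. \<integral>\<^sup>+t. ennreal (f (x, level Y) / pi * Ft t x) \<partial>lborel \<partial>lborel)"
    by (rule lborel_pair.Fubini'[symmetric, OF joint])
  also have "\<dots> = (\<integral>\<^sup>+x. ennreal (density_on (x, level Y)) \<partial>lborel)"
  proof (rule nn_integral_cong_AE)
    have "AE x in lborel. x \<noteq> (p - half_H) / 2 \<and> x \<noteq> (half_H - q) / 2"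
      using AE_lborel_singleton[of "(p - half_H) / 2"] AE_lborel_singleton[of "(half_H - q) / 2"] by eventually_elim simp
    then show "AE x in lborel. (\<integral>\<^sup>+t. ennreal (f (x, level Y) / pi * Ft t x) \<partial>lborel) = ennreal (density_on (x, level Y))"
    proof eventually_elim
      case (elim x)
      have [measurable]: "(\<lambda>t. Ft t x) \<in> borel_measurable borel" by measurable
      have "(\<integral>\<^sup>+t. ennreal (f (x, level Y) / pi * Ft t x) \<partial>lborel) = ennreal (f (x, level Y) / pi) * (\<integral>\<^sup>+t. ennreal (Ft t x) \<partial>lborel)"
      proof -
        define k where "k = f (x, level Y) / pi"
        have "k \<ge> 0" unfolding k_def using f_nonneg by simp
        then show ?thesis unfolding k_def[symmetric]
          using F0 by (subst nn_integral_cmult[symmetric]) (auto simp: ennreal_mult)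
      qed
      also have "(\<integral>\<^sup>+t. ennreal (Ft t x) \<partial>lborel) = (\<integral>\<^sup>+t. ennreal (if 0 < t \<and> t < half_K - (p + q) / 2 \<and> discr half_H p q x ((t + (p + q) / 2)\<^sup>2) > 0
          then 2 * (t + (p + q) / 2) / sqrt (discr half_H p q x ((t + (p + q) / 2)\<^sup>2)) else 0) \<partial>lborel)"
        using half_facts(3)[OF Y]
        by (intro nn_integral_cong) (auto simp: Ft_def kernel_def Let_def p_def q_def N_def)
      also have "\<dots> = (if p - half_H < 2 * x \<and> 2 * x < half_H - q
         then ennreal (angle (midpoint_u half_H p q x - half_K\<^sup>2) (radius_sq half_H p q x - (midpoint_u half_H p q x - half_K\<^sup>2)\<^sup>2)) else 0)"
        by (rule level_integral) (use half_facts(1,2)[OF Y] in \<open>auto simp: p_def q_def\<close>)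
      also have "\<dots> = (if p - half_H < 2 * x \<and> 2 * x < half_H - q then ennreal (pi * limit_density \<alpha> \<beta> \<gamma> (x, level Y)) else 0)"
        unfolding p_def q_def unfolding forms_level(2) unfolding forms_level(1) limit_density_def by simp
      also have "ennreal (f (x, level Y) / pi) * \<dots> = ennreal (density_on (x, level Y))"
      proof (cases "p - half_H < 2 * x \<and> 2 * x < half_H - q")
        case True
        then have "(x, level Y) \<in> hexagon \<alpha> \<beta> \<gamma>" unfolding hexagon_level using Y by (auto simp: p_def q_def)
        then show ?thesis using True f_nonneg limit_density_bounds
          by (simp add: density_on_def ennreal_mult[symmetric])
      next
        case False
        then have "(x, level Y) \<notin> hexagon \<alpha> \<beta> \<gamma>" unfolding hexagon_level p_def[symmetric] q_def[symmetric] using elim by auto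
        then have "density_on (x, level Y) = 0" unfolding density_on_def by simp
        then show ?thesis unfolding if_not_P[OF False] by simp
      qed
      finally show ?case .
    qed
  qed
  finally show "(\<integral>\<^sup>+t. ennreal (if 0 < t \<and> t < size_lim \<alpha> \<gamma> Y then arc_lim f \<alpha> \<beta> \<gamma> Y t else 0) \<partial>lborel) = row_mass Y"
    unfolding N_def .
qed

text \<open>The factor \<open>2 / sqrt 3\<close> is the inverse Jacobian of \<open>level\<close>, as
  neighbouring lattice rows have distance \<open>sqrt 3 / 2\<close>. The passage through nonnegative
  integrals makes the exchange of variables free of integrability conditions.\<close>

lemma limit_integral:
  "(LINT Y|lborel. (if - \<gamma> < Y \<and> Y < \<alpha> then
      (LINT t|lborel. (if 0 < t \<and> t < size_lim \<alpha> \<gamma> Y then arc_lim f \<alpha> \<beta> \<gamma> Y t else 0)) else 0))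
    = 2 / sqrt 3 * (LINT z|lborel. density_on z)"
proof -
  have inner: "(LINT t|lborel. (if 0 < t \<and> t < size_lim \<alpha> \<gamma> Y then arc_lim f \<alpha> \<beta> \<gamma> Y t else 0)) = enn2real (row_mass Y)"
    if Y: "- \<gamma> < Y" "Y < \<alpha>" for Y
    using row_mass_eq[OF Y] arc_lim_kernel(2)[OF Y]
    by (subst integral_eq_nn_integral) auto
  have rm [measurable]: "row_mass \<in> borel_measurable borel"
  proof -
    have "(\<lambda>(Y, x). ennreal (density_on (x, level Y))) \<in> borel_measurable (borel \<Otimes>\<^sub>M lborel)" by measurable
    from lborel.borel_measurable_nn_integral[OF this] show ?thesis by simp
  qed
  have "(LINT Y|lborel. (if - \<gamma> < Y \<and> Y < \<alpha> then
      (LINT t|lborel. (if 0 < t \<and> t < size_lim \<alpha> \<gamma> Y then arc_lim f \<alpha> \<beta> \<gamma> Y t else 0)) else 0))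
    = (LINT Y|lborel. (if - \<gamma> < Y \<and> Y < \<alpha> then enn2real (row_mass Y) else 0))"
    by (intro Bochner_Integration.integral_cong refl) (auto simp: inner)
  also have "\<dots> = enn2real (\<integral>\<^sup>+Y. ennreal (if - \<gamma> < Y \<and> Y < \<alpha> then enn2real (row_mass Y) else 0) \<partial>lborel)"
    by (rule integral_eq_nn_integral) auto
  also have "(\<integral>\<^sup>+Y. ennreal (if - \<gamma> < Y \<and> Y < \<alpha> then enn2real (row_mass Y) else 0) \<partial>lborel) = (\<integral>\<^sup>+Y. row_mass Y \<partial>lborel)"
  proof (rule nn_integral_cong_AE)
    have "AE Y in lborel. Y \<noteq> - \<gamma> \<and> Y \<noteq> \<alpha>"
      using AE_lborel_singleton[of "- \<gamma>"] AE_lborel_singleton[of \<alpha>] by eventually_elim simp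
    then show "AE Y in lborel. ennreal (if - \<gamma> < Y \<and> Y < \<alpha> then enn2real (row_mass Y) else 0) = row_mass Y"
    proof eventually_elim
      case (elim Y)
      show ?case
      proof (cases "- \<gamma> < Y \<and> Y < \<alpha>")
        case True
        then show ?thesis using row_mass_finite[of Y] by (simp add: ennreal_enn2real)
      next
        case False
        then have "(x, level Y) \<notin> hexagon \<alpha> \<beta> \<gamma>" for x unfolding hexagon_level using elim by auto
        with False show ?thesis by (simp add: density_on_def)
      qed
    qed
  qed
  finally have L: "(LINT Y|lborel. (if - \<gamma> < Y \<and> Y < \<alpha> then
      (LINT t|lborel. (if 0 < t \<and> t < size_lim \<alpha> \<gamma> Y then arc_lim f \<alpha> \<beta> \<gamma> Y t else 0)) else 0)) = enn2real (\<integral>\<^sup>+Y. row_mass Y \<partial>lborel)" .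
  have "(LINT z|lborel. density_on z) = enn2real (\<integral>\<^sup>+z. ennreal (density_on z) \<partial>lborel)"
    by (rule integral_eq_nn_integral) (auto simp: density_on_bounds)
  also have "(\<integral>\<^sup>+z. ennreal (density_on z) \<partial>lborel) = (\<integral>\<^sup>+z. ennreal (density_on z) \<partial>(lborel \<Otimes>\<^sub>M lborel))"
    by (simp add: lborel_prod)
  also have "\<dots> = (\<integral>\<^sup>+y. \<integral>\<^sup>+x. ennreal (density_on (x, y)) \<partial>lborel \<partial>lborel)"
    by (rule lborel_pair.nn_integral_snd[symmetric]) (simp add: lborel_prod)
  also have "\<dots> = ennreal \<bar>sqrt 3 / 2\<bar> * (\<integral>\<^sup>+Y. row_mass Y \<partial>lborel)"
  proof (rule nn_integral_real_affine)
    have "(\<lambda>(y, x). ennreal (density_on (x, y))) \<in> borel_measurable (borel \<Otimes>\<^sub>M lborel)" by measurable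
    from lborel.borel_measurable_nn_integral[OF this]
    show "(\<lambda>y. \<integral>\<^sup>+x. ennreal (density_on (x, y)) \<partial>lborel) \<in> borel_measurable borel" by simp
  qed simp
  finally have "(LINT z|lborel. density_on z) = sqrt 3 / 2 * enn2real (\<integral>\<^sup>+Y. row_mass Y \<partial>lborel)"
    unfolding enn2real_mult by (simp only: enn2real_ennreal abs_of_nonneg abs_ge_zero real_sqrt_ge_zero) simp
  then show ?thesis unfolding L by (simp only:) simp
qed

end

end

section \<open>The regions outside the ellipse\<close>

lemma convex_hexagon: "convex (hexagon \<alpha> \<beta> \<gamma>)"
proof -
  let ?r = "sqrt 3 :: real"
  have eq: "hexagon \<alpha> \<beta> \<gamma> = {z. inner (- ?r, 1) z \<le> ?r / 2 * (\<beta> + \<gamma>)} \<inter> {z. inner (0, 1) z \<le> ?r / 4 * (\<alpha> + \<gamma>)}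
    \<inter> {z. inner (?r, 1) z \<le> ?r / 2 * (\<alpha> + \<beta>)} \<inter> {z. inner (- ?r, 1) z \<ge> - (?r / 2 * (\<beta> + \<gamma>))}
    \<inter> {z. inner (0, 1) z \<ge> - (?r / 4 * (\<alpha> + \<gamma>))} \<inter> {z. inner (?r, 1) z \<ge> - (?r / 2 * (\<alpha> + \<beta>))}"
    unfolding hexagon_def by (auto simp: inner_prod_def field_simps)
  show ?thesis unfolding eq
    by (intro convex_Int convex_halfspace_le convex_halfspace_ge)
qed

lemma hexagon_uminus: "- z \<in> hexagon \<alpha> \<beta> \<gamma> \<longleftrightarrow> z \<in> hexagon \<alpha> \<beta> \<gamma>"
  by (cases z) (auto simp: hexagon_def field_simps)

lemma forms_uminus: "E_form \<alpha> \<beta> \<gamma> (- z) = E_form \<alpha> \<beta> \<gamma> z" "Q_form \<alpha> \<beta> \<gamma> (- z) = Q_form \<alpha> \<beta> \<gamma> z"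
  by (cases z; simp add: E_form_def Q_form_def)+

lemma connected_sign:
  fixes Q :: "'a::topological_space \<Rightarrow> real"
  assumes "connected C" "continuous_on C Q" "\<And>z. z \<in> C \<Longrightarrow> Q z \<noteq> 0" "x \<in> C" "y \<in> C" "Q x < 0"
  shows "Q y < 0"
proof (rule ccontr)
  assume "\<not> Q y < 0"
  then have "0 \<in> {Q x..Q y}" using assms(6) by simp
  moreover have "{Q x..Q y} \<subseteq> Q ` C"
    using assms by (intro connected_contains_Icc connected_continuous_image) auto
  ultimately show False using assms(3) by auto
qed

context
  fixes \<alpha> \<beta> \<gamma> :: real
  assumes greek: "\<alpha> > 0" "\<beta> > 0" "\<gamma> > 0"
begin

abbreviation (input) "hex \<equiv> hexagon \<alpha> \<beta> \<gamma>"
abbreviation (input) "E \<equiv> E_form \<alpha> \<beta> \<gamma>"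
abbreviation (input) "Q \<equiv> Q_form \<alpha> \<beta> \<gamma>"

definition left_vertex :: point where
  "left_vertex = (- (\<alpha> + 2 * \<beta> + \<gamma>) / 4, sqrt 3 / 4 * (\<gamma> - \<alpha>))"

text \<open>The line \<open>polar z = E_max\<close> is the polar of the leftmost vertex with respect to the ellipse.\<close>

definition polar :: "point \<Rightarrow> real" where
  "polar = (\<lambda>(x, y). \<alpha> * \<gamma> * (sqrt 3 * (\<alpha> - \<gamma>) * y - 3 * (\<alpha> + 2 * \<beta> + \<gamma>) * x))"

abbreviation (input) "E_max \<equiv> 3 * \<alpha> * \<beta> * \<gamma> * (\<alpha> + \<beta> + \<gamma>)"

text \<open>Scaling the second coordinate by \<open>sqrt 3\<close> removes the irrational
  coefficients, so the identities below reduce to polynomial algebra.\<close>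

lemma forms_sqrt3:
  "E (x, sqrt 3 * u) = E_max - (3 * (\<alpha> + \<gamma>)\<^sup>2 * x\<^sup>2 - 6 * (\<alpha> + 2 * \<beta> + \<gamma>) * (\<alpha> - \<gamma>) * x * u
      + 3 * ((\<alpha> + 2 * \<beta> + \<gamma>)\<^sup>2 - 4 * \<alpha> * \<gamma>) * u\<^sup>2)"
  "2 * sqrt 3 * Q (x, sqrt 3 * u) = 3 * (4 * u\<^sup>2 - 4 * x\<^sup>2 + \<beta>\<^sup>2 + \<alpha> * \<beta> + \<beta> * \<gamma> - \<alpha> * \<gamma>)"
  "polar (x, sqrt 3 * u) = 3 * \<alpha> * \<gamma> * ((\<alpha> - \<gamma>) * u - (\<alpha> + 2 * \<beta> + \<gamma>) * x)"
proof -
  have e1: "2 * r * k * l * x * (r * u) = (r * r) * (2 * k * l * x * u)" for r k l :: real by (simp add: field_simps)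
  have e2: "2 * r * (r / 2 * k) = r * r * k" for r k :: real by (simp add: field_simps)
  have e3: "r * k * (r * u) = r * r * (k * u)" for r k :: real by (simp add: field_simps)
  show "E (x, sqrt 3 * u) = E_max - (3 * (\<alpha> + \<gamma>)\<^sup>2 * x\<^sup>2 - 6 * (\<alpha> + 2 * \<beta> + \<gamma>) * (\<alpha> - \<gamma>) * x * u
      + 3 * ((\<alpha> + 2 * \<beta> + \<gamma>)\<^sup>2 - 4 * \<alpha> * \<gamma>) * u\<^sup>2)"
    unfolding E_form_def prod.case e1 power_mult_distrib by (simp add: field_simps)
  show "2 * sqrt 3 * Q (x, sqrt 3 * u) = 3 * (4 * u\<^sup>2 - 4 * x\<^sup>2 + \<beta>\<^sup>2 + \<alpha> * \<beta> + \<beta> * \<gamma> - \<alpha> * \<gamma>)"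
    unfolding Q_form_def prod.case e2 by (simp add: power_mult_distrib)
  show "polar (x, sqrt 3 * u) = 3 * \<alpha> * \<gamma> * ((\<alpha> - \<gamma>) * u - (\<alpha> + 2 * \<beta> + \<gamma>) * x)"
    unfolding polar_def prod.case e3 by (simp add: field_simps)
qed

lemma point_sqrt3:
  obtains x u where "z = (x, sqrt 3 * u)"
proof
  show "z = (fst z, sqrt 3 * (snd z / sqrt 3))" by simp
qed

lemma left_vertex_sqrt3: "left_vertex = (- (\<alpha> + 2 * \<beta> + \<gamma>) / 4, sqrt 3 * ((\<gamma> - \<alpha>) / 4))"
  by (simp add: left_vertex_def)

text \<open>Outside the ellipse with \<open>Q z < 0\<close> both terms on the right are negative, so
  the point lies beyond the polar line of one of the two extreme vertices.\<close>

lemma polar_identity: "E_max\<^sup>2 - (polar z)\<^sup>2 = E_max * (\<alpha> * \<gamma>) * (2 * sqrt 3 * Q z) + 3 * (\<alpha> * \<gamma>)\<^sup>2 * E z"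
proof -
  obtain x u where z: "z = (x, sqrt 3 * u)" by (rule point_sqrt3)
  show ?thesis unfolding z forms_sqrt3 by (simp add: power2_eq_square field_simps)
qed

text \<open>A quadratic polynomial is expanded along a segment; the mixed term is the bilinear form
  with \<open>left_vertex\<close>, and this is \<open>polar\<close>.\<close>

lemma E_segment:
  "E ((1 - t) *\<^sub>R z + t *\<^sub>R left_vertex) = (1 - t)\<^sup>2 * E z - 2 * t * (1 - t) * (polar z - E_max) + t\<^sup>2 * E left_vertex"
proof -
  obtain x u where z: "z = (x, sqrt 3 * u)" by (rule point_sqrt3)
  define x0 u0 where "x0 = - (\<alpha> + 2 * \<beta> + \<gamma>) / 4" and "u0 = (\<gamma> - \<alpha>) / 4"
  have v: "left_vertex = (x0, sqrt 3 * u0)" unfolding left_vertex_sqrt3 x0_def u0_def ..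
  have c: "(1 - t) *\<^sub>R z + t *\<^sub>R left_vertex = ((1 - t) * x + t * x0, sqrt 3 * ((1 - t) * u + t * u0))"
    unfolding z v by (simp add: algebra_simps)
  have quad: "k - (A * ((1 - t) * x + t * x0)\<^sup>2 - 2 * B * ((1 - t) * x + t * x0) * ((1 - t) * u + t * u0) + D * ((1 - t) * u + t * u0)\<^sup>2)
    = (1 - t)\<^sup>2 * (k - (A * x\<^sup>2 - 2 * B * x * u + D * u\<^sup>2)) - 2 * t * (1 - t) * ((A * x * x0 - B * (x * u0 + u * x0) + D * u * u0) - k)
      + t\<^sup>2 * (k - (A * x0\<^sup>2 - 2 * B * x0 * u0 + D * u0\<^sup>2))" for k A B D :: real
    by (simp add: power2_eq_square algebra_simps)
  have E: "E (x, sqrt 3 * u) = E_max - (3 * (\<alpha> + \<gamma>)\<^sup>2 * x\<^sup>2 - 2 * (3 * (\<alpha> + 2 * \<beta> + \<gamma>) * (\<alpha> - \<gamma>)) * x * u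
      + 3 * ((\<alpha> + 2 * \<beta> + \<gamma>)\<^sup>2 - 4 * \<alpha> * \<gamma>) * u\<^sup>2)" for x u
    unfolding forms_sqrt3 by simp
  have "polar z = 3 * (\<alpha> + \<gamma>)\<^sup>2 * x * x0 - 3 * (\<alpha> + 2 * \<beta> + \<gamma>) * (\<alpha> - \<gamma>) * (x * u0 + u * x0)
      + 3 * ((\<alpha> + 2 * \<beta> + \<gamma>)\<^sup>2 - 4 * \<alpha> * \<gamma>) * u * u0"
    unfolding z forms_sqrt3 x0_def u0_def by (simp add: power2_eq_square field_simps)
  then show ?thesis unfolding c unfolding E quad unfolding v z E by simp
qed

lemma E_left_vertex: "E left_vertex = - 3 * (\<alpha> * \<gamma>)\<^sup>2"
  unfolding left_vertex_sqrt3 forms_sqrt3 by (simp add: power2_eq_square field_simps)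

lemma Q_left_vertex: "2 * sqrt 3 * Q left_vertex = - 6 * \<alpha> * \<gamma>"
  unfolding left_vertex_sqrt3 forms_sqrt3 by (simp add: power2_eq_square field_simps)

lemma left_vertex_forms: "E left_vertex < 0" "Q left_vertex < 0"
proof -
  have ag: "\<alpha> * \<gamma> > 0" using greek by simp
  then have "(\<alpha> * \<gamma>)\<^sup>2 > 0" by (rule zero_less_power)
  then show "E left_vertex < 0" unfolding E_left_vertex by linarith
  have "2 * sqrt 3 * Q left_vertex < 0" unfolding Q_left_vertex using ag by simp
  then show "Q left_vertex < 0" by (simp add: mult_less_0_iff)
qed

lemma level_of: obtains Y where "z = (fst z, sqrt 3 / 4 * (\<gamma> - \<alpha>) + sqrt 3 / 2 * Y)"
proof
  have "sqrt 3 / 2 * (2 / sqrt 3 * w) = w" for w :: real by simp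
  then show "z = (fst z, sqrt 3 / 4 * (\<gamma> - \<alpha>) + sqrt 3 / 2 * (2 / sqrt 3 * (snd z - sqrt 3 / 4 * (\<gamma> - \<alpha>))))"
    by (simp only: prod_eq_iff fst_conv snd_conv) simp
qed

lemma left_vertex_hexagon: "left_vertex \<in> hex"
proof -
  have "(- (\<alpha> + 2 * \<beta> + \<gamma>) / 4, sqrt 3 / 4 * (\<gamma> - \<alpha>) + sqrt 3 / 2 * 0) \<in> hex"
    unfolding hexagon_level[OF greek] using greek by (auto simp: abs_if field_simps)
  then show ?thesis by (simp add: left_vertex_def)
qed

lemma hexagon_fst_ge:
  assumes "z \<in> hex"
  shows "fst left_vertex \<le> fst z" "fst z = fst left_vertex \<Longrightarrow> z = left_vertex"
proof -
  obtain Y where z: "z = (fst z, sqrt 3 / 4 * (\<gamma> - \<alpha>) + sqrt 3 / 2 * Y)" by (rule level_of)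
  have "(fst z, sqrt 3 / 4 * (\<gamma> - \<alpha>) + sqrt 3 / 2 * Y) \<in> hex" using assms z by simp
  then have h: "\<bar>Y\<bar> - (\<alpha> + 2 * \<beta> + \<gamma>) / 2 \<le> 2 * fst z" unfolding hexagon_level[OF greek] by simp
  show "fst left_vertex \<le> fst z" unfolding left_vertex_def fst_conv using h abs_ge_zero[of Y] by linarith
  assume f: "fst z = fst left_vertex"
  then have "\<bar>Y\<bar> \<le> 0" using h unfolding left_vertex_def fst_conv by linarith
  then have "Y = 0" by simp
  then show "z = left_vertex" using z f by (simp add: left_vertex_def)
qed

lemma extreme_iff: "leftmost_or_rightmost hex z \<longleftrightarrow> z = left_vertex \<or> z = - left_vertex"
proof
  assume l: "leftmost_or_rightmost hex z"
  then have z: "z \<in> hex" by (simp add: leftmost_or_rightmost_def)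
  then have z': "- z \<in> hex" by (simp add: hexagon_uminus)
  have "- left_vertex \<in> hex" using left_vertex_hexagon by (simp add: hexagon_uminus)
  then have "fst z \<le> fst left_vertex \<or> fst (- left_vertex) \<le> fst z"
    using l left_vertex_hexagon unfolding leftmost_or_rightmost_def by blast
  then show "z = left_vertex \<or> z = - left_vertex"
  proof
    assume "fst z \<le> fst left_vertex"
    then show ?thesis using hexagon_fst_ge[OF z] by simp
  next
    assume "fst (- left_vertex) \<le> fst z"
    then have "- z = left_vertex" using hexagon_fst_ge[OF z'] by simp
    then show ?thesis by (metis minus_minus)
  qed
next
  have "fst q \<le> fst (- left_vertex)" if "q \<in> hex" for q
  proof -
    have "- q \<in> hex" using that by (simp add: hexagon_uminus)
    from hexagon_fst_ge(1)[OF this] show ?thesis by simp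
  qed
  then show "z = left_vertex \<or> z = - left_vertex \<Longrightarrow> leftmost_or_rightmost hex z"
    using hexagon_fst_ge(1) left_vertex_hexagon hexagon_uminus[of left_vertex] unfolding leftmost_or_rightmost_def by blast
qed

lemma outside_Q_nonzero:
  assumes "z \<in> hex" "E z < 0"
  shows "Q z \<noteq> 0"
proof -
  obtain Y where z: "z = (fst z, sqrt 3 / 4 * (\<gamma> - \<alpha>) + sqrt 3 / 2 * Y)" by (rule level_of)
  define H p q x where "H = (\<alpha> + 2 * \<beta> + \<gamma>) / 2" and "p = \<bar>Y\<bar>" and "q = \<bar>Y - (\<alpha> - \<gamma>)\<bar>" and "x = fst z"
  have "(fst z, sqrt 3 / 4 * (\<gamma> - \<alpha>) + sqrt 3 / 2 * Y) \<in> hex" using assms z by simp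
  then have h: "p - H \<le> 2 * x" "2 * x \<le> H - q" unfolding hexagon_level[OF greek] p_def q_def H_def x_def by auto
  have "q \<le> H - 2 * x" "p \<le> H + 2 * x" "p \<ge> 0" "q \<ge> 0" using h by (simp_all add: p_def q_def)
  then have "q\<^sup>2 \<le> (H - 2 * x)\<^sup>2" "p\<^sup>2 \<le> (H + 2 * x)\<^sup>2" by (simp_all only: power_mono)
  then have "radius_sq H p q x \<ge> 0" unfolding radius_sq_def by simp
  moreover have "radius_sq H p q x = E z / 3 + (Q z / sqrt 3)\<^sup>2"
    using forms_level[OF greek, of Y x] z unfolding H_def p_def q_def x_def by simp
  ultimately show ?thesis using assms(2) by auto
qed

abbreviation (input) "outer \<equiv> {z \<in> hex. E z < 0}"

text \<open>On the far side of its polar line, the vertex sees every point outside the ellipse along a segment that avoids the ellipse.\<close>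

lemma segment_outside:
  assumes z: "z \<in> outer" and p: "polar z \<ge> E_max"
  shows "closed_segment z left_vertex \<subseteq> outer"
proof
  fix w assume w: "w \<in> closed_segment z left_vertex"
  then obtain t where t: "w = (1 - t) *\<^sub>R z + t *\<^sub>R left_vertex" "0 \<le> t" "t \<le> 1"
    unfolding in_segment by blast
  have "w \<in> hex" using closed_segment_subset[OF _ left_vertex_hexagon convex_hexagon, of z] z w by auto
  moreover have "E w < 0"
  proof (cases "t = 1")
    case False
    have "(1 - t)\<^sup>2 * E z < 0" using False z by (simp add: mult_less_0_iff)
    moreover have "2 * t * (1 - t) * (polar z - E_max) \<ge> 0" using t p by simp
    moreover have "t\<^sup>2 * E left_vertex \<le> 0" using left_vertex_forms(1) by (simp add: mult_le_0_iff)
    ultimately show ?thesis unfolding t(1) E_segment by linarith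
  qed (use t left_vertex_forms in simp)
  ultimately show "w \<in> outer" by simp
qed

text \<open>By \<open>polar_identity\<close> the point lies beyond one of two polar lines, and the
  segment to the corresponding vertex stays outside the ellipse; for the rightmost vertex the
  segment argument is applied to \<open>- z\<close>.\<close>

lemma component_extreme:
  assumes z: "z \<in> outer" and Qz: "Q z < 0"
  shows "left_vertex \<in> connected_component_set outer z \<or> - left_vertex \<in> connected_component_set outer z"
proof -
  have k: "E_max > 0" using greek by simp
  have "E_max * (\<alpha> * \<gamma>) * (2 * sqrt 3 * Q z) < 0" using Qz greek by (simp add: mult_less_0_iff zero_less_mult_iff)
  moreover have "3 * (\<alpha> * \<gamma>)\<^sup>2 * E z < 0" using z greek by (simp add: mult_less_0_iff)
  ultimately have "E_max\<^sup>2 < (polar z)\<^sup>2" using polar_identity[of z] by linarith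
  then have "E_max < \<bar>polar z\<bar>" using k by (metis abs_ge_zero power2_abs power2_less_imp_less)
  then have "polar z \<ge> E_max \<or> polar (- z) \<ge> E_max"
    by (cases z) (auto simp: polar_def abs_if algebra_simps split: if_splits)
  then show ?thesis
  proof
    assume "polar z \<ge> E_max"
    from segment_outside[OF z this] have "connected_component outer z left_vertex"
      unfolding connected_component_def by (intro exI[of _ "closed_segment z left_vertex"]) auto
    then show ?thesis by simp
  next
    assume p: "polar (- z) \<ge> E_max"
    have z': "- z \<in> outer" using z by (simp add: hexagon_uminus forms_uminus)
    have "uminus ` closed_segment (- z) left_vertex \<subseteq> outer"
    proof (rule image_subsetI)
      fix w assume "w \<in> closed_segment (- z) left_vertex"
      then have "w \<in> outer" using segment_outside[OF z' p] by blast
      then show "- w \<in> outer" by (simp only: mem_Collect_eq hexagon_uminus forms_uminus)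
    qed
    moreover have "connected (uminus ` closed_segment (- z) left_vertex)"
      by (intro connected_continuous_image continuous_intros) auto
    moreover have "z \<in> uminus ` closed_segment (- z) left_vertex"
      by (rule image_eqI[of _ _ "- z"]) auto
    ultimately have "connected_component outer z (- left_vertex)"
      unfolding connected_component_def by (intro exI[of _ "uminus ` closed_segment (- z) left_vertex"]) auto
    then show ?thesis by simp
  qed
qed

lemma component_sign:
  assumes "C \<in> components outer" "x \<in> C" "y \<in> C" "Q x < 0"
  shows "Q y < 0"
proof (rule connected_sign[OF _ continuous_forms(2) _ assms(2,3,4)])
  show "connected C" using assms(1) by (rule in_components_connected)
  show "Q z \<noteq> 0" if "z \<in> C" for z
    using in_components_subset[OF assms(1)] that outside_Q_nonzero[of z] by blast
qed

text \<open>\<open>Q\<close> keeps its sign on a component and is negative at the two extreme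
  vertices; conversely a point with negative \<open>Q\<close> is joined to one of them.\<close>

lemma extreme_component_iff:
  assumes C: "C \<in> components outer" and z: "z \<in> C"
  shows "(\<exists>p\<in>C. leftmost_or_rightmost hex p) \<longleftrightarrow> Q z < 0"
proof
  assume "\<exists>p\<in>C. leftmost_or_rightmost hex p"
  then obtain p where p: "p \<in> C" "p = left_vertex \<or> p = - left_vertex" unfolding extreme_iff by blast
  then have "Q p < 0" using left_vertex_forms(2) forms_uminus(2)[of \<alpha> \<beta> \<gamma> left_vertex] by auto
  then show "Q z < 0" by (rule component_sign[OF C p(1) z])
next
  assume Qz: "Q z < 0"
  have zo: "z \<in> outer" using in_components_subset[OF C] z by blast
  have "C = connected_component_set outer z" using C z
    by (metis (no_types, lifting) components_iff connected_component_eq)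
  then show "\<exists>p\<in>C. leftmost_or_rightmost hex p"
    using component_extreme[OF zo Qz] unfolding extreme_iff by blast
qed

lemma in_own_component:
  assumes "z \<in> outer"
  obtains C where "C \<in> components outer" "z \<in> C"
proof -
  have "z \<in> \<Union> (components outer)" using assms by (simp only: Union_components)
  then show ?thesis using that by blast
qed

lemma P_density_eq:
  assumes z: "z \<in> hex" and E: "E z \<noteq> 0"
  shows "P_density \<alpha> \<beta> \<gamma> z = limit_density \<alpha> \<beta> \<gamma> z"
proof (cases "E z > 0")
  case True
  have e: "Q z / sqrt 3 / sqrt (E z / 3) = Q z / sqrt (E z)" by (simp add: real_sqrt_divide)
  have E3: "E z / 3 > 0" using True by simp
  show ?thesis unfolding P_density_def limit_density_def angle_def arccot_eq if_P[OF True] if_P[OF E3] e by simp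
next
  case False
  then have neg: "E z < 0" using E by simp
  then have zo: "z \<in> outer" using z by simp
  have ns: "z \<notin> singular_points \<alpha> \<beta> \<gamma>" using neg by (simp add: singular_points_def)
  obtain C where C: "C \<in> components outer" "z \<in> C" using in_own_component[OF zo] .
  have comp: "outer_components \<alpha> \<beta> \<gamma> = components outer" by (simp add: outer_components_def)
  show ?thesis
  proof (cases "Q z < 0")
    case True
    \<comment> \<open>\<open>P_density\<close> tests \<open>R0\<close> before \<open>R1\<close>, so
      \<open>z\<close> has to be kept out of the closure that defines \<open>R0\<close>; that
      closure stays within the closed set \<open>0 \<le> Q\<close>.\<close>
    let ?U = "\<Union>{C \<in> outer_components \<alpha> \<beta> \<gamma>. \<not> (\<exists>p\<in>C. leftmost_or_rightmost hex p)}"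
    have "?U \<subseteq> {w. 0 \<le> Q w}" unfolding comp using extreme_component_iff by fastforce
    moreover have "closed {w. 0 \<le> Q w}" by (intro closed_Collect_le continuous_intros continuous_forms(2))
    ultimately have "closure ?U \<subseteq> {w. 0 \<le> Q w}" by (rule closure_minimal)
    then have "z \<notin> R0 \<alpha> \<beta> \<gamma>" using True unfolding R0_def by auto
    moreover have "z \<in> R1 \<alpha> \<beta> \<gamma>"
    proof -
      have "z \<in> \<Union>{C \<in> components outer. \<exists>p\<in>C. leftmost_or_rightmost hex p}"
        using C extreme_component_iff[OF C] True by blast
      from subsetD[OF closure_subset this] ns show ?thesis unfolding R1_def comp by (rule DiffI)
    qed
    ultimately show ?thesis using True False
      by (simp add: P_density_def limit_density_def angle_def divide_less_0_iff zero_less_divide_iff)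
  next
    case False
    have "z \<in> R0 \<alpha> \<beta> \<gamma>"
    proof -
      have "z \<in> \<Union>{C \<in> components outer. \<not> (\<exists>p\<in>C. leftmost_or_rightmost hex p)}"
        using C extreme_component_iff[OF C] False by blast
      from subsetD[OF closure_subset this] ns show ?thesis unfolding R0_def comp by (rule DiffI)
    qed
    then show ?thesis using False neg
      by (simp add: P_density_def limit_density_def angle_def divide_less_0_iff zero_less_divide_iff)
  qed
qed

text \<open>Each vertical line meets the ellipse in finitely many points, the coefficient of
  \<open>y\<^sup>2\<close> being nonzero; integration over the lines shows that the ellipse is a
  null set.\<close>

lemma AE_E_nonzero: "AE z in lborel. E z \<noteq> 0"
proof -
  have [measurable]: "E \<in> borel_measurable borel" by (rule borel_measurable_continuous_onI[OF continuous_forms(1)])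
  have "AE x in lborel. AE y in lborel. E (x, y) \<noteq> 0"
  proof (rule AE_I2)
    fix x :: real
    define c0 c1 c2 where "c0 = E_max - 3 * (\<alpha> + \<gamma>)\<^sup>2 * x\<^sup>2"
      and "c1 = 2 * sqrt 3 * (\<alpha> + 2 * \<beta> + \<gamma>) * (\<alpha> - \<gamma>) * x"
      and "c2 = - ((\<alpha> + 2 * \<beta> + \<gamma>)\<^sup>2 - 4 * \<alpha> * \<gamma>)"
    have "c2 = - ((\<alpha> - \<gamma>)\<^sup>2 + 4 * \<beta> * (\<alpha> + \<beta> + \<gamma>))" unfolding c2_def by (simp add: power2_eq_square algebra_simps)
    moreover have "4 * \<beta> * (\<alpha> + \<beta> + \<gamma>) > 0" using greek by simp
    ultimately have "c2 \<noteq> 0" using zero_le_power2[of "\<alpha> - \<gamma>"] by linarith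
    then have fin: "finite {y. poly [:c0, c1, c2:] y = 0}" by (intro poly_roots_finite) simp
    have "E (x, y) = poly [:c0, c1, c2:] y" for y
      unfolding E_form_def prod.case c0_def c1_def c2_def by (simp add: algebra_simps power2_eq_square)
    then have "finite {y. E (x, y) = 0}" using fin by simp
    then have "{y. E (x, y) = 0} \<in> null_sets lborel" by (rule finite_imp_null_set_lborel)
    then show "AE y in lborel. E (x, y) \<noteq> 0" by (rule AE_I'[of _ lborel]) auto
  qed
  moreover have "{z \<in> space (lborel \<Otimes>\<^sub>M lborel). E z \<noteq> 0} \<in> sets (lborel \<Otimes>\<^sub>M lborel)"
    unfolding lborel_prod by measurable
  ultimately have "AE z in lborel \<Otimes>\<^sub>M lborel. E z \<noteq> 0"
    by (intro lborel_pair.AE_pair_measure)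
  then show ?thesis unfolding lborel_prod .
qed

lemma P_density_measurable: "P_density \<alpha> \<beta> \<gamma> \<in> borel_measurable borel"
proof -
  have [measurable]: "E \<in> borel_measurable borel" "Q \<in> borel_measurable borel"
    by (intro borel_measurable_continuous_onI continuous_forms(1) continuous_forms(2))+
  have [measurable]: "hex \<in> sets borel" by (rule borel_closed[OF closed_hexagon])
  have s [measurable]: "singular_points \<alpha> \<beta> \<gamma> \<in> sets borel"
  proof -
    have "closed (hex \<inter> {p. E p = 0} \<inter> {p. snd p = sqrt 3 / 2 * (2 * fst p + \<beta> + \<gamma>) \<or>
      snd p = sqrt 3 / 2 * (- 2 * fst p + \<alpha> + \<beta>) \<or>
      snd p = sqrt 3 / 2 * (2 * fst p - \<beta> - \<gamma>) \<or>
      snd p = sqrt 3 / 2 * (- 2 * fst p - \<alpha> - \<beta>)})"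
      by (intro closed_Int closed_hexagon closed_Collect_eq closed_Collect_disj continuous_intros continuous_forms(1))
    moreover have "singular_points \<alpha> \<beta> \<gamma> = hex \<inter> {p. E p = 0} \<inter> {p. snd p = sqrt 3 / 2 * (2 * fst p + \<beta> + \<gamma>) \<or>
      snd p = sqrt 3 / 2 * (- 2 * fst p + \<alpha> + \<beta>) \<or>
      snd p = sqrt 3 / 2 * (2 * fst p - \<beta> - \<gamma>) \<or>
      snd p = sqrt 3 / 2 * (- 2 * fst p - \<alpha> - \<beta>)}"
      by (auto simp: singular_points_def)
    ultimately show ?thesis by (simp add: borel_closed)
  qed
  have [measurable]: "R0 \<alpha> \<beta> \<gamma> \<in> sets borel" "R1 \<alpha> \<beta> \<gamma> \<in> sets borel"
    unfolding R0_def R1_def by (intro sets.Diff borel_closed closed_closure s)+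
  show ?thesis unfolding P_density_def[abs_def] arccot_eq by measurable
qed

end

section \<open>Domains bounded by a smooth curve\<close>

text \<open>The exact expectation with a test function in place of the indicator of
  \<open>U\<close>, so that continuous functions can be inserted.\<close>

definition tiling_sum :: "(point \<Rightarrow> real) \<Rightarrow> nat \<Rightarrow> nat \<Rightarrow> nat \<Rightarrow> real \<Rightarrow> real" where
  "tiling_sum f a b c s = (\<Sum>j\<in>{- int c<..<int a}. \<Sum>k\<in>{0..<row_size a c j}. inner_sum f a b c s j k)"

context
  fixes a b c :: nat
  assumes pos: "a > 0" "b > 0" "c > 0"
begin

lemma expected_vertical_tiling_sum: "expected_vertical a b c s U = tiling_sum (indicator U) a b c s"
proof -
  have "(\<Sum>k<nat N. h k) = (\<Sum>k\<in>{0..<N}. h (nat k))" for N and h :: "nat \<Rightarrow> real"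
    by (rule sum.reindex_bij_witness[of _ nat int]) auto
  then show ?thesis unfolding expected_vertical_exact[OF pos] tiling_sum_def inner_sum_def by simp
qed

lemma tiling_sum_mono:
  assumes "\<And>z. f z \<le> h z"
  shows "tiling_sum f a b c s \<le> tiling_sum h a b c s"
  unfolding tiling_sum_def
proof (intro sum_mono)
  fix j k assume j: "j \<in> {- int c<..<int a}" and k: "k \<in> {0..<row_size a c j}"
  have "nat k \<le> row_M a b c j" using row_M_n(1)[OF pos, of j] j k pos by auto
  then show "inner_sum f a b c s j k \<le> inner_sum h a b c s j k"
    unfolding inner_sum_def using assms by (intro sum_mono mult_right_mono hahn_mass_nonneg) auto
qed

end

lemma bounded_hexagon:
  assumes "\<alpha> > 0" "\<beta> > 0" "\<gamma> > 0"
  shows "bounded (hexagon \<alpha> \<beta> \<gamma>)"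
proof -
  define L where "L = (\<alpha> + 2 * \<beta> + \<gamma>) / 4"
  have "hexagon \<alpha> \<beta> \<gamma> \<subseteq> cbox (- L, - sqrt 3 / 4 * (\<alpha> + \<gamma>)) (L, sqrt 3 / 4 * (\<alpha> + \<gamma>))"
  proof
    fix z assume z: "z \<in> hexagon \<alpha> \<beta> \<gamma>"
    then have z': "- z \<in> hexagon \<alpha> \<beta> \<gamma>" by (simp only: hexagon_uminus)
    have "- L \<le> fst z" "fst z \<le> L"
      using hexagon_fst_ge(1)[OF assms z] hexagon_fst_ge(1)[OF assms z']
      unfolding left_vertex_def[OF assms] L_def fst_conv fst_uminus by linarith+
    moreover have "- sqrt 3 / 4 * (\<alpha> + \<gamma>) \<le> snd z" "snd z \<le> sqrt 3 / 4 * (\<alpha> + \<gamma>)"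
      using z by (auto simp: hexagon_def)
    ultimately show "z \<in> cbox (- L, - sqrt 3 / 4 * (\<alpha> + \<gamma>)) (L, sqrt 3 / 4 * (\<alpha> + \<gamma>))"
      by (cases z) (simp add: cbox_Pair_eq)
  qed
  then show ?thesis by (rule bounded_subset[OF bounded_cbox])
qed

lemma cutoff_tendsto:
  assumes "closed K" "K \<noteq> {}"
  shows "(\<lambda>m. min 1 (real m * infdist z K)) \<longlonglongrightarrow> indicator (- K) z"
proof (cases "z \<in> K")
  case True
  then show ?thesis using assms by (simp add: in_closed_iff_infdist_zero)
next
  case False
  then have d: "infdist z K > 0" using assms by (simp add: infdist_pos_not_in_closed)
  then have "filterlim (\<lambda>m. real m * infdist z K) at_top sequentially"
    by (intro filterlim_at_top_mult_tendsto_pos[OF tendsto_const] filterlim_real_sequentially)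
  then have "eventually (\<lambda>m. 1 \<le> real m * infdist z K) sequentially" by (simp add: filterlim_at_top)
  then have "eventually (\<lambda>m. min 1 (real m * infdist z K) = indicator (- K) z) sequentially"
    by eventually_elim (use False in simp)
  then show ?thesis by (rule tendsto_eventually)
qed

context
  fixes a b c :: "nat \<Rightarrow> nat" and s :: "nat \<Rightarrow> real" and \<alpha> \<beta> \<gamma> :: real
  assumes greek: "\<alpha> > 0" "\<beta> > 0" "\<gamma> > 0"
    and abc: "\<And>n. a n > 0" "\<And>n. b n > 0" "\<And>n. c n > 0"
    and s_pos: "\<And>n. s n > 0" and s_lim: "filterlim s at_top sequentially"
    and a_lim: "(\<lambda>n. real (a n) / s n) \<longlonglongrightarrow> \<alpha>" and b_lim: "(\<lambda>n. real (b n) / s n) \<longlonglongrightarrow> \<beta>" and c_lim: "(\<lambda>n. real (c n) / s n) \<longlonglongrightarrow> \<gamma>"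
begin

abbreviation (input) "weight z \<equiv> limit_density \<alpha> \<beta> \<gamma> z * indicator (hexagon \<alpha> \<beta> \<gamma>) z"

lemma tiling_sum_continuous:
  assumes "continuous_on UNIV f" "\<And>z. 0 \<le> f z" "\<And>z. f z \<le> 1"
  shows "(\<lambda>n. tiling_sum f (a n) (b n) (c n) (s n) / (s n)\<^sup>2) \<longlonglongrightarrow> 2 / sqrt 3 * (LINT z|lborel. f z * weight z)"
proof -
  have ab: "\<bar>f z\<bar> \<le> 1" for z using assms(2,3)[of z] by simp
  have eq: "(LINT z|lborel. density_on \<alpha> \<beta> \<gamma> f z) = (LINT z|lborel. f z * weight z)"
    unfolding density_on_def[OF greek assms] by (simp add: mult.assoc)
  show ?thesis
    using tiling_sum_lim[OF abc s_pos s_lim a_lim b_lim c_lim greek assms(1) ab]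
    unfolding limit_integral[OF greek assms] eq tiling_sum_def .
qed

lemma weight_integral_limit:
  fixes F :: "nat \<Rightarrow> point \<Rightarrow> real"
  assumes F: "\<And>m. F m \<in> borel_measurable borel" "\<And>m z. 0 \<le> F m z" "\<And>m z. F m z \<le> 1"
    and lim: "\<And>z. (\<lambda>m. F m z) \<longlonglongrightarrow> F' z"
  shows "(\<lambda>m. 2 / sqrt 3 * (LINT z|lborel. F m z * weight z)) \<longlonglongrightarrow> 2 / sqrt 3 * (LINT z|lborel. F' z * weight z)"
proof (intro tendsto_mult tendsto_const integral_dominated_convergence[where w = "indicator (hexagon \<alpha> \<beta> \<gamma>)"])
  have [measurable]: "hexagon \<alpha> \<beta> \<gamma> \<in> sets borel" by (rule borel_closed[OF closed_hexagon])
  note [measurable] = F(1)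
  show "(\<lambda>z. F m z * weight z) \<in> borel_measurable lborel" for m by measurable
  have [measurable]: "F' \<in> borel_measurable borel" using lim by (rule borel_measurable_LIMSEQ_real) (rule F(1))
  show "(\<lambda>z. F' z * weight z) \<in> borel_measurable lborel" by measurable
  show "integrable lborel (indicator (hexagon \<alpha> \<beta> \<gamma>) :: point \<Rightarrow> real)"
    using emeasure_bounded_finite[OF bounded_hexagon[OF greek]] by simp
  show "AE z in lborel. (\<lambda>m. F m z * weight z) \<longlonglongrightarrow> F' z * weight z"
    by (intro AE_I2 tendsto_mult tendsto_const lim)
  show "AE z in lborel. norm (F m z * weight z) \<le> indicator (hexagon \<alpha> \<beta> \<gamma>) z" for m
    using F(2,3)[of m] limit_density_bounds[of \<alpha> \<beta> \<gamma>]
    by (intro AE_I2) (auto simp: indicator_def abs_mult intro!: mult_le_one)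
qed

text \<open>Distance cutoffs approximate the indicator of the open \<open>U\<close> from below and
  that of the closed \<open>K\<close> from above. Both limiting integrals agree because
  \<open>K - U\<close> is null, and monotonicity of \<open>tiling_sum\<close> transfers the
  bounds.\<close>

lemma tiling_sum_indicator:
  assumes U: "open U" "U \<noteq> UNIV" and K: "closed K" "K \<noteq> {}" "U \<subseteq> K" and null: "K - U \<in> null_sets lborel"
  shows "(\<lambda>n. tiling_sum (indicator U) (a n) (b n) (c n) (s n) / (s n)\<^sup>2)
    \<longlonglongrightarrow> 2 / sqrt 3 * (LINT z|lborel. indicator U z * weight z)" (is "?X \<longlonglongrightarrow> ?l")
proof -
  define f where "f m z = min 1 (real m * infdist z (- U))" for m z
  define h where "h m z = 1 - min 1 (real m * infdist z K)" for m z
  have cont: "continuous_on UNIV (f m)" "continuous_on UNIV (h m)" for m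
    unfolding f_def h_def by (intro continuous_intros)+
  have bd: "0 \<le> f m z" "f m z \<le> 1" "0 \<le> h m z" "h m z \<le> 1" for m z
    unfolding f_def h_def by (auto simp: infdist_nonneg)
  have le: "f m z \<le> indicator U z" "indicator U z \<le> h m z" for m z
    unfolding f_def h_def using K(3) by (auto simp: indicator_def infdist_nonneg)
  have flim: "(\<lambda>m. f m z) \<longlonglongrightarrow> indicator U z" for z
    using cutoff_tendsto[of "- U" z] U unfolding f_def by auto
  have hlim: "(\<lambda>m. h m z) \<longlonglongrightarrow> indicator K z" for z
    using tendsto_diff[OF tendsto_const[of 1] cutoff_tendsto[OF K(1,2), of z]] unfolding h_def
    by (simp add: indicator_compl)
  note meas = borel_measurable_continuous_onI[OF cont(1)] borel_measurable_continuous_onI[OF cont(2)]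
  have fl: "(\<lambda>m. 2 / sqrt 3 * (LINT z|lborel. f m z * weight z)) \<longlonglongrightarrow> ?l"
    by (rule weight_integral_limit[OF meas(1) bd(1,2) flim])
  have hl: "(\<lambda>m. 2 / sqrt 3 * (LINT z|lborel. h m z * weight z)) \<longlonglongrightarrow> ?l"
  proof -
    have "(LINT z|lborel. indicator K z * weight z) = (LINT z|lborel. indicator U z * weight z)"
    proof (rule integral_cong_AE)
      have [measurable]: "hexagon \<alpha> \<beta> \<gamma> \<in> sets borel" "K \<in> sets borel" "U \<in> sets borel"
        using closed_hexagon K U by (auto intro: borel_closed borel_open)
      show "(\<lambda>z. indicator K z * weight z) \<in> borel_measurable lborel" "(\<lambda>z. indicator U z * weight z) \<in> borel_measurable lborel"
        by measurable
      have "AE z in lborel. z \<notin> K - U" using null by (rule AE_not_in)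
      then show "AE z in lborel. indicator K z * weight z = indicator U z * weight z"
        by eventually_elim (use K(3) in \<open>auto simp: indicator_def\<close>)
    qed
    then show ?thesis using weight_integral_limit[OF meas(2) bd(3,4) hlim] by simp
  qed
  show ?thesis
  proof (rule order_tendstoI)
    fix x assume "x < ?l"
    then have "eventually (\<lambda>m. x < 2 / sqrt 3 * (LINT z|lborel. f m z * weight z)) sequentially"
      using fl by (simp add: order_tendsto_iff)
    then obtain m where m: "x < 2 / sqrt 3 * (LINT z|lborel. f m z * weight z)"
      by (auto simp: eventually_sequentially)
    have "eventually (\<lambda>n. x < tiling_sum (f m) (a n) (b n) (c n) (s n) / (s n)\<^sup>2) sequentially"
      by (rule order_tendstoD(1)[OF tiling_sum_continuous[OF cont(1) bd(1,2)] m])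
    then show "eventually (\<lambda>n. x < ?X n) sequentially"
    proof eventually_elim
      case (elim n)
      have "tiling_sum (f m) (a n) (b n) (c n) (s n) / (s n)\<^sup>2 \<le> ?X n"
        by (intro divide_right_mono tiling_sum_mono abc le) simp
      with elim show ?case by linarith
    qed
  next
    fix x assume "?l < x"
    then have "eventually (\<lambda>m. 2 / sqrt 3 * (LINT z|lborel. h m z * weight z) < x) sequentially"
      using hl by (simp add: order_tendsto_iff)
    then obtain m where m: "2 / sqrt 3 * (LINT z|lborel. h m z * weight z) < x"
      by (auto simp: eventually_sequentially)
    have "eventually (\<lambda>n. tiling_sum (h m) (a n) (b n) (c n) (s n) / (s n)\<^sup>2 < x) sequentially"
      by (rule order_tendstoD(2)[OF tiling_sum_continuous[OF cont(2) bd(3,4)] m])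
    then show "eventually (\<lambda>n. ?X n < x) sequentially"
    proof eventually_elim
      case (elim n)
      have "?X n \<le> tiling_sum (h m) (a n) (b n) (c n) (s n) / (s n)\<^sup>2"
        by (intro divide_right_mono tiling_sum_mono abc le) simp
      with elim show ?case by linarith
    qed
  qed
qed

end

text \<open>A differentiable map from a line into the plane has a negligible image.\<close>

lemma smooth_path_image_null:
  assumes "smooth_simple_closed_curve g"
  shows "path_image g \<in> null_sets lborel"
proof -
  have "g C1_differentiable_on {0..1}" and p: "path g"
    using assms by (auto simp: smooth_simple_closed_curve_def simple_path_imp_path)
  then have "g differentiable_on {0..1}"
    unfolding C1_differentiable_on_def differentiable_on_def
    by (meson differentiableI_vector differentiable_at_withinI)
  then have "negligible (path_image g)" unfolding path_image_def
    by (intro negligible_differentiable_image_lowdim) auto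
  moreover have "path_image g \<in> sets lborel" using p by (simp add: closed_path_image borel_closed)
  ultimately show ?thesis by (simp add: negligible_iff_null_sets null_sets_completion_iff)
qed

text \<open>The unknown factors \<open>r n\<close> cancel on division by the sum of the coordinates,
  whose scaled value has a positive limit; so \<open>1 / s n\<close> is a valid choice of
  factors.\<close>

lemma scaled_sides:
  fixes x y z \<alpha> \<beta> \<gamma> :: "real" and X Y Z :: "nat \<Rightarrow> real"
  assumes lim: "projective_tendsto (\<lambda>n. (X n, Y n, Z n)) (\<alpha>, \<beta>, \<gamma>)" and S: "\<alpha> + \<beta> + \<gamma> > 0"
    and pos: "\<And>n. X n + Y n + Z n > 0"
  defines "s \<equiv> \<lambda>n. (X n + Y n + Z n) / (\<alpha> + \<beta> + \<gamma>)"
  shows "(\<lambda>n. X n / s n) \<longlonglongrightarrow> \<alpha>" "(\<lambda>n. Y n / s n) \<longlonglongrightarrow> \<beta>" "(\<lambda>n. Z n / s n) \<longlonglongrightarrow> \<gamma>"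
proof -
  obtain r where r: "\<And>n. r n \<noteq> 0" and l: "(\<lambda>n. r n *\<^sub>R (X n, Y n, Z n)) \<longlonglongrightarrow> (\<alpha>, \<beta>, \<gamma>)"
    using lim unfolding projective_tendsto_def by blast
  have x: "(\<lambda>n. r n * X n) \<longlonglongrightarrow> \<alpha>" using tendsto_fst[OF l] by simp
  have y: "(\<lambda>n. r n * Y n) \<longlonglongrightarrow> \<beta>" using tendsto_fst[OF tendsto_snd[OF l]] by simp
  have z: "(\<lambda>n. r n * Z n) \<longlonglongrightarrow> \<gamma>" using tendsto_snd[OF tendsto_snd[OF l]] by simp
  have t: "(\<lambda>n. (\<alpha> + \<beta> + \<gamma>) / (r n * X n + r n * Y n + r n * Z n)) \<longlonglongrightarrow> (\<alpha> + \<beta> + \<gamma>) / (\<alpha> + \<beta> + \<gamma>)"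
    by (intro tendsto_intros x y z) (use S in simp)
  have e: "r n * w * ((\<alpha> + \<beta> + \<gamma>) / (r n * X n + r n * Y n + r n * Z n)) = w / s n" for n w
  proof -
    have "r n * X n + r n * Y n + r n * Z n = r n * (X n + Y n + Z n)" by (simp add: algebra_simps)
    then show ?thesis unfolding s_def using r[of n] by simp
  qed
  have "(\<alpha> + \<beta> + \<gamma>) / (\<alpha> + \<beta> + \<gamma>) = 1" using S by simp
  note * = t[unfolded this]
  show "(\<lambda>n. X n / s n) \<longlonglongrightarrow> \<alpha>" "(\<lambda>n. Y n / s n) \<longlonglongrightarrow> \<beta>" "(\<lambda>n. Z n / s n) \<longlonglongrightarrow> \<gamma>"
    using tendsto_mult[OF x *] tendsto_mult[OF y *] tendsto_mult[OF z *] unfolding e by simp_all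
qed

theorem theorem1p1:
  fixes \<alpha> \<beta> \<gamma> :: real
    and g :: "real \<Rightarrow> real \<times> real"
    and U :: "(real \<times> real) set"
    and a b c :: "nat \<Rightarrow> nat"
  assumes "\<alpha> > 0" and "\<beta> > 0" and "\<gamma> > 0"
    and "smooth_simple_closed_curve g"
    and "path_image g \<subseteq> hexagon \<alpha> \<beta> \<gamma>"
    and "U = inside (path_image g)"
    and "\<And>n. a n > 0" and "\<And>n. b n > 0" and "\<And>n. c n > 0"
    and "filterlim a at_top sequentially"
    and "filterlim b at_top sequentially"
    and "filterlim c at_top sequentially"
    and "projective_tendsto (\<lambda>n. (real (a n), real (b n), real (c n))) (\<alpha>, \<beta>, \<gamma>)"
  shows "\<exists>\<epsilon> :: nat \<Rightarrow> real. \<epsilon> \<longlonglongrightarrow> 0 \<and>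
    (\<forall>n. expected_vertical (a n) (b n) (c n)
           (real (a n + b n + c n) / (\<alpha> + \<beta> + \<gamma>)) U
         = real (a n * b n + b n * c n + a n * c n)
           * (1 / ((\<alpha> * \<beta> + \<beta> * \<gamma> + \<alpha> * \<gamma>) * sqrt 3 / 2)
                * (LINT p:U|lborel. P_density \<alpha> \<beta> \<gamma> p)
              + \<epsilon> n))"
proof -
  note greek = assms(1-3) and abc = assms(7-9)
  define s where "s n = (real (a n) + real (b n) + real (c n)) / (\<alpha> + \<beta> + \<gamma>)" for n
  have S: "\<alpha> + \<beta> + \<gamma> > 0" using greek by simp
  have abc_sum: "real (a n) + real (b n) + real (c n) > 0" for n using abc[of n] by simp
  have s_pos: "s n > 0" for n unfolding s_def using abc_sum[of n] S by simp
  note lim = scaled_sides[OF assms(13) S abc_sum, folded s_def]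
  have s_lim: "filterlim s at_top sequentially"
  proof (rule filterlim_at_top_mono)
    have "filterlim (\<lambda>n. real (a n)) at_top sequentially"
      by (rule filterlim_compose[OF filterlim_real_sequentially assms(10)])
    then show "filterlim (\<lambda>n. real (a n) * (1 / (\<alpha> + \<beta> + \<gamma>))) at_top sequentially"
      using S by (intro filterlim_at_top_mult_tendsto_pos[OF tendsto_const]) auto
    show "eventually (\<lambda>n. real (a n) * (1 / (\<alpha> + \<beta> + \<gamma>)) \<le> s n) sequentially"
      unfolding s_def using S by (intro always_eventually allI) (simp add: divide_right_mono)
  qed
  let ?I = "LINT p:U|lborel. P_density \<alpha> \<beta> \<gamma> p"
  let ?N = "\<lambda>n. real (a n * b n + b n * c n + a n * c n)"
  let ?D = "\<alpha> * \<beta> + \<beta> * \<gamma> + \<alpha> * \<gamma>"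
  let ?V = "\<lambda>n. expected_vertical (a n) (b n) (c n) (real (a n + b n + c n) / (\<alpha> + \<beta> + \<gamma>)) U"
  have path: "path g" using assms(4) by (simp add: smooth_simple_closed_curve_def simple_path_imp_path)
  have cl: "closed (path_image g)" using path by (rule closed_path_image)
  have Uhex: "U \<subseteq> hexagon \<alpha> \<beta> \<gamma>"
    using inside_mono[OF assms(5)] inside_convex[OF convex_hexagon[of \<alpha> \<beta> \<gamma>]] unfolding assms(6) by blast
  have Uopen: "open U" unfolding assms(6) by (rule open_inside[OF cl])
  have Une: "U \<noteq> UNIV"
    using bounded_subset[OF bounded_hexagon[OF greek] Uhex] not_bounded_UNIV by metis
  \<comment> \<open>The closure of the inside adds only points of the curve, so
    \<open>path_image g \<union> U\<close> is a closed set that exceeds \<open>U\<close> by a null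
    set.\<close>
  have clK: "closed (path_image g \<union> U)"
  proof -
    have "path_image g \<union> U = path_image g \<union> closure U"
      using closure_inside_subset[OF cl] closure_subset[of U] unfolding assms(6) by blast
    then show ?thesis using cl by (simp add: closed_Un)
  qed
  have null: "path_image g \<union> U - U \<in> null_sets lborel"
  proof (rule null_sets_subset[OF smooth_path_image_null[OF assms(4)]])
    show "path_image g \<union> U - U \<in> sets lborel" using clK Uopen by (simp add: borel_closed borel_open sets.Diff)
  qed blast
  have "(\<lambda>n. ?V n / (s n)\<^sup>2) \<longlonglongrightarrow> 2 / sqrt 3 * (LINT z|lborel. indicator U z * (limit_density \<alpha> \<beta> \<gamma> z * indicator (hexagon \<alpha> \<beta> \<gamma>) z))"
    using tiling_sum_indicator[OF greek abc s_pos s_lim lim Uopen Une clK _ _ null] path_image_nonempty[of g]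
    unfolding expected_vertical_tiling_sum[OF abc] s_def by (auto simp: add_ac)
  also have "(LINT z|lborel. indicator U z * (limit_density \<alpha> \<beta> \<gamma> z * indicator (hexagon \<alpha> \<beta> \<gamma>) z)) = ?I"
    unfolding set_lebesgue_integral_def real_scaleR_def
  proof (rule integral_cong_AE)
    have [measurable]: "hexagon \<alpha> \<beta> \<gamma> \<in> sets borel" "U \<in> sets borel"
      using closed_hexagon Uopen by (auto intro: borel_closed borel_open)
    note [measurable] = P_density_measurable[OF greek]
    show "(\<lambda>z. indicator U z * (limit_density \<alpha> \<beta> \<gamma> z * indicator (hexagon \<alpha> \<beta> \<gamma>) z)) \<in> borel_measurable lborel"
      by measurable
    show "(\<lambda>z. indicator U z * P_density \<alpha> \<beta> \<gamma> z) \<in> borel_measurable lborel" by measurable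
    show "AE z in lborel. indicator U z * (limit_density \<alpha> \<beta> \<gamma> z * indicator (hexagon \<alpha> \<beta> \<gamma>) z) = indicator U z * P_density \<alpha> \<beta> \<gamma> z"
      using AE_E_nonzero[OF greek]
    proof eventually_elim
      case (elim z)
      show ?case
      proof (cases "z \<in> U")
        case True
        then have "z \<in> hexagon \<alpha> \<beta> \<gamma>" using Uhex by blast
        then show ?thesis using P_density_eq[OF greek _ elim] by simp
      qed simp
    qed
  qed
  finally have V: "(\<lambda>n. ?V n / (s n)\<^sup>2) \<longlonglongrightarrow> 2 / sqrt 3 * ?I" .
  have Nlim: "(\<lambda>n. ?N n / (s n)\<^sup>2) \<longlonglongrightarrow> ?D"
  proof -
    have "(\<lambda>n. real (a n) / s n * (real (b n) / s n) + real (b n) / s n * (real (c n) / s n) + real (a n) / s n * (real (c n) / s n)) \<longlonglongrightarrow> ?D"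
      by (intro tendsto_intros lim)
    then show ?thesis by (simp add: power2_eq_square add_divide_distrib)
  qed
  have D: "?D > 0" using greek by (intro add_pos_pos mult_pos_pos)
  have N: "?N n > 0" for n unfolding of_nat_0_less_iff using abc[of n] by (simp add: add_pos_pos)
  have "(\<lambda>n. ?V n / (s n)\<^sup>2 / (?N n / (s n)\<^sup>2)) \<longlonglongrightarrow> 2 / sqrt 3 * ?I / ?D"
    by (rule tendsto_divide[OF V Nlim]) (use D in simp)
  moreover have "v / (s n)\<^sup>2 / (m / (s n)\<^sup>2) = v / m" for v m n using s_pos[of n] by simp
  \<comment> \<open>The inverse Jacobian \<open>2 / sqrt 3\<close> and the limit \<open>?D\<close>
    of the scaled number of lozenges combine to the reciprocal of the area of the hexagon.\<close>
  moreover have "2 / sqrt 3 * ?I / ?D = 1 / (?D * sqrt 3 / 2) * ?I" by (simp add: mult.commute)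
  ultimately have V': "(\<lambda>n. ?V n / ?N n) \<longlonglongrightarrow> 1 / (?D * sqrt 3 / 2) * ?I"
    by (simp only:)
  show ?thesis
  \<comment> \<open>As \<open>?N n\<close> is positive, the error term is found by solving the
    equation for it; its convergence to 0 is \<open>V'\<close>.\<close>
  proof (intro exI[of _ "\<lambda>n. ?V n / ?N n - 1 / (?D * sqrt 3 / 2) * ?I"] conjI allI)
    show "(\<lambda>n. ?V n / ?N n - 1 / (?D * sqrt 3 / 2) * ?I) \<longlonglongrightarrow> 0"
      using tendsto_diff[OF V' tendsto_const[of "1 / (?D * sqrt 3 / 2) * ?I"]] by (simp only: diff_self)
    show "?V n = ?N n * (1 / (?D * sqrt 3 / 2) * ?I + (?V n / ?N n - 1 / (?D * sqrt 3 / 2) * ?I))" for n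
    proof -
      have "v = m * (w + (v / m - w))" if "m > 0" for v m w :: real using that by simp
      from this[OF N] show ?thesis .
    qed
  qed
qed

end
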